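(* Let $V = \bigoplus_{i=1}^k S_i^{\oplus e_i}$ be a semisimple $n$-dimensional complex representation of $B_3$, where the $S_i$ are pairwise non-isomorphic simple representations and $e_i \geq 1$, and write $S_i = \lambda_i S'_i$ with $\lambda_i \in \mathbb{C}^*$ and $S'_i$ a simple representation of $\Gamma$, $S'_i \in \mathrm{rep}_{\alpha_i}\Gamma$. Then $\mathrm{rep}_n B_3$ is smooth in $V$ if and only if both of the following conditions hold: (1) for all $1 \leq i < j \leq k$: $\mathrm{Ext}^1_{B_3}(S_i,S_j) = 0$; and (2) for all $1 \leq i \leq k$: $\dim S_i = 1$ or $e_i = 1$.
   Context: $B_3 = \langle X,Y \mid X^2 = Y^3\rangle$ is the braid group on 3 strands and $\Gamma = B_3/(X^2) \cong \mathbb{Z}_2 * \mathbb{Z}_3$. All representations are finite-dimensional over $\mathbb{C}$; $\mathrm{Ext}^1_{B_3}$ means $\mathrm{Ext}^1$ over the group algebra $\mathbb{C}B_3$. The representation variety is $\mathrm{rep}_n B_3 = \{(A,B) \in \mathrm{GL}_n(\mathbb{C}) \times \mathrm{GL}_n(\mathbb{C}) \mid A^2 = B^3\}$, on which $\mathrm{PGL}_n(\mathbb{C})$ acts by simultaneous conjugation. Its tangent spaces are those defined by the equations $A^2=B^3$, so that $T_V \mathrm{rep}_n B_3 / T_V \mathcal{O}(V) \cong \mathrm{Ext}^1_{B_3}(V,V)$, where $\mathcal{O}(V)$ is the $\mathrm{PGL}_n(\mathbb{C})$-orbit of $V$. For $t \in \mathbb{C}^*$ and a representation $W = (A,B)$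 of $\Gamma$ (or $B_3$), $tW$ denotes the $B_3$-representation $(t^3A, t^2B)$. Every simple $B_3$-representation has the form $\lambda S'$ with $\lambda\in\mathbb{C}^*$ and $S'$ a simple $\Gamma$-representation. Let $\omega$ be a primitive third root of unity. For $\alpha = (a,b;x,y,z)\in\mathbb{Z}_{\ge 0}^5$ with $a+b=x+y+z=n$, $\mathrm{rep}_\alpha \Gamma$ is the set of pairs $(A,B)\in \mathrm{GL}_n(\mathbb{C})^2$ with $A^2=B^3=1$ such that $A$ has eigenvalues $1,-1$ with multiplicities $a,b$, and $B$ has eigenvalues $1,\omega,\omega^2$ with multiplicities $x,y,z$. *)

theory Defs
  imports
    "Jordan_Normal_Form.Matrix_Kernel"
    "Jordan_Normal_Form.Char_Poly"
    "HOL-Library.Extended_Nat"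
begin

hide_const (open) Multiset.mult Polynomial.smult Coset.order

section \<open>Representations of the three-strand braid group\<close>

text \<open>
  An \<open>n\<close>-dimensional representation of \<open>B\<^sub>3 = \<langle>X, Y | X\<^sup>2 = Y\<^sup>3\<rangle>\<close>, equivalently an
  \<open>n\<close>-dimensional module over its complex group algebra, is given by the pair \<open>(A, B)\<close> of
  invertible matrices by which \<open>X\<close> and \<open>Y\<close> act on column vectors.
\<close>

type_synonym rep = "complex mat \<times> complex mat"

definition GL :: "nat \<Rightarrow> complex mat set" where
  "GL n = {A \<in> carrier_mat n n. invertible_mat A}"

definition rep_B3 :: "nat \<Rightarrow> rep set" where
  "rep_B3 n = {(A, B). A \<in> GL n \<and> B \<in> GL n \<and> A ^\<^sub>m 2 = B ^\<^sub>m 3}"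

definition rep_dim :: "rep \<Rightarrow> nat" where
  "rep_dim V = dim_row (fst V)"

definition is_rep_B3 :: "rep \<Rightarrow> bool" where
  "is_rep_B3 V \<longleftrightarrow> V \<in> rep_B3 (rep_dim V)"

text \<open>
  A subspace that is stable under an invertible matrix is stable under its inverse because
  everything is finite-dimensional, so stability under \<open>A\<close> and \<open>B\<close> describes the submodules.
\<close>

definition invariant_subspace :: "rep \<Rightarrow> complex vec set \<Rightarrow> bool" where
  "invariant_subspace V W \<longleftrightarrow>
     VectorSpace.subspace class_ring W (module_vec TYPE(complex) (rep_dim V)) \<and>
     (\<forall>w\<in>W. fst V *\<^sub>v w \<in> W \<and> snd V *\<^sub>v w \<in> W)"

definition simple_rep :: "rep \<Rightarrow> bool" where
  "simple_rep V \<longleftrightarrow>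
     is_rep_B3 V \<and> rep_dim V \<noteq> 0 \<and>
     (\<forall>W. invariant_subspace V W \<longrightarrow> W = {0\<^sub>v (rep_dim V)} \<or> W = carrier_vec (rep_dim V))"

definition intertwiners :: "rep \<Rightarrow> rep \<Rightarrow> complex mat set" where
  "intertwiners V W =
     {\<phi> \<in> carrier_mat (rep_dim W) (rep_dim V).
        \<phi> * fst V = fst W * \<phi> \<and> \<phi> * snd V = snd W * \<phi>}"

definition rep_iso :: "rep \<Rightarrow> rep \<Rightarrow> bool" where
  "rep_iso V W \<longleftrightarrow> (\<exists>\<phi>\<in>intertwiners V W. invertible_mat \<phi>)"

definition direct_sum_reps :: "rep list \<Rightarrow> rep" where
  "direct_sum_reps Vs = (diag_block_mat (map fst Vs), diag_block_mat (map snd Vs))"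

definition twist :: "complex \<Rightarrow> rep \<Rightarrow> rep" where
  "twist t W = (t ^ 3 \<cdot>\<^sub>m fst W, t ^ 2 \<cdot>\<^sub>m snd W)"

text \<open>
  The eigenvalue multiplicities are the algebraic ones, which agree with the geometric ones
  since matrices of finite order are diagonalisable.
\<close>

definition rep_alpha :: "complex \<Rightarrow> nat \<times> nat \<times> nat \<times> nat \<times> nat \<Rightarrow> rep set" where
  "rep_alpha \<omega> = (\<lambda>(a, b, x, y, z). {(A, B).
     a + b = x + y + z \<and> A \<in> GL (a + b) \<and> B \<in> GL (a + b) \<and>
     A ^\<^sub>m 2 = 1\<^sub>m (a + b) \<and> B ^\<^sub>m 3 = 1\<^sub>m (a + b) \<and>
     order 1 (char_poly A) = a \<and> order (-1) (char_poly A) = b \<and>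
     order 1 (char_poly B) = x \<and> order \<omega> (char_poly B) = y \<and> order (\<omega>\<^sup>2) (char_poly B) = z})"


section \<open>Yoneda extensions\<close>

text \<open>
  An element \<open>(E, \<iota>, \<pi>)\<close> of \<open>extensions M N\<close> is a short exact sequence
  \<open>0 \<longrightarrow> N \<longrightarrow> E \<longrightarrow> M \<longrightarrow> 0\<close> of representations with maps \<open>\<iota>\<close> and \<open>\<pi>\<close>.
  \<open>Ext\<^sup>1(M, N)\<close> is the set of equivalence classes of such sequences; its zero element for the
  Baer sum is the class of the split sequence. Every module extension of \<open>M\<close> by \<open>N\<close> is
  finite-dimensional, so nothing is lost by taking \<open>E\<close> to be a pair of matrices.
\<close>

type_synonym extension = "rep \<times> complex mat \<times> complex mat"

definition extensions :: "rep \<Rightarrow> rep \<Rightarrow> extension set" where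
  "extensions M N = {(E, \<iota>, \<pi>).
     is_rep_B3 E \<and> \<iota> \<in> intertwiners N E \<and> \<pi> \<in> intertwiners E M \<and>
     mat_kernel \<iota> = {0\<^sub>v (rep_dim N)} \<and>
     (\<lambda>v. \<iota> *\<^sub>v v) ` carrier_vec (rep_dim N) = mat_kernel \<pi> \<and>
     (\<lambda>v. \<pi> *\<^sub>v v) ` carrier_vec (rep_dim E) = carrier_vec (rep_dim M)}"

text \<open>By the five lemma the intertwiner \<open>\<phi>\<close> below is automatically an isomorphism.\<close>

definition ext_equiv :: "rep \<Rightarrow> rep \<Rightarrow> (extension \<times> extension) set" where
  "ext_equiv M N = {((E, \<iota>, \<pi>), (E', \<iota>', \<pi>')).
     (E, \<iota>, \<pi>) \<in> extensions M N \<and> (E', \<iota>', \<pi>') \<in> extensions M N \<and>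
     (\<exists>\<phi>\<in>intertwiners E E'. \<phi> * \<iota> = \<iota>' \<and> \<pi>' * \<phi> = \<pi>)}"

definition Ext1 :: "rep \<Rightarrow> rep \<Rightarrow> extension set set" where
  "Ext1 M N = extensions M N // ext_equiv M N"

definition split_extension :: "rep \<Rightarrow> rep \<Rightarrow> extension" where
  "split_extension M N =
     (direct_sum_reps [N, M],
      1\<^sub>m (rep_dim N) @\<^sub>r 0\<^sub>m (rep_dim M) (rep_dim N),
      mat (rep_dim M) (rep_dim N + rep_dim M) (\<lambda>(i, j). if j = rep_dim N + i then 1 else 0))"

definition Ext1_zero :: "rep \<Rightarrow> rep \<Rightarrow> extension set" where
  "Ext1_zero M N = ext_equiv M N `` {split_extension M N}"


section \<open>Smooth points of the representation variety\<close>

text \<open>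
  The tangent space at \<open>(A, B)\<close> is the kernel of the differential
  \<open>(X, Y) \<mapsto> (A X + X A) - (B\<^sup>2 Y + B Y B + Y B\<^sup>2)\<close> of the defining equation \<open>A\<^sup>2 - B\<^sup>3 = 0\<close>,
  as a complex vector space. The ring components \<open>mult\<close> and \<open>one\<close> of the record play no role.
\<close>

definition tangent_space :: "nat \<Rightarrow> rep \<Rightarrow> (complex, rep) module" where
  "tangent_space n V = (let A = fst V; B = snd V in
     \<lparr> carrier = {(X, Y). X \<in> carrier_mat n n \<and> Y \<in> carrier_mat n n \<and>
                   A * X + X * A = B * B * Y + B * Y * B + Y * B * B},
       mult = undefined, one = undefined,
       zero = (0\<^sub>m n n, 0\<^sub>m n n),
       add = (\<lambda>(X, Y) (X', Y'). (X + X', Y + Y')),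
       smult = (\<lambda>c (X, Y). (c \<cdot>\<^sub>m X, c \<cdot>\<^sub>m Y)) \<rparr>)"

text \<open>Polynomial functions on pairs of \<open>n \<times> n\<close> matrices.\<close>

inductive_set poly_fun :: "nat \<Rightarrow> (rep \<Rightarrow> complex) set" for n :: nat where
  const: "(\<lambda>_. c) \<in> poly_fun n"
| coord1: "i < n \<Longrightarrow> j < n \<Longrightarrow> (\<lambda>V. fst V $$ (i, j)) \<in> poly_fun n"
| coord2: "i < n \<Longrightarrow> j < n \<Longrightarrow> (\<lambda>V. snd V $$ (i, j)) \<in> poly_fun n"
| add: "f \<in> poly_fun n \<Longrightarrow> g \<in> poly_fun n \<Longrightarrow> (\<lambda>V. f V + g V) \<in> poly_fun n"
| mult: "f \<in> poly_fun n \<Longrightarrow> g \<in> poly_fun n \<Longrightarrow> (\<lambda>V. f V * g V) \<in> poly_fun n"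

text \<open>
  Zariski closed subsets of \<open>rep_B3 n\<close>. Inverting the two determinants does not give
  further closed sets.
\<close>

definition zariski_closed :: "nat \<Rightarrow> rep set \<Rightarrow> bool" where
  "zariski_closed n Z \<longleftrightarrow>
     (\<exists>F\<subseteq>poly_fun n. Z = {V \<in> rep_B3 n. \<forall>f\<in>F. f V = 0})"

definition irreducible_closed :: "nat \<Rightarrow> rep set \<Rightarrow> bool" where
  "irreducible_closed n Z \<longleftrightarrow>
     zariski_closed n Z \<and> Z \<noteq> {} \<and>
     (\<forall>C D. zariski_closed n C \<and> zariski_closed n D \<and> Z = C \<union> D \<longrightarrow> Z = C \<or> Z = D)"

text \<open>
  The dimension of \<open>rep_B3 n\<close> at \<open>V\<close> is the supremum of the lengths \<open>d\<close> of chains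
  \<open>Z\<^sub>0 \<subset> \<dots> \<subset> Z\<^sub>d\<close> of irreducible closed subsets containing \<open>V\<close>. These correspond to the chains of
  prime ideals in the local ring at \<open>V\<close>, so this is the Krull dimension of that ring.
\<close>

definition local_dim :: "nat \<Rightarrow> rep \<Rightarrow> enat" where
  "local_dim n V = Sup {enat d | d. \<exists>Z :: nat \<Rightarrow> rep set.
     (\<forall>i\<le>d. irreducible_closed n (Z i) \<and> V \<in> Z i) \<and> (\<forall>i<d. Z i \<subset> Z (Suc i))}"

text \<open>
  Since the tangent space is that of the scheme defined by \<open>A\<^sup>2 = B\<^sup>3\<close>, the following condition
  says that the local ring of this scheme at \<open>V\<close> is regular.
\<close>

definition smooth_at :: "nat \<Rightarrow> rep \<Rightarrow> bool" where
  "smooth_at n V \<longleftrightarrow>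
     V \<in> rep_B3 n \<and>
     enat (vectorspace.dim class_ring (tangent_space n V)) = local_dim n V"

end

theory Submission
  imports Defs "HOL-Library.Function_Algebras"
begin

text \<open>
  Let \<open>T\<close> be the tangent space at \<open>V = (A, B)\<close>. The local dimension is at most \<open>dim T\<close>: along a chain
  of \<open>d\<close> strict inclusions the number of functions that are independent modulo the \<open>k\<close>-th power of
  the maximal ideal grows at least like \<open>k\<^sup>d\<close> (Artin--Rees), whereas monomials in \<open>dim T\<close> local coordinates
  span. If \<open>N\<close> annihilates the image of the differential of \<open>A\<^sup>2 - B\<^sup>3\<close> and the quadratic form
  \<open>tr (N (X\<^sup>2 - (B Y\<^sup>2 + Y B Y + Y\<^sup>2 B)))\<close> does not vanish on \<open>T\<close>, then one local coordinate satisfies a quadratic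
  equation and the bound drops by one, so \<open>V\<close> is singular. If every tangent vector is the velocity of an
  explicit rational family of representations, then such a family in \<open>dim T\<close> parameters yields a
  chain of length \<open>dim T\<close>, so \<open>V\<close> is smooth.

  On a simple representation \<open>A\<^sup>2 = B\<^sup>3\<close> is a scalar \<open>c\<close>. Extensions between simples with different scalars
  split. For equal scalars the extensions of \<open>S\<close> by \<open>S'\<close> split if and only if every linear map \<open>S \<rightarrow> S'\<close> is
  the sum of one commuting with \<open>A\<close> and one commuting with \<open>B\<close>; otherwise a nonzero functional
  vanishing on such sums provides the matrix \<open>N\<close>. For \<open>S = S'\<close> of dimension at least two such sums never
  exhaust all maps, by a dimension count, and repeated copies of \<open>S\<close> give \<open>N\<close> as well.
\<close>

section \<open>Noetherian rings of functions\<close>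

text \<open>The linear part of tr (N (A^2 - B^3)) at V is zero, because N is a linear form on the
  cokernel of the differential. On the variety its quadratic part is therefore a relation among
  local coordinates up to cubic terms. A coordinate whose square has a nonzero coefficient then
  occurs at most linearly in normal forms, and the number of monomials loses one order of growth.
  Conversely, tangent vectors are of three kinds: conjugation of the pair, scaling along (t^3 A, t^2
  B), and separate conjugation of A and of B by matrices commuting with A^2. The last two must
  commute to be integrated together. Condition (2) guarantees this: scalings that mix distinct
  copies of one simple occur only in dimension one, where separate conjugation is trivial. Condition
  (1) only concerns i < j. The reverse order follows because the number of blocks between matching
  eigenspaces, a sum of products m'_l m_l, is symmetric in the two simples, while maps between
  non-isomorphic simples are zero in both directions.\<close>

definition subring_of :: "'a::comm_ring_1 set \<Rightarrow> bool" where
  "subring_of R \<longleftrightarrow> 0 \<in> R \<and> 1 \<in> R \<and> (\<forall>x\<in>R. - x \<in> R) \<and>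
     (\<forall>x\<in>R. \<forall>y\<in>R. x + y \<in> R) \<and> (\<forall>x\<in>R. \<forall>y\<in>R. x * y \<in> R)"

definition ideal_of :: "'a::comm_ring_1 set \<Rightarrow> 'a set \<Rightarrow> bool" where
  "ideal_of R J \<longleftrightarrow> J \<subseteq> R \<and> 0 \<in> J \<and> (\<forall>x\<in>J. \<forall>y\<in>J. x + y \<in> J) \<and> (\<forall>r\<in>R. \<forall>x\<in>J. r * x \<in> J)"

text \<open>\<open>F\<close> generates \<open>J\<close> in the sense that every ideal containing
  \<open>F\<close> contains \<open>J\<close>. No generated ideal has to be constructed;
  \<open>ideal_combination\<close> extracts explicit coefficients later.\<close>

definition noetherian_subring :: "'a::comm_ring_1 set \<Rightarrow> bool" where
  "noetherian_subring R \<longleftrightarrow> subring_of R \<and>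
     (\<forall>J. ideal_of R J \<longrightarrow>
        (\<exists>F. finite F \<and> F \<subseteq> J \<and> (\<forall>I. ideal_of R I \<and> F \<subseteq> I \<longrightarrow> J \<subseteq> I)))"

definition adjoin :: "'a::comm_ring_1 set \<Rightarrow> 'a \<Rightarrow> 'a set" where
  "adjoin R x = {poly p x | p. \<forall>i. coeff p i \<in> R}"

lemma subring_ofD:
  assumes "subring_of R"
  shows "0 \<in> R" "1 \<in> R" "x \<in> R \<Longrightarrow> - x \<in> R" "x \<in> R \<Longrightarrow> y \<in> R \<Longrightarrow> x + y \<in> R"
    "x \<in> R \<Longrightarrow> y \<in> R \<Longrightarrow> x * y \<in> R" "x \<in> R \<Longrightarrow> y \<in> R \<Longrightarrow> x - y \<in> R"
proof -
  show "x \<in> R \<Longrightarrow> y \<in> R \<Longrightarrow> x - y \<in> R"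
    using assms unfolding subring_of_def by (metis diff_conv_add_uminus)
qed (use assms in \<open>auto simp: subring_of_def\<close>)

lemma subring_of_sum:
  assumes "subring_of R" "\<And>i. i \<in> I \<Longrightarrow> f i \<in> R"
  shows "sum f I \<in> R"
  using assms(2) by (induction I rule: infinite_finite_induct) (auto intro: subring_ofD[OF assms(1)])

lemma ideal_ofD:
  assumes "ideal_of R J"
  shows "x \<in> J \<Longrightarrow> x \<in> R" "0 \<in> J" "x \<in> J \<Longrightarrow> y \<in> J \<Longrightarrow> x + y \<in> J"
    "r \<in> R \<Longrightarrow> x \<in> J \<Longrightarrow> r * x \<in> J"
  using assms by (auto simp: ideal_of_def)

lemma coeff_mult_in_subring:
  assumes "subring_of R" "\<forall>i. coeff p i \<in> R" "\<forall>i. coeff q i \<in> R"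
  shows "coeff (p * q) i \<in> R"
  using assms by (auto simp: coeff_mult intro!: subring_of_sum subring_ofD)

lemma subring_adjoin:
  assumes R: "subring_of R"
  shows "subring_of (adjoin R x)" "R \<subseteq> adjoin R x" "x \<in> adjoin R x"
proof -
  note RD = subring_ofD[OF R]
  show sub: "R \<subseteq> adjoin R x"
  proof
    fix r assume "r \<in> R"
    then show "r \<in> adjoin R x"
      unfolding adjoin_def using RD
      by (intro CollectI exI[of _ "[:r:]"]) (auto simp: coeff_pCons split: nat.split)
  qed
  show "x \<in> adjoin R x"
    unfolding adjoin_def using RD
    by (intro CollectI exI[of _ "[:0, 1:]"]) (auto simp: coeff_pCons split: nat.split)
  show "subring_of (adjoin R x)"
    unfolding subring_of_def
  proof (intro conjI ballI)
    show "0 \<in> adjoin R x" "1 \<in> adjoin R x" using sub RD by auto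
    fix a assume "a \<in> adjoin R x"
    then obtain p where p: "a = poly p x" "\<forall>i. coeff p i \<in> R" by (auto simp: adjoin_def)
    show "- a \<in> adjoin R x"
      unfolding adjoin_def using RD p by (intro CollectI exI[of _ "- p"]) auto
    fix b assume "b \<in> adjoin R x"
    then obtain q where q: "b = poly q x" "\<forall>i. coeff q i \<in> R" by (auto simp: adjoin_def)
    show "a + b \<in> adjoin R x"
      unfolding adjoin_def using RD p q by (intro CollectI exI[of _ "p + q"]) auto
    show "a * b \<in> adjoin R x"
      unfolding adjoin_def using coeff_mult_in_subring[OF R p(2) q(2)] p q
      by (intro CollectI exI[of _ "p * q"]) auto
  qed
qed

text \<open>
  Hilbert's basis theorem. The ideals of leading coefficients are formed from all polynomial
  representations of the elements of the ideal, so \<open>x\<close> need not be transcendental over \<open>R\<close>.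
\<close>

lemma noetherian_adjoin:
  assumes N: "noetherian_subring R"
  shows "noetherian_subring (adjoin R x)"
  unfolding noetherian_subring_def
proof (intro conjI allI impI)
  have R: "subring_of R" using N by (simp add: noetherian_subring_def)
  note RD = subring_ofD[OF R]
  show SR': "subring_of (adjoin R x)" by (rule subring_adjoin[OF R])
  note xin = subring_adjoin(3)[OF R, of x] and Rin = subring_adjoin(2)[OF R, of x]
  have xpow: "x ^ m \<in> adjoin R x" for m
    by (induction m) (auto intro: subring_ofD[OF SR'] xin)
  fix J assume J: "ideal_of (adjoin R x) J"
  \<comment> \<open>Coefficients in degree \<open>d\<close> of polynomials of degree at most
    \<open>d\<close> with value in \<open>I\<close>. The weak bound makes \<open>L I d\<close>
    closed under addition.\<close>
  define L where "L I d = {coeff p d | p. degree p \<le> d \<and> (\<forall>i. coeff p i \<in> R) \<and> poly p x \<in> I}" for I d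
  have L_ideal: "ideal_of R (L I d)" if I: "ideal_of (adjoin R x) I" for I d
    unfolding ideal_of_def
  proof (intro conjI ballI subsetI)
    show "0 \<in> L I d" unfolding L_def using RD ideal_ofD[OF I]
      by (intro CollectI exI[of _ 0]) auto
    fix a assume a: "a \<in> L I d"
    then obtain p where p: "a = coeff p d" "degree p \<le> d" "\<forall>i. coeff p i \<in> R" "poly p x \<in> I"
      by (auto simp: L_def)
    show "a \<in> R" using p by auto
    { fix b assume "b \<in> L I d"
      then obtain q where q: "b = coeff q d" "degree q \<le> d" "\<forall>i. coeff q i \<in> R" "poly q x \<in> I"
        by (auto simp: L_def)
      show "a + b \<in> L I d" unfolding L_def using p q RD ideal_ofD[OF I]
        by (intro CollectI exI[of _ "p + q"]) (auto intro: degree_add_le) }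
  next
    fix r a assume r: "r \<in> R" and a: "a \<in> L I d"
    then obtain p where p: "a = coeff p d" "degree p \<le> d" "\<forall>i. coeff p i \<in> R" "poly p x \<in> I"
      by (auto simp: L_def)
    show "r * a \<in> L I d" unfolding L_def using p r RD ideal_ofD[OF I] Rin
      by (intro CollectI exI[of _ "Polynomial.smult r p"])
         (auto intro: order_trans[OF degree_smult_le])
  qed
  have L_shift: "L I d \<subseteq> L I (d + m)" if I: "ideal_of (adjoin R x) I" for I d m
  proof
    fix a assume "a \<in> L I d"
    then obtain p where p: "a = coeff p d" "degree p \<le> d" "\<forall>i. coeff p i \<in> R" "poly p x \<in> I"
      by (auto simp: L_def)
    show "a \<in> L I (d + m)" unfolding L_def
    proof (intro CollectI exI[of _ "monom 1 m * p"] conjI allI)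
      show "a = coeff (monom 1 m * p) (d + m)" using p by (simp add: coeff_monom_mult)
      show "degree (monom 1 m * p) \<le> d + m"
        using degree_mult_le[of "monom 1 m" p] degree_monom_le[of "1::'a" m] p(2) by linarith
      show "coeff (monom 1 m * p) i \<in> R" for i using p(3) RD by (auto simp: coeff_monom_mult)
      show "poly (monom 1 m * p) x \<in> I"
        using p(4) ideal_ofD(4)[OF I xpow[of m] p(4)] by (simp add: poly_monom)
    qed
  qed
  define U where "U = (\<Union>d. L J d)"
  have "ideal_of R U"
    unfolding ideal_of_def
  proof (intro conjI ballI)
    show "U \<subseteq> R" "0 \<in> U"
      using ideal_ofD(1,2)[OF L_ideal[OF J]] by (auto simp: U_def)
    fix a assume "a \<in> U"
    then obtain d where d: "a \<in> L J d" by (auto simp: U_def)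
    { fix b assume "b \<in> U"
      then obtain e where e: "b \<in> L J e" by (auto simp: U_def)
      have "a \<in> L J (d + e)" "b \<in> L J (d + e)"
        using d e L_shift[OF J, of d e] L_shift[OF J, of e d] by (auto simp: add.commute)
      then show "a + b \<in> U" using L_ideal[OF J] by (auto simp: U_def dest: ideal_ofD) }
  next
    fix r a assume "r \<in> R" "a \<in> U"
    then show "r * a \<in> U" using L_ideal[OF J] by (auto simp: U_def dest: ideal_ofD)
  qed
  then obtain F0 where F0: "finite F0" "F0 \<subseteq> U" "\<And>I. ideal_of R I \<Longrightarrow> F0 \<subseteq> I \<Longrightarrow> U \<subseteq> I"
    using N by (auto simp: noetherian_subring_def)
  have "\<forall>a\<in>F0. \<exists>d. a \<in> L J d" using F0(2) by (auto simp: U_def)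
  then obtain dd where dd: "\<And>a. a \<in> F0 \<Longrightarrow> a \<in> L J (dd a)" by metis
  \<comment> \<open>The sum dominates every \<open>dd a\<close>, so by \<open>L_shift\<close> the
    single degree \<open>D\<close> carries all leading coefficients in \<open>U\<close>.\<close>
  define D where "D = (\<Sum>a\<in>F0. dd a)"
  have "F0 \<subseteq> L J D"
  proof
    fix a assume a: "a \<in> F0"
    then have "dd a \<le> D" unfolding D_def using F0(1) by (simp add: member_le_sum)
    then show "a \<in> L J D" using dd[OF a] L_shift[OF J, of "dd a" "D - dd a"] by auto
  qed
  then have "U \<subseteq> L J D" using F0(3) L_ideal[OF J] by blast
  then have LD: "L J d \<subseteq> L J D" for d by (auto simp: U_def)
  have "\<forall>d. \<exists>F. finite F \<and> F \<subseteq> L J d \<and> (\<forall>I. ideal_of R I \<and> F \<subseteq> I \<longrightarrow> L J d \<subseteq> I)"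
    using N L_ideal[OF J] by (simp add: noetherian_subring_def)
  then obtain G where G: "\<And>d. finite (G d)" "\<And>d. G d \<subseteq> L J d"
      "\<And>d I. ideal_of R I \<Longrightarrow> G d \<subseteq> I \<Longrightarrow> L J d \<subseteq> I" by metis
  have "\<forall>d. \<forall>a\<in>G d. \<exists>q. a = coeff q d \<and> degree q \<le> d \<and> (\<forall>i. coeff q i \<in> R) \<and> poly q x \<in> J"
    using G(2) by (fastforce simp: L_def)
  then obtain Q where Q: "\<And>d a. a \<in> G d \<Longrightarrow> a = coeff (Q d a) d \<and> degree (Q d a) \<le> d \<and>
      (\<forall>i. coeff (Q d a) i \<in> R) \<and> poly (Q d a) x \<in> J" by metis
  \<comment> \<open>Lifts of generators of the finitely many ideals \<open>L J d\<close> with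
    \<open>d\<close> at most \<open>D\<close>; above \<open>D\<close> these ideals no longer
    grow.\<close>
  define F where "F = (\<Union>d\<in>{..D}. (\<lambda>a. poly (Q d a) x) ` G d)"
  show "\<exists>F. finite F \<and> F \<subseteq> J \<and> (\<forall>I. ideal_of (adjoin R x) I \<and> F \<subseteq> I \<longrightarrow> J \<subseteq> I)"
  proof (intro exI[of _ F] conjI allI impI)
    show "finite F" unfolding F_def using G(1) by auto
    show "F \<subseteq> J" unfolding F_def using Q by auto
    fix I assume "ideal_of (adjoin R x) I \<and> F \<subseteq> I"
    then have I: "ideal_of (adjoin R x) I" and FI: "F \<subseteq> I" by auto
    \<comment> \<open>The intersection keeps the value of the subtracted polynomial \<open>q\<close>
      in \<open>J\<close>, so that the remainder \<open>p - q\<close> stays within reach of the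
      induction on degrees.\<close>
    have IJ: "ideal_of (adjoin R x) (I \<inter> J)" using I J by (auto simp: ideal_of_def)
    have lead: "L J d \<subseteq> L (I \<inter> J) d" for d
    proof -
      define d' where "d' = min d D"
      have "G d' \<subseteq> L (I \<inter> J) d'"
      proof
        fix a assume a: "a \<in> G d'"
        have "poly (Q d' a) x \<in> I" 
          using FI a min.cobounded2[of d D] unfolding F_def d'_def by blast
        then show "a \<in> L (I \<inter> J) d'" unfolding L_def using Q[OF a] by auto
      qed
      then have "L J d' \<subseteq> L (I \<inter> J) d'" using G(3) L_ideal[OF IJ] by blast
      moreover have "L J d \<subseteq> L J d'"
      proof (cases "d \<le> D")
        case False
        then have "d' = D" unfolding d'_def by simp
        then show ?thesis using LD by simp
      qed (simp add: d'_def)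
      moreover have "L (I \<inter> J) d' \<subseteq> L (I \<inter> J) d"
        using L_shift[OF IJ, of d' "d - d'"] by (simp add: d'_def)
      ultimately show ?thesis by blast
    qed
    have main: "poly p x \<in> I" if "degree p < m" "\<forall>i. coeff p i \<in> R" "poly p x \<in> J" for m p
      using that
    proof (induction m arbitrary: p)
      case (Suc m)
      have "coeff p m \<in> L J m" unfolding L_def using Suc.prems by auto
      then have "coeff p m \<in> L (I \<inter> J) m" using lead by blast
      then obtain q where q: "coeff p m = coeff q m" "degree q \<le> m" "\<forall>i. coeff q i \<in> R"
          "poly q x \<in> I" "poly q x \<in> J" by (auto simp: L_def)
      have mem: "poly (p - q) x \<in> J"
        using ideal_ofD(3)[OF J Suc.prems(3) ideal_ofD(4)[OF J subring_ofD(3)[OF SR' subring_ofD(2)[OF SR']] q(5)]]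
        by simp
      have "poly (p - q) x \<in> I"
      proof (cases "p - q = 0")
        case True then show ?thesis using ideal_ofD(2)[OF I] by simp
      next
        case False
        have cf: "coeff (p - q) m = 0" using q(1) by simp
        have "degree (p - q) \<le> m" using Suc.prems(1) q(2) by (intro degree_diff_le) auto
        moreover have "degree (p - q) \<noteq> m" using False cf by (metis leading_coeff_0_iff)
        ultimately have "degree (p - q) < m" by simp
        then show ?thesis using Suc.IH[of "p - q"] mem Suc.prems(2) q(3) RD by auto
      qed
      then have "poly (p - q) x + poly q x \<in> I" using q(4) ideal_ofD(3)[OF I] by blast
      then show ?case by simp
    qed simp
    show "J \<subseteq> I"
    proof
      fix y assume y: "y \<in> J"
      then obtain p where "y = poly p x" "\<forall>i. coeff p i \<in> R"
        using ideal_ofD(1)[OF J] by (fastforce simp: adjoin_def)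
      then show "y \<in> I" using main[of p "Suc (degree p)"] y by auto
    qed
  qed
qed

text \<open>A nonzero element of an ideal is invertible and hence generates it. The tower of
  adjunctions starts from the field of constants.\<close>

lemma noetherian_field:
  assumes R: "subring_of R" and inv: "\<And>x. x \<in> R \<Longrightarrow> x \<noteq> 0 \<Longrightarrow> \<exists>y\<in>R. y * x = 1"
  shows "noetherian_subring R"
  unfolding noetherian_subring_def
proof (intro conjI allI impI R)
  fix J assume J: "ideal_of R J"
  show "\<exists>F. finite F \<and> F \<subseteq> J \<and> (\<forall>I. ideal_of R I \<and> F \<subseteq> I \<longrightarrow> J \<subseteq> I)"
  proof (cases "J \<subseteq> {0}")
    case True
    then show ?thesis by (intro exI[of _ "{}"]) (auto simp: ideal_of_def)
  next
    case False
    then obtain x where x: "x \<in> J" "x \<noteq> 0" by auto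
    then obtain y where y: "y \<in> R" "y * x = 1" using inv J by (meson ideal_ofD(1))
    have "J \<subseteq> I" if I: "ideal_of R I" "x \<in> I" for I
    proof
      fix z assume "z \<in> J"
      then have z: "z \<in> R" using J by (meson ideal_ofD(1))
      have "z * (y * x) \<in> I" using z y I by (meson ideal_ofD(4))
      then show "z \<in> I" using y by simp
    qed
    then show ?thesis using x by (intro exI[of _ "{x}"]) auto
  qed
qed

section \<open>Finitely generated extensions of a noetherian subring\<close>

primrec adjoin_list :: "'a::comm_ring_1 set \<Rightarrow> 'a list \<Rightarrow> 'a set" where
  "adjoin_list R [] = R"
| "adjoin_list R (x # xs) = adjoin (adjoin_list R xs) x"

lemma noetherian_adjoin_list:
  "noetherian_subring R \<Longrightarrow> noetherian_subring (adjoin_list R xs)"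
  by (induction xs) (auto intro: noetherian_adjoin)

lemma adjoin_list_mono:
  assumes "subring_of R"
  shows "subring_of (adjoin_list R xs) \<and> R \<subseteq> adjoin_list R xs \<and> set xs \<subseteq> adjoin_list R xs"
proof (induction xs)
  case (Cons x xs)
  then show ?case using subring_adjoin[of "adjoin_list R xs" x] by auto
qed (use assms in auto)

text \<open>Horner's scheme writes an element of an iterated adjunction by sums and products, so a
  property closed under both need only be checked on the base ring and the generators.\<close>

lemma adjoin_list_induct [consumes 2, case_names base gen add mult]:
  assumes "subring_of R" "y \<in> adjoin_list R xs"
    and base: "\<And>r. r \<in> R \<Longrightarrow> P r" and gen: "\<And>x. x \<in> set xs \<Longrightarrow> P x"
    and add: "\<And>a b. P a \<Longrightarrow> P b \<Longrightarrow> P (a + b)" and mult: "\<And>a b. P a \<Longrightarrow> P b \<Longrightarrow> P (a * b)"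
  shows "P y"
  using assms(2) gen
proof (induction xs arbitrary: y)
  case Nil
  then show ?case using base by simp
next
  case (Cons x xs)
  have sub: "P z" if "z \<in> adjoin_list R xs" for z using Cons that by auto
  obtain p where p: "y = poly p x" "\<forall>i. coeff p i \<in> adjoin_list R xs"
    using Cons.prems by (auto simp: adjoin_def)
  have "P (poly q x)" if "\<forall>i. coeff q i \<in> adjoin_list R xs" for q
    using that
  proof (induction q)
    case 0
    then show ?case using base subring_ofD[OF assms(1)] by auto
  next
    case (pCons a q)
    have "coeff q i \<in> adjoin_list R xs" for i using spec[OF pCons.prems, of "Suc i"] by simp
    moreover have "P a" using sub spec[OF pCons.prems, of 0] by simp
    ultimately have "P a" "P (poly q x)" "P x" using pCons.IH Cons.prems by auto
    then show ?case using add mult by auto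
  qed
  then show ?case using p by auto
qed

text \<open>The \<open>R\<close>-combinations of \<open>F\<close> form an ideal containing
  \<open>F\<close>, so the minimality hypothesis places \<open>J\<close> inside it.\<close>

lemma ideal_combination:
  assumes R: "subring_of R" and F: "finite F"
    and J: "\<And>I. ideal_of R I \<Longrightarrow> F \<subseteq> I \<Longrightarrow> J \<subseteq> I" "F \<subseteq> R" and y: "y \<in> J"
  obtains c where "\<And>f. f \<in> F \<Longrightarrow> c f \<in> R" "y = (\<Sum>f\<in>F. c f * f)"
proof -
  define I where "I = {\<Sum>f\<in>F. c f * f | c. \<forall>f\<in>F. c f \<in> R}"
  have "ideal_of R I"
    unfolding ideal_of_def
  proof (intro conjI ballI subsetI)
    show "0 \<in> I" unfolding I_def using subring_ofD[OF R]
      by (intro CollectI exI[of _ "\<lambda>_. 0"]) auto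
    fix a assume "a \<in> I"
    then obtain c where c: "a = (\<Sum>f\<in>F. c f * f)" "\<forall>f\<in>F. c f \<in> R" by (auto simp: I_def)
    show "a \<in> R" unfolding c(1) using c(2) J(2) by (auto intro!: subring_of_sum subring_ofD R)
    { fix b assume "b \<in> I"
      then obtain d where d: "b = (\<Sum>f\<in>F. d f * f)" "\<forall>f\<in>F. d f \<in> R" by (auto simp: I_def)
      show "a + b \<in> I" unfolding I_def using c d subring_ofD[OF R]
        by (intro CollectI exI[of _ "\<lambda>f. c f + d f"]) (auto simp: distrib_right sum.distrib) }
  next
    fix r a assume "r \<in> R" "a \<in> I"
    then obtain c where c: "a = (\<Sum>f\<in>F. c f * f)" "\<forall>f\<in>F. c f \<in> R" by (auto simp: I_def)
    then show "r * a \<in> I" unfolding I_def using \<open>r \<in> R\<close> subring_ofD[OF R]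
      by (intro CollectI exI[of _ "\<lambda>f. r * c f"]) (auto simp: sum_distrib_left mult.assoc)
  qed
  moreover have "F \<subseteq> I"
  proof
    fix g assume g: "g \<in> F"
    have "(\<Sum>f\<in>F. (if f = g then 1 else 0) * f) = g" using g F
      by (simp add: if_distrib[of "\<lambda>a. a * _"] cong: if_cong)
    then show "g \<in> I" unfolding I_def using subring_ofD[OF R]
      by (intro CollectI exI[of _ "\<lambda>f. if f = g then 1 else 0"]) auto
  qed
  ultimately have "y \<in> I" using J(1) y by blast
  then show thesis using that unfolding I_def by blast
qed

section \<open>Polynomial functions and orders of vanishing\<close>

inductive_set polyfun :: "('p \<Rightarrow> complex) set \<Rightarrow> ('p \<Rightarrow> complex) set" for X where
  const: "(\<lambda>_. c) \<in> polyfun X"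
| gen: "x \<in> X \<Longrightarrow> x \<in> polyfun X"
| add: "f \<in> polyfun X \<Longrightarrow> g \<in> polyfun X \<Longrightarrow> (\<lambda>p. f p + g p) \<in> polyfun X"
| mult: "f \<in> polyfun X \<Longrightarrow> g \<in> polyfun X \<Longrightarrow> (\<lambda>p. f p * g p) \<in> polyfun X"

text \<open>The \<open>k\<close>-th power of the maximal ideal at \<open>v\<close> in the ring
  \<open>polyfun X\<close>, generated by the differences \<open>x - x v\<close>. It concerns
  functions on the whole point set; passing to a subset \<open>Z\<close> is expressed separately, by
  equality on \<open>Z\<close>.\<close>

inductive vanish :: "('p \<Rightarrow> complex) set \<Rightarrow> 'p \<Rightarrow> nat \<Rightarrow> ('p \<Rightarrow> complex) \<Rightarrow> bool" for X v where
  zero: "vanish X v k (\<lambda>_. 0)"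
| poly: "f \<in> polyfun X \<Longrightarrow> vanish X v 0 f"
| step: "x \<in> X \<Longrightarrow> vanish X v k f \<Longrightarrow> vanish X v (Suc k) (\<lambda>p. (x p - x v) * f p)"
| add: "vanish X v k f \<Longrightarrow> vanish X v k g \<Longrightarrow> vanish X v k (\<lambda>p. f p + g p)"

lemma polyfun_uminus: "f \<in> polyfun X \<Longrightarrow> (\<lambda>p. - f p) \<in> polyfun X"
  using polyfun.mult[OF polyfun.const[of "-1"], of f X] by simp

lemma polyfun_diff: "f \<in> polyfun X \<Longrightarrow> g \<in> polyfun X \<Longrightarrow> (\<lambda>p. f p - g p) \<in> polyfun X"
  using polyfun.add[OF _ polyfun_uminus, of f X g] by simp

lemma polyfun_sum: "(\<And>i. i \<in> I \<Longrightarrow> f i \<in> polyfun X) \<Longrightarrow> (\<lambda>p. \<Sum>i\<in>I. f i p) \<in> polyfun X"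
  by (induction I rule: infinite_finite_induct) (auto intro: polyfun.intros)

lemma polyfun_prod: "(\<And>i. i \<in> I \<Longrightarrow> f i \<in> polyfun X) \<Longrightarrow> (\<lambda>p. \<Prod>i\<in>I. f i p) \<in> polyfun X"
  by (induction I rule: infinite_finite_induct) (auto intro: polyfun.intros)

lemma polyfun_power: "f \<in> polyfun X \<Longrightarrow> (\<lambda>p. f p ^ m) \<in> polyfun X"
  by (induction m) (auto intro: polyfun.intros)

lemma vanish_polyfun: "vanish X v k f \<Longrightarrow> f \<in> polyfun X"
proof (induction rule: vanish.induct)
  case (step x k f)
  then show ?case
    using polyfun.mult[OF polyfun_diff[OF polyfun.gen polyfun.const]] by blast
next
  case (add k f g)
  then show ?case by (intro polyfun.add)
qed (auto intro: polyfun.const)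

lemma vanish_sum: "(\<And>i. i \<in> I \<Longrightarrow> vanish X v k (f i)) \<Longrightarrow> vanish X v k (\<lambda>p. \<Sum>i\<in>I. f i p)"
  by (induction I rule: infinite_finite_induct) (auto intro: vanish.zero vanish.add)

lemma vanish_mult_poly:
  assumes "f \<in> polyfun X" "vanish X v k g"
  shows "vanish X v k (\<lambda>p. f p * g p)"
  using assms(2)
proof (induction rule: vanish.induct)
  case (zero k)
  then show ?case by (simp add: vanish.zero)
next
  case (poly g)
  then show ?case using assms(1) by (intro vanish.poly polyfun.mult)
next
  case (step x k g)
  then have "vanish X v (Suc k) (\<lambda>p. (x p - x v) * (f p * g p))" by (intro vanish.step)
  then show ?case by (simp add: mult.left_commute)
next
  case (add k g h)
  then show ?case using vanish.add[OF add.IH] by (simp add: distrib_left)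
qed

lemma vanish_mult:
  assumes "vanish X v k f" "vanish X v l g"
  shows "vanish X v (k + l) (\<lambda>p. f p * g p)"
  using assms(1)
proof (induction rule: vanish.induct)
  case (zero k)
  then show ?case by (simp add: vanish.zero)
next
  case (poly f)
  then show ?case using vanish_mult_poly[OF _ assms(2)] by simp
next
  case (step x k f)
  then have "vanish X v (Suc (k + l)) (\<lambda>p. (x p - x v) * (f p * g p))" by (intro vanish.step)
  then show ?case by (simp add: mult.assoc)
next
  case (add k f h)
  then show ?case using vanish.add[OF add.IH] by (simp add: distrib_right)
qed

lemma vanish_Suc:
  assumes "vanish X v (Suc k) f"
  shows "vanish X v k f"
proof -
  have "\<forall>l. k = Suc l \<longrightarrow> vanish X v l f" if "vanish X v k f" for k
    using that
  proof (induction rule: vanish.induct)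
    case (step x k f)
    have "(\<lambda>p. x p - x v) \<in> polyfun X"
      using step by (intro polyfun_diff polyfun.gen polyfun.const)
    from vanish_mult_poly[OF this] show ?case using step by auto
  qed (auto intro: vanish.zero vanish.add)
  then show ?thesis using assms by blast
qed

lemma vanish_mono:
  assumes "vanish X v k f" "l \<le> k"
  shows "vanish X v l f"
proof -
  have "vanish X v (l + m) f \<Longrightarrow> vanish X v l f" for m
    by (induction m) (auto dest: vanish_Suc)
  from this[of "k - l"] show ?thesis using assms by simp
qed

lemma vanish_1: "vanish X v (Suc k) f \<Longrightarrow> f v = 0"
  by (induction "Suc k" f arbitrary: k rule: vanish.induct) auto

lemma vanish_scale: "vanish X v k f \<Longrightarrow> vanish X v k (\<lambda>p. c * f p)"
  using vanish_mult_poly[OF polyfun.const, of X v k f c] by simp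

lemma vanish_diff: "vanish X v k f \<Longrightarrow> vanish X v k g \<Longrightarrow> vanish X v k (\<lambda>p. f p - g p)"
  using vanish.add[OF _ vanish_scale[of X v k g "-1"], of f] by simp

lemma polyfun_diff_vanish:
  "f \<in> polyfun X \<Longrightarrow> vanish X v 1 (\<lambda>p. f p - f v)"
proof (induction rule: polyfun.induct)
  case (const c)
  then show ?case by (simp add: vanish.zero)
next
  case (gen x)
  then show ?case using vanish.step[OF gen vanish.poly[OF polyfun.const[of 1]], of v] by simp
next
  case (add f g)
  then show ?case using vanish.add[OF add.IH] by (simp add: algebra_simps)
next
  case (mult f g)
  have "vanish X v 1 (\<lambda>p. f p * (g p - g v) + g v * (f p - f v))"
    using mult by (intro vanish.add vanish_mult_poly vanish_scale)
  moreover have "(\<lambda>p. f p * (g p - g v) + g v * (f p - f v)) = (\<lambda>p. f p * g p - f v * g v)"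
    by (auto simp: algebra_simps)
  ultimately show ?case by simp
qed

text \<open>The ideal of functions vanishing on \<open>Z\<close> is prime. Irreducibility enters the
  dimension bound in this form, where it allows a factor to be cancelled.\<close>

definition prime_on :: "('p \<Rightarrow> complex) set \<Rightarrow> 'p set \<Rightarrow> bool" where
  "prime_on X Z \<longleftrightarrow> (\<forall>f\<in>polyfun X. \<forall>g\<in>polyfun X. (\<forall>p\<in>Z. f p * g p = 0) \<longrightarrow>
     (\<forall>p\<in>Z. f p = 0) \<or> (\<forall>p\<in>Z. g p = 0))"

lemma fun_sum_apply: "(\<Sum>i\<in>I. a i) p = (\<Sum>i\<in>I. a i p)" for a :: "'i \<Rightarrow> 'p \<Rightarrow> complex"
  by (induction I rule: infinite_finite_induct) auto

lemma const_poly_mult: "[:a:] * [:b:] = [:a * b :: 'a::comm_ring_1:]"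
  by simp

text \<open>
  The Artin--Rees lemma for a principal ideal of the coordinate ring of \<open>Z\<close>: the Rees algebra
  \<open>\<Oplus>\<^sub>k m\<^sup>k T\<^sup>k\<close>, a finitely generated subring of the polynomials over the ring of functions, is
  noetherian. Composing with the retraction of the point set onto \<open>Z\<close> restricts functions
  to \<open>Z\<close> without changing their type.
\<close>

lemma artin_rees:
  fixes X :: "('p \<Rightarrow> complex) set"
  assumes X: "finite X" and v: "v \<in> Z" and Z: "prime_on X Z"
    and f: "f \<in> polyfun X" and nz: "p0 \<in> Z" "f p0 \<noteq> 0"
  obtains c where "\<And>k g h. g \<in> polyfun X \<Longrightarrow> vanish X v (k + c) h \<Longrightarrow> (\<forall>p\<in>Z. f p * g p = h p) \<Longrightarrow>
    \<exists>h'. vanish X v k h' \<and> (\<forall>p\<in>Z. g p = h' p)"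
proof -
  define r where "r p = (if p \<in> Z then p else v)" for p
  have r_in: "r p \<in> Z" for p using v by (simp add: r_def)
  have r_id: "p \<in> Z \<Longrightarrow> r p = p" for p by (simp add: r_def)
  define res where "res h = (\<lambda>p. h (r p))" for h :: "'p \<Rightarrow> complex"
  have res_add: "res (\<lambda>p. a p + b p) = res a + res b" for a b by (auto simp: res_def)
  have res_mult: "res (\<lambda>p. a p * b p) = res a * res b" for a b by (auto simp: res_def)
  have res_zero: "res (\<lambda>_. 0) = 0" by (auto simp: res_def)
  have res_sum: "res (\<lambda>p. \<Sum>i\<in>I. a i p) = (\<Sum>i\<in>I. res (a i))" for I :: "nat set" and a
    by (rule ext) (simp only: res_def fun_sum_apply)
  \<comment> \<open>The constants, placed in degree zero of the polynomials over the ring of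
    functions; this field is the base of the noetherian tower.\<close>
  define K :: "('p \<Rightarrow> complex) poly set" where "K = {[:\<lambda>_. c:] | c. True}"
  have K0: "0 \<in> K" unfolding K_def by (intro CollectI exI[of _ 0]) (auto simp: zero_fun_def)
  have K: "subring_of K"
    unfolding subring_of_def
  proof (intro conjI ballI)
    show "0 \<in> K" by (rule K0)
    show "1 \<in> K" unfolding K_def by (intro CollectI exI[of _ 1]) (auto simp: one_pCons one_fun_def)
    fix a assume "a \<in> K"
    then obtain c where c: "a = [:\<lambda>_. c:]" by (auto simp: K_def)
    show "- a \<in> K" unfolding K_def c
      by (intro CollectI exI[of _ "-c"]) (simp add: fun_eq_iff)
    fix b assume "b \<in> K"
    then obtain d where d: "b = [:\<lambda>_. d:]" by (auto simp: K_def)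
    show "a + b \<in> K" unfolding K_def c d by (intro CollectI exI[of _ "c + d"]) (auto simp: plus_fun_def)
    show "a * b \<in> K" unfolding K_def c d by (intro CollectI exI[of _ "c * d"]) (auto simp: times_fun_def)
  qed
  have "noetherian_subring K"
  proof (rule noetherian_field[OF K])
    fix a assume "a \<in> K" "a \<noteq> 0"
    then obtain c where c: "a = [:\<lambda>_. c:]" by (auto simp: K_def)
    have "c \<noteq> 0" using \<open>a \<noteq> 0\<close> c by (auto simp: zero_fun_def)
    then have "[:\<lambda>_. inverse c:] * a = 1" unfolding c
      by (simp add: one_pCons times_fun_def one_fun_def)
    then show "\<exists>y\<in>K. y * a = 1" unfolding K_def by blast
  qed
  obtain xs where xs: "set xs = X" using X finite_list by blast
  define m where "m x = res (\<lambda>p. x p - x v)" for x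
  \<comment> \<open>The generators \<open>monom (m x) 1\<close> produce the powers of the maximal
    ideal. The copies in degree zero are there because the degree-zero part of the Rees algebra is
    the whole coordinate ring.\<close>
  define W where "W = adjoin_list K (map (\<lambda>x. [:m x:]) xs @ map (\<lambda>x. monom (m x) 1) xs)"
  have W_noeth: "noetherian_subring W"
    unfolding W_def by (rule noetherian_adjoin_list) fact
  have W: "subring_of W" using W_noeth by (simp add: noetherian_subring_def)
  have K_W: "K \<subseteq> W" unfolding W_def using adjoin_list_mono[OF K] by blast
  have gen_W: "[:m x:] \<in> W" "monom (m x) 1 \<in> W" if "x \<in> X" for x
    using adjoin_list_mono[OF K, of "map (\<lambda>x. [:m x:]) xs @ map (\<lambda>x. monom (m x) 1) xs"] that xs
    by (auto simp: W_def)
  have W_coeff: "\<forall>k. \<exists>h. vanish X v k h \<and> coeff F k = res h" if "F \<in> W" for F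
  proof -
    have const: "\<forall>k. \<exists>h. vanish X v k h \<and> coeff [:res h0:] k = res h" if "h0 \<in> polyfun X" for h0
    proof
      fix k show "\<exists>h. vanish X v k h \<and> coeff [:res h0:] k = res h"
      proof (cases k)
        case 0 then show ?thesis using vanish.poly[OF that] by auto
      next
        case (Suc l)
        show ?thesis
          by (intro exI[of _ "\<lambda>_. 0"] conjI vanish.zero)
             (simp only: Suc coeff_pCons_Suc coeff_0 res_zero)
      qed
    qed
    show ?thesis using that unfolding W_def
    proof (induction rule: adjoin_list_induct[OF K, consumes 1])
      case (1 a)
      then obtain c where c: "a = [:res (\<lambda>_. c):]" by (auto simp: K_def res_def)
      show ?case unfolding c by (rule const[OF polyfun.const])
    next
      case (2 a)
      then consider x where "x \<in> X" "a = [:m x:]" | x where "x \<in> X" "a = monom (m x) 1"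
        using xs by auto
      then show ?case
      proof cases
        case 1
        then show ?thesis unfolding m_def
          using const polyfun_diff[OF polyfun.gen polyfun.const] by blast
      next
        case 2
        have v1: "vanish X v 1 (\<lambda>p. x p - x v)" using polyfun_diff_vanish[OF polyfun.gen[OF 2(1)]] .
        show ?thesis
        proof
          fix k show "\<exists>h. vanish X v k h \<and> coeff a k = res h"
          proof (cases "k = 1")
            case True
            then show ?thesis using v1 by (auto simp: \<open>a = _\<close> m_def)
          next
            case False
            then have "coeff a k = 0" by (simp only: \<open>a = _\<close> coeff_monom) simp
            then show ?thesis
              by (intro exI[of _ "\<lambda>_. 0"] conjI vanish.zero) (simp only: res_zero)
          qed
        qed
      qed
    next
      case (3 a b)
      show ?case
      proof
        fix k
        obtain h1 h2 where "vanish X v k h1" "coeff a k = res h1" "vanish X v k h2" "coeff b k = res h2"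
          using 3 by blast
        then show "\<exists>h. vanish X v k h \<and> coeff (a + b) k = res h"
          by (intro exI[of _ "\<lambda>p. h1 p + h2 p"] conjI vanish.add)
             (simp_all only: res_add coeff_add)
      qed
    next
      case (4 a b)
      show ?case
      proof
        fix k
        obtain h1 h2 where h: "\<And>i. vanish X v i (h1 i)" "\<And>i. coeff a i = res (h1 i)"
            "\<And>i. vanish X v i (h2 i)" "\<And>i. coeff b i = res (h2 i)"
          using 4 by metis
        have "vanish X v k (\<lambda>p. \<Sum>i\<le>k. h1 i p * h2 (k - i) p)"
        proof (rule vanish_sum)
          fix i assume "i \<in> {..k}"
          then show "vanish X v k (\<lambda>p. h1 i p * h2 (k - i) p)"
            using vanish_mult[OF h(1)[of i] h(3)[of "k - i"]] by simp
        qed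
        moreover have "coeff (a * b) k = res (\<lambda>p. \<Sum>i\<le>k. h1 i p * h2 (k - i) p)"
          by (simp only: coeff_mult res_sum res_mult h)
        ultimately show "\<exists>h. vanish X v k h \<and> coeff (a * b) k = res h" by blast
      qed
    qed
  qed
  have W_const: "[:res h:] \<in> W" if "h \<in> polyfun X" for h
    using that
  proof (induction rule: polyfun.induct)
    case (const c)
    then show ?case using K_W by (auto simp: K_def res_def)
  next
    case (gen x)
    have "[:res x:] = [:m x:] + [:\<lambda>_. x v:]" by (auto simp: m_def res_def)
    moreover have "[:\<lambda>_. x v:] \<in> W" using K_W by (auto simp: K_def)
    ultimately show ?case using gen_W(1)[OF gen] subring_ofD(4)[OF W] by metis
  next
    case (add a b)
    have "[:res (\<lambda>p. a p + b p):] = [:res a:] + [:res b:]"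
      by (simp only: add_pCons add_0_right res_add)
    then show ?case using subring_ofD(4)[OF W add.IH] by (simp only:)
  next
    case (mult a b)
    have "[:res (\<lambda>p. a p * b p):] = [:res a:] * [:res b:]"
      by (simp only: const_poly_mult res_mult)
    then show ?case using subring_ofD(5)[OF W mult.IH] by (simp only:)
  qed
  have W_monom: "monom (res h) k \<in> W" if "vanish X v k h" for h k
    using that
  proof (induction rule: vanish.induct)
    case (zero k)
    show ?case by (simp only: res_zero monom_eq_0 subring_ofD(1)[OF W])
  next
    case (poly h)
    then show ?case using W_const by (simp add: monom_0)
  next
    case (step x k h)
    have "monom (m x) 1 * monom (res h) k \<in> W"
      using step gen_W subring_ofD(5)[OF W] by blast
    then show ?case unfolding mult_monom m_def res_mult by (simp only: plus_1_eq_Suc)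
  next
    case (add k a b)
    then show ?case using subring_ofD(4)[OF W add.IH] by (simp only: res_add add_monom[symmetric])
  qed
  have J_zero: "\<exists>g\<in>polyfun X. 0 = res f * res g"
    by (intro bexI[of _ "\<lambda>_. 0"] polyfun.const) (simp only: res_zero mult_zero_right)
  \<comment> \<open>Its piece of degree \<open>k\<close> consists of the multiples of
    \<open>f\<close> that lie in the \<open>k\<close>-th power of the maximal ideal, all restricted
    to \<open>Z\<close>.\<close>
  define J where "J = {F \<in> W. \<forall>k. \<exists>g\<in>polyfun X. coeff F k = res f * res g}"
  have J: "ideal_of W J"
    unfolding ideal_of_def
  proof (intro conjI ballI)
    show "J \<subseteq> W" by (auto simp: J_def)
    show "0 \<in> J" unfolding J_def mem_Collect_eq coeff_0 using subring_ofD(1)[OF W] J_zero by blast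
    fix a assume a: "a \<in> J"
    { fix b assume b: "b \<in> J"
      have "\<exists>g\<in>polyfun X. coeff (a + b) k = res f * res g" for k
      proof -
        obtain g1 g2 where "g1 \<in> polyfun X" "coeff a k = res f * res g1" "g2 \<in> polyfun X" "coeff b k = res f * res g2"
          using a b unfolding J_def by blast
        then show ?thesis
          by (intro bexI[of _ "\<lambda>p. g1 p + g2 p"] polyfun.add)
             (simp_all only: res_add distrib_left coeff_add)
      qed
      then show "a + b \<in> J" using a b subring_ofD(4)[OF W] unfolding J_def by blast }
  next
    fix w a assume w: "w \<in> W" and a: "a \<in> J"
    have "\<exists>g\<in>polyfun X. coeff (w * a) k = res f * res g" for k
    proof -
      obtain h where h: "\<And>i. vanish X v i (h i)" "\<And>i. coeff w i = res (h i)"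
        using W_coeff[OF w] by metis
      obtain g where g: "\<And>i. g i \<in> polyfun X" "\<And>i. coeff a i = res f * res (g i)"
      proof -
        have "\<forall>i. \<exists>g. g \<in> polyfun X \<and> coeff a i = res f * res g" using a unfolding J_def by blast
        then show thesis using that by metis
      qed
      have "coeff (w * a) k = (\<Sum>i\<le>k. res (h i) * (res f * res (g (k - i))))"
        by (simp only: coeff_mult h g)
      also have "\<dots> = res f * res (\<lambda>p. \<Sum>i\<le>k. h i p * g (k - i) p)"
        by (simp only: res_sum res_mult sum_distrib_left mult.left_commute)
      finally show ?thesis using polyfun_sum[of "{..k}" "\<lambda>i p. h i p * g (k - i) p" X]
        using polyfun.mult[OF vanish_polyfun[OF h(1)] g(1)] by blast
    qed
    moreover have "w * a \<in> W" using w a subring_ofD(5)[OF W] unfolding J_def by blast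
    ultimately show "w * a \<in> J" unfolding J_def by blast
  qed
  obtain Fs where Fs: "finite Fs" "Fs \<subseteq> J" "\<And>I. ideal_of W I \<Longrightarrow> Fs \<subseteq> I \<Longrightarrow> J \<subseteq> I"
    using W_noeth J by (auto simp: noetherian_subring_def)
  have Fs_W: "Fs \<subseteq> W" using Fs(2) by (auto simp: J_def)
  \<comment> \<open>A common bound for the degrees of the generators of \<open>J\<close>; this is
    the Artin-Rees shift.\<close>
  define c where "c = (\<Sum>F\<in>Fs. degree F)"
  show thesis
  proof (rule that[of c])
    fix k g h assume g: "g \<in> polyfun X" and h: "vanish X v (k + c) h" and eq: "\<forall>p\<in>Z. f p * g p = h p"
    have res_eq: "res h = res f * res g" using eq r_in by (auto simp: res_def)
    have "monom (res h) (k + c) \<in> J"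
      unfolding J_def coeff_monom using W_monom[OF h] g res_eq J_zero by auto
    then obtain C where C: "\<And>F. F \<in> Fs \<Longrightarrow> C F \<in> W" "monom (res h) (k + c) = (\<Sum>F\<in>Fs. C F * F)"
      using ideal_combination[OF W Fs(1) Fs(3) Fs_W] by metis
    have "\<exists>h'. vanish X v k h' \<and> coeff (C F * F) (k + c) = res f * res h'" if F: "F \<in> Fs" for F
    proof -
      obtain a where a: "\<And>i. vanish X v i (a i)" "\<And>i. coeff (C F) i = res (a i)"
        using W_coeff[OF C(1)[OF F]] by metis
      obtain b where b: "\<And>i. b i \<in> polyfun X" "\<And>i. coeff F i = res f * res (b i)"
      proof -
        have "\<forall>i. \<exists>g. g \<in> polyfun X \<and> coeff F i = res f * res g" using Fs(2) F unfolding J_def by blast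
        then show thesis using that by metis
      qed
      have dF: "degree F \<le> c" unfolding c_def using F Fs(1) by (simp add: member_le_sum)
      have "coeff (C F * F) (k + c) = (\<Sum>i\<le>k + c. coeff (C F) i * coeff F (k + c - i))"
        by (simp only: coeff_mult)
      \<comment> \<open>The generators have degree at most \<open>c\<close>, so only coefficients of
        \<open>C F\<close> in degree at least \<open>k\<close> contribute to degree
        \<open>k + c\<close>, and these lie in the \<open>k\<close>-th power.\<close>
      also have "\<dots> = (\<Sum>i\<in>{k..k + c}. coeff (C F) i * coeff F (k + c - i))"
      proof (intro sum.mono_neutral_right ballI)
        fix i assume "i \<in> {..k + c} - {k..k + c}"
        then have "degree F < k + c - i" using dF by auto
        then have "coeff F (k + c - i) = 0" by (rule coeff_eq_0)
        then show "coeff (C F) i * coeff F (k + c - i) = 0" by (simp only: mult_zero_right)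
      qed auto
      also have "\<dots> = res f * res (\<lambda>p. \<Sum>i\<in>{k..k + c}. b (k + c - i) p * a i p)"
        by (simp only: res_sum res_mult sum_distrib_left a b mult_ac)
      finally have "coeff (C F * F) (k + c) = \<dots>" .
      moreover have "vanish X v k (\<lambda>p. \<Sum>i\<in>{k..k + c}. b (k + c - i) p * a i p)"
        using vanish_mono[OF a(1)] by (intro vanish_sum vanish_mult_poly b) auto
      ultimately show ?thesis by blast
    qed
    then obtain h' where h': "\<And>F. F \<in> Fs \<Longrightarrow> vanish X v k (h' F)"
        "\<And>F. F \<in> Fs \<Longrightarrow> coeff (C F * F) (k + c) = res f * res (h' F)" by metis
    have "res h = coeff (monom (res h) (k + c)) (k + c)"
      by (simp only: coeff_monom refl if_True)
    also have "\<dots> = (\<Sum>F\<in>Fs. coeff (C F * F) (k + c))"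
      unfolding C(2) by (simp only: coeff_sum)
    also have "\<dots> = (\<Sum>F\<in>Fs. res f * res (h' F))"
      by (rule sum.cong[OF refl]) (rule h'(2))
    finally have sum: "res h = (\<Sum>F\<in>Fs. res f * res (h' F))" .
    define H where "H p = (\<Sum>F\<in>Fs. h' F p)" for p
    have vH: "vanish X v k H" unfolding H_def using h'(1) by (rule vanish_sum)
    \<comment> \<open>Both products with \<open>f\<close> equal \<open>h\<close> on
      \<open>Z\<close>. Since \<open>f\<close> does not vanish identically there, primality cancels
      it.\<close>
    have "f p * (g p - H p) = 0" if "p \<in> Z" for p
    proof -
      have "h p = (\<Sum>F\<in>Fs. f p * h' F p)"
        using fun_cong[OF sum, of p] unfolding fun_sum_apply times_fun_apply res_def r_id[OF that] .
      then show ?thesis using eq that by (simp add: H_def right_diff_distrib sum_distrib_left)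
    qed
    then have "(\<forall>p\<in>Z. f p = 0) \<or> (\<forall>p\<in>Z. g p - H p = 0)"
      by (intro Z[unfolded prime_on_def, rule_format, OF f polyfun_diff[OF g vanish_polyfun[OF vH]]])
    then have "\<forall>p\<in>Z. g p - H p = 0" using nz by blast
    then show "\<exists>h'. vanish X v k h' \<and> (\<forall>p\<in>Z. g p = h' p)" using vH by auto
  qed
qed

section \<open>Lengths of chains of irreducible closed sets\<close>

text \<open>Gaussian elimination by induction on the equations: one with a nonzero coefficient at
  \<open>i0\<close> expresses that unknown through the others.\<close>

lemma nontrivial_solution:
  fixes m :: "'i \<Rightarrow> 'j \<Rightarrow> complex"
  assumes "finite J" "finite I" "card J < card I"
  shows "\<exists>f. (\<exists>i\<in>I. f i \<noteq> 0) \<and> (\<forall>j\<in>J. (\<Sum>i\<in>I. f i * m i j) = 0)"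
  using assms
proof (induction J arbitrary: I m rule: finite_induct)
  case empty
  then have "I \<noteq> {}" by auto
  then obtain i where "i \<in> I" by blast
  then show ?case by (intro exI[of _ "\<lambda>_. 1"]) auto
next
  case (insert j0 J)
  show ?case
  proof (cases "\<forall>i\<in>I. m i j0 = 0")
    case True
    obtain f where "\<exists>i\<in>I. f i \<noteq> 0" "\<forall>j\<in>J. (\<Sum>i\<in>I. f i * m i j) = 0"
      using insert.IH[of I m] insert.prems insert.hyps by auto
    then show ?thesis using True by (intro exI[of _ f]) auto
  next
    case False
    then obtain i0 where i0: "i0 \<in> I" "m i0 j0 \<noteq> 0" by auto
    define I' where "I' = I - {i0}"
    have I': "finite I'" "card J < card I'" "i0 \<notin> I'" "I = insert i0 I'"
      using insert.prems insert.hyps i0 by (auto simp: I'_def)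
    define q where "q i = m i j0 / m i0 j0" for i
    obtain f where f: "\<exists>i\<in>I'. f i \<noteq> 0" "\<forall>j\<in>J. (\<Sum>i\<in>I'. f i * (m i j - q i * m i0 j)) = 0"
      using insert.IH[of I' "\<lambda>i j. m i j - q i * m i0 j"] I' by auto
    define F where "F i = (if i = i0 then - (\<Sum>i\<in>I'. f i * q i) else f i)" for i
    have FI: "(\<Sum>i\<in>I. F i * m i j) = (\<Sum>i\<in>I'. f i * (m i j - q i * m i0 j))" for j
    proof -
      have "(\<Sum>i\<in>I. F i * m i j) = F i0 * m i0 j + (\<Sum>i\<in>I'. F i * m i j)"
        unfolding I'(4) using I' by simp
      also have "(\<Sum>i\<in>I'. F i * m i j) = (\<Sum>i\<in>I'. f i * m i j)"
        using I'(3) by (intro sum.cong) (auto simp: F_def)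
      finally show ?thesis
        by (simp add: F_def sum_subtractf right_diff_distrib sum_distrib_right mult.assoc)
    qed
    have "(\<Sum>i\<in>I. F i * m i j0) = 0" unfolding FI using i0 by (simp add: q_def)
    moreover have "\<exists>i\<in>I. F i \<noteq> 0" using f(1) I' by (auto simp: F_def)
    ultimately show ?thesis using f(2) FI by (intro exI[of _ F]) auto
  qed
qed

text \<open>Independence of \<open>N\<close> functions modulo the ideal of \<open>Z\<close> plus the
  \<open>k\<close>-th power of the maximal ideal at \<open>v\<close>: a lower bound for the
  Hilbert-Samuel function of \<open>Z\<close> at \<open>v\<close>.\<close>

definition indep_mod :: "('p \<Rightarrow> complex) set \<Rightarrow> 'p \<Rightarrow> 'p set \<Rightarrow> nat \<Rightarrow> nat \<Rightarrow> bool" where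
  "indep_mod X v Z k N \<longleftrightarrow> (\<exists>g. (\<forall>i<N. g i \<in> polyfun X) \<and>
     (\<forall>c h. vanish X v k h \<longrightarrow> (\<forall>p\<in>Z. (\<Sum>i<N. c i * g i p) = h p) \<longrightarrow> (\<forall>i<N. c i = 0)))"

lemma indep_modI:
  assumes "\<And>i. i < N \<Longrightarrow> g i \<in> polyfun X"
    and "\<And>c h i. vanish X v k h \<Longrightarrow> (\<And>p. p \<in> Z \<Longrightarrow> (\<Sum>i<N. c i * g i p) = h p) \<Longrightarrow> i < N \<Longrightarrow> c i = 0"
  shows "indep_mod X v Z k N"
  unfolding indep_mod_def
proof (intro exI[of _ g] conjI allI impI)
  fix c h i assume "vanish X v k h" "\<forall>p\<in>Z. (\<Sum>i<N. c i * g i p) = h p" "i < N"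
  then show "c i = 0" by (intro assms(2)[of h c]) simp_all
qed (rule assms(1))

lemma indep_modD:
  fixes N :: nat
  assumes "\<forall>c h. vanish X v k h \<longrightarrow> (\<forall>p\<in>Z. (\<Sum>i<N. c i * g i p) = h p) \<longrightarrow> (\<forall>i<N. c i = 0)"
    and "vanish X v k h" "\<And>p. p \<in> Z \<Longrightarrow> (\<Sum>i<N. c i * g i p) = h p" "i < N"
  shows "c i = 0"
  using assms(1)[THEN spec[of _ c], THEN spec[of _ h]] assms(2-) by simp

lemma indep_mod_mono:
  assumes "indep_mod X v Z k N" "k \<le> l"
  shows "indep_mod X v Z l N"
proof -
  obtain g where g: "\<forall>i<N. g i \<in> polyfun X"
      "\<forall>c h. vanish X v k h \<longrightarrow> (\<forall>p\<in>Z. (\<Sum>i<N. c i * g i p) = h p) \<longrightarrow> (\<forall>i<N. c i = 0)"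
    using assms(1) unfolding indep_mod_def by (elim exE conjE)
  show ?thesis
  proof (rule indep_modI[of _ g])
    fix c h i
    assume h: "vanish X v l h" and eq: "\<And>p. p \<in> Z \<Longrightarrow> (\<Sum>i<N. c i * g i p) = h p" and i: "i < N"
    show "c i = 0" by (rule indep_modD[OF g(2) vanish_mono[OF h assms(2)] eq i])
  qed (use g(1) in simp)
qed

lemma sum_lessThan_add: "(\<Sum>i<N + M. f i) = (\<Sum>i<N. f i) + (\<Sum>i<M. f (N + i))"
  for f :: "nat \<Rightarrow> 'a::comm_monoid_add"
  by (induction M) (auto simp: add.assoc)

text \<open>The new family consists of the \<open>N\<close> functions for \<open>Z\<close> and of
  \<open>f\<close> times the \<open>M\<close> functions for \<open>Z'\<close>. Restricting a
  relation to \<open>Z\<close>, where \<open>f\<close> is zero, kills the first coefficients; what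
  remains is divisible by \<open>f\<close>, and dividing costs the Artin-Rees shift
  \<open>c\<close>.\<close>

lemma indep_mod_step:
  assumes X: "finite X" and v: "v \<in> Z'" and Z': "prime_on X Z'" and sub: "Z \<subseteq> Z'"
    and f: "f \<in> polyfun X" "\<forall>p\<in>Z. f p = 0" "p0 \<in> Z'" "f p0 \<noteq> 0"
  shows "\<exists>c. \<forall>k N M. indep_mod X v Z (k + c) N \<longrightarrow> indep_mod X v Z' k M \<longrightarrow> indep_mod X v Z' (k + c) (N + M)"
proof -
  obtain c where c: "\<And>k g h. g \<in> polyfun X \<Longrightarrow> vanish X v (k + c) h \<Longrightarrow> (\<forall>p\<in>Z'. f p * g p = h p) \<Longrightarrow>
    \<exists>h'. vanish X v k h' \<and> (\<forall>p\<in>Z'. g p = h' p)"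
    using artin_rees[OF X v Z' f(1) f(3,4)] by blast
  show ?thesis
  proof (intro exI[of _ c] allI impI)
    fix k N M assume N: "indep_mod X v Z (k + c) N" and M: "indep_mod X v Z' k M"
    obtain a where a: "\<forall>i<N. a i \<in> polyfun X"
        "\<forall>d h. vanish X v (k + c) h \<longrightarrow> (\<forall>p\<in>Z. (\<Sum>i<N. d i * a i p) = h p) \<longrightarrow> (\<forall>i<N. d i = 0)"
      using N unfolding indep_mod_def by (elim exE conjE)
    obtain b where b: "\<forall>i<M. b i \<in> polyfun X"
        "\<forall>c h. vanish X v k h \<longrightarrow> (\<forall>p\<in>Z'. (\<Sum>i<M. c i * b i p) = h p) \<longrightarrow> (\<forall>i<M. c i = 0)"
      using M unfolding indep_mod_def by (elim exE conjE)
    define g where "g i = (if i < N then a i else (\<lambda>p. f p * b (i - N) p))" for i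
    show "indep_mod X v Z' (k + c) (N + M)"
    proof (rule indep_modI[of _ g])
      fix i assume "i < N + M"
      then have "i < N \<or> i - N < M" by auto
      then show "g i \<in> polyfun X" using a(1) b(1) f(1)
        by (auto simp: g_def intro!: polyfun.mult)
    next
      fix d h i assume h: "vanish X v (k + c) h" and i: "i < N + M"
        and eq: "\<And>p. p \<in> Z' \<Longrightarrow> (\<Sum>i<N + M. d i * g i p) = h p"
      have split: "(\<Sum>i<N + M. d i * g i p) = (\<Sum>i<N. d i * a i p) + f p * (\<Sum>i<M. d (N + i) * b i p)" for p
        by (simp add: sum_lessThan_add g_def sum_distrib_left mult_ac)
      have da: "(\<Sum>i<N. d i * a i p) = h p" if "p \<in> Z" for p
        using eq[of p] sub f(2) that by (auto simp: split)
      have dN: "d i = 0" if "i < N" for i by (rule indep_modD[OF a(2) h da that])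
      have fb: "\<forall>p\<in>Z'. f p * (\<Sum>i<M. d (N + i) * b i p) = h p"
        using eq dN by (simp add: split)
      have "(\<lambda>p. \<Sum>i<M. d (N + i) * b i p) \<in> polyfun X"
        using b(1) by (intro polyfun_sum polyfun.mult polyfun.const) simp
      from c[OF this h fb] obtain h' where h': "vanish X v k h'"
          "\<forall>p\<in>Z'. (\<Sum>i<M. d (N + i) * b i p) = h' p" by blast
      have dM: "d (N + i) = 0" if "i < M" for i
        by (rule indep_modD[OF b(2) h'(1) _ that, of "\<lambda>i. d (N + i)"]) (use h'(2) in simp)
      show "d i = 0"
      proof (cases "i < N")
        case False
        then show ?thesis using dM[of "i - N"] i by simp
      qed (rule dN)
    qed
  qed
qed

text \<open>Pascal's rule: the independent functions of the smaller set are added to those already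
  found for the larger set. The order of the modulus stays linear in \<open>k\<close>, because each
  step costs the same Artin-Rees shift.\<close>

lemma chain_growth:
  assumes X: "finite X"
    and Z: "\<And>i. i \<le> d \<Longrightarrow> v \<in> Z i \<and> prime_on X (Z i)"
    and strict: "\<And>i. i < d \<Longrightarrow> Z i \<subseteq> Z (Suc i) \<and>
      (\<exists>f\<in>polyfun X. (\<forall>p\<in>Z i. f p = 0) \<and> (\<exists>p\<in>Z (Suc i). f p \<noteq> 0))"
  shows "\<exists>C. \<forall>k. indep_mod X v (Z d) (C * Suc k) (k choose d)"
  using Z strict
proof (induction d)
  case 0
  have "indep_mod X v (Z 0) (Suc k) 1" for k
  proof (rule indep_modI[of _ "\<lambda>_ _. 1"])
    fix c :: "nat \<Rightarrow> complex" and h i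
    assume h: "vanish X v (Suc k) h" "\<And>p. p \<in> Z 0 \<Longrightarrow> (\<Sum>i<1. c i * 1) = h p" and i: "i < (1::nat)"
    have "v \<in> Z 0" using 0(1)[of 0] by simp
    from h(2)[OF this] show "c i = 0" using vanish_1[OF h(1)] i by simp
  qed (rule polyfun.const)
  then show ?case by (intro exI[of _ 1]) auto
next
  case (Suc d)
  obtain C where C: "\<And>k. indep_mod X v (Z d) (C * Suc k) (k choose d)"
    using Suc.IH Suc.prems by (meson le_SucI less_SucI)
  obtain f p0 where f: "f \<in> polyfun X" "\<forall>p\<in>Z d. f p = 0" "p0 \<in> Z (Suc d)" "f p0 \<noteq> 0" "Z d \<subseteq> Z (Suc d)"
    using Suc.prems(2)[of d] by blast
  obtain c where c: "\<And>k N M. indep_mod X v (Z d) (k + c) N \<Longrightarrow> indep_mod X v (Z (Suc d)) k M \<Longrightarrow>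
      indep_mod X v (Z (Suc d)) (k + c) (N + M)"
    using indep_mod_step[OF X _ _ f(5) f(1-4)] Suc.prems(1)[of "Suc d"] by blast
  define C' where "C' = C + c"
  have "indep_mod X v (Z (Suc d)) (C' * Suc k) (k choose Suc d)" for k
  proof (induction k)
    case 0
    show ?case by (auto simp: indep_mod_def)
  next
    case (Suc k)
    have "indep_mod X v (Z d) (C' * Suc k + c) (k choose d)"
      by (rule indep_mod_mono[OF C[of k]]) (simp add: C'_def algebra_simps)
    from indep_mod_mono[OF c[OF this Suc], of "C' * Suc (Suc k)"]
    show ?case by (simp add: C'_def algebra_simps)
  qed
  then show ?case by blast
qed

section \<open>Spanning families of functions on a subset\<close>

definition combination_on :: "'p set \<Rightarrow> ('p \<Rightarrow> complex) set \<Rightarrow> ('p \<Rightarrow> complex) \<Rightarrow> bool" where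
  "combination_on Z G f \<longleftrightarrow> (\<exists>a. \<forall>p\<in>Z. f p = (\<Sum>g\<in>G. a g * g p))"

lemma combination_onI: "finite G \<Longrightarrow> g \<in> G \<Longrightarrow> combination_on Z G g"
  unfolding combination_on_def
  by (intro exI[of _ "\<lambda>h. if h = g then 1 else 0"]) (simp add: if_distrib[of "\<lambda>a. a * _"] cong: if_cong)

lemma combination_on_add:
  assumes "combination_on Z G f" "combination_on Z G g"
  shows "combination_on Z G (\<lambda>p. f p + g p)"
proof -
  obtain a b where "\<forall>p\<in>Z. f p = (\<Sum>h\<in>G. a h * h p)" "\<forall>p\<in>Z. g p = (\<Sum>h\<in>G. b h * h p)"
    using assms unfolding combination_on_def by blast
  then show ?thesis unfolding combination_on_def
    by (intro exI[of _ "\<lambda>h. a h + b h"]) (auto simp: distrib_right sum.distrib)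
qed

lemma combination_on_scale:
  assumes "combination_on Z G f"
  shows "combination_on Z G (\<lambda>p. c * f p)"
proof -
  obtain a where "\<forall>p\<in>Z. f p = (\<Sum>h\<in>G. a h * h p)"
    using assms unfolding combination_on_def by blast
  then show ?thesis unfolding combination_on_def
    by (intro exI[of _ "\<lambda>h. c * a h"]) (auto simp: sum_distrib_left mult.assoc)
qed

lemma combination_on_zero: "combination_on Z G (\<lambda>_. 0)"
  unfolding combination_on_def by (intro exI[of _ "\<lambda>_. 0"]) auto

lemma combination_on_sum:
  "(\<And>i. i \<in> I \<Longrightarrow> combination_on Z G (f i)) \<Longrightarrow> combination_on Z G (\<lambda>p. \<Sum>i\<in>I. f i p)"
  by (induction I rule: infinite_finite_induct)
     (auto intro: combination_on_zero combination_on_add)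

lemma combination_on_cong:
  "combination_on Z G f \<Longrightarrow> (\<And>p. p \<in> Z \<Longrightarrow> f p = g p) \<Longrightarrow> combination_on Z G g"
  unfolding combination_on_def by auto

lemma combination_on_mono:
  assumes "combination_on Z G f" "G \<subseteq> H" "finite H"
  shows "combination_on Z H f"
proof -
  obtain a where "\<forall>p\<in>Z. f p = (\<Sum>h\<in>G. a h * h p)"
    using assms unfolding combination_on_def by blast
  then have "combination_on Z H (\<lambda>p. \<Sum>h\<in>G. a h * h p)"
    using assms(2,3) by (intro combination_on_sum combination_on_scale combination_onI) auto
  then show ?thesis by (rule combination_on_cong) (use \<open>\<forall>p\<in>Z. f p = _ p\<close> in auto)
qed

lemma combination_on_mult:
  assumes "combination_on Z G f" and "\<And>g. g \<in> G \<Longrightarrow> combination_on Z H (\<lambda>p. t p * g p)"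
  shows "combination_on Z H (\<lambda>p. t p * f p)"
proof -
  obtain a where a: "\<forall>p\<in>Z. f p = (\<Sum>h\<in>G. a h * h p)"
    using assms unfolding combination_on_def by blast
  have "combination_on Z H (\<lambda>p. \<Sum>h\<in>G. a h * (t p * h p))"
    using assms(2) by (intro combination_on_sum combination_on_scale)
  then show ?thesis by (rule combination_on_cong) (use a in \<open>auto simp: sum_distrib_left mult_ac\<close>)
qed

text \<open>If \<open>G m\<close> spans the \<open>m\<close>-th power modulo the next one on
  \<open>Z\<close>, then the union spans everything modulo the \<open>k\<close>-th power, and a
  family larger than this union satisfies a relation.\<close>

lemma indep_mod_le_card:
  assumes ind: "indep_mod X v Z k N" and fin: "\<And>m. finite (G m)"
    and span: "\<And>m f. vanish X v m f \<Longrightarrow>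
      \<exists>g h. combination_on Z (G m) g \<and> vanish X v (Suc m) h \<and> (\<forall>p\<in>Z. f p = g p + h p)"
  shows "N \<le> card (\<Union>m<k. G m)"
proof (rule ccontr)
  define H where "H = (\<Union>m<k. G m)"
  have H: "finite H" unfolding H_def using fin by auto
  have exp: "\<exists>g h. combination_on Z H g \<and> vanish X v k h \<and> (\<forall>p\<in>Z. f p = g p + h p)"
    if "vanish X v m f" "m \<le> k" for m f
    using that
  proof (induction "k - m" arbitrary: m f)
    case 0
    then show ?case by (intro exI[of _ "\<lambda>_. 0"] exI[of _ f]) (auto intro: combination_on_zero)
  next
    case (Suc l)
    obtain g h where g: "combination_on Z (G m) g" "vanish X v (Suc m) h" "\<forall>p\<in>Z. f p = g p + h p"
      using span[OF Suc.prems(1)] by blast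
    obtain g' h' where h: "combination_on Z H g'" "vanish X v k h'" "\<forall>p\<in>Z. h p = g' p + h' p"
    proof -
      have "l = k - Suc m" "Suc m \<le> k" using Suc.hyps(2) by auto
      from Suc.hyps(1)[OF this(1) g(2) this(2)] show thesis using that by blast
    qed
    have "m < k" using Suc.hyps(2) by simp
    then have "G m \<subseteq> H" unfolding H_def by blast
    then have "combination_on Z H g" by (rule combination_on_mono[OF g(1) _ H])
    then show ?case using combination_on_add[OF _ h(1)] h g
      by (intro exI[of _ "\<lambda>p. g p + g' p"] exI[of _ h']) (auto simp: add.assoc)
  qed
  obtain b where b: "\<forall>i<N. b i \<in> polyfun X"
        "\<forall>c h. vanish X v k h \<longrightarrow> (\<forall>p\<in>Z. (\<Sum>i<N. c i * b i p) = h p) \<longrightarrow> (\<forall>i<N. c i = 0)"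
      using ind unfolding indep_mod_def by (elim exE conjE)
  have "\<exists>a h. vanish X v k h \<and> (\<forall>p\<in>Z. b i p = (\<Sum>g\<in>H. a g * g p) + h p)" if i: "i < N" for i
  proof -
    obtain g h where g: "combination_on Z H g" "vanish X v k h" "\<forall>p\<in>Z. b i p = g p + h p"
      using exp[OF vanish.poly[OF b(1)[THEN spec, THEN mp, OF i]] le0] by blast
    obtain a where "\<forall>p\<in>Z. g p = (\<Sum>h\<in>H. a h * h p)" using g(1) unfolding combination_on_def by blast
    then show ?thesis using g(2,3) by (intro exI[of _ a] exI[of _ h]) simp
  qed
  then obtain a h where ah: "\<And>i. i < N \<Longrightarrow> vanish X v k (h i)"
      "\<And>i p. i < N \<Longrightarrow> p \<in> Z \<Longrightarrow> b i p = (\<Sum>g\<in>H. a i g * g p) + h i p" by metis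
  assume "\<not> N \<le> card (\<Union>m<k. G m)"
  then have "card H < card {..<N}" by (simp add: H_def)
  then obtain c where c: "\<exists>i\<in>{..<N}. c i \<noteq> 0" "\<forall>g\<in>H. (\<Sum>i<N. c i * a i g) = 0"
    using nontrivial_solution[OF H, of "{..<N}" a] by auto
  have eq: "(\<Sum>i<N. c i * b i p) = (\<Sum>i<N. c i * h i p)" if p: "p \<in> Z" for p
  proof -
    have "(\<Sum>i<N. c i * b i p) = (\<Sum>i<N. \<Sum>g\<in>H. c i * a i g * g p) + (\<Sum>i<N. c i * h i p)"
      using p by (simp add: ah(2) distrib_left sum.distrib sum_distrib_left mult.assoc)
    also have "(\<Sum>i<N. \<Sum>g\<in>H. c i * a i g * g p) = (\<Sum>g\<in>H. (\<Sum>i<N. c i * a i g) * g p)"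
      unfolding sum_distrib_right by (rule sum.swap)
    finally show ?thesis using c(2) by simp
  qed
  have "vanish X v k (\<lambda>p. \<Sum>i<N. c i * h i p)"
    using ah(1) by (intro vanish_sum vanish_scale) auto
  from indep_modD[OF b(2) this eq] show False using c(1) by auto
qed

section \<open>Counting monomials in local coordinates\<close>

definition monomial :: "(nat \<Rightarrow> 'p \<Rightarrow> complex) \<Rightarrow> nat set \<Rightarrow> (nat \<Rightarrow> nat) \<Rightarrow> 'p \<Rightarrow> complex" where
  "monomial t I e = (\<lambda>p. \<Prod>j\<in>I. t j p ^ e j)"

definition monomials :: "(nat \<Rightarrow> 'p \<Rightarrow> complex) \<Rightarrow> nat set \<Rightarrow> nat \<Rightarrow> ('p \<Rightarrow> complex) set" where
  "monomials t I m = monomial t I ` {e \<in> PiE I (\<lambda>_. UNIV). sum e I = m}"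

lemma exponents_subset:
  assumes "finite I" "m < k"
  shows "{e \<in> PiE I (\<lambda>_. UNIV). sum e I = m} \<subseteq> PiE I (\<lambda>_. {..<k::nat})"
proof
  fix e assume e: "e \<in> {e \<in> PiE I (\<lambda>_. UNIV). sum e I = m}"
  then have "e i < k" if "i \<in> I" for i
    using member_le_sum[OF that, of e] assms by auto
  then show "e \<in> PiE I (\<lambda>_. {..<k})" using e by (auto simp: PiE_iff)
qed

lemma finite_monomials: "finite I \<Longrightarrow> finite (monomials t I m)"
  unfolding monomials_def
  by (intro finite_imageI finite_subset[OF exponents_subset[of I m "Suc m"]] finite_PiE) auto

text \<open>Bounding every exponent separately overcounts, but only the order of growth in
  \<open>k\<close> matters.\<close>

lemma card_monomials:
  assumes "finite I"
  shows "card (\<Union>m<k. monomials t I m) \<le> k ^ card I"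
proof -
  have "(\<Union>m<k. monomials t I m) \<subseteq> monomial t I ` PiE I (\<lambda>_. {..<k})"
  proof (rule UN_least)
    fix m assume "m \<in> {..<k}"
    then show "monomials t I m \<subseteq> monomial t I ` PiE I (\<lambda>_. {..<k})"
      unfolding monomials_def by (intro image_mono exponents_subset assms) simp
  qed
  then have "card (\<Union>m<k. monomials t I m) \<le> card (monomial t I ` PiE I (\<lambda>_. {..<k}))"
    using assms by (intro card_mono finite_imageI finite_PiE) auto
  also have "\<dots> \<le> card (PiE I (\<lambda>_. {..<k}))" using assms by (intro card_image_le finite_PiE) auto
  finally show ?thesis using assms by (simp add: card_PiE)
qed

lemma monomials_0: "finite I \<Longrightarrow> (\<lambda>_. 1) \<in> monomials t I 0"
  unfolding monomials_def monomial_def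
  by (intro image_eqI[of _ _ "\<lambda>i. if i \<in> I then 0 else undefined"]) auto

lemma monomials_Suc:
  assumes "finite I" "j \<in> I" "g \<in> monomials t I m"
  shows "(\<lambda>p. t j p * g p) \<in> monomials t I (Suc m)"
proof -
  obtain e where e: "e \<in> PiE I (\<lambda>_. UNIV)" "sum e I = m" "g = monomial t I e"
    using assms(3) by (auto simp: monomials_def)
  define e' where "e' = e(j := Suc (e j))"
  have "e' \<in> PiE I (\<lambda>_. UNIV)" using e(1) assms(2) by (auto simp: e'_def PiE_iff extensional_def)
  moreover have "sum e' I = Suc m"
    using assms(1,2) e(2) by (simp add: e'_def sum.remove[of I j])
  moreover have "(\<lambda>p. t j p * g p) = monomial t I e'"
    using assms(1,2) by (auto simp: fun_eq_iff monomial_def e(3) e'_def prod.remove[of I j])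
  ultimately show ?thesis unfolding monomials_def by blast
qed

text \<open>Each factor \<open>x - x v\<close> is replaced by its linear part in the coordinates
  \<open>t\<close>; every error that this creates gains one order of vanishing.\<close>

lemma vanish_combination:
  assumes I: "finite I" and tv: "\<And>j. j \<in> I \<Longrightarrow> vanish X v 1 (t j)"
    and gens: "\<And>x. x \<in> X \<Longrightarrow> \<exists>a h. vanish X v 2 h \<and> (\<forall>p\<in>Z. x p - x v = (\<Sum>j\<in>I. a j * t j p) + h p)"
    and f: "vanish X v m f"
  shows "\<exists>g h. combination_on Z (monomials t I m) g \<and> vanish X v m g \<and> vanish X v (Suc m) h \<and>
    (\<forall>p\<in>Z. f p = g p + h p)"
  using f
proof (induction rule: vanish.induct)
  case (zero k)
  show ?case
    by (intro exI[of _ "\<lambda>_. 0"]) (auto intro: combination_on_zero vanish.zero)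
next
  case (poly f)
  have "combination_on Z (monomials t I 0) (\<lambda>p. f v * 1)"
    by (intro combination_on_scale combination_onI finite_monomials monomials_0 I)
  moreover have "vanish X v (Suc 0) (\<lambda>p. f p - f v)" using polyfun_diff_vanish[OF poly] by simp
  ultimately show ?case
    by (intro exI[of _ "\<lambda>p. f v * 1"] exI[of _ "\<lambda>p. f p - f v"])
       (auto intro: vanish.poly polyfun.const)
next
  case (step x k f)
  obtain a h2 where x: "vanish X v 2 h2" "\<forall>p\<in>Z. x p - x v = (\<Sum>j\<in>I. a j * t j p) + h2 p"
    using gens[OF step(1)] by blast
  obtain g h where g: "combination_on Z (monomials t I k) g" "vanish X v k g" "vanish X v (Suc k) h"
      "\<forall>p\<in>Z. f p = g p + h p" using step.IH by blast
  define l where "l p = (\<Sum>j\<in>I. a j * t j p)" for p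
  have l: "vanish X v 1 l" unfolding l_def by (intro vanish_sum vanish_scale tv)
  have "combination_on Z (monomials t I (Suc k)) (\<lambda>p. \<Sum>j\<in>I. a j * (t j p * g p))"
    by (intro combination_on_sum combination_on_scale combination_on_mult[OF g(1)]
        combination_onI finite_monomials monomials_Suc I)
  moreover have "(\<lambda>p. \<Sum>j\<in>I. a j * (t j p * g p)) = (\<lambda>p. l p * g p)"
    by (auto simp: l_def sum_distrib_right mult.assoc)
  moreover have "vanish X v (Suc k) (\<lambda>p. l p * g p)"
    using vanish_mult[OF l g(2)] by simp
  moreover have "vanish X v (Suc (Suc k)) (\<lambda>p. l p * h p)" "vanish X v (Suc (Suc k)) (\<lambda>p. h2 p * f p)"
    using vanish_mult[OF l g(3)] vanish_mult[OF x(1) step(2)] by simp_all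
  ultimately show ?case using x(2) g(4)
    by (intro exI[of _ "\<lambda>p. l p * g p"] exI[of _ "\<lambda>p. l p * h p + h2 p * f p"])
       (auto intro!: vanish.add simp: l_def algebra_simps)
next
  case (add k f f')
  obtain g h g' h' where "combination_on Z (monomials t I k) g" "vanish X v k g" "vanish X v (Suc k) h"
      "\<forall>p\<in>Z. f p = g p + h p" "combination_on Z (monomials t I k) g'" "vanish X v k g'"
      "vanish X v (Suc k) h'" "\<forall>p\<in>Z. f' p = g' p + h' p" using add.IH by blast
  then show ?case
    by (intro exI[of _ "\<lambda>p. g p + g' p"] exI[of _ "\<lambda>p. h p + h' p"])
       (auto intro: vanish.add combination_on_add)
qed

text \<open>A quadratic relation solved for \<open>s\<^sup>2\<close> leaves only the monomials that are at most linear in \<open>s\<close>.\<close>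

definition monomials1 :: "(nat \<Rightarrow> 'p \<Rightarrow> complex) \<Rightarrow> nat set \<Rightarrow> ('p \<Rightarrow> complex) \<Rightarrow> nat \<Rightarrow> ('p \<Rightarrow> complex) set" where
  "monomials1 t I s m = monomials t I m \<union> (case m of 0 \<Rightarrow> {} | Suc l \<Rightarrow> (\<lambda>g p. s p * g p) ` monomials t I l)"

lemma finite_monomials1: "finite I \<Longrightarrow> finite (monomials1 t I s m)"
  by (auto simp: monomials1_def finite_monomials split: nat.split)

lemma card_monomials1:
  assumes "finite I"
  shows "card (\<Union>m<k. monomials1 t I s m) \<le> 2 * k ^ card I"
proof -
  define U where "U = (\<Union>m<k. monomials t I m)"
  have U: "finite U" unfolding U_def using finite_monomials[OF assms] by auto
  have "(\<Union>m<k. monomials1 t I s m) \<subseteq> U \<union> (\<lambda>g p. s p * g p) ` U"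
  proof (rule UN_least)
    fix m assume m: "m \<in> {..<k}"
    have *: "monomials t I l \<subseteq> U" if "l \<le> m" for l
      unfolding U_def using that m by (intro UN_upper) simp
    show "monomials1 t I s m \<subseteq> U \<union> (\<lambda>g p. s p * g p) ` U"
    proof (cases m)
      case 0
      then show ?thesis using *[of 0] by (simp add: monomials1_def le_supI1)
    next
      case (Suc l)
      then have "(\<lambda>g p. s p * g p) ` monomials t I l \<subseteq> (\<lambda>g p. s p * g p) ` U"
        using *[of l] by (intro image_mono) simp
      then show ?thesis using *[of m] Suc unfolding monomials1_def by (simp only: nat.case) blast
    qed
  qed
  then have "card (\<Union>m<k. monomials1 t I s m) \<le> card (U \<union> (\<lambda>g p. s p * g p) ` U)"
    using U by (intro card_mono) auto
  also have "\<dots> \<le> card U + card ((\<lambda>g p. s p * g p) ` U)" by (rule card_Un_le)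
  also have "\<dots> \<le> 2 * card U" using card_image_le[OF U] by (simp add: mult_2)
  finally show ?thesis using card_monomials[OF assms, of t k] unfolding U_def by linarith
qed

text \<open>Normal forms \<open>r0 + s * r1\<close>, with \<open>r0\<close> of degree
  \<open>m\<close> and \<open>r1\<close> of degree \<open>m - 1\<close> in \<open>t\<close>.
  Multiplying by a generator creates \<open>s * s * r1\<close>, which the quadratic relation makes
  linear in \<open>s\<close> again; the cubic error times \<open>r1\<close> still has sufficient
  order.\<close>

lemma vanish_combination1:
  assumes I: "finite I" and tv: "\<And>j. j \<in> I \<Longrightarrow> vanish X v 1 (t j)" and sv: "vanish X v 1 s"
    and gens: "\<And>x. x \<in> X \<Longrightarrow> \<exists>a b h. vanish X v 2 h \<and> (\<forall>p\<in>Z. x p - x v = b * s p + (\<Sum>j\<in>I. a j * t j p) + h p)"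
    and quad: "vanish X v 3 h3" "\<forall>p\<in>Z. s p * s p = s p * (\<Sum>j\<in>I. a1 j * t j p) +
       (\<Sum>i\<in>I. \<Sum>j\<in>I. a2 i j * (t i p * t j p)) + h3 p"
    and f: "vanish X v m f"
  shows "\<exists>g h. combination_on Z (monomials1 t I s m) g \<and> vanish X v (Suc m) h \<and> (\<forall>p\<in>Z. f p = g p + h p)"
proof -
  define A where "A m g \<longleftrightarrow> combination_on Z (monomials t I m) g \<and> vanish X v m g" for m g
  \<comment> \<open>The coefficient of \<open>s\<close> has one degree less, so it is forced to be
    zero when \<open>m\<close> is zero.\<close>
  define B where "B m g \<longleftrightarrow> (case m of 0 \<Rightarrow> g = (\<lambda>_. 0) | Suc l \<Rightarrow> A l g)" for m and g :: "'a \<Rightarrow> complex"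
  have A_zero: "A m (\<lambda>_. 0)" for m by (simp add: A_def combination_on_zero vanish.zero)
  have A_add: "A m (\<lambda>p. f p + g p)" if "A m f" "A m g" for m f g
    using that by (auto simp: A_def intro: combination_on_add vanish.add)
  have A_scale: "A m (\<lambda>p. c * f p)" if "A m f" for m c f
    using that by (auto simp: A_def intro: combination_on_scale vanish_scale)
  have A_sum: "A m (\<lambda>p. \<Sum>i\<in>J. f i p)" if "\<And>i. i \<in> J \<Longrightarrow> A m (f i)" for J :: "nat set" and m f
    using that by (auto simp: A_def intro: combination_on_sum vanish_sum)
  have A_t: "A (Suc m) (\<lambda>p. t j p * g p)" if "A m g" "j \<in> I" for m g j
  proof -
    have "combination_on Z (monomials t I (Suc m)) (\<lambda>p. t j p * g p)"
      by (rule combination_on_mult[OF that(1)[unfolded A_def, THEN conjunct1]],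
          rule combination_onI[OF finite_monomials[OF I]]) (rule monomials_Suc[OF I that(2)])
    then show ?thesis using vanish_mult[OF tv[OF that(2)], of m g] that(1) by (simp add: A_def)
  qed
  have A_lin: "A (Suc m) (\<lambda>p. (\<Sum>j\<in>I. a j * t j p) * g p)" if "A m g" for m g a
  proof -
    have "A (Suc m) (\<lambda>p. \<Sum>j\<in>I. a j * (t j p * g p))" by (intro A_sum A_scale A_t that)
    then show ?thesis by (simp add: sum_distrib_right mult.assoc)
  qed
  have A_quad: "A (Suc (Suc m)) (\<lambda>p. (\<Sum>i\<in>I. \<Sum>j\<in>I. a2 i j * (t i p * t j p)) * g p)" if "A m g" for m g
  proof -
    have "A (Suc (Suc m)) (\<lambda>p. \<Sum>i\<in>I. \<Sum>j\<in>I. a2 i j * (t i p * (t j p * g p)))"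
      by (intro A_sum A_scale A_t that)
    then show ?thesis by (simp add: sum_distrib_right mult.assoc)
  qed
  have B_add: "B m (\<lambda>p. f p + g p)" if "B m f" "B m g" for m f g
    using that by (auto simp: B_def intro: A_add split: nat.splits)
  have B_scale: "B m (\<lambda>p. c * f p)" if "B m f" for m c f
    using that by (auto simp: B_def intro: A_scale split: nat.splits)
  have B_lin: "A m (\<lambda>p. (\<Sum>j\<in>I. a j * t j p) * g p)" if "B m g" for m g a
    using that A_lin A_zero by (auto simp: B_def split: nat.splits)
  have B_quad: "A (Suc m) (\<lambda>p. (\<Sum>i\<in>I. \<Sum>j\<in>I. a2 i j * (t i p * t j p)) * g p)" if "B m g" for m g
    using that A_quad A_zero by (auto simp: B_def split: nat.splits)
  have B_h3: "vanish X v (Suc (Suc m)) (\<lambda>p. h3 p * g p)" if "B m g" for m g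
  proof (cases m)
    case 0 then show ?thesis using that by (simp add: B_def vanish.zero)
  next
    case (Suc l)
    then have "vanish X v l g" using that by (simp add: B_def A_def)
    from vanish_mult[OF quad(1) this] show ?thesis by (simp add: Suc eval_nat_numeral)
  qed
  have main: "\<exists>r0 r1 h. A m r0 \<and> B m r1 \<and> vanish X v (Suc m) h \<and> (\<forall>p\<in>Z. f p = r0 p + s p * r1 p + h p)"
    using f
  proof (induction rule: vanish.induct)
    case (zero k)
    have "B k (\<lambda>_. 0)" using A_zero by (auto simp: B_def split: nat.split)
    then show ?case using A_zero vanish.zero by (intro exI[of _ "\<lambda>_. 0"]) auto
  next
    case (poly f)
    have "combination_on Z (monomials t I 0) (\<lambda>p. f v * 1)"
      by (intro combination_on_scale combination_onI finite_monomials monomials_0 I)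
    then have "A 0 (\<lambda>p. f v)" by (simp add: A_def vanish.poly polyfun.const)
    moreover have "vanish X v (Suc 0) (\<lambda>p. f p - f v)" using polyfun_diff_vanish[OF poly] by simp
    ultimately show ?case
      by (intro exI[of _ "\<lambda>p. f v"] exI[of _ "\<lambda>_. 0"] exI[of _ "\<lambda>p. f p - f v"]) (auto simp: B_def)
  next
    case (step x k f)
    obtain a b h2 where x: "vanish X v 2 h2"
        "\<And>p. p \<in> Z \<Longrightarrow> x p - x v = b * s p + (\<Sum>j\<in>I. a j * t j p) + h2 p"
      using gens[OF step(1)] by blast
    obtain r0 r1 h where r: "A k r0" "B k r1" "vanish X v (Suc k) h" "\<And>p. p \<in> Z \<Longrightarrow> f p = r0 p + s p * r1 p + h p"
      using step.IH by blast
    define l where "l p = (\<Sum>j\<in>I. a j * t j p)" for p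
    define l1 where "l1 p = (\<Sum>j\<in>I. a1 j * t j p)" for p
    define q2 where "q2 p = (\<Sum>i\<in>I. \<Sum>j\<in>I. a2 i j * (t i p * t j p))" for p
    have ss: "s p * s p = s p * l1 p + q2 p + h3 p" if "p \<in> Z" for p
      using quad(2) that by (simp add: l1_def q2_def)
    have xl: "x p - x v = b * s p + l p + h2 p" if "p \<in> Z" for p
      using x(2)[OF that] by (simp add: l_def)
    have l: "vanish X v 1 l" unfolding l_def by (intro vanish_sum vanish_scale tv)
    define R0 where "R0 p = l p * r0 p + b * (q2 p * r1 p)" for p
    define R1 where "R1 p = b * r0 p + (l p * r1 p + b * (l1 p * r1 p))" for p
    define H where "H p = (b * s p + l p) * h p + h2 p * f p + b * (h3 p * r1 p)" for p
    have "A (Suc k) R0" unfolding R0_def l_def q2_def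
      by (intro A_add A_scale A_lin r(1) B_quad r(2))
    moreover have "A k R1" unfolding R1_def l_def l1_def
      by (intro A_add A_scale B_lin r)
    moreover have "vanish X v (Suc (Suc k)) H" unfolding H_def
    proof (intro vanish.add vanish_scale B_h3 r)
      have "vanish X v 1 (\<lambda>p. b * s p + l p)" by (intro vanish.add vanish_scale sv l)
      from vanish_mult[OF this r(3)] show "vanish X v (Suc (Suc k)) (\<lambda>p. (b * s p + l p) * h p)" by simp
      from vanish_mult[OF x(1) step(2)] show "vanish X v (Suc (Suc k)) (\<lambda>p. h2 p * f p)" by simp
    qed
    moreover have "(x p - x v) * f p = R0 p + s p * R1 p + H p" if p: "p \<in> Z" for p
    proof -
      \<comment> \<open>The discrepancy is a combination of three relations valid on
        \<open>Z\<close>: the quadratic one, the linear expansion of \<open>x\<close>, and the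
        induction hypothesis for \<open>f\<close>.\<close>
      have "R0 p + s p * R1 p + H p - (x p - x v) * f p =
          b * r1 p * (s p * l1 p + q2 p + h3 p - s p * s p)
          + ((b * s p + l p + h2 p) - (x p - x v)) * f p
          + (b * s p + l p) * (r0 p + s p * r1 p + h p - f p)"
        by (simp add: R0_def R1_def H_def algebra_simps)
      then show ?thesis using ss[OF p] xl[OF p] r(4)[OF p] by simp
    qed
    ultimately show ?case
      by (intro exI[of _ R0] exI[of _ R1] exI[of _ H]) (auto simp: B_def)
  next
    case (add k f f')
    obtain r0 r1 h r0' r1' h' where "A k r0" "B k r1" "vanish X v (Suc k) h"
        "\<forall>p\<in>Z. f p = r0 p + s p * r1 p + h p" "A k r0'" "B k r1'" "vanish X v (Suc k) h'"
        "\<forall>p\<in>Z. f' p = r0' p + s p * r1' p + h' p" using add.IH by blast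
    then show ?case
      by (intro exI[of _ "\<lambda>p. r0 p + r0' p"] exI[of _ "\<lambda>p. r1 p + r1' p"] exI[of _ "\<lambda>p. h p + h' p"])
         (auto intro: vanish.add A_add B_add simp: distrib_left)
  qed
  then obtain r0 r1 h where r: "A m r0" "B m r1" "vanish X v (Suc m) h" "\<forall>p\<in>Z. f p = r0 p + s p * r1 p + h p"
    by blast
  have "combination_on Z (monomials1 t I s m) r0"
    by (rule combination_on_mono[OF r(1)[unfolded A_def, THEN conjunct1] _ finite_monomials1[OF I]])
       (simp add: monomials1_def)
  moreover have "combination_on Z (monomials1 t I s m) (\<lambda>p. s p * r1 p)"
  proof (cases m)
    case 0
    then show ?thesis using r(2) by (simp add: B_def combination_on_zero)
  next
    case (Suc l)
    then have "combination_on Z (monomials t I l) r1" using r(2) by (simp add: B_def A_def)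
    then show ?thesis
      by (rule combination_on_mult, intro combination_onI finite_monomials1 I)
         (auto simp: monomials1_def Suc)
  qed
  ultimately show ?thesis using combination_on_add r(3,4)
    by (intro exI[of _ "\<lambda>p. r0 p + s p * r1 p"] exI[of _ h]) auto
qed

text \<open>\<open>k choose d\<close> is at least \<open>(k / d) ^ d\<close>, which outgrows any
  polynomial of degree \<open>s\<close> below \<open>d\<close>. The factor 2 leaves room for the
  second half of \<open>monomials1\<close>.\<close>

lemma growth_contradiction:
  fixes C s d :: nat
  assumes "\<And>k. k choose d \<le> 2 * (C * Suc k) ^ s"
  shows "d \<le> s"
proof (rule ccontr)
  assume "\<not> d \<le> s"
  then have ds: "Suc s \<le> d" by simp
  \<comment> \<open>Makes \<open>k / d\<close> exceed by 2 the constant that is left after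
    cancelling \<open>(k / d) ^ s\<close>. Also \<open>k\<close> is at least \<open>d\<close>, as
    the binomial bound requires.\<close>
  define k where "k = d * (2 * (2 * C) ^ s * d ^ s + 1) + d"
  have k: "k \<ge> d" "d > 0" "k > 0" using ds by (auto simp: k_def)
  have "(real k / real d) ^ Suc s \<le> (real k / real d) ^ d"
    using k ds by (intro power_increasing) auto
  also have "\<dots> \<le> real (k choose d)" using binomial_ge_n_over_k_pow_k[OF k(1), where 'a = real] by simp
  also have "\<dots> \<le> real (2 * (C * Suc k) ^ s)" using assms[of k] by (rule of_nat_mono)
  also have "\<dots> \<le> real (2 * (C * (2 * k)) ^ s)"
    using k by (intro of_nat_mono mult_left_mono power_mono) auto
  also have "\<dots> = 2 * (2 * real C) ^ s * real d ^ s * (real k / real d) ^ s"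
    using k by (simp add: power_mult_distrib power_divide)
  finally have "(real k / real d) ^ s * (real k / real d) \<le> (2 * (2 * real C) ^ s * real d ^ s) * (real k / real d) ^ s"
    by (simp add: mult.commute)
  then have "real k / real d * (real k / real d) ^ s \<le> (2 * (2 * real C) ^ s * real d ^ s) * (real k / real d) ^ s"
    by (simp only: mult.commute)
  then have "real k / real d \<le> 2 * (2 * real C) ^ s * real d ^ s"
    by (rule mult_right_le_imp_le) (use k in simp)
  moreover have "real k / real d > 2 * (2 * real C) ^ s * real d ^ s"
  proof -
    have "real k = real d * (2 * (2 * real C) ^ s * real d ^ s + 1) + real d * 1"
      by (simp only: k_def of_nat_add of_nat_mult of_nat_power of_nat_numeral of_nat_1 mult_1_right)
    then have "real k = real d * (2 * (2 * real C) ^ s * real d ^ s + 1 + 1)"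
      by (simp only: distrib_left)
    then have "real k / real d = 2 * (2 * real C) ^ s * real d ^ s + 2"
      using k by simp
    then show ?thesis by simp
  qed
  ultimately show False by simp
qed

text \<open>The growth forced by the chain cannot exceed the number of monomials in
  \<open>card I\<close> coordinates: the dimension is at most the embedding dimension.\<close>

lemma chain_length_le:
  fixes I :: "nat set"
  assumes X: "finite X"
    and Z: "\<And>i. i \<le> d \<Longrightarrow> v \<in> Z i \<and> prime_on X (Z i)"
    and strict: "\<And>i. i < d \<Longrightarrow> Z i \<subseteq> Z (Suc i) \<and>
      (\<exists>f\<in>polyfun X. (\<forall>p\<in>Z i. f p = 0) \<and> (\<exists>p\<in>Z (Suc i). f p \<noteq> 0))"
    and I: "finite I" and tv: "\<And>j. j \<in> I \<Longrightarrow> vanish X v 1 (t j)"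
    and gens: "\<And>x. x \<in> X \<Longrightarrow> \<exists>a h. vanish X v 2 h \<and> (\<forall>p\<in>Z d. x p - x v = (\<Sum>j\<in>I. a j * t j p) + h p)"
  shows "d \<le> card I"
proof -
  obtain C where C: "\<And>k. indep_mod X v (Z d) (C * Suc k) (k choose d)"
    using chain_growth[of X d v Z, OF X Z strict] by blast
  show ?thesis
  proof (rule growth_contradiction)
    fix k
    have "k choose d \<le> card (\<Union>m<C * Suc k. monomials t I m)"
    proof (rule indep_mod_le_card[OF C finite_monomials[OF I]])
      fix m f assume "vanish X v m f"
      from vanish_combination[OF I tv gens this]
      show "\<exists>g h. combination_on (Z d) (monomials t I m) g \<and> vanish X v (Suc m) h \<and> (\<forall>p\<in>Z d. f p = g p + h p)"
        by blast
    qed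
    also have "\<dots> \<le> (C * Suc k) ^ card I" by (rule card_monomials[OF I])
    finally show "k choose d \<le> 2 * (C * Suc k) ^ card I" by linarith
  qed
qed

text \<open>The coordinate \<open>s\<close> does not count towards the bound: monomials at most
  linear in it only contribute a factor 2.\<close>

lemma chain_length_le1:
  fixes I :: "nat set"
  assumes X: "finite X"
    and Z: "\<And>i. i \<le> d \<Longrightarrow> v \<in> Z i \<and> prime_on X (Z i)"
    and strict: "\<And>i. i < d \<Longrightarrow> Z i \<subseteq> Z (Suc i) \<and>
      (\<exists>f\<in>polyfun X. (\<forall>p\<in>Z i. f p = 0) \<and> (\<exists>p\<in>Z (Suc i). f p \<noteq> 0))"
    and I: "finite I" and tv: "\<And>j. j \<in> I \<Longrightarrow> vanish X v 1 (t j)" and sv: "vanish X v 1 s"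
    and gens: "\<And>x. x \<in> X \<Longrightarrow> \<exists>a b h. vanish X v 2 h \<and>
      (\<forall>p\<in>Z d. x p - x v = b * s p + (\<Sum>j\<in>I. a j * t j p) + h p)"
    and quad: "vanish X v 3 h3" "\<forall>p\<in>Z d. s p * s p = s p * (\<Sum>j\<in>I. a1 j * t j p) +
       (\<Sum>i\<in>I. \<Sum>j\<in>I. a2 i j * (t i p * t j p)) + h3 p"
  shows "d \<le> card I"
proof -
  obtain C where C: "\<And>k. indep_mod X v (Z d) (C * Suc k) (k choose d)"
    using chain_growth[of X d v Z, OF X Z strict] by blast
  show ?thesis
  proof (rule growth_contradiction)
    fix k
    have "k choose d \<le> card (\<Union>m<C * Suc k. monomials1 t I s m)"
      by (rule indep_mod_le_card[OF C finite_monomials1[OF I]])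
         (rule vanish_combination1[OF I tv sv gens quad])
    also have "\<dots> \<le> 2 * (C * Suc k) ^ card I" by (rule card_monomials1[OF I])
    finally show "k choose d \<le> 2 * (C * Suc k) ^ card I" .
  qed
qed

section \<open>Matrices of unspecified size\<close>

text \<open>
  Matrices of all sizes are padded with zeros to form one ring without unit, so that ring
  simplification applies to rectangular products; \<open>shp r c\<close> recovers the size.
\<close>

typedef fmat = "{f :: nat \<Rightarrow> nat \<Rightarrow> complex. \<exists>N. \<forall>i j. N \<le> i \<or> N \<le> j \<longrightarrow> f i j = 0}"
  morphisms ent Abs_fmat
  by (intro exI[of _ "\<lambda>_ _. 0"]) auto

setup_lifting type_definition_fmat

lemma fmat_eqI: "(\<And>i j. ent X i j = ent Y i j) \<Longrightarrow> X = Y"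
  by (metis ent_inject ext)

lemma ent_bound: "\<exists>N. \<forall>i j. N \<le> i \<or> N \<le> j \<longrightarrow> ent X i j = 0"
  using ent[of X] by simp

lemma ent_bounds2: "\<exists>N. \<forall>i j. N \<le> i \<or> N \<le> j \<longrightarrow> ent X i j = 0 \<and> ent Y i j = 0"
proof -
  obtain N1 N2 where "\<And>i j. N1 \<le> i \<or> N1 \<le> j \<Longrightarrow> ent X i j = 0" "\<And>i j. N2 \<le> i \<or> N2 \<le> j \<Longrightarrow> ent Y i j = 0"
    using ent_bound[of X] ent_bound[of Y] by blast
  then show ?thesis by (intro exI[of _ "max N1 N2"]) auto
qed

text \<open>The index set of the sum is finite, and it contains every \<open>k\<close> that contributes.\<close>

definition fm_mult_fun :: "(nat \<Rightarrow> nat \<Rightarrow> complex) \<Rightarrow> (nat \<Rightarrow> nat \<Rightarrow> complex) \<Rightarrow> nat \<Rightarrow> nat \<Rightarrow> complex" where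
  "fm_mult_fun f g i j = (\<Sum>k\<in>{k. f i k \<noteq> 0}. f i k * g k j)"

lemma fm_mult_fun_eq:
  assumes "\<And>k. N \<le> k \<Longrightarrow> f i k = 0 \<or> g k j = 0" "\<exists>M. \<forall>k\<ge>M. f i k = 0"
  shows "fm_mult_fun f g i j = (\<Sum>k<N. f i k * g k j)"
proof -
  obtain M where M: "\<And>k. M \<le> k \<Longrightarrow> f i k = 0" using assms(2) by auto
  have sub: "{k. f i k \<noteq> 0} \<subseteq> {..<M}" using M by (auto simp: not_le[symmetric])
  have "fm_mult_fun f g i j = (\<Sum>k\<in>{..<M} \<union> {..<N}. f i k * g k j)"
    unfolding fm_mult_fun_def using sub by (intro sum.mono_neutral_left) auto
  also have "\<dots> = (\<Sum>k<N. f i k * g k j)"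
  proof (rule sum.mono_neutral_right)
    show "\<forall>k\<in>{..<M} \<union> {..<N} - {..<N}. f i k * g k j = 0"
      using assms(1) by (metis DiffD2 lessThan_iff linorder_not_less mult_zero_left mult_zero_right)
  qed auto
  finally show ?thesis .
qed

instantiation fmat :: ring
begin

lift_definition zero_fmat :: fmat is "\<lambda>_ _. 0" by simp

lift_definition plus_fmat :: "fmat \<Rightarrow> fmat \<Rightarrow> fmat" is "\<lambda>f g i j. f i j + g i j"
proof -
  fix f g :: "nat \<Rightarrow> nat \<Rightarrow> complex"
  assume "\<exists>N. \<forall>i j. N \<le> i \<or> N \<le> j \<longrightarrow> f i j = 0" "\<exists>N. \<forall>i j. N \<le> i \<or> N \<le> j \<longrightarrow> g i j = 0"
  then obtain N1 N2 where "\<forall>i j. N1 \<le> i \<or> N1 \<le> j \<longrightarrow> f i j = 0" "\<forall>i j. N2 \<le> i \<or> N2 \<le> j \<longrightarrow> g i j = 0"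
    by blast
  then show "\<exists>N. \<forall>i j. N \<le> i \<or> N \<le> j \<longrightarrow> f i j + g i j = 0"
    by (intro exI[of _ "max N1 N2"]) auto
qed

lift_definition uminus_fmat :: "fmat \<Rightarrow> fmat" is "\<lambda>f i j. - f i j" by simp

definition minus_fmat :: "fmat \<Rightarrow> fmat \<Rightarrow> fmat" where "minus_fmat X Y = X + (- Y)"

lift_definition times_fmat :: "fmat \<Rightarrow> fmat \<Rightarrow> fmat" is fm_mult_fun
proof -
  fix f g :: "nat \<Rightarrow> nat \<Rightarrow> complex"
  assume "\<exists>N. \<forall>i j. N \<le> i \<or> N \<le> j \<longrightarrow> f i j = 0" "\<exists>N. \<forall>i j. N \<le> i \<or> N \<le> j \<longrightarrow> g i j = 0"
  then obtain N1 N2 where "\<forall>i j. N1 \<le> i \<or> N1 \<le> j \<longrightarrow> f i j = 0" "\<forall>i j. N2 \<le> i \<or> N2 \<le> j \<longrightarrow> g i j = 0"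
    by blast
  then show "\<exists>N. \<forall>i j. N \<le> i \<or> N \<le> j \<longrightarrow> fm_mult_fun f g i j = 0"
    by (intro exI[of _ "max N1 N2"]) (auto simp: fm_mult_fun_def)
qed

lemma ent_mult_bound:
  assumes "\<And>k. N \<le> k \<Longrightarrow> ent X i k = 0 \<or> ent Y k j = 0"
  shows "ent (X * Y) i j = (\<Sum>k<N. ent X i k * ent Y k j)"
proof -
  have "\<exists>M. \<forall>k\<ge>M. ent X i k = 0" using ent_bound[of X] by blast
  then show ?thesis unfolding times_fmat.rep_eq by (intro fm_mult_fun_eq assms)
qed

instance
proof
  fix a b c :: fmat
  show "a + b + c = a + (b + c)" "a + b = b + a" "0 + a = a" "- a + a = 0"
    by (intro fmat_eqI; simp add: plus_fmat.rep_eq zero_fmat.rep_eq uminus_fmat.rep_eq)+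
  show "a - b = a + (- b)" by (rule minus_fmat_def)
  obtain N1 where N1: "\<And>i j. N1 \<le> i \<or> N1 \<le> j \<Longrightarrow> ent a i j = 0" "\<And>i j. N1 \<le> i \<or> N1 \<le> j \<Longrightarrow> ent b i j = 0"
    using ent_bounds2[of a b] by blast
  obtain N2 where N2: "\<And>i j. N2 \<le> i \<or> N2 \<le> j \<Longrightarrow> ent c i j = 0"
    using ent_bound[of c] by blast
  define N where "N = max N1 N2"
  have N: "ent a i j = 0" "ent b i j = 0" "ent c i j = 0" if "N \<le> i \<or> N \<le> j" for i j
    using N1 N2 that by (auto simp: N_def)
  have mult: "ent (x * y) i j = (\<Sum>k<N. ent x i k * ent y k j)"
    if "\<And>i j. N \<le> i \<or> N \<le> j \<Longrightarrow> ent x i j = 0" for x y i j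
    using that by (intro ent_mult_bound) auto
  have ab: "ent (a * b) i j = 0" if "N \<le> i \<or> N \<le> j" for i j
  proof -
    have "ent (a * b) i j = (\<Sum>k<N. ent a i k * ent b k j)" by (rule mult) (rule N(1))
    also have "\<dots> = 0" by (rule sum.neutral) (use that N in auto)
    finally show ?thesis .
  qed
  show "a * b * c = a * (b * c)"
  proof (rule fmat_eqI)
    fix i j
    have "ent (a * b * c) i j = (\<Sum>k<N. \<Sum>l<N. ent a i l * ent b l k * ent c k j)"
      by (simp add: mult[OF ab] mult[OF N(1)] sum_distrib_right)
    also have "\<dots> = (\<Sum>l<N. \<Sum>k<N. ent a i l * ent b l k * ent c k j)" by (rule sum.swap)
    also have "\<dots> = ent (a * (b * c)) i j"
      by (simp add: mult[OF N(1)] mult[OF N(2)] sum_distrib_left mult.assoc)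
    finally show "ent (a * b * c) i j = ent (a * (b * c)) i j" .
  qed
  have abs: "ent (a + b) i j = 0" if "N \<le> i \<or> N \<le> j" for i j
    using N that by (simp add: plus_fmat.rep_eq)
  show "(a + b) * c = a * c + b * c"
    by (rule fmat_eqI) (simp add: mult[OF abs] mult[OF N(1)] mult[OF N(2)] plus_fmat.rep_eq distrib_right sum.distrib)
  show "a * (b + c) = a * b + a * c"
    by (rule fmat_eqI) (simp add: mult[OF N(1)] plus_fmat.rep_eq distrib_left sum.distrib)
qed

end

lift_definition sc :: "complex \<Rightarrow> fmat \<Rightarrow> fmat" is "\<lambda>c f i j. c * f i j"
  by auto

lift_definition idm :: "nat \<Rightarrow> fmat" is "\<lambda>n i j. if i = j \<and> i < n then 1 else 0"
proof -
  fix n :: nat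
  show "\<exists>N. \<forall>i j. N \<le> i \<or> N \<le> j \<longrightarrow> (if i = j \<and> i < n then 1 else 0) = (0::complex)"
    by (intro exI[of _ n]) auto
qed

lift_definition fm :: "nat \<Rightarrow> nat \<Rightarrow> (nat \<Rightarrow> nat \<Rightarrow> complex) \<Rightarrow> fmat" is
  "\<lambda>r c f i j. if i < r \<and> j < c then f i j else 0"
proof -
  fix r c :: nat and f :: "nat \<Rightarrow> nat \<Rightarrow> complex"
  show "\<exists>N. \<forall>i j. N \<le> i \<or> N \<le> j \<longrightarrow> (if i < r \<and> j < c then f i j else 0) = 0"
    by (intro exI[of _ "max r c"]) auto
qed

definition shp :: "nat \<Rightarrow> nat \<Rightarrow> fmat set" where
  "shp r c = {X. \<forall>i j. ent X i j \<noteq> 0 \<longrightarrow> i < r \<and> j < c}"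

text \<open>Summing over the finitely many nonzero diagonal entries makes the trace independent of a
  size, so that cyclicity also holds for rectangular factors.\<close>

definition trc :: "fmat \<Rightarrow> complex" where
  "trc X = (\<Sum>i\<in>{i. ent X i i \<noteq> 0}. ent X i i)"

definition emb :: "complex mat \<Rightarrow> fmat" where
  "emb A = fm (dim_row A) (dim_col A) (\<lambda>i j. A $$ (i, j))"

definition tomat :: "nat \<Rightarrow> nat \<Rightarrow> fmat \<Rightarrow> complex mat" where
  "tomat r c X = mat r c (\<lambda>(i, j). ent X i j)"

lemmas ent_simps [simp] = zero_fmat.rep_eq plus_fmat.rep_eq uminus_fmat.rep_eq sc.rep_eq

lemma ent_minus [simp]: "ent (X - Y) i j = ent X i j - ent Y i j"
  by (simp only: minus_fmat_def ent_simps diff_conv_add_uminus)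

lemma ent_sum: "ent (\<Sum>i\<in>I. f i) a b = (\<Sum>i\<in>I. ent (f i) a b)"
  by (induction I rule: infinite_finite_induct) auto

lemma ent_shp: "X \<in> shp r c \<Longrightarrow> \<not> (i < r \<and> j < c) \<Longrightarrow> ent X i j = 0"
  unfolding shp_def by blast

lemma ent_mult: "X \<in> shp r m \<Longrightarrow> ent (X * Y) i j = (\<Sum>k<m. ent X i k * ent Y k j)"
  by (rule ent_mult_bound) (simp add: ent_shp)

lemma ent_mult': "Y \<in> shp m c \<Longrightarrow> ent (X * Y) i j = (\<Sum>k<m. ent X i k * ent Y k j)"
  by (rule ent_mult_bound) (simp add: ent_shp)

lemma sc_simps:
  "sc a X * Y = sc a (X * Y)" "X * sc a Y = sc a (X * Y)" "sc a (sc b X) = sc (a * b) X"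
  "sc a (X + Y) = sc a X + sc a Y" "sc a (X - Y) = sc a X - sc a Y" "sc a (- X) = - sc a X"
  "sc 1 X = X" "sc 0 X = 0" "sc a 0 = 0"
proof -
  obtain N where N: "\<And>i j. N \<le> i \<or> N \<le> j \<Longrightarrow> ent X i j = 0" "\<And>i j. N \<le> i \<or> N \<le> j \<Longrightarrow> ent Y i j = 0"
    using ent_bounds2[of X Y] by blast
  have "ent (sc a X * Y) i j = ent (sc a (X * Y)) i j" "ent (X * sc a Y) i j = ent (sc a (X * Y)) i j" for i j
    using N by (simp_all add: ent_mult_bound[of N] sum_distrib_left mult_ac)
  then show "sc a X * Y = sc a (X * Y)" "X * sc a Y = sc a (X * Y)" by (auto intro: fmat_eqI)
qed (auto intro!: fmat_eqI simp: algebra_simps)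

lemma sc_add_left: "sc (a + b) X = sc a X + sc b X"
  by (rule fmat_eqI) (simp add: distrib_right)

lemma sc_diff_left: "sc (a - b) X = sc a X - sc b X"
  by (rule fmat_eqI) (simp add: left_diff_distrib)

lemma sc_sum: "sc a (\<Sum>i\<in>I. f i) = (\<Sum>i\<in>I. sc a (f i))"
  by (rule fmat_eqI) (simp add: ent_sum sum_distrib_left)

lemma sc_inverse: "c \<noteq> 0 \<Longrightarrow> sc c X = Y \<Longrightarrow> X = sc (1 / c) Y"
  by (auto simp: sc_simps)

lemma shpI: "(\<And>i j. \<not> (i < r \<and> j < c) \<Longrightarrow> ent X i j = 0) \<Longrightarrow> X \<in> shp r c"
  unfolding shp_def by blast

lemma shp_simps [intro, simp]:
  "0 \<in> shp r c" "X \<in> shp r c \<Longrightarrow> Y \<in> shp r c \<Longrightarrow> X + Y \<in> shp r c"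
  "X \<in> shp r c \<Longrightarrow> Y \<in> shp r c \<Longrightarrow> X - Y \<in> shp r c" "X \<in> shp r c \<Longrightarrow> - X \<in> shp r c"
  "X \<in> shp r c \<Longrightarrow> sc a X \<in> shp r c" "fm r c f \<in> shp r c" "idm r \<in> shp r r"
proof -
  show "fm r c f \<in> shp r c" "idm r \<in> shp r r"
    by (rule shpI, auto simp: fm.rep_eq idm.rep_eq)+
qed (rule shpI, simp add: ent_shp)+

lemma shp_mult [intro]: "X \<in> shp r m \<Longrightarrow> Y \<in> shp m c \<Longrightarrow> X * Y \<in> shp r c"
proof (rule shpI)
  fix i j assume X: "X \<in> shp r m" and Y: "Y \<in> shp m c" and "\<not> (i < r \<and> j < c)"
  then show "ent (X * Y) i j = 0"
    unfolding ent_mult[OF X] by (intro sum.neutral) (auto simp: ent_shp[OF X] ent_shp[OF Y])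
qed

lemma shp_sum [intro]: "(\<And>i. i \<in> I \<Longrightarrow> f i \<in> shp r c) \<Longrightarrow> (\<Sum>i\<in>I. f i) \<in> shp r c"
  by (induction I rule: infinite_finite_induct) auto

lemma idm_left [simp]: "X \<in> shp r c \<Longrightarrow> idm r * X = X"
proof (rule fmat_eqI)
  fix i j assume X: "X \<in> shp r c"
  have "ent (idm r * X) i j = (\<Sum>k<r. ent (idm r) i k * ent X k j)" by (rule ent_mult'[OF X])
  also have "\<dots> = (\<Sum>k<r. if k = i then ent X i j else 0)"
    by (intro sum.cong) (auto simp: idm.rep_eq)
  also have "\<dots> = ent X i j" using ent_shp[OF X, of i j] by (cases "i < r") (auto simp: sum.delta)
  finally show "ent (idm r * X) i j = ent X i j" .
qed

lemma idm_right [simp]: "X \<in> shp r c \<Longrightarrow> X * idm c = X"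
proof (rule fmat_eqI)
  fix i j assume X: "X \<in> shp r c"
  have "ent (X * idm c) i j = (\<Sum>k<c. ent X i k * ent (idm c) k j)" by (rule ent_mult[OF X])
  also have "\<dots> = (\<Sum>k<c. if k = j then ent X i j else 0)"
    by (intro sum.cong) (auto simp: idm.rep_eq)
  also have "\<dots> = ent X i j" using ent_shp[OF X, of i j] by (cases "j < c") (auto simp: sum.delta)
  finally show "ent (X * idm c) i j = ent X i j" .
qed

lemma trc_eq: "X \<in> shp n n \<Longrightarrow> trc X = (\<Sum>i<n. ent X i i)"
  unfolding trc_def by (rule sum.mono_neutral_left) (auto dest: ent_shp simp: shp_def)

lemma fmat_shp: "\<exists>N. X \<in> shp N N"
  using ent_bound[of X] by (auto simp: shp_def not_le[symmetric])

lemma shp_mono: "X \<in> shp r c \<Longrightarrow> r \<le> r' \<Longrightarrow> c \<le> c' \<Longrightarrow> X \<in> shp r' c'"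
  unfolding shp_def by force

lemma fmat_shp2: obtains N where "X \<in> shp N N" "Y \<in> shp N N"
proof -
  obtain N1 N2 where "X \<in> shp N1 N1" "Y \<in> shp N2 N2" using fmat_shp by meson
  then show thesis by (intro that[of "max N1 N2"]) (auto elim: shp_mono)
qed

lemma trc_mult: "trc (X * Y) = trc (Y * X)"
proof -
  obtain N where N: "X \<in> shp N N" "Y \<in> shp N N" by (rule fmat_shp2)
  have "trc (X * Y) = (\<Sum>i<N. \<Sum>k<N. ent X i k * ent Y k i)"
    using N by (subst trc_eq[of _ N]) (auto simp: ent_mult[OF N(1)])
  also have "\<dots> = (\<Sum>k<N. \<Sum>i<N. ent X i k * ent Y k i)" by (rule sum.swap)
  also have "\<dots> = trc (Y * X)"
    using N by (subst trc_eq[of _ N]) (auto simp: ent_mult[OF N(2)] mult.commute)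
  finally show ?thesis .
qed

lemma trc_simps:
  "trc (X + Y) = trc X + trc Y" "trc (X - Y) = trc X - trc Y" "trc (sc a X) = a * trc X"
  "trc 0 = 0" "trc (- X) = - trc X"
proof -
  obtain N where N: "X \<in> shp N N" "Y \<in> shp N N" by (rule fmat_shp2)
  then show "trc (X + Y) = trc X + trc Y" "trc (X - Y) = trc X - trc Y" "trc (sc a X) = a * trc X"
     "trc 0 = 0" "trc (- X) = - trc X"
    by (auto simp: trc_eq[of _ N] sum.distrib sum_subtractf sum_distrib_left sum_negf)
qed

lemma trc_sum: "trc (\<Sum>i\<in>I. f i) = (\<Sum>i\<in>I. trc (f i))"
  by (induction I rule: infinite_finite_induct) (auto simp: trc_simps)

text \<open>Matrix units as test matrices read off the single entries of \<open>N\<close>.\<close>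

lemma trc_nondegenerate:
  assumes N: "N \<in> shp r c" and Z: "\<And>Z. Z \<in> shp c r \<Longrightarrow> trc (N * Z) = 0"
  shows "N = 0"
proof (rule fmat_eqI)
  fix i j
  show "ent N i j = ent 0 i j"
  proof (cases "i < r \<and> j < c")
    case True
    define E where "E = fm c r (\<lambda>a b. if a = j \<and> b = i then 1 else 0)"
    have E: "E \<in> shp c r" by (simp add: E_def)
    have NE: "N * E \<in> shp r r" using N E by (rule shp_mult)
    have "trc (N * E) = (\<Sum>a<r. \<Sum>k<c. ent N a k * ent E k a)"
      by (simp add: trc_eq[OF NE] ent_mult[OF N])
    also have "\<dots> = (\<Sum>a<r. \<Sum>k<c. if k = j then (if a = i then ent N i j else 0) else 0)"
      by (intro sum.cong) (auto simp: E_def fm.rep_eq)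
    also have "\<dots> = ent N i j" using True by (simp add: sum.delta)
    finally show ?thesis using Z[OF E] by simp
  next
    case False
    then show ?thesis using ent_shp[OF N] by simp
  qed
qed

lemma ent_emb: "A \<in> carrier_mat r c \<Longrightarrow> ent (emb A) i j = (if i < r \<and> j < c then A $$ (i, j) else 0)"
  by (auto simp: emb_def fm.rep_eq)

lemma emb_shp: "A \<in> carrier_mat r c \<Longrightarrow> emb A \<in> shp r c"
  by (auto simp: emb_def)

lemma emb_add: "A \<in> carrier_mat r c \<Longrightarrow> B \<in> carrier_mat r c \<Longrightarrow> emb (A + B) = emb A + emb B"
  by (rule fmat_eqI) (simp add: ent_emb[of _ r c])

lemma emb_smult: "emb (a \<cdot>\<^sub>m A) = sc a (emb A)"
  by (rule fmat_eqI) (auto simp: emb_def fm.rep_eq)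

lemma emb_mult:
  assumes "A \<in> carrier_mat r m" "B \<in> carrier_mat m c"
  shows "emb (A * B) = emb A * emb B"
proof (rule fmat_eqI)
  fix i j
  have AB: "A * B \<in> carrier_mat r c" using assms by simp
  show "ent (emb (A * B)) i j = ent (emb A * emb B) i j"
    unfolding ent_mult[OF emb_shp[OF assms(1)]] ent_emb[OF assms(1)] ent_emb[OF assms(2)] ent_emb[OF AB]
    using assms by (auto simp: scalar_prod_def atLeast0LessThan intro!: sum.cong)
qed

lemma emb_one: "emb (1\<^sub>m n) = idm n"
  by (rule fmat_eqI) (auto simp: ent_emb[of _ n n] idm.rep_eq)

lemma emb_inj:
  assumes "A \<in> carrier_mat r c" "B \<in> carrier_mat r c" "emb A = emb B"
  shows "A = B"
proof (rule eq_matI)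
  fix i j assume "i < dim_row B" "j < dim_col B"
  then show "A $$ (i, j) = B $$ (i, j)"
    using assms(1,2) arg_cong[OF assms(3), of "\<lambda>X. ent X i j"]
    by (simp add: ent_emb[OF assms(1)] ent_emb[OF assms(2)])
qed (use assms in auto)

lemma tomat_carrier [simp]: "tomat r c X \<in> carrier_mat r c"
  by (simp add: tomat_def)

lemma emb_tomat: "X \<in> shp r c \<Longrightarrow> emb (tomat r c X) = X"
  by (rule fmat_eqI) (auto simp: ent_emb[of _ r c] ent_shp tomat_def)

lemma tomat_emb: "A \<in> carrier_mat r c \<Longrightarrow> tomat r c (emb A) = A"
  by (rule emb_inj[of _ r c]) (auto simp: emb_tomat emb_shp)

section \<open>Tangent spaces\<close>

definition lin_functional :: "(('x \<Rightarrow> complex) \<Rightarrow> complex) \<Rightarrow> bool" where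
  "lin_functional \<phi> \<longleftrightarrow> (\<forall>a b u v. \<phi> (\<lambda>x. a * u x + b * v x) = a * \<phi> u + b * \<phi> v)"

lemma lin_functionalD: "lin_functional \<phi> \<Longrightarrow> \<phi> (\<lambda>x. a * u x + b * v x) = a * \<phi> u + b * \<phi> v"
  unfolding lin_functional_def by blast

lemma lin_functional_0: "lin_functional \<phi> \<Longrightarrow> \<phi> (\<lambda>_. 0) = 0"
  using lin_functionalD[of \<phi> 0 "\<lambda>_. 0" 0 "\<lambda>_. 0"] by simp

lemma lin_functional_sum:
  assumes "lin_functional \<phi>"
  shows "\<phi> (\<lambda>x. \<Sum>i\<in>I. a i * u i x) = (\<Sum>i\<in>I. a i * \<phi> (u i))"
proof (induction I rule: infinite_finite_induct)
  case (insert i I)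
  then show ?case using lin_functionalD[OF assms, of "a i" "u i" 1 "\<lambda>x. \<Sum>i\<in>I. a i * u i x"] by simp
qed (auto simp: lin_functional_0[OF assms])

text \<open>When \<open>r j0\<close> is not redundant, some \<open>v\<close> is killed by the other
  functionals but not by \<open>r j0\<close>. The value of \<open>\<xi>\<close> at \<open>v\<close>
  fixes the coefficient of \<open>r j0\<close>, and the difference falls under the induction
  hypothesis.\<close>

lemma lin_functional_combination:
  assumes "finite J" and "\<And>j. j \<in> J \<Longrightarrow> lin_functional (r j)" and "lin_functional \<xi>"
    and "\<And>u. (\<And>j. j \<in> J \<Longrightarrow> r j u = 0) \<Longrightarrow> \<xi> u = 0"
  shows "\<exists>\<eta>. \<forall>u. \<xi> u = (\<Sum>j\<in>J. \<eta> j * r j u)"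
  using assms
proof (induction J arbitrary: \<xi> rule: finite_induct)
  case (insert j0 J)
  show ?case
  proof (cases "\<exists>v. (\<forall>j\<in>J. r j v = 0) \<and> r j0 v \<noteq> 0")
    case False
    have "\<exists>\<eta>. \<forall>u. \<xi> u = (\<Sum>j\<in>J. \<eta> j * r j u)"
    proof (rule insert.IH)
      fix u assume u: "\<And>j. j \<in> J \<Longrightarrow> r j u = 0"
      then have "r j0 u = 0" using False by blast
      then show "\<xi> u = 0" using u by (intro insert.prems(3)) auto
    qed (use insert.prems in auto)
    then obtain \<eta> where "\<forall>u. \<xi> u = (\<Sum>j\<in>J. \<eta> j * r j u)" by blast
    then show ?thesis using insert.hyps
      by (intro exI[of _ "\<eta>(j0 := 0)"]) (auto intro!: sum.cong)
  next
    case True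
    then obtain v where v: "\<And>j. j \<in> J \<Longrightarrow> r j v = 0" "r j0 v \<noteq> 0" by blast
    define q where "q = \<xi> v / r j0 v"
    define \<xi>' where "\<xi>' u = \<xi> u - q * r j0 u" for u
    have lr: "lin_functional (r j0)" using insert.prems by simp
    have "lin_functional \<xi>'"
      unfolding lin_functional_def \<xi>'_def
      using lin_functionalD[OF lr] lin_functionalD[OF insert.prems(2)] by (simp add: algebra_simps)
    moreover have "\<xi>' u = 0" if u: "\<And>j. j \<in> J \<Longrightarrow> r j u = 0" for u
    proof -
      define w where "w = (\<lambda>x. 1 * u x + (- (r j0 u / r j0 v)) * v x)"
      have "r j w = 0" if "j \<in> insert j0 J" for j
        unfolding w_def lin_functionalD[OF insert.prems(1)[OF that]] using that u v by auto
      then have "\<xi> w = 0" using insert.prems(3) by blast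
      then have "\<xi> u = (r j0 u / r j0 v) * \<xi> v"
        unfolding w_def lin_functionalD[OF insert.prems(2)] by simp
      then show ?thesis by (simp add: \<xi>'_def q_def)
    qed
    ultimately have "\<exists>\<eta>. \<forall>u. \<xi>' u = (\<Sum>j\<in>J. \<eta> j * r j u)"
      using insert.prems(1) by (intro insert.IH) auto
    then obtain \<eta> where \<eta>: "\<And>u. \<xi>' u = (\<Sum>j\<in>J. \<eta> j * r j u)" by blast
    have "\<xi> u = q * r j0 u + (\<Sum>j\<in>J. \<eta> j * r j u)" for u
      using \<eta>[of u] by (simp add: \<xi>'_def diff_eq_eq add.commute)
    moreover have "(\<Sum>j\<in>J. (\<eta>(j0 := q)) j * r j u) = (\<Sum>j\<in>J. \<eta> j * r j u)" for u
      using insert.hyps by (intro sum.cong) auto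
    ultimately show ?thesis using insert.hyps
      by (intro exI[of _ "\<eta>(j0 := q)"]) auto
  qed
qed auto

section \<open>Bases and dual functionals\<close>

definition indep_family :: "nat \<Rightarrow> (nat \<Rightarrow> 'x \<Rightarrow> complex) \<Rightarrow> bool" where
  "indep_family T u \<longleftrightarrow> (\<forall>c. (\<forall>x. (\<Sum>l<T. c l * u l x) = 0) \<longrightarrow> (\<forall>l<T. c l = 0))"

lemma indep_family_card:
  fixes u :: "nat \<Rightarrow> 'x \<Rightarrow> complex"
  assumes D: "finite D" and "\<And>l x. l < T \<Longrightarrow> x \<notin> D \<Longrightarrow> u l x = 0" "indep_family T u"
  shows "T \<le> card D"
proof (rule ccontr)
  assume "\<not> T \<le> card D"
  then obtain c where c: "\<exists>i\<in>{..<T}. c i \<noteq> 0" "\<forall>x\<in>D. (\<Sum>i<T. c i * u i x) = 0"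
    using nontrivial_solution[OF D, of "{..<T}" u] by auto
  have "(\<Sum>i<T. c i * u i x) = 0" for x
    using c(2) assms(2) by (cases "x \<in> D") auto
  then show False using assms(3) c(1) unfolding indep_family_def by auto
qed

text \<open>An independent family starting with \<open>w\<close> of greatest length spans, and
  supports in \<open>D\<close> bound the length. Prescribing the first vector later allows the first
  coordinate to be a direction on which the quadratic form is nonzero.\<close>

lemma extend_to_basis:
  fixes S :: "('x \<Rightarrow> complex) set"
  assumes D: "finite D" and supp: "\<And>u x. u \<in> S \<Longrightarrow> x \<notin> D \<Longrightarrow> u x = 0"
    and w: "S \<noteq> {\<lambda>_. 0} \<Longrightarrow> w \<in> S \<and> w \<noteq> (\<lambda>_. 0)" and S0: "(\<lambda>_. 0) \<in> S"
  obtains T u where "T > 0 \<Longrightarrow> u 0 = w" "S \<noteq> {\<lambda>_. 0} \<Longrightarrow> T > 0" "\<And>l. l < T \<Longrightarrow> u l \<in> S" "indep_family T u"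
    "\<And>v. v \<in> S \<Longrightarrow> \<exists>c. \<forall>x. v x = (\<Sum>l<T. c l * u l x)"
proof (cases "S = {\<lambda>_. 0}")
  case True
  show thesis by (rule that[of 0]) (use True in \<open>auto simp: indep_family_def\<close>)
next
  case False
  define P where "P T \<longleftrightarrow> T > 0 \<and> (\<exists>u. u 0 = w \<and> (\<forall>l<T. u l \<in> S) \<and> indep_family T u)" for T
  have "P 1"
    unfolding P_def
  proof (intro conjI exI[of _ "\<lambda>_. w"])
    have "\<exists>x. w x \<noteq> 0" using w[OF False] by auto
    then show "indep_family 1 (\<lambda>_. w)" by (auto simp: indep_family_def)
  qed (use w[OF False] in auto)
  moreover have bound: "\<forall>T. P T \<longrightarrow> T < Suc (card D)"
  proof (intro allI impI)
    fix T assume "P T"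
    then obtain u where "\<forall>l<T. u l \<in> S" "indep_family T u" unfolding P_def by blast
    then have "T \<le> card D" using supp by (intro indep_family_card[OF D, of T u]) auto
    then show "T < Suc (card D)" by simp
  qed
  ultimately obtain T where T: "P T" "\<forall>T'. P T' \<longrightarrow> T' \<le> T"
    using ex_has_greatest_nat[of P 1 "\<lambda>t. t" "Suc (card D)"] by auto
  then obtain u where u: "T > 0" "u 0 = w" "\<And>l. l < T \<Longrightarrow> u l \<in> S" "indep_family T u"
    unfolding P_def by auto
  show thesis
  proof (rule that[of T u])
    fix v assume v: "v \<in> S"
    show "\<exists>c. \<forall>x. v x = (\<Sum>l<T. c l * u l x)"
    proof (rule ccontr)
      assume no: "\<nexists>c. \<forall>x. v x = (\<Sum>l<T. c l * u l x)"
      have "indep_family (Suc T) (u(T := v))"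
        unfolding indep_family_def
      proof (intro allI impI)
        fix c l assume c: "\<forall>x. (\<Sum>l<Suc T. c l * (u(T := v)) l x) = 0" and l: "l < Suc T"
        have c': "(\<Sum>l<T. c l * u l x) + c T * v x = 0" for x
        proof -
          have "(\<Sum>l<T. c l * (u(T := v)) l x) = (\<Sum>l<T. c l * u l x)" by (intro sum.cong) auto
          then show ?thesis using c by simp
        qed
        have "c T = 0"
        proof (rule ccontr)
          assume cT: "c T \<noteq> 0"
          have "v x = (\<Sum>l<T. (- (c l / c T)) * u l x)" for x
          proof -
            have "c T * v x = - (\<Sum>l<T. c l * u l x)" using c'[of x] by (simp add: eq_neg_iff_add_eq_0 add.commute)
            then have "v x = - (\<Sum>l<T. c l * u l x) / c T" using cT by (simp add: field_simps)
            then show ?thesis by (simp add: sum_divide_distrib sum_negf)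
          qed
          then have "\<exists>c. \<forall>x. v x = (\<Sum>l<T. c l * u l x)" by (intro exI[of _ "\<lambda>l. - (c l / c T)"]) simp
          then show False using no by simp
        qed
        then show "c l = 0" using u(4) c' l unfolding indep_family_def by (auto simp: less_Suc_eq)
      qed
      then have "P (Suc T)" unfolding P_def using u v by (intro conjI exI[of _ "u(T := v)"]) auto
      then show False using T(2) by fastforce
    qed
  qed (use u in auto)
qed

text \<open>By independence a combination with all values zero has all coefficients zero, so each
  coefficient is a linear combination of values at points of \<open>D\<close>.\<close>

lemma dual_functionals:
  fixes u :: "nat \<Rightarrow> 'x \<Rightarrow> complex"
  assumes D: "finite D" and supp: "\<And>l x. l < T \<Longrightarrow> x \<notin> D \<Longrightarrow> u l x = 0" and ind: "indep_family T u"
  obtains \<eta> where "\<And>j l. j < T \<Longrightarrow> l < T \<Longrightarrow> (\<Sum>x\<in>D. \<eta> j x * u l x) = (if j = l then 1 else 0)"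
proof -
  have "\<exists>\<eta>. \<forall>l<T. (\<Sum>x\<in>D. \<eta> x * u l x) = (if j = l then 1 else 0)" if j: "j < T" for j
  proof -
    have "\<exists>\<eta>. \<forall>c. c j = (\<Sum>x\<in>D. \<eta> x * (\<Sum>l<T. c l * u l x))"
    proof (rule lin_functional_combination[OF D])
      show "lin_functional (\<lambda>c. \<Sum>l<T. c l * u l x)" for x
        by (auto simp: lin_functional_def distrib_right sum.distrib sum_distrib_left mult.assoc)
      show "lin_functional (\<lambda>c. c j)" by (auto simp: lin_functional_def)
      fix c assume c: "\<And>x. x \<in> D \<Longrightarrow> (\<Sum>l<T. c l * u l x) = 0"
      have "(\<Sum>l<T. c l * u l x) = 0" for x using c supp by (cases "x \<in> D") auto
      then show "c j = 0" using ind j by (auto simp: indep_family_def)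
    qed
    then obtain \<eta> where \<eta>: "\<And>c. c j = (\<Sum>x\<in>D. \<eta> x * (\<Sum>l<T. c l * u l x))" by blast
    have "(\<Sum>x\<in>D. \<eta> x * u l x) = (if j = l then 1 else 0)" if "l < T" for l
    proof -
      have "(\<Sum>i<T. (if i = l then 1 else 0) * u i x) = u l x" for x
        using that by (simp add: if_distrib[of "\<lambda>a. a * _"] cong: if_cong)
      then show ?thesis using \<eta>[of "\<lambda>i. if i = l then 1 else 0"] by simp
    qed
    then show ?thesis by blast
  qed
  then obtain \<eta> where "\<And>j l. j < T \<Longrightarrow> l < T \<Longrightarrow> (\<Sum>x\<in>D. \<eta> j x * u l x) = (if j = l then 1 else 0)" by metis
  then show thesis by (rule that)
qed

section \<open>Coordinates on pairs of matrices\<close>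

type_synonym coord = "bool \<times> nat \<times> nat"

definition crd :: "coord \<Rightarrow> rep \<Rightarrow> complex" where
  "crd = (\<lambda>(b, i, j) W. (if b then fst W else snd W) $$ (i, j))"

definition coords :: "nat \<Rightarrow> coord set" where
  "coords n = UNIV \<times> {..<n} \<times> {..<n}"

lemma finite_coords [simp]: "finite (coords n)"
  by (simp add: coords_def)

lemma poly_fun_eq: "poly_fun n = polyfun (crd ` coords n)"
proof (rule subset_antisym; rule subsetI)
  fix f assume "f \<in> poly_fun n"
  then show "f \<in> polyfun (crd ` coords n)"
  proof induction
    case (coord1 i j)
    then show ?case by (intro polyfun.gen image_eqI[of _ _ "(True, i, j)"]) (auto simp: crd_def coords_def)
  next
    case (coord2 i j)
    then show ?case by (intro polyfun.gen image_eqI[of _ _ "(False, i, j)"]) (auto simp: crd_def coords_def)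
  qed (auto intro: polyfun.intros)
next
  fix f assume "f \<in> polyfun (crd ` coords n)"
  then show "f \<in> poly_fun n"
  proof induction
    case (gen x)
    then obtain b i j where "x = crd (b, i, j)" "i < n" "j < n" by (auto simp: coords_def)
    then show ?case using poly_fun.coord1[of i n j] poly_fun.coord2[of i n j] by (cases b) (auto simp: crd_def)
  qed (auto intro: poly_fun.intros)
qed

text \<open>If \<open>f * g\<close> vanishes on \<open>Z\<close>, then \<open>Z\<close> is the union
  of the closed subsets on which \<open>f\<close> and \<open>g\<close> vanish.\<close>

lemma irreducible_prime_on:
  assumes "irreducible_closed n Z"
  shows "prime_on (crd ` coords n) Z"
  unfolding prime_on_def poly_fun_eq[symmetric]
proof (intro ballI impI)
  fix f g assume f: "f \<in> poly_fun n" and g: "g \<in> poly_fun n" and fg: "\<forall>p\<in>Z. f p * g p = 0"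
  obtain F where F: "F \<subseteq> poly_fun n" "Z = {V \<in> rep_B3 n. \<forall>f\<in>F. f V = 0}"
    using assms unfolding irreducible_closed_def zariski_closed_def by blast
  have cl: "zariski_closed n {V \<in> Z. h V = 0}" if "h \<in> poly_fun n" for h
    unfolding zariski_closed_def using F that by (intro exI[of _ "insert h F"]) auto
  have "Z = {V \<in> Z. f V = 0} \<union> {V \<in> Z. g V = 0}" using fg by auto
  then have "Z = {V \<in> Z. f V = 0} \<or> Z = {V \<in> Z. g V = 0}"
    using assms cl[OF f] cl[OF g] unfolding irreducible_closed_def by blast
  then show "(\<forall>p\<in>Z. f p = 0) \<or> (\<forall>p\<in>Z. g p = 0)" by blast
qed

lemma closed_psubset:
  assumes "zariski_closed n Z" "irreducible_closed n Z'" "Z \<subset> Z'"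
  shows "\<exists>f\<in>polyfun (crd ` coords n). (\<forall>p\<in>Z. f p = 0) \<and> (\<exists>p\<in>Z'. f p \<noteq> 0)"
proof -
  obtain F where F: "F \<subseteq> poly_fun n" "Z = {V \<in> rep_B3 n. \<forall>f\<in>F. f V = 0}"
    using assms unfolding zariski_closed_def by blast
  obtain p where p: "p \<in> Z'" "p \<notin> Z" using assms(3) by blast
  then have "p \<in> rep_B3 n" using assms(2) unfolding irreducible_closed_def zariski_closed_def by blast
  then obtain f where "f \<in> F" "f p \<noteq> 0" using p F by auto
  then show ?thesis using F p unfolding poly_fun_eq[symmetric] by blast
qed

definition fX :: "nat \<Rightarrow> (coord \<Rightarrow> complex) \<Rightarrow> fmat" where "fX n u = fm n n (\<lambda>i j. u (True, i, j))"
definition fY :: "nat \<Rightarrow> (coord \<Rightarrow> complex) \<Rightarrow> fmat" where "fY n u = fm n n (\<lambda>i j. u (False, i, j))"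

definition dF :: "fmat \<Rightarrow> fmat \<Rightarrow> fmat \<Rightarrow> fmat \<Rightarrow> fmat" where
  "dF A B X Y = A * X + X * A - (B * B * Y + B * Y * B + Y * B * B)"

lemma fXY_shp [simp]: "fX n u \<in> shp n n" "fY n u \<in> shp n n"
  by (simp_all add: fX_def fY_def)

lemma fXY_lin:
  "fX n (\<lambda>x. a * u x + b * v x) = sc a (fX n u) + sc b (fX n v)"
  "fY n (\<lambda>x. a * u x + b * v x) = sc a (fY n u) + sc b (fY n v)"
  by (rule fmat_eqI; simp add: fX_def fY_def fm.rep_eq)+

lemma fXY_cong:
  assumes "\<And>x. x \<in> coords n \<Longrightarrow> u x = v x"
  shows "fX n u = fX n v" "fY n u = fY n v"
  by (rule fmat_eqI; use assms in \<open>simp add: fX_def fY_def fm.rep_eq coords_def\<close>)+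

lemma dF_lin:
  "dF A B (sc a X + sc b X') (sc a Y + sc b Y') = sc a (dF A B X Y) + sc b (dF A B X' Y')"
  by (simp add: dF_def algebra_simps sc_simps)

abbreviation tangent_dim :: "nat \<Rightarrow> rep \<Rightarrow> nat" where
  "tangent_dim n V \<equiv> vectorspace.dim class_ring (tangent_space n V)"

text \<open>The tangent space in coordinate form. Requiring support in \<open>coords n\<close> makes
  a vector equal to its pair of matrices, so the linear algebra of functions applies; the lemma
  \<open>tangent_dim\<close> carries a basis back to the module.\<close>

definition tangents :: "nat \<Rightarrow> rep \<Rightarrow> (coord \<Rightarrow> complex) set" where
  "tangents n V = {u. (\<forall>x. x \<notin> coords n \<longrightarrow> u x = 0) \<and> dF (emb (fst V)) (emb (snd V)) (fX n u) (fY n u) = 0}"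

lemma tangents_lin:
  "u \<in> tangents n V \<Longrightarrow> v \<in> tangents n V \<Longrightarrow> (\<lambda>x. a * u x + b * v x) \<in> tangents n V"
  by (simp add: tangents_def fXY_lin dF_lin sc_simps)

lemma tangents_0: "(\<lambda>_. 0) \<in> tangents n V"
proof -
  have "fX n (\<lambda>_. 0) = 0" "fY n (\<lambda>_. 0) = 0" by (rule fmat_eqI; simp add: fX_def fY_def fm.rep_eq)+
  then show ?thesis by (simp add: tangents_def dF_def)
qed

definition rep_of :: "nat \<Rightarrow> (coord \<Rightarrow> complex) \<Rightarrow> rep" where
  "rep_of n u = (mat n n (\<lambda>(i, j). u (True, i, j)), mat n n (\<lambda>(i, j). u (False, i, j)))"

definition vec_of :: "nat \<Rightarrow> rep \<Rightarrow> coord \<Rightarrow> complex" where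
  "vec_of n W x = (if x \<in> coords n then crd x W else 0)"

lemma vec_of_rep_of: "(\<And>x. x \<notin> coords n \<Longrightarrow> u x = 0) \<Longrightarrow> vec_of n (rep_of n u) = u"
  by (auto simp: fun_eq_iff vec_of_def rep_of_def crd_def coords_def)

lemma rep_of_vec_of:
  "fst W \<in> carrier_mat n n \<Longrightarrow> snd W \<in> carrier_mat n n \<Longrightarrow> rep_of n (vec_of n W) = W"
  by (cases W) (auto simp: vec_of_def rep_of_def crd_def coords_def intro!: eq_matI)

lemma fXY_vec_of:
  "fst W \<in> carrier_mat n n \<Longrightarrow> fX n (vec_of n W) = emb (fst W)"
  "snd W \<in> carrier_mat n n \<Longrightarrow> fY n (vec_of n W) = emb (snd W)"
  by (rule fmat_eqI; auto simp: fX_def fY_def fm.rep_eq ent_emb[of _ n n] vec_of_def crd_def coords_def)+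

lemma rep_B3D:
  assumes "V \<in> rep_B3 n"
  shows "fst V \<in> carrier_mat n n" "snd V \<in> carrier_mat n n"
    "emb (fst V) * emb (fst V) = emb (snd V) * emb (snd V) * emb (snd V)"
    "emb (fst V) \<in> shp n n" "emb (snd V) \<in> shp n n"
proof -
  obtain A B where V: "V = (A, B)" by (cases V)
  have c: "A \<in> carrier_mat n n" "B \<in> carrier_mat n n" "A ^\<^sub>m 2 = B ^\<^sub>m 3"
    using assms by (auto simp: V rep_B3_def GL_def)
  then have "A * A = B * B * B" by (simp add: eval_nat_numeral)
  then have "emb (A * A) = emb (B * B * B)" by simp
  then show "emb (fst V) * emb (fst V) = emb (snd V) * emb (snd V) * emb (snd V)"
    using c by (simp add: V emb_mult[of _ n n _ n] mult.assoc)
  show "fst V \<in> carrier_mat n n" "snd V \<in> carrier_mat n n" "emb (fst V) \<in> shp n n" "emb (snd V) \<in> shp n n"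
    using c by (auto simp: V intro: emb_shp)
qed

lemma tangent_space_iff:
  assumes V: "V \<in> rep_B3 n"
  shows "W \<in> carrier (tangent_space n V) \<longleftrightarrow>
    fst W \<in> carrier_mat n n \<and> snd W \<in> carrier_mat n n \<and> vec_of n W \<in> tangents n V"
proof -
  obtain A B where VV: "V = (A, B)" by (cases V)
  obtain X Y where WW: "W = (X, Y)" by (cases W)
  have c: "A \<in> carrier_mat n n" "B \<in> carrier_mat n n" using rep_B3D[OF V] by (auto simp: VV)
  have "A * X + X * A = B * B * Y + B * Y * B + Y * B * B \<longleftrightarrow> dF (emb A) (emb B) (emb X) (emb Y) = 0"
    if x: "X \<in> carrier_mat n n" "Y \<in> carrier_mat n n"
  proof -
    have "A * X + X * A = B * B * Y + B * Y * B + Y * B * B \<longleftrightarrow>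
        emb (A * X + X * A) = emb (B * B * Y + B * Y * B + Y * B * B)"
      using c x by (metis emb_inj add_carrier_mat mult_carrier_mat)
    also have "\<dots> \<longleftrightarrow> dF (emb A) (emb B) (emb X) (emb Y) = 0"
      using c x by (simp add: dF_def emb_add[of _ n n] emb_mult[of _ n n _ n] mult.assoc)
    finally show ?thesis .
  qed
  then show ?thesis
    using fXY_vec_of[of W n] by (auto simp: tangent_space_def VV WW tangents_def vec_of_def)
qed

lemma tangent_space_ops:
  "\<zero>\<^bsub>tangent_space n V\<^esub> = (0\<^sub>m n n, 0\<^sub>m n n)"
  "W \<oplus>\<^bsub>tangent_space n V\<^esub> W' = (fst W + fst W', snd W + snd W')"
  "c \<odot>\<^bsub>tangent_space n V\<^esub> W = (c \<cdot>\<^sub>m fst W, c \<cdot>\<^sub>m snd W)"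
  by (auto simp: tangent_space_def Let_def split: prod.splits)

lemma vec_of_ops:
  assumes "fst W \<in> carrier_mat n n" "snd W \<in> carrier_mat n n" "fst W' \<in> carrier_mat n n" "snd W' \<in> carrier_mat n n"
  shows "vec_of n (fst W + fst W', snd W + snd W') = (\<lambda>x. 1 * vec_of n W x + 1 * vec_of n W' x)"
    "vec_of n (c \<cdot>\<^sub>m fst W, c \<cdot>\<^sub>m snd W) = (\<lambda>x. c * vec_of n W x + 0 * vec_of n W' x)"
    "vec_of n (0\<^sub>m n n, 0\<^sub>m n n) = (\<lambda>_. 0)"
  using assms by (auto simp: fun_eq_iff vec_of_def crd_def coords_def)

lemma tangent_vectorspace:
  assumes V: "V \<in> rep_B3 n"
  shows "vectorspace class_ring (tangent_space n V)"
proof (rule vs_criteria)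
  note T = tangent_space_iff[OF V] tangent_space_ops
  show "field (class_ring :: complex ring)" by (rule class_field)
  show "\<zero>\<^bsub>tangent_space n V\<^esub> \<in> carrier (tangent_space n V)"
    by (simp add: T vec_of_ops(3)[of "(0\<^sub>m n n, 0\<^sub>m n n)" n "(0\<^sub>m n n, 0\<^sub>m n n)"] tangents_0)
  have add: "v \<oplus>\<^bsub>tangent_space n V\<^esub> w \<in> carrier (tangent_space n V)"
    if "v \<in> carrier (tangent_space n V)" "w \<in> carrier (tangent_space n V)" for v w
    using that tangents_lin[of "vec_of n v" n V "vec_of n w" 1 1] by (auto simp: T vec_of_ops(1))
  then show "\<forall>v w. v \<in> carrier (tangent_space n V) \<and> w \<in> carrier (tangent_space n V) \<longrightarrow>
      v \<oplus>\<^bsub>tangent_space n V\<^esub> w \<in> carrier (tangent_space n V)" by blast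
  have smult: "c \<odot>\<^bsub>tangent_space n V\<^esub> v \<in> carrier (tangent_space n V)"
    if "v \<in> carrier (tangent_space n V)" for c v
    using that tangents_lin[of "vec_of n v" n V "vec_of n v" c 0] by (auto simp: T vec_of_ops(2)[of v n v])
  then show "\<forall>c v. c \<in> carrier class_ring \<and> v \<in> carrier (tangent_space n V) \<longrightarrow>
      c \<odot>\<^bsub>tangent_space n V\<^esub> v \<in> carrier (tangent_space n V)" by blast
  show "\<forall>v\<in>carrier (tangent_space n V). \<exists>neg_v\<in>carrier (tangent_space n V).
      v \<oplus>\<^bsub>tangent_space n V\<^esub> neg_v = \<zero>\<^bsub>tangent_space n V\<^esub>"
  proof
    fix v assume v: "v \<in> carrier (tangent_space n V)"
    then have c: "fst v \<in> carrier_mat n n" "snd v \<in> carrier_mat n n" by (auto simp: T)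
    have "fst v + (-1) \<cdot>\<^sub>m fst v = 0\<^sub>m n n" "snd v + (-1) \<cdot>\<^sub>m snd v = 0\<^sub>m n n"
      using c by (auto intro!: eq_matI)
    then show "\<exists>neg_v\<in>carrier (tangent_space n V). v \<oplus>\<^bsub>tangent_space n V\<^esub> neg_v = \<zero>\<^bsub>tangent_space n V\<^esub>"
      by (intro bexI[OF _ smult[OF v, of "-1"]]) (auto simp: T)
  qed
qed (auto simp: tangent_space_iff[OF V] tangent_space_ops class_ring_simps comm_add_mat[of _ n n] assoc_add_mat[of _ n n]
      add_smult_distrib_left_mat[of _ n n] add_smult_distrib_right_mat[of _ n n] intro!: prod_eqI eq_matI simp: algebra_simps)

lemma tangent_dim:
  assumes V: "V \<in> rep_B3 n" and u: "\<And>l. l < T \<Longrightarrow> u l \<in> tangents n V" and ind: "indep_family T u"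
    and span: "\<And>v. v \<in> tangents n V \<Longrightarrow> \<exists>c. \<forall>x. v x = (\<Sum>l<T. c l * u l x)"
  shows "tangent_dim n V = T"
proof -
  interpret vs: vectorspace class_ring "tangent_space n V" by (rule tangent_vectorspace[OF V])
  note T = tangent_space_iff[OF V] tangent_space_ops
  define A where "A = (\<lambda>l. rep_of n (u l)) ` {..<T}"
  have supp: "u l x = 0" if "l < T" "x \<notin> coords n" for l x using u[OF that(1)] that(2) unfolding tangents_def by blast
  have vec: "vec_of n (rep_of n (u l)) = u l" if "l < T" for l
    using supp[OF that] by (rule vec_of_rep_of)
  have u_inj: "l = m" if "l < T" "m < T" "u l = u m" for l m
  proof (rule ccontr)
    assume ne: "l \<noteq> m"
    define c where "c = (\<lambda>i. if i = l then 1 else if i = m then -1 else (0::complex))"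
    have "(\<Sum>i<T. c i * u i x) = 0" for x
    proof -
      have "(\<Sum>i<T. c i * u i x) = (\<Sum>i\<in>{l, m}. c i * u i x)"
        using that by (intro sum.mono_neutral_right) (auto simp: c_def)
      then show ?thesis using ne that by (simp add: c_def)
    qed
    then have "c l = 0" using ind that unfolding indep_family_def by blast
    then show False by (simp add: c_def)
  qed
  have inj: "inj_on (\<lambda>l. rep_of n (u l)) {..<T}"
    using u_inj vec by (intro inj_onI) (metis lessThan_iff)
  have A_carrier: "A \<subseteq> carrier (tangent_space n V)"
    using u vec by (auto simp: A_def T rep_of_def)
  have lin: "vs.lincomb a S \<in> carrier (tangent_space n V) \<and>
      vec_of n (vs.lincomb a S) = (\<lambda>x. \<Sum>W\<in>S. a W * vec_of n W x)"
    if "finite S" "S \<subseteq> carrier (tangent_space n V)" for S a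
    using that
  proof (induction S rule: finite_induct)
    case empty
    show ?case by (auto simp: vs.lincomb_def T vec_of_ops(3)[of "(0\<^sub>m n n, 0\<^sub>m n n)" n "(0\<^sub>m n n, 0\<^sub>m n n)"] tangents_0)
  next
    case (insert W S)
    have W: "W \<in> carrier (tangent_space n V)" and S: "S \<subseteq> carrier (tangent_space n V)" using insert.prems by auto
    have aW: "a W \<odot>\<^bsub>tangent_space n V\<^esub> W \<in> carrier (tangent_space n V)" using W by (simp add: class_ring_simps)
    have "vs.lincomb a (insert W S) = a W \<odot>\<^bsub>tangent_space n V\<^esub> W \<oplus>\<^bsub>tangent_space n V\<^esub> vs.lincomb a S"
      unfolding vs.lincomb_def using insert.hyps S aW
      by (intro vs.finsum_insert) (auto simp: class_ring_simps)
    moreover have "vec_of n (a W \<odot>\<^bsub>tangent_space n V\<^esub> W) = (\<lambda>x. a W * vec_of n W x + 0 * vec_of n W x)"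
      unfolding T(4) using W by (intro vec_of_ops(2)) (auto simp: T)
    moreover have "vec_of n (a W \<odot>\<^bsub>tangent_space n V\<^esub> W \<oplus>\<^bsub>tangent_space n V\<^esub> vs.lincomb a S) =
        (\<lambda>x. 1 * vec_of n (a W \<odot>\<^bsub>tangent_space n V\<^esub> W) x + 1 * vec_of n (vs.lincomb a S) x)"
      unfolding T(3) using aW insert.IH[OF S] by (intro vec_of_ops(1)) (auto simp: T(1))
    ultimately show ?case using insert.IH[OF S] insert.hyps aW by auto
  qed
  have sumA: "(\<Sum>W\<in>A. a W * vec_of n W x) = (\<Sum>l<T. a (rep_of n (u l)) * u l x)" for a x
    unfolding A_def by (subst sum.reindex[OF inj]) (auto simp: vec intro!: sum.cong)
  have fin: "finite A" by (simp add: A_def)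
  have "vs.lin_indpt A"
  proof
    assume "vs.lin_dep A"
    then obtain a v where a: "vs.lincomb a A = \<zero>\<^bsub>tangent_space n V\<^esub>" "v \<in> A" "a v \<noteq> \<zero>\<^bsub>class_ring\<^esub>"
      using vs.finite_lin_dep[OF fin _ A_carrier] by blast
    have sum0: "(\<Sum>l<T. a (rep_of n (u l)) * u l x) = 0" for x
    proof -
      have "(\<Sum>W\<in>A. a W * vec_of n W x) = vec_of n (vs.lincomb a A) x"
        using lin[OF fin A_carrier, of a] by simp
      also have "\<dots> = 0"
        unfolding a(1) T(2) by (simp add: vec_of_ops(3)[of "(0\<^sub>m n n, 0\<^sub>m n n)" n "(0\<^sub>m n n, 0\<^sub>m n n)"])
      finally show ?thesis by (simp add: sumA)
    qed
    then have "a (rep_of n (u l)) = 0" if "l < T" for l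
      using ind[unfolded indep_family_def, THEN spec[of _ "\<lambda>l. a (rep_of n (u l))"]] sum0 that by simp
    then show False using a(2,3) by (auto simp: A_def class_ring_simps)
  qed
  moreover have "vs.span A = carrier (tangent_space n V)"
  proof
    show "vs.span A \<subseteq> carrier (tangent_space n V)"
      using A_carrier by (rule vs.span_is_subset2)
    show "carrier (tangent_space n V) \<subseteq> vs.span A"
    proof
      fix W assume W: "W \<in> carrier (tangent_space n V)"
      then have "vec_of n W \<in> tangents n V" by (simp add: T(1))
      from span[OF this] obtain c where c: "\<And>x. vec_of n W x = (\<Sum>l<T. c l * u l x)" by blast
      \<comment> \<open>Linear combinations in the module are indexed by the matrix pairs
        themselves; injectivity of the family recovers the index \<open>l\<close>.\<close>
      define a where "a = (\<lambda>W. c (THE l. l < T \<and> rep_of n (u l) = W))"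
      have a: "a (rep_of n (u l)) = c l" if "l < T" for l
      proof -
        have "(THE m. m < T \<and> rep_of n (u m) = rep_of n (u l)) = l"
          using inj that by (intro the_equality) (auto dest: inj_onD)
        then show ?thesis by (simp add: a_def)
      qed
      have "vec_of n (vs.lincomb a A) = vec_of n W"
        using lin[OF fin A_carrier, of a] by (auto simp: sumA a c intro!: sum.cong)
      moreover have "rep_of n (vec_of n W') = W'" if "W' \<in> carrier (tangent_space n V)" for W'
        using that by (intro rep_of_vec_of) (auto simp: T(1))
      ultimately have "vs.lincomb a A = W"
        using W lin[OF fin A_carrier, of a] by metis
      then have "W \<in> {vs.lincomb a A |a. a \<in> A \<rightarrow> carrier class_ring}"
        by (intro CollectI exI[of _ a]) (auto simp: class_ring_simps)
      then show "W \<in> vs.span A" using vs.finite_span[OF fin A_carrier] by simp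
    qed
  qed
  ultimately have "vs.basis A" using A_carrier by (simp add: vs.basis_def)
  then have "vs.dim = card A" by (rule vs.dim_basis[OF fin])
  then show ?thesis using card_image[OF inj] by (simp add: A_def)
qed

section \<open>Upper bounds for the local dimension\<close>

definition fvan :: "nat \<Rightarrow> rep \<Rightarrow> nat \<Rightarrow> (rep \<Rightarrow> fmat) \<Rightarrow> bool" where
  "fvan n V k M \<longleftrightarrow> (\<forall>p. M p \<in> shp n n) \<and> (\<forall>i j. vanish (crd ` coords n) V k (\<lambda>p. ent (M p) i j))"

lemma fvanD:
  assumes "fvan n V k M"
  shows "M p \<in> shp n n" "vanish (crd ` coords n) V k (\<lambda>p. ent (M p) i j)"
  using assms unfolding fvan_def by blast+

lemma fvanI:
  assumes "\<And>p. M p \<in> shp n n" "\<And>i j. vanish (crd ` coords n) V k (\<lambda>p. ent (M p) i j)"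
  shows "fvan n V k M"
  unfolding fvan_def using assms by simp

lemma fvan_mult:
  assumes M: "fvan n V k M" and N: "fvan n V l N"
  shows "fvan n V (k + l) (\<lambda>p. M p * N p)"
proof (rule fvanI)
  show "M p * N p \<in> shp n n" for p using fvanD(1)[OF M] fvanD(1)[OF N] by (rule shp_mult)
  fix i j
  show "vanish (crd ` coords n) V (k + l) (\<lambda>p. ent (M p * N p) i j)"
    unfolding ent_mult[OF fvanD(1)[OF M]]
    by (intro vanish_sum vanish_mult fvanD(2)[OF M] fvanD(2)[OF N])
qed

lemma fvan_add: "fvan n V k M \<Longrightarrow> fvan n V k N \<Longrightarrow> fvan n V k (\<lambda>p. M p + N p)"
  by (auto simp: fvan_def intro: vanish.add)

lemma fvan_diff: "fvan n V k M \<Longrightarrow> fvan n V k N \<Longrightarrow> fvan n V k (\<lambda>p. M p - N p)"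
  by (auto simp: fvan_def intro: vanish_diff)

lemma fvan_mono: "fvan n V k M \<Longrightarrow> l \<le> k \<Longrightarrow> fvan n V l M"
  by (rule fvanI) (auto intro: fvanD vanish_mono)

lemma fvan_const: "M \<in> shp n n \<Longrightarrow> fvan n V 0 (\<lambda>_. M)"
  by (auto simp: fvan_def intro: vanish.poly polyfun.const)

lemma fvan_const_mult:
  assumes "M \<in> shp n n" "fvan n V k N"
  shows "fvan n V k (\<lambda>p. M * N p)" "fvan n V k (\<lambda>p. N p * M)"
  using fvan_mult[OF fvan_const[OF assms(1)] assms(2)] fvan_mult[OF assms(2) fvan_const[OF assms(1)]] by simp_all

lemma fvan_trc:
  assumes "fvan n V k M"
  shows "vanish (crd ` coords n) V k (\<lambda>p. trc (M p))"
proof -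
  have eq: "(\<lambda>p. trc (M p)) = (\<lambda>p. \<Sum>i<n. ent (M p) i i)"
    by (intro ext trc_eq fvanD(1)[OF assms])
  show ?thesis unfolding eq by (intro vanish_sum fvanD(2)[OF assms])
qed

lemma fvan_XY:
  assumes "\<And>x. x \<in> coords n \<Longrightarrow> vanish (crd ` coords n) V k (\<lambda>p. H p x)"
  shows "fvan n V k (\<lambda>p. fX n (H p))" "fvan n V k (\<lambda>p. fY n (H p))"
proof -
  have "vanish (crd ` coords n) V k (\<lambda>p. if i < n \<and> j < n then H p (b, i, j) else 0)" for b i j
  proof (cases "i < n \<and> j < n")
    case True
    then have "(b, i, j) \<in> coords n" by (simp add: coords_def)
    from assms[OF this] True show ?thesis by simp
  qed (auto intro: vanish.zero)
  then show "fvan n V k (\<lambda>p. fX n (H p))" "fvan n V k (\<lambda>p. fY n (H p))"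
    by (simp_all add: fvan_def fX_def fY_def fm.rep_eq)
qed

definition displ :: "nat \<Rightarrow> rep \<Rightarrow> rep \<Rightarrow> coord \<Rightarrow> complex" where
  "displ n V p x = vec_of n p x - vec_of n V x"

lemma displ_vanish: "x \<in> coords n \<Longrightarrow> vanish (crd ` coords n) V 1 (\<lambda>p. displ n V p x)"
  using polyfun_diff_vanish[OF polyfun.gen[of "crd x" "crd ` coords n"]]
  by (simp add: displ_def vec_of_def)

lemma displ_fXY:
  assumes "V \<in> rep_B3 n" "p \<in> rep_B3 n"
  shows "emb (fst p) = emb (fst V) + fX n (displ n V p)" "emb (snd p) = emb (snd V) + fY n (displ n V p)"
proof -
  have *: "displ n V p = (\<lambda>x. 1 * vec_of n p x + (-1) * vec_of n V x)"
    by (auto simp: displ_def)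
  show "emb (fst p) = emb (fst V) + fX n (displ n V p)" "emb (snd p) = emb (snd V) + fY n (displ n V p)"
    unfolding * fXY_lin using rep_B3D[OF assms(1)] rep_B3D[OF assms(2)]
    by (auto intro!: fmat_eqI simp: fXY_vec_of)
qed

text \<open>Subtracting the equation at \<open>V\<close> from the one at \<open>p\<close> isolates
  the linear part: on the variety, the differential of a displacement is of second order in
  it.\<close>

lemma displ_expansion:
  assumes "V \<in> rep_B3 n" "p \<in> rep_B3 n"
  defines "A \<equiv> emb (fst V)" and "B \<equiv> emb (snd V)"
    and "X \<equiv> fX n (displ n V p)" and "Y \<equiv> fY n (displ n V p)"
  shows "dF A B X Y = (B * Y * Y + Y * B * Y + Y * Y * B) + Y * Y * Y - X * X"
proof -
  have "(A + X) * (A + X) = (B + Y) * (B + Y) * (B + Y)" "A * A = B * B * B"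
    using rep_B3D(3)[OF assms(2)] rep_B3D(3)[OF assms(1)]
    by (simp_all add: displ_fXY[OF assms(1,2)] A_def B_def X_def Y_def)
  then show ?thesis by (simp add: dF_def algebra_simps)
qed

text \<open>For a coordinate \<open>x\<close>, the functional \<open>\<xi>\<close> that measures the
  error of the linear expansion vanishes on tangent vectors. It is therefore a combination of
  entries of the differential, and these are of second order on the variety by
  \<open>displ_expansion\<close>.\<close>

lemma tangent_coordinates:
  assumes V: "V \<in> rep_B3 n" and u: "\<And>l. l < T \<Longrightarrow> u l \<in> tangents n V" and ind: "indep_family T u"
    and span: "\<And>v. v \<in> tangents n V \<Longrightarrow> \<exists>c. \<forall>x. v x = (\<Sum>l<T. c l * u l x)"
  shows "\<exists>t. (\<forall>l<T. vanish (crd ` coords n) V 1 (t l)) \<and>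
    (\<forall>x\<in>coords n. \<exists>h. vanish (crd ` coords n) V 2 h \<and>
      (\<forall>p\<in>rep_B3 n. crd x p - crd x V = (\<Sum>l<T. u l x * t l p) + h p))"
proof -
  define A where "A = emb (fst V)"
  define B where "B = emb (snd V)"
  have AB: "A \<in> shp n n" "B \<in> shp n n" using rep_B3D[OF V] by (auto simp: A_def B_def)
  have supp: "u l x = 0" if "l < T" "x \<notin> coords n" for l x
    using u[OF that(1)] that(2) unfolding tangents_def by blast
  obtain \<eta> where \<eta>: "\<And>j l. j < T \<Longrightarrow> l < T \<Longrightarrow> (\<Sum>x\<in>coords n. \<eta> j x * u l x) = (if j = l then 1 else 0)"
    using dual_functionals[OF finite_coords supp ind] by blast
  define \<tau> where "\<tau> l v = (\<Sum>y\<in>coords n. \<eta> l y * v y)" for l and v :: "coord \<Rightarrow> complex"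
  define t where "t l p = \<tau> l (displ n V p)" for l p
  have lin_\<tau>: "lin_functional (\<tau> l)" for l
    by (auto simp: \<tau>_def lin_functional_def distrib_left sum.distrib sum_distrib_left mult_ac)
  define r where "r = (\<lambda>(i, j) v. ent (dF A B (fX n v) (fY n v)) i j)"
  have lin_r: "lin_functional (r ij)" for ij
    by (cases ij) (simp add: r_def lin_functional_def fXY_lin dF_lin)
  define Q where "Q p = (B * fY n (displ n V p) * fY n (displ n V p) + fY n (displ n V p) * B * fY n (displ n V p)
      + fY n (displ n V p) * fY n (displ n V p) * B) + fY n (displ n V p) * fY n (displ n V p) * fY n (displ n V p)
      - fX n (displ n V p) * fX n (displ n V p)" for p
  have fv: "fvan n V 1 (\<lambda>p. fX n (displ n V p))" "fvan n V 1 (\<lambda>p. fY n (displ n V p))"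
    by (intro fvan_XY displ_vanish; assumption)+
  have fv3: "fvan n V 2 (\<lambda>p. fY n (displ n V p) * fY n (displ n V p) * fY n (displ n V p))"
    by (rule fvan_mono[OF fvan_mult[OF fvan_mult[OF fv(2) fv(2)] fv(2)]]) simp
  have fv2: "fvan n V 2 (\<lambda>p. fY n (displ n V p) * fY n (displ n V p))" "fvan n V 2 (\<lambda>p. fX n (displ n V p) * fX n (displ n V p))"
    using fvan_mult[OF fv(2) fv(2)] fvan_mult[OF fv(1) fv(1)] by (simp_all add: numeral_2_eq_2)
  have fv2': "fvan n V 2 (\<lambda>p. fY n (displ n V p) * B * fY n (displ n V p))"
    using fvan_mult[OF fvan_const_mult(2)[OF AB(2) fv(2)] fv(2)] by (simp add: numeral_2_eq_2)
  have "fvan n V 2 Q"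
    unfolding Q_def using fvan_const_mult[OF AB(2) fv2(1)] fv2' fv2(2) fv3
    by (intro fvan_diff fvan_add) (simp_all add: mult.assoc)
  then have vQ: "vanish (crd ` coords n) V 2 (\<lambda>p. ent (Q p) i j)" for i j by (rule fvanD(2))
  show ?thesis
  proof (intro exI[of _ t] conjI allI impI ballI)
    fix l assume "l < T"
    show "vanish (crd ` coords n) V 1 (t l)"
      unfolding t_def \<tau>_def by (intro vanish_sum vanish_scale displ_vanish)
  next
    fix x assume x: "x \<in> coords n"
    define \<xi> where "\<xi> v = v x - (\<Sum>l<T. u l x * \<tau> l v)" for v :: "coord \<Rightarrow> complex"
    have "lin_functional \<xi>"
      using lin_functionalD[OF lin_\<tau>] unfolding lin_functional_def \<xi>_def
      by (simp add: algebra_simps sum.distrib sum_distrib_left)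
    moreover have "\<xi> v = 0" if v: "\<And>ij. ij \<in> {..<n} \<times> {..<n} \<Longrightarrow> r ij v = 0" for v
    proof -
      \<comment> \<open>Truncation changes neither matrix but gives the support that membership in
        \<open>tangents n V\<close> requires.\<close>
      define v' where "v' y = (if y \<in> coords n then v y else 0)" for y
      have eq: "fX n v = fX n v'" "fY n v = fY n v'" by (rule fXY_cong; simp add: v'_def)+
      have "dF A B (fX n v') (fY n v') \<in> shp n n"
        unfolding dF_def by (intro shp_simps(2,3) shp_mult[of _ n n _ n] fXY_shp AB)
      then have "dF A B (fX n v') (fY n v') = 0"
        using v by (intro fmat_eqI) (auto simp: r_def eq[symmetric] dest: ent_shp)
      then have "v' \<in> tangents n V" unfolding tangents_def A_def B_def by (simp add: v'_def)
      then obtain c where c: "\<And>y. v' y = (\<Sum>l<T. c l * u l y)" using span by blast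
      have \<tau>c: "\<tau> l v = c l" if "l < T" for l
      proof -
        have "\<tau> l v = \<tau> l v'" by (auto simp: \<tau>_def v'_def intro!: sum.cong)
        also have "v' = (\<lambda>y. \<Sum>m<T. c m * u m y)" using c by auto
        also have "\<tau> l \<dots> = (\<Sum>m<T. c m * \<tau> l (u m))" by (rule lin_functional_sum[OF lin_\<tau>])
        also have "\<dots> = (\<Sum>m<T. if m = l then c l else 0)"
          using that \<eta> by (intro sum.cong) (auto simp: \<tau>_def)
        finally show ?thesis using that by simp
      qed
      have "\<xi> v = v' x - (\<Sum>l<T. u l x * c l)" using x \<tau>c by (simp add: \<xi>_def v'_def)
      then show ?thesis by (simp add: c mult.commute)
    qed
    ultimately obtain \<zeta> where \<zeta>: "\<And>v. \<xi> v = (\<Sum>ij\<in>{..<n} \<times> {..<n}. \<zeta> ij * r ij v)"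
      using lin_functional_combination[of "{..<n} \<times> {..<n}" r \<xi>] lin_r by auto
    show "\<exists>h. vanish (crd ` coords n) V 2 h \<and> (\<forall>p\<in>rep_B3 n. crd x p - crd x V = (\<Sum>l<T. u l x * t l p) + h p)"
    proof (intro exI conjI ballI)
      show "vanish (crd ` coords n) V 2 (\<lambda>p. \<Sum>ij\<in>{..<n} \<times> {..<n}. \<zeta> ij * ent (Q p) (fst ij) (snd ij))"
        by (intro vanish_sum vanish_scale vQ)
      fix p assume p: "p \<in> rep_B3 n"
      have "dF A B (fX n (displ n V p)) (fY n (displ n V p)) = Q p"
        using displ_expansion[OF V p] by (simp add: A_def B_def Q_def)
      then have "\<xi> (displ n V p) = (\<Sum>ij\<in>{..<n} \<times> {..<n}. \<zeta> ij * ent (Q p) (fst ij) (snd ij))"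
        unfolding \<zeta> by (intro sum.cong) (auto simp: r_def)
      then show "crd x p - crd x V = (\<Sum>l<T. u l x * t l p) + (\<Sum>ij\<in>{..<n} \<times> {..<n}. \<zeta> ij * ent (Q p) (fst ij) (snd ij))"
        using x by (simp add: \<xi>_def t_def displ_def vec_of_def diff_eq_eq add.commute)
    qed
  qed
qed

definition tangent_basis :: "nat \<Rightarrow> rep \<Rightarrow> (nat \<Rightarrow> coord \<Rightarrow> complex) \<Rightarrow> bool" where
  "tangent_basis n V u \<longleftrightarrow> (\<forall>l<tangent_dim n V. u l \<in> tangents n V) \<and>
     indep_family (tangent_dim n V) u \<and>
     (\<forall>v\<in>tangents n V. \<exists>c. \<forall>x. v x = (\<Sum>l<tangent_dim n V. c l * u l x))"

lemma tangent_basisD: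
  assumes "tangent_basis n V u"
  shows "l < tangent_dim n V \<Longrightarrow> u l \<in> tangents n V"
    "indep_family (tangent_dim n V) u"
    "v \<in> tangents n V \<Longrightarrow> \<exists>c. \<forall>x. v x = (\<Sum>l<tangent_dim n V. c l * u l x)"
  using assms unfolding tangent_basis_def by simp_all

lemma tangent_basis_exists:
  assumes V: "V \<in> rep_B3 n" and w: "tangents n V \<noteq> {\<lambda>_. 0} \<Longrightarrow> w \<in> tangents n V \<and> w \<noteq> (\<lambda>_. 0)"
  shows "\<exists>u. tangent_basis n V u \<and>
    (tangents n V \<noteq> {\<lambda>_. 0} \<longrightarrow> tangent_dim n V > 0 \<and> u 0 = w)"
proof (rule extend_to_basis[of "coords n" "tangents n V" w])
  fix T u
  assume u: "T > 0 \<Longrightarrow> u 0 = w" "tangents n V \<noteq> {\<lambda>_. 0} \<Longrightarrow> T > 0"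
    "\<And>l. l < T \<Longrightarrow> u l \<in> tangents n V" "indep_family T u"
    "\<And>v. v \<in> tangents n V \<Longrightarrow> \<exists>c. \<forall>x. v x = (\<Sum>l<T. c l * u l x)"
  have "tangent_dim n V = T" by (rule tangent_dim[OF V u(3-5)])
  then show ?thesis using u by (intro exI[of _ u]) (simp add: tangent_basis_def)
next
  show "v x = 0" if "v \<in> tangents n V" "x \<notin> coords n" for v x
    using that unfolding tangents_def by blast
qed (use w tangents_0 in auto)

lemma tangent_basis_coordinates:
  assumes V: "V \<in> rep_B3 n" and u: "tangent_basis n V u"
  shows "\<exists>t. (\<forall>l<tangent_dim n V. vanish (crd ` coords n) V 1 (t l)) \<and>
    (\<forall>x\<in>coords n. \<exists>h. vanish (crd ` coords n) V 2 h \<and> (\<forall>p\<in>rep_B3 n. crd x p - crd x V =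
      (\<Sum>l<tangent_dim n V. u l x * t l p) + h p))"
  by (rule tangent_coordinates[OF V], erule tangent_basisD(1)[OF u], rule tangent_basisD(2)[OF u],
      erule tangent_basisD(3)[OF u])

section \<open>Chains of closed sets through a representation\<close>

definition closed_chain :: "nat \<Rightarrow> rep \<Rightarrow> nat \<Rightarrow> (nat \<Rightarrow> rep set) \<Rightarrow> bool" where
  "closed_chain n V d Z \<longleftrightarrow> (\<forall>i\<le>d. irreducible_closed n (Z i) \<and> V \<in> Z i) \<and> (\<forall>i<d. Z i \<subset> Z (Suc i))"

lemma closed_chainD:
  assumes "closed_chain n V d Z"
  shows "i \<le> d \<Longrightarrow> V \<in> Z i \<and> prime_on (crd ` coords n) (Z i)"
    and "i < d \<Longrightarrow> Z i \<subseteq> Z (Suc i) \<and>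
      (\<exists>f\<in>polyfun (crd ` coords n). (\<forall>p\<in>Z i. f p = 0) \<and> (\<exists>p\<in>Z (Suc i). f p \<noteq> 0))"
    and "Z d \<subseteq> rep_B3 n"
proof -
  show "i \<le> d \<Longrightarrow> V \<in> Z i \<and> prime_on (crd ` coords n) (Z i)"
    using assms irreducible_prime_on unfolding closed_chain_def by blast
  show "i < d \<Longrightarrow> Z i \<subseteq> Z (Suc i) \<and>
      (\<exists>f\<in>polyfun (crd ` coords n). (\<forall>p\<in>Z i. f p = 0) \<and> (\<exists>p\<in>Z (Suc i). f p \<noteq> 0))"
  proof -
    assume "i < d"
    then have "irreducible_closed n (Z i)" "irreducible_closed n (Z (Suc i))" "Z i \<subset> Z (Suc i)"
      using assms unfolding closed_chain_def by auto
    then show ?thesis using closed_psubset[of n "Z i" "Z (Suc i)"] unfolding irreducible_closed_def by blast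
  qed
  have "irreducible_closed n (Z d)" using assms unfolding closed_chain_def by blast
  then show "Z d \<subseteq> rep_B3 n" unfolding irreducible_closed_def zariski_closed_def by blast
qed

lemma closed_chain_le:
  assumes V: "V \<in> rep_B3 n" and Z: "closed_chain n V d Z"
  shows "d \<le> tangent_dim n V"
proof -
  define T where "T = tangent_dim n V"
  have "\<exists>w. tangents n V \<noteq> {\<lambda>_. 0} \<longrightarrow> w \<in> tangents n V \<and> w \<noteq> (\<lambda>_. 0)"
    using tangents_0[of n V] by blast
  then obtain w where w: "tangents n V \<noteq> {\<lambda>_. 0} \<Longrightarrow> w \<in> tangents n V \<and> w \<noteq> (\<lambda>_. 0)" by blast
  obtain u where u: "tangent_basis n V u" using tangent_basis_exists[OF V w] by blast
  obtain t where t: "\<forall>l<T. vanish (crd ` coords n) V 1 (t l)"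
    "\<forall>x\<in>coords n. \<exists>h. vanish (crd ` coords n) V 2 h \<and>
      (\<forall>p\<in>rep_B3 n. crd x p - crd x V = (\<Sum>l<T. u l x * t l p) + h p)"
    using tangent_basis_coordinates[OF V u] unfolding T_def by (elim exE conjE)
  have "d \<le> card {..<T}"
  proof (rule chain_length_le[of "crd ` coords n" d V Z _ t])
    show "finite (crd ` coords n)" by simp
    show "V \<in> Z i \<and> prime_on (crd ` coords n) (Z i)" if "i \<le> d" for i by (rule closed_chainD(1)[OF Z that])
    show "Z i \<subseteq> Z (Suc i) \<and> (\<exists>f\<in>polyfun (crd ` coords n). (\<forall>p\<in>Z i. f p = 0) \<and> (\<exists>p\<in>Z (Suc i). f p \<noteq> 0))"
      if "i < d" for i by (rule closed_chainD(2)[OF Z that])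
    show "\<exists>a h. vanish (crd ` coords n) V 2 h \<and> (\<forall>p\<in>Z d. x p - x V = (\<Sum>j<T. a j * t j p) + h p)"
      if x: "x \<in> crd ` coords n" for x
    proof -
      obtain y where y: "y \<in> coords n" "x = crd y" using x by blast
      obtain h where "vanish (crd ` coords n) V 2 h"
          "\<forall>p\<in>rep_B3 n. crd y p - crd y V = (\<Sum>l<T. u l y * t l p) + h p" using t(2) y(1) by blast
      then show ?thesis using closed_chainD(3)[OF Z] y by (intro exI[of _ "\<lambda>l. u l y"] exI[of _ h]) auto
    qed
  qed (use t(1) in auto)
  then show ?thesis by (simp add: T_def)
qed

text \<open>A bilinear form, not symmetrised, whose diagonal is the second-order part of the trace
  of \<open>N\<close> times A^2 - B^3 at the given point. Linearity in each argument is all that the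
  expansion in a basis uses.\<close>

definition quad_form :: "nat \<Rightarrow> fmat \<Rightarrow> fmat \<Rightarrow> (coord \<Rightarrow> complex) \<Rightarrow> (coord \<Rightarrow> complex) \<Rightarrow> complex" where
  "quad_form n B N u v = trc (N * (fX n u * fX n v
     - (B * fY n u * fY n v + fY n u * B * fY n v + fY n u * fY n v * B)))"

lemma quad_form_lin:
  "lin_functional (\<lambda>u. quad_form n B N u v)" "lin_functional (quad_form n B N u)"
  unfolding lin_functional_def quad_form_def fXY_lin
  by (simp_all add: algebra_simps sc_simps trc_simps)

text \<open>Cyclicity of the trace collects the factors around \<open>N\<close>; the two hypotheses
  say exactly that \<open>N\<close> annihilates the image of the differential.\<close>

lemma trc_dF:
  assumes "N * A + A * N = 0" "N * B * B + B * N * B + B * B * N = 0"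
  shows "trc (N * dF A B X Y) = 0"
proof -
  have "trc (N * dF A B X Y) = trc (N * A * X) + trc (N * X * A)
      - (trc (N * B * B * Y) + trc (N * B * Y * B) + trc (N * Y * B * B))"
    by (simp add: dF_def algebra_simps trc_simps)
  also have "trc (N * X * A) = trc (A * N * X)" by (metis trc_mult mult.assoc)
  also have "trc (N * B * Y * B) = trc (B * N * B * Y)" by (metis trc_mult mult.assoc)
  also have "trc (N * Y * B * B) = trc (B * B * N * Y)" by (metis trc_mult mult.assoc)
  finally have "trc (N * dF A B X Y) = trc ((N * A + A * N) * X) - trc ((N * B * B + B * N * B + B * B * N) * Y)"
    by (simp add: algebra_simps trc_simps)
  then show ?thesis by (simp add: assms trc_simps)
qed

text \<open>Pairing the expansion with \<open>N\<close> removes its linear part and leaves the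
  quadratic form equal to a cubic term. With \<open>w\<close> as first basis vector the square of
  \<open>t 0\<close> has a nonzero coefficient and can be eliminated.\<close>

lemma closed_chain_less:
  assumes V: "V \<in> rep_B3 n" and Z: "closed_chain n V d Z"
    and N: "N \<in> shp n n" "N * emb (fst V) + emb (fst V) * N = 0"
      "N * emb (snd V) * emb (snd V) + emb (snd V) * N * emb (snd V) + emb (snd V) * emb (snd V) * N = 0"
    and w: "w \<in> tangents n V" "quad_form n (emb (snd V)) N w w \<noteq> 0"
  shows "d < tangent_dim n V"
proof -
  define T where "T = tangent_dim n V"
  define B where "B = emb (snd V)"
  have B: "B \<in> shp n n" using rep_B3D[OF V] by (simp add: B_def)
  define \<beta> where "\<beta> = quad_form n B N"
  have w0: "w \<noteq> (\<lambda>_. 0)"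
    using w(2) lin_functional_0[OF quad_form_lin(2)] by auto
  then have S0: "tangents n V \<noteq> {\<lambda>_. 0}" using w(1) by blast
  have "\<exists>u. tangent_basis n V u \<and>
    (tangents n V \<noteq> {\<lambda>_. 0} \<longrightarrow> tangent_dim n V > 0 \<and> u 0 = w)"
    using w(1) w0 by (intro tangent_basis_exists[OF V]) blast
  then obtain u where ub: "tangent_basis n V u" and u: "T > 0" "u 0 = w"
    using S0 unfolding T_def by blast
  have u3: "u l \<in> tangents n V" if "l < T" for l using tangent_basisD(1)[OF ub] that by (simp add: T_def)
  obtain t where t0: "\<forall>l<T. vanish (crd ` coords n) V 1 (t l)"
    "\<forall>x\<in>coords n. \<exists>h. vanish (crd ` coords n) V 2 h \<and>
      (\<forall>p\<in>rep_B3 n. crd x p - crd x V = (\<Sum>l<T. u l x * t l p) + h p)"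
    using tangent_basis_coordinates[OF V ub] unfolding T_def by (elim exE conjE)
  have t: "vanish (crd ` coords n) V 1 (t l)" if "l < T" for l using t0(1) that by simp
  from bchoice[OF t0(2)] obtain H where H0: "\<forall>x\<in>coords n. vanish (crd ` coords n) V 2 (H x) \<and>
      (\<forall>p\<in>rep_B3 n. crd x p - crd x V = (\<Sum>l<T. u l x * t l p) + H x p)" by (elim exE)
  have H: "vanish (crd ` coords n) V 2 (H x)"
      "p \<in> rep_B3 n \<Longrightarrow> crd x p - crd x V = (\<Sum>l<T. u l x * t l p) + H x p" if "x \<in> coords n" for x p
    using H0 that by simp_all
  \<comment> \<open>The second-order remainders, extended by zero so that the expansion of
    \<open>displ\<close> is an equality of functions on all of \<open>coord\<close>.\<close>
  define K where "K p x = (if x \<in> coords n then H x p else 0)" for p x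
  have K: "vanish (crd ` coords n) V 2 (\<lambda>p. K p x)" if "x \<in> coords n" for x
    using H(1)[OF that] that by (simp add: K_def)
  have dK: "displ n V p = (\<lambda>x. 1 * (\<Sum>l<T. t l p * u l x) + 1 * K p x)" if p: "p \<in> rep_B3 n" for p
  proof
    fix x
    show "displ n V p x = 1 * (\<Sum>l<T. t l p * u l x) + 1 * K p x"
    proof (cases "x \<in> coords n")
      case True
      then show ?thesis using H(2)[OF True p] by (simp add: displ_def vec_of_def K_def mult.commute)
    next
      case False
      then have "u l x = 0" if "l < T" for l using u3[OF that] unfolding tangents_def by blast
      then show ?thesis using False by (simp add: displ_def vec_of_def K_def)
    qed
  qed
  have vform: "vanish (crd ` coords n) V (k + l) (\<lambda>p. \<beta> (f p) (g p))"
    if "fvan n V k (\<lambda>p. fX n (f p))" "fvan n V k (\<lambda>p. fY n (f p))"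
      "fvan n V l (\<lambda>p. fX n (g p))" "fvan n V l (\<lambda>p. fY n (g p))" for k l f g
    unfolding \<beta>_def quad_form_def
    by (intro fvan_trc fvan_const_mult(1)[OF N(1)] fvan_diff fvan_add fvan_mult[OF that(1,3)]
        fvan_mult[OF fvan_const_mult(1)[OF B that(2)] that(4)] fvan_mult[OF fvan_const_mult(2)[OF B that(2)] that(4)]
        fvan_const_mult(2)[OF B fvan_mult[OF that(2,4)]])
  have fK: "fvan n V 2 (\<lambda>p. fX n (K p))" "fvan n V 2 (\<lambda>p. fY n (K p))" by (intro fvan_XY K; assumption)+
  have fd: "fvan n V 1 (\<lambda>p. fX n (displ n V p))" "fvan n V 1 (\<lambda>p. fY n (displ n V p))"
    by (intro fvan_XY displ_vanish; assumption)+
  \<comment> \<open>The terms of the form that involve a remainder. Each has order at least 3: a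
    first-order factor meets the second-order \<open>K\<close>.\<close>
  define R where "R p = (\<Sum>l<T. t l p * \<beta> (u l) (K p)) + \<beta> (K p) (displ n V p)" for p
  have "vanish (crd ` coords n) V (1 + (0 + 2)) (\<lambda>p. t l p * \<beta> (u l) (K p))" if "l < T" for l
    by (intro vanish_mult t[OF that] vform fK fvan_const fXY_shp)
  then have vR: "vanish (crd ` coords n) V 3 R"
    unfolding R_def using vform[OF fK fd] by (intro vanish.add vanish_sum) (auto simp: numeral_3_eq_3)
  define h3 where "h3 p = trc (N * (fY n (displ n V p) * fY n (displ n V p) * fY n (displ n V p)))" for p
  have vh3: "vanish (crd ` coords n) V 3 h3"
    using fvan_trc[OF fvan_const_mult(1)[OF N(1) fvan_mult[OF fvan_mult[OF fd(2) fd(2)] fd(2)]]]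
    by (simp add: h3_def[abs_def] numeral_3_eq_3)
  have key: "(\<Sum>l<T. \<Sum>m<T. t l p * t m p * \<beta> (u l) (u m)) + R p = h3 p" if p: "p \<in> rep_B3 n" for p
  proof -
    have \<beta>u: "\<beta> (u l) (displ n V p) = (\<Sum>m<T. t m p * \<beta> (u l) (u m)) + \<beta> (u l) (K p)" for l
      unfolding \<beta>_def dK[OF p] lin_functionalD[OF quad_form_lin(2)] lin_functional_sum[OF quad_form_lin(2)] by simp
    have "\<beta> (displ n V p) (displ n V p) =
        1 * \<beta> (\<lambda>x. \<Sum>l<T. t l p * u l x) (displ n V p) + 1 * \<beta> (K p) (displ n V p)"
      unfolding \<beta>_def
      by (subst (1) dK[OF p]) (rule lin_functionalD[OF quad_form_lin(1)])
    also have "\<beta> (\<lambda>x. \<Sum>l<T. t l p * u l x) (displ n V p) = (\<Sum>l<T. t l p * \<beta> (u l) (displ n V p))"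
      unfolding \<beta>_def by (rule lin_functional_sum[OF quad_form_lin(1)])
    finally have "\<beta> (displ n V p) (displ n V p) = (\<Sum>l<T. \<Sum>m<T. t l p * t m p * \<beta> (u l) (u m)) + R p"
      by (simp add: R_def \<beta>u distrib_left sum.distrib sum_distrib_left mult.assoc)
    moreover have "\<beta> (displ n V p) (displ n V p) = h3 p"
    proof -
      define X where "X = fX n (displ n V p)"
      define Y where "Y = fY n (displ n V p)"
      have "dF (emb (fst V)) B X Y = (B * Y * Y + Y * B * Y + Y * Y * B) + Y * Y * Y - X * X"
        using displ_expansion[OF V p] by (simp add: B_def X_def Y_def)
      then have "X * X - (B * Y * Y + Y * B * Y + Y * Y * B) = Y * Y * Y - dF (emb (fst V)) B X Y"
        by (simp add: algebra_simps)
      then show ?thesis using trc_dF[OF N(2,3), of X Y]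
        by (simp add: \<beta>_def quad_form_def h3_def X_def[symmetric] Y_def[symmetric] right_diff_distrib trc_simps B_def)
    qed
    ultimately show ?thesis by simp
  qed
  have \<beta>0: "\<beta> (u 0) (u 0) \<noteq> 0" using w(2) u(2) by (simp add: \<beta>_def B_def)
  define I where "I = {1..<T}"
  have IT: "{..<T} = insert 0 I" "0 \<notin> I" "finite I" using u(1) by (auto simp: I_def)
  have "d \<le> card I"
  proof (rule chain_length_le1[of "crd ` coords n" d V Z I t "t 0" "\<lambda>p. (h3 p - R p) / \<beta> (u 0) (u 0)"
        "\<lambda>j. - (\<beta> (u 0) (u j) + \<beta> (u j) (u 0)) / \<beta> (u 0) (u 0)" "\<lambda>i j. - \<beta> (u i) (u j) / \<beta> (u 0) (u 0)"])
    show "finite (crd ` coords n)" by simp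
    show "V \<in> Z i \<and> prime_on (crd ` coords n) (Z i)" if "i \<le> d" for i by (rule closed_chainD(1)[OF Z that])
    show "Z i \<subseteq> Z (Suc i) \<and> (\<exists>f\<in>polyfun (crd ` coords n). (\<forall>p\<in>Z i. f p = 0) \<and> (\<exists>p\<in>Z (Suc i). f p \<noteq> 0))"
      if "i < d" for i by (rule closed_chainD(2)[OF Z that])
    show "\<exists>a b h. vanish (crd ` coords n) V 2 h \<and> (\<forall>p\<in>Z d. x p - x V = b * t 0 p + (\<Sum>j\<in>I. a j * t j p) + h p)"
      if x: "x \<in> crd ` coords n" for x
    proof -
      obtain y where y: "y \<in> coords n" "x = crd y" using x by blast
      have "x p - x V = u 0 y * t 0 p + (\<Sum>j\<in>I. u j y * t j p) + H y p" if "p \<in> Z d" for p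
        using H(2)[OF y(1), of p] closed_chainD(3)[OF Z] that IT by (auto simp: y)
      then show ?thesis using H(1)[OF y(1)]
        by (intro exI[of _ "\<lambda>l. u l y"] exI[of _ "u 0 y"] exI[of _ "H y"]) auto
    qed
    show "vanish (crd ` coords n) V 3 (\<lambda>p. (h3 p - R p) / \<beta> (u 0) (u 0))"
      using vanish_scale[OF vanish_diff[OF vh3 vR], of "1 / \<beta> (u 0) (u 0)"] by simp
    show "\<forall>p\<in>Z d. t 0 p * t 0 p = t 0 p * (\<Sum>j\<in>I. - (\<beta> (u 0) (u j) + \<beta> (u j) (u 0)) / \<beta> (u 0) (u 0) * t j p) +
       (\<Sum>i\<in>I. \<Sum>j\<in>I. - \<beta> (u i) (u j) / \<beta> (u 0) (u 0) * (t i p * t j p)) + (h3 p - R p) / \<beta> (u 0) (u 0)"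
    proof
      fix p assume "p \<in> Z d"
      then have p: "p \<in> rep_B3 n" using closed_chainD(3)[OF Z] by blast
      define b where "b = \<beta> (u 0) (u 0)"
      have "(\<Sum>l<T. \<Sum>m<T. t l p * t m p * \<beta> (u l) (u m)) =
          t 0 p * t 0 p * b + t 0 p * (\<Sum>j\<in>I. (\<beta> (u 0) (u j) + \<beta> (u j) (u 0)) * t j p)
            + (\<Sum>i\<in>I. \<Sum>j\<in>I. \<beta> (u i) (u j) * (t i p * t j p))"
        unfolding IT(1) using IT(2,3)
        by (simp add: b_def distrib_left distrib_right sum.distrib sum_distrib_left mult_ac)
      then have "t 0 p * t 0 p * b = - (t 0 p * (\<Sum>j\<in>I. (\<beta> (u 0) (u j) + \<beta> (u j) (u 0)) * t j p))
            - (\<Sum>i\<in>I. \<Sum>j\<in>I. \<beta> (u i) (u j) * (t i p * t j p)) + (h3 p - R p)"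
        using key[OF p] by (simp add: algebra_simps)
      then have "t 0 p * t 0 p = (- (t 0 p * (\<Sum>j\<in>I. (\<beta> (u 0) (u j) + \<beta> (u j) (u 0)) * t j p))
            - (\<Sum>i\<in>I. \<Sum>j\<in>I. \<beta> (u i) (u j) * (t i p * t j p)) + (h3 p - R p)) / b"
        using \<beta>0 by (simp add: b_def nonzero_eq_divide_eq)
      also have "\<dots> = t 0 p * (\<Sum>j\<in>I. - (\<beta> (u 0) (u j) + \<beta> (u j) (u 0)) / b * t j p) +
       (\<Sum>i\<in>I. \<Sum>j\<in>I. - \<beta> (u i) (u j) / b * (t i p * t j p)) + (h3 p - R p) / b"
        by (simp add: divide_inverse sum_distrib_left sum_distrib_right sum_negf sum_subtractf sum.distrib algebra_simps)
      finally show "t 0 p * t 0 p = t 0 p * (\<Sum>j\<in>I. - (\<beta> (u 0) (u j) + \<beta> (u j) (u 0)) / \<beta> (u 0) (u 0) * t j p) +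
       (\<Sum>i\<in>I. \<Sum>j\<in>I. - \<beta> (u i) (u j) / \<beta> (u 0) (u 0) * (t i p * t j p)) + (h3 p - R p) / \<beta> (u 0) (u 0)"
        by (simp add: b_def)
    qed
  qed (use t IT u(1) in auto)
  then show ?thesis using u(1) by (simp add: I_def T_def)
qed

lemma local_dim_eq: "local_dim n V = Sup {enat d | d. \<exists>Z. closed_chain n V d Z}"
  unfolding local_dim_def closed_chain_def ..

lemma smooth_atI:
  assumes "V \<in> rep_B3 n" "closed_chain n V (tangent_dim n V) Z"
  shows "smooth_at n V"
  unfolding smooth_at_def local_dim_eq
proof (intro conjI assms(1) antisym Sup_upper Sup_least)
  show "enat (tangent_dim n V) \<in> {enat d |d. \<exists>Z. closed_chain n V d Z}"
    using assms(2) by blast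
  fix y assume "y \<in> {enat d |d. \<exists>Z. closed_chain n V d Z}"
  then show "y \<le> enat (tangent_dim n V)"
    using closed_chain_le[OF assms(1)] by auto
qed

lemma not_smooth_atI:
  assumes V: "V \<in> rep_B3 n"
    and N: "N \<in> shp n n" "N * emb (fst V) + emb (fst V) * N = 0"
      "N * emb (snd V) * emb (snd V) + emb (snd V) * N * emb (snd V) + emb (snd V) * emb (snd V) * N = 0"
    and w: "w \<in> tangents n V" "quad_form n (emb (snd V)) N w w \<noteq> 0"
  shows "\<not> smooth_at n V"
proof
  define T where "T = tangent_dim n V"
  have lt: "d < T" if "closed_chain n V d Z" for d Z
    unfolding T_def by (rule closed_chain_less[OF V that N w])
  assume "smooth_at n V"
  then have eq: "enat T = Sup {enat d | d. \<exists>Z. closed_chain n V d Z}"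
    by (simp add: smooth_at_def local_dim_eq T_def)
  have "Sup {enat d | d. \<exists>Z. closed_chain n V d Z} \<le> enat (T - 1)"
  proof (rule Sup_least)
    fix y assume "y \<in> {enat d | d. \<exists>Z. closed_chain n V d Z}"
    then obtain d Z where "y = enat d" "closed_chain n V d Z" by blast
    then show "y \<le> enat (T - 1)" using lt[of d Z] by simp
  qed
  \<comment> \<open>Subtraction is truncated, so this only gives \<open>T = 0\<close>; the nonzero
    tangent vector \<open>w\<close> excludes that case.\<close>
  then have "enat T \<le> enat (T - 1)" by (simp only: eq[symmetric])
  then have "T = 0" by simp
  moreover have "T > 0"
  proof -
    have w0: "w \<noteq> (\<lambda>_. 0)" using w(2) lin_functional_0[OF quad_form_lin(2)] by auto
    then have "tangents n V \<noteq> {\<lambda>_. 0}" using w(1) by blast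
    then have "\<exists>u. tangent_basis n V u \<and>
      (tangents n V \<noteq> {\<lambda>_. 0} \<longrightarrow> tangent_dim n V > 0 \<and> u 0 = w)"
      using w(1) w0 by (intro tangent_basis_exists[OF V]) blast
    then show ?thesis using \<open>tangents n V \<noteq> {\<lambda>_. 0}\<close> unfolding T_def by blast
  qed
  ultimately show False by simp
qed

section \<open>Rational parametrizations\<close>

lemma digits_bound:
  assumes "\<And>j. j < m \<Longrightarrow> e j < (k::nat)"
  shows "(\<Sum>j<m. e j * k ^ j) < k ^ m"
  using assms
proof (induction m)
  case (Suc m)
  have "(\<Sum>j<m. e j * k ^ j) < k ^ m" using Suc by simp
  moreover have "e m * k ^ m \<le> (k - 1) * k ^ m" using Suc.prems[of m] by (intro mult_right_mono) auto
  moreover have "k ^ m + (k - 1) * k ^ m = k ^ Suc m" using Suc.prems[of m] by (cases k) auto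
  ultimately show ?case unfolding sum.lessThan_Suc by linarith
qed simp

lemma digits_unique:
  assumes "\<And>j. j < m \<Longrightarrow> e j < (k::nat)" "\<And>j. j < m \<Longrightarrow> e' j < k"
    and "(\<Sum>j<m. e j * k ^ j) = (\<Sum>j<m. e' j * k ^ j)" "j < m"
  shows "e j = e' j"
  using assms
proof (induction m)
  case (Suc m)
  define a where "a = (\<Sum>j<m. e j * k ^ j)"
  define b where "b = (\<Sum>j<m. e' j * k ^ j)"
  have ab: "a < k ^ m" "b < k ^ m" unfolding a_def b_def using Suc.prems by (auto intro!: digits_bound)
  have eq: "a + e m * k ^ m = b + e' m * k ^ m" using Suc.prems(3) by (simp add: a_def b_def)
  have pos: "k ^ m \<noteq> 0" using ab(1) by linarith
  have "e m = (a + e m * k ^ m) div k ^ m" "a = (a + e m * k ^ m) mod k ^ m"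
    using ab div_mult_self1[OF pos, of a "e m"] by simp_all
  moreover have "e' m = (b + e' m * k ^ m) div k ^ m" "b = (b + e' m * k ^ m) mod k ^ m"
    using ab div_mult_self1[OF pos, of b "e' m"] by simp_all
  ultimately have "e m = e' m" "a = b" using eq by metis+
  then show ?case using Suc.IH Suc.prems by (cases "j = m") (auto simp: a_def b_def less_Suc_eq)
qed simp

text \<open>Kronecker substitution: a polynomial in \<open>m\<close> variables with exponents below \<open>k\<close> does not
  vanish on the curve \<open>s\<^sub>j = y\<^bsup>k\<^sup>j\<^esup>\<close>.\<close>

lemma nonvanishing_point:
  fixes c :: "(nat \<Rightarrow> nat) \<Rightarrow> complex"
  assumes e0: "e0 \<in> PiE {..<m} (\<lambda>_. {..<k})" "c e0 \<noteq> 0"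
  obtains s where "(\<Sum>e\<in>PiE {..<m} (\<lambda>_. {..<k}). c e * (\<Prod>j<m. s j ^ e j)) \<noteq> 0" "\<And>j. m \<le> j \<Longrightarrow> s j = 0"
proof -
  define E where "E = PiE {..<m} (\<lambda>_. {..<k})"
  define K where "K e = (\<Sum>j<m. e j * k ^ j)" for e
  have E: "finite E" by (simp add: E_def finite_PiE)
  have K: "e = e'" if "e \<in> E" "e' \<in> E" "K e = K e'" for e e'
  proof (rule PiE_ext[of e "{..<m}" "\<lambda>_. {..<k}" e'])
    fix j assume "j \<in> {..<m}"
    then show "e j = e' j"
      using that by (intro digits_unique[of m e k e']) (auto simp: E_def K_def PiE_iff)
  qed (use that in \<open>auto simp: E_def\<close>)
  define p where "p = (\<Sum>e\<in>E. monom (c e) (K e))"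
  have "coeff p (K e0) = (\<Sum>e\<in>E. if e = e0 then c e0 else 0)"
    unfolding p_def coeff_sum coeff_monom
    using K e0(1) by (intro sum.cong) (auto simp: E_def[symmetric])
  also have "\<dots> = c e0" using E e0 by (simp add: E_def[symmetric])
  finally have "p \<noteq> 0" using e0(2) by auto
  then obtain y where y: "poly p y \<noteq> 0" using poly_all_0_iff_0 by blast
  define s where "s j = (if j < m then y ^ (k ^ j) else 0)" for j
  have "(\<Sum>e\<in>E. c e * (\<Prod>j<m. s j ^ e j)) = poly p y"
    unfolding p_def poly_sum
  proof (rule sum.cong)
    fix e
    have "(\<Prod>j<m. s j ^ e j) = (\<Prod>j<m. y ^ (e j * k ^ j))"
      by (intro prod.cong) (auto simp: s_def power_mult[symmetric] mult.commute)
    then show "c e * (\<Prod>j<m. s j ^ e j) = poly (monom (c e) (K e)) y"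
      by (simp add: poly_monom K_def power_sum)
  qed simp
  then show thesis using y by (intro that[of s]) (auto simp: E_def s_def)
qed

section \<open>Polynomials in parameters and their degrees\<close>

definition slots :: "nat \<Rightarrow> ((nat \<Rightarrow> complex) \<Rightarrow> complex) set" where
  "slots T = (\<lambda>j s. s j) ` {..<T}"

text \<open>Restriction to the line through \<open>a\<close> and \<open>b\<close> reduces questions
  of nonvanishing to polynomials in one variable.\<close>

lemma polyfun_on_line:
  "h \<in> polyfun (slots T) \<Longrightarrow> \<exists>p. \<forall>y. h (\<lambda>j. a j + y * (b j - a j)) = poly p y"
proof (induction rule: polyfun.induct)
  case (const c)
  show ?case by (intro exI[of _ "[:c:]"]) simp
next
  case (gen x)
  then obtain j where "x = (\<lambda>s. s j)" by (auto simp: slots_def)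
  then show ?case by (intro exI[of _ "[:a j, b j - a j:]"]) simp
next
  case (add f g)
  then obtain p q where "\<forall>y. f (\<lambda>j. a j + y * (b j - a j)) = poly p y" "\<forall>y. g (\<lambda>j. a j + y * (b j - a j)) = poly q y"
    by blast
  then show ?case by (intro exI[of _ "p + q"]) simp
next
  case (mult f g)
  then obtain p q where "\<forall>y. f (\<lambda>j. a j + y * (b j - a j)) = poly p y" "\<forall>y. g (\<lambda>j. a j + y * (b j - a j)) = poly q y"
    by blast
  then show ?case by (intro exI[of _ "p * q"]) simp
qed

definition bounded_monomials :: "nat \<Rightarrow> nat \<Rightarrow> ((nat \<Rightarrow> complex) \<Rightarrow> complex) set" where
  "bounded_monomials i C = monomial (\<lambda>j s. s j) {..<i} ` PiE {..<i} (\<lambda>_. {..C})"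

definition subparams :: "nat \<Rightarrow> (nat \<Rightarrow> complex) set" where
  "subparams i = {s. \<forall>j\<ge>i. s j = 0}"

text \<open>Bounds every exponent separately by \<open>C\<close>, and compares functions only where
  the parameters from index \<open>i\<close> on are zero; this suits a count of monomials in
  \<open>i\<close> variables.\<close>

definition of_degree :: "nat \<Rightarrow> nat \<Rightarrow> ((nat \<Rightarrow> complex) \<Rightarrow> complex) \<Rightarrow> bool" where
  "of_degree i C h \<longleftrightarrow> combination_on (subparams i) (bounded_monomials i C) h"

lemma finite_bounded_monomials [simp]: "finite (bounded_monomials i C)"
  by (simp add: bounded_monomials_def finite_PiE)

lemma card_bounded_monomials: "card (bounded_monomials i C) \<le> (C + 1) ^ i"
proof -
  have "card (bounded_monomials i C) \<le> card (PiE {..<i} (\<lambda>_. {..C}))"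
    unfolding bounded_monomials_def by (intro card_image_le finite_PiE) auto
  then show ?thesis by (simp add: card_PiE)
qed

lemma bounded_monomials_mult:
  assumes "f \<in> bounded_monomials i C" "g \<in> bounded_monomials i C'"
  shows "(\<lambda>s. f s * g s) \<in> bounded_monomials i (C + C')"
proof -
  obtain e e' where e: "e \<in> PiE {..<i} (\<lambda>_. {..C})" "f = monomial (\<lambda>j s. s j) {..<i} e"
    "e' \<in> PiE {..<i} (\<lambda>_. {..C'})" "g = monomial (\<lambda>j s. s j) {..<i} e'"
    using assms by (auto simp: bounded_monomials_def)
  define d where "d j = (if j < i then e j + e' j else undefined)" for j
  have "e j + e' j \<le> C + C'" if "j < i" for j
    using e that by (intro add_mono) (auto simp: PiE_iff)
  then have "d \<in> PiE {..<i} (\<lambda>_. {..C + C'})" by (auto simp: d_def PiE_iff extensional_def)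
  moreover have "(\<lambda>s. f s * g s) = monomial (\<lambda>j s. s j) {..<i} d"
    unfolding e(2,4) monomial_def prod.distrib[symmetric]
    by (intro ext prod.cong) (simp_all add: d_def power_add)
  ultimately show ?thesis unfolding bounded_monomials_def by blast
qed

lemma of_degree_mult:
  assumes f: "of_degree i C f" and g: "of_degree i C' g"
  shows "of_degree i (C + C') (\<lambda>s. f s * g s)"
  unfolding of_degree_def
proof (rule combination_on_mult[OF g[unfolded of_degree_def]])
  fix g' assume g': "g' \<in> bounded_monomials i C'"
  have "combination_on (subparams i) (bounded_monomials i (C + C')) (\<lambda>s. g' s * f s)"
  proof (rule combination_on_mult[OF f[unfolded of_degree_def]])
    fix f' assume "f' \<in> bounded_monomials i C"
    from bounded_monomials_mult[OF this g'] show "combination_on (subparams i) (bounded_monomials i (C + C')) (\<lambda>s. g' s * f' s)"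
      by (intro combination_onI) (simp_all add: mult.commute)
  qed
  then show "combination_on (subparams i) (bounded_monomials i (C + C')) (\<lambda>s. f s * g' s)"
    by (simp add: mult.commute)
qed

lemma of_degree_mono:
  assumes "of_degree i C f" "C \<le> C'"
  shows "of_degree i C' f"
proof -
  have "bounded_monomials i C \<subseteq> bounded_monomials i C'"
    unfolding bounded_monomials_def using assms(2) by (intro image_mono PiE_mono) auto
  with assms(1) show ?thesis
    unfolding of_degree_def by (rule combination_on_mono) simp
qed

lemma of_degree_const: "of_degree i 0 (\<lambda>_. c)"
proof -
  have "(\<lambda>_. 1) \<in> bounded_monomials i 0"
    unfolding bounded_monomials_def monomial_def
    by (intro image_eqI[of _ _ "\<lambda>j. if j < i then 0 else undefined"]) (auto simp: PiE_iff extensional_def)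
  then have "of_degree i 0 (\<lambda>_. c * 1)" unfolding of_degree_def by (intro combination_on_scale combination_onI) simp_all
  then show ?thesis by simp
qed

lemma of_degree_power: "of_degree i C f \<Longrightarrow> of_degree i (m * C) (\<lambda>s. f s ^ m)"
proof (induction m)
  case 0
  then show ?case using of_degree_const[of i 1] by simp
next
  case (Suc m)
  then show ?case using of_degree_mult[OF Suc.prems, of "m * C"] by simp
qed

lemma of_degree_prod: "(\<And>j. j < m \<Longrightarrow> of_degree i C (f j)) \<Longrightarrow> of_degree i (m * C) (\<lambda>s. \<Prod>j<m. f j s)"
proof (induction m)
  case 0
  then show ?case using of_degree_const[of i 1] by simp
next
  case (Suc m)
  then have "of_degree i (m * C + C) (\<lambda>s. (\<Prod>j<m. f j s) * f m s)" by (intro of_degree_mult) auto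
  then show ?case by (simp add: add.commute)
qed

lemma polyfun_of_degree: "h \<in> polyfun (slots T) \<Longrightarrow> \<exists>C. of_degree i C h"
proof (induction rule: polyfun.induct)
  case (const c)
  then show ?case using of_degree_const by blast
next
  case (gen x)
  then obtain j where j: "x = (\<lambda>s. s j)" by (auto simp: slots_def)
  show ?case
  proof (cases "j < i")
    case True
    define e :: "nat \<Rightarrow> nat" where "e l = (if l < i then (if l = j then 1 else 0) else undefined)" for l
    have "(\<Prod>l<i. s l ^ e l) = s j" for s :: "nat \<Rightarrow> complex"
    proof -
      have "(\<Prod>l<i. s l ^ e l) = (\<Prod>l<i. if l = j then s j else 1)"
        by (intro prod.cong) (auto simp: e_def)
      then show ?thesis using True by simp
    qed
    then have "x = monomial (\<lambda>j s. s j) {..<i} e" by (auto simp: j monomial_def)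
    moreover have "e \<in> PiE {..<i} (\<lambda>_. {..1})" by (auto simp: e_def PiE_iff extensional_def)
    ultimately have "x \<in> bounded_monomials i 1" unfolding bounded_monomials_def by blast
    then show ?thesis unfolding of_degree_def by (intro exI[of _ 1] combination_onI) simp_all
  next
    case False
    have "combination_on (subparams i) (bounded_monomials i 0) x"
      by (rule combination_on_cong[OF combination_on_zero]) (use False j in \<open>auto simp: subparams_def\<close>)
    then show ?thesis unfolding of_degree_def by blast
  qed
next
  case (add f g)
  then obtain C C' where "of_degree i C f" "of_degree i C' g" by blast
  then have "of_degree i (C + C') f" "of_degree i (C + C') g" by (auto elim: of_degree_mono)
  then show ?case unfolding of_degree_def using combination_on_add by blast
next
  case (mult f g)
  then show ?case using of_degree_mult by blast
qed

text \<open>The left side counts monomials in \<open>m\<close> variables and is at most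
  \<open>M * k ^ m\<close>; the right side counts products of powers of \<open>m + 1\<close>
  functions. Once \<open>k\<close> exceeds \<open>M\<close> there are more products than monomials,
  which forces algebraic dependence.\<close>

lemma degree_count:
  obtains k where "0 < k" "((m + 1) * (k * C) + 1) ^ m < (k::nat) ^ (m + 1)"
proof -
  define M where "M = ((m + 1) * C + 1) ^ m"
  define k where "k = M + 1"
  have "(m + 1) * (k * C) + 1 \<le> ((m + 1) * C + 1) * k"
    by (simp add: k_def algebra_simps)
  then have "((m + 1) * (k * C) + 1) ^ m \<le> (((m + 1) * C + 1) * k) ^ m" by (rule power_mono) simp
  also have "\<dots> = M * k ^ m" by (simp only: M_def power_mult_distrib)
  also have "\<dots> < k * k ^ m" by (simp add: k_def)
  finally show thesis by (intro that[of k]) (auto simp: k_def)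
qed

lemma polyfun_tendsto:
  "h \<in> polyfun (slots T) \<Longrightarrow> ((\<lambda>y. h (\<lambda>j. y * s j)) \<longlongrightarrow> h (\<lambda>_. 0)) (at 0)"
proof (induction rule: polyfun.induct)
  case (gen x)
  then obtain j where "x = (\<lambda>s. s j)" by (auto simp: slots_def)
  moreover have "((\<lambda>y. y * s j) \<longlongrightarrow> 0) (at 0)" by (rule tendsto_eq_intros | simp)+
  ultimately show ?case by simp
qed (auto intro: tendsto_intros)

text \<open>A rational map regular at the origin: \<open>q\<close> is a common denominator of all
  matrix entries. Nothing is asked of \<open>\<phi>\<close> where \<open>q\<close> is zero.\<close>

definition rational_param :: "nat \<Rightarrow> nat \<Rightarrow> ((nat \<Rightarrow> complex) \<Rightarrow> rep) \<Rightarrow> ((nat \<Rightarrow> complex) \<Rightarrow> complex) \<Rightarrow> bool" where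
  "rational_param n T \<phi> q \<longleftrightarrow> q \<in> polyfun (slots T) \<and> q (\<lambda>_. 0) \<noteq> 0 \<and>
     (\<forall>s. q s \<noteq> 0 \<longrightarrow> \<phi> s \<in> rep_B3 n) \<and>
     (\<forall>x\<in>coords n. \<exists>h\<in>polyfun (slots T). \<forall>s. q s \<noteq> 0 \<longrightarrow> crd x (\<phi> s) * q s = h s)"

lemma rational_param_pullback:
  assumes \<phi>: "rational_param n T \<phi> q" and f: "f \<in> poly_fun n"
  shows "\<exists>r h. h \<in> polyfun (slots T) \<and> (\<forall>s. q s \<noteq> 0 \<longrightarrow> f (\<phi> s) * q s ^ r = h s)"
  using f unfolding poly_fun_eq
proof (induction rule: polyfun.induct)
  case (const c)
  show ?case by (intro exI[of _ 0] exI[of _ "\<lambda>_. c"]) (auto intro: polyfun.const)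
next
  case (gen x)
  then obtain h where "h \<in> polyfun (slots T)" "\<forall>s. q s \<noteq> 0 \<longrightarrow> x (\<phi> s) * q s = h s"
    using \<phi> unfolding rational_param_def by blast
  then show ?case by (intro exI[of _ 1] exI[of _ h]) simp
next
  case (add f g)
  then obtain r1 h1 r2 h2 where *: "h1 \<in> polyfun (slots T)" "\<forall>s. q s \<noteq> 0 \<longrightarrow> f (\<phi> s) * q s ^ r1 = h1 s"
    "h2 \<in> polyfun (slots T)" "\<forall>s. q s \<noteq> 0 \<longrightarrow> g (\<phi> s) * q s ^ r2 = h2 s" by blast
  have q: "q \<in> polyfun (slots T)" using \<phi> by (simp add: rational_param_def)
  have "(f (\<phi> s) + g (\<phi> s)) * q s ^ (r1 + r2) = h1 s * q s ^ r2 + h2 s * q s ^ r1" if "q s \<noteq> 0" for s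
    using *(2,4) that by (auto simp: power_add algebra_simps)
  then show ?case using * q
    by (intro exI[of _ "r1 + r2"] exI[of _ "\<lambda>s. h1 s * q s ^ r2 + h2 s * q s ^ r1"])
       (auto intro!: polyfun.add polyfun.mult polyfun_power)
next
  case (mult f g)
  then obtain r1 h1 r2 h2 where *: "h1 \<in> polyfun (slots T)" "\<forall>s. q s \<noteq> 0 \<longrightarrow> f (\<phi> s) * q s ^ r1 = h1 s"
    "h2 \<in> polyfun (slots T)" "\<forall>s. q s \<noteq> 0 \<longrightarrow> g (\<phi> s) * q s ^ r2 = h2 s" by blast
  have "(f (\<phi> s) * g (\<phi> s)) * q s ^ (r1 + r2) = h1 s * h2 s" if "q s \<noteq> 0" for s
    using *(2,4) that by (auto simp: power_add algebra_simps)
  then show ?case using *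
    by (intro exI[of _ "r1 + r2"] exI[of _ "\<lambda>s. h1 s * h2 s"]) (auto intro!: polyfun.mult)
qed

section \<open>Closures of images of coordinate subspaces\<close>

definition param_set :: "nat \<Rightarrow> ((nat \<Rightarrow> complex) \<Rightarrow> complex) \<Rightarrow> (nat \<Rightarrow> complex) set" where
  "param_set i q = {s \<in> subparams i. q s \<noteq> 0}"

text \<open>The Zariski closure, inside \<open>rep_B3 n\<close>, of the image of the
  \<open>i\<close>-dimensional coordinate subspace. Letting \<open>i\<close> increase gives the
  chain that shows smoothness.\<close>

definition param_closure :: "nat \<Rightarrow> ((nat \<Rightarrow> complex) \<Rightarrow> rep) \<Rightarrow> ((nat \<Rightarrow> complex) \<Rightarrow> complex) \<Rightarrow> nat \<Rightarrow> rep set" where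
  "param_closure n \<phi> q i = {W \<in> rep_B3 n. \<forall>f\<in>poly_fun n. (\<forall>s\<in>param_set i q. f (\<phi> s) = 0) \<longrightarrow> f W = 0}"

lemma param_closure_in:
  assumes "rational_param n T \<phi> q" "s \<in> param_set i q"
  shows "\<phi> s \<in> param_closure n \<phi> q i"
  using assms by (auto simp: rational_param_def param_closure_def param_set_def)

text \<open>On the line from \<open>a\<close> to \<open>b\<close> the three conditions become
  nonzero polynomials in one variable, and their product has a point where it does not
  vanish.\<close>

lemma param_set_prime:
  assumes \<phi>: "rational_param n T \<phi> q" and f: "f \<in> poly_fun n" and g: "g \<in> poly_fun n"
    and a: "a \<in> param_set i q" "f (\<phi> a) \<noteq> 0" and b: "b \<in> param_set i q" "g (\<phi> b) \<noteq> 0"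
  obtains s where "s \<in> param_set i q" "f (\<phi> s) \<noteq> 0" "g (\<phi> s) \<noteq> 0"
proof -
  define l where "l y = (\<lambda>j. a j + y * (b j - a j))" for y
  have l01: "l 0 = a" "l 1 = b" by (auto simp: l_def)
  have q: "q \<in> polyfun (slots T)" using \<phi> by (simp add: rational_param_def)
  obtain pq where pq: "\<And>y. q (l y) = poly pq y" using polyfun_on_line[OF q, of a b] by (auto simp: l_def)
  obtain r1 h1 where h1: "h1 \<in> polyfun (slots T)" "\<And>s. q s \<noteq> 0 \<Longrightarrow> f (\<phi> s) * q s ^ r1 = h1 s"
    using rational_param_pullback[OF \<phi> f] by blast
  obtain r2 h2 where h2: "h2 \<in> polyfun (slots T)" "\<And>s. q s \<noteq> 0 \<Longrightarrow> g (\<phi> s) * q s ^ r2 = h2 s"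
    using rational_param_pullback[OF \<phi> g] by blast
  obtain p1 where p1: "\<And>y. h1 (l y) = poly p1 y" using polyfun_on_line[OF h1(1), of a b] by (auto simp: l_def)
  obtain p2 where p2: "\<And>y. h2 (l y) = poly p2 y" using polyfun_on_line[OF h2(1), of a b] by (auto simp: l_def)
  have qa: "q a \<noteq> 0" and qb: "q b \<noteq> 0" using a b by (auto simp: param_set_def)
  have "poly pq 0 \<noteq> 0" using pq[of 0] qa l01 by simp
  moreover have "poly p1 0 \<noteq> 0" using p1[of 0] h1(2)[OF qa] a(2) qa l01 by (metis no_zero_divisors power_not_zero)
  moreover have "poly p2 1 \<noteq> 0" using p2[of 1] h2(2)[OF qb] b(2) qb l01 by (metis no_zero_divisors power_not_zero)
  ultimately have "pq * p1 * p2 \<noteq> 0" by auto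
  then obtain y where y: "poly (pq * p1 * p2) y \<noteq> 0" using poly_all_0_iff_0 by blast
  then have qy: "q (l y) \<noteq> 0" and "h1 (l y) \<noteq> 0" "h2 (l y) \<noteq> 0" using pq p1 p2 by auto
  then have "f (\<phi> (l y)) \<noteq> 0" "g (\<phi> (l y)) \<noteq> 0" using h1(2)[OF qy] h2(2)[OF qy] by auto
  moreover have "l y \<in> param_set i q" using qy a(1) b(1) by (auto simp: param_set_def subparams_def l_def)
  ultimately show thesis using that by blast
qed

lemma param_closure_irreducible:
  assumes \<phi>: "rational_param n T \<phi> q"
  shows "irreducible_closed n (param_closure n \<phi> q i)"
  unfolding irreducible_closed_def
proof (intro conjI allI impI)
  show "zariski_closed n (param_closure n \<phi> q i)"
    unfolding zariski_closed_def param_closure_def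
    by (intro exI[of _ "{f \<in> poly_fun n. \<forall>s\<in>param_set i q. f (\<phi> s) = 0}"]) auto
  have "(\<lambda>_. 0) \<in> param_set i q" using \<phi> by (simp add: param_set_def subparams_def rational_param_def)
  then show "param_closure n \<phi> q i \<noteq> {}" using param_closure_in[OF \<phi>] by blast
  fix C D assume CD: "zariski_closed n C \<and> zariski_closed n D \<and> param_closure n \<phi> q i = C \<union> D"
  have sub: "param_closure n \<phi> q i \<subseteq> E" if E: "zariski_closed n E" "\<And>s. s \<in> param_set i q \<Longrightarrow> \<phi> s \<in> E" for E
  proof -
    obtain F where F: "F \<subseteq> poly_fun n" "E = {V \<in> rep_B3 n. \<forall>f\<in>F. f V = 0}"
      using E(1) unfolding zariski_closed_def by blast
    have "\<forall>f\<in>F. \<forall>s\<in>param_set i q. f (\<phi> s) = 0" using E(2) F(2) by auto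
    then show ?thesis using F by (auto simp: param_closure_def)
  qed
  have "(\<forall>s\<in>param_set i q. \<phi> s \<in> C) \<or> (\<forall>s\<in>param_set i q. \<phi> s \<in> D)"
  proof (rule ccontr)
    assume "\<not> ?thesis"
    then obtain a b where a: "a \<in> param_set i q" "\<phi> a \<notin> C" and b: "b \<in> param_set i q" "\<phi> b \<notin> D" by blast
    obtain F where F: "F \<subseteq> poly_fun n" "C = {V \<in> rep_B3 n. \<forall>f\<in>F. f V = 0}"
      using CD unfolding zariski_closed_def by blast
    obtain G where G: "G \<subseteq> poly_fun n" "D = {V \<in> rep_B3 n. \<forall>f\<in>G. f V = 0}"
      using CD unfolding zariski_closed_def by blast
    have "\<phi> a \<in> rep_B3 n" "\<phi> b \<in> rep_B3 n" using a b \<phi> by (auto simp: param_set_def rational_param_def)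
    then obtain f g where f: "f \<in> F" "f (\<phi> a) \<noteq> 0" and g: "g \<in> G" "g (\<phi> b) \<noteq> 0" using a b F G by auto
    have fg: "f \<in> poly_fun n" "g \<in> poly_fun n" using f g F G by blast+
    obtain s where s: "s \<in> param_set i q" "f (\<phi> s) \<noteq> 0" "g (\<phi> s) \<noteq> 0"
      by (rule param_set_prime[OF \<phi> fg a(1) f(2) b(1) g(2)])
    then have "\<phi> s \<in> C \<union> D" using param_closure_in[OF \<phi> s(1)] CD by simp
    then show False using s f(1) g(1) F(2) G(2) by auto
  qed
  then have "param_closure n \<phi> q i \<subseteq> C \<or> param_closure n \<phi> q i \<subseteq> D" using sub CD by blast
  then show "param_closure n \<phi> q i = C \<or> param_closure n \<phi> q i = D" using CD by blast
qed

text \<open>On \<open>i\<close> parameters the \<open>i + 1\<close> functions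
  \<open>t 0, ..., t i\<close> are algebraically dependent, by \<open>degree_count\<close>. With one
  more parameter free, their leading terms at the origin are independent coordinates, so the
  dependency \<open>f\<close> fails there: its lowest homogeneous part is nonzero in some
  direction.\<close>

lemma param_closure_strict:
  assumes \<phi>: "rational_param n T \<phi> q" and i: "i < T"
    and t: "\<And>j. j < T \<Longrightarrow> t j \<in> poly_fun n"
    and deriv: "\<And>s j. j < T \<Longrightarrow> ((\<lambda>y. t j (\<phi> (\<lambda>l. y * s l)) / y) \<longlongrightarrow> s j) (at 0)"
  shows "param_closure n \<phi> q i \<noteq> param_closure n \<phi> q (Suc i)"
proof -
  have q: "q \<in> polyfun (slots T)" and q0: "q (\<lambda>_. 0) \<noteq> 0" using \<phi> by (simp_all add: rational_param_def)
  have "\<forall>j. \<exists>r h C. j < T \<longrightarrow> of_degree i C h \<and> (\<forall>s. q s \<noteq> 0 \<longrightarrow> t j (\<phi> s) * q s ^ r = h s)"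
  proof
    fix j
    show "\<exists>r h C. j < T \<longrightarrow> of_degree i C h \<and> (\<forall>s. q s \<noteq> 0 \<longrightarrow> t j (\<phi> s) * q s ^ r = h s)"
    proof (cases "j < T")
      case True
      obtain r h where "h \<in> polyfun (slots T)" "\<forall>s. q s \<noteq> 0 \<longrightarrow> t j (\<phi> s) * q s ^ r = h s"
        using rational_param_pullback[OF \<phi> t[OF True]] by blast
      then show ?thesis using polyfun_of_degree by blast
    qed blast
  qed
  then obtain r h C0 where rh: "\<And>j. j < T \<Longrightarrow> of_degree i (C0 j) (h j)"
      "\<And>j s. j < T \<Longrightarrow> q s \<noteq> 0 \<Longrightarrow> t j (\<phi> s) * q s ^ r j = h j s" by metis
  obtain Cq where Cq: "of_degree i Cq q" using polyfun_of_degree[OF q] by blast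
  define R where "R = (\<Sum>j<T. r j)"
  define C where "C = (\<Sum>j<T. C0 j) + R * Cq"
  define H where "H j s = h j s * q s ^ (R - r j)" for j s
  have rR: "r j \<le> R" if "j < T" for j unfolding R_def using that by (intro member_le_sum) auto
  have H: "t j (\<phi> s) * q s ^ R = H j s" if "j < T" "q s \<noteq> 0" for j s
  proof -
    have "q s ^ R = q s ^ r j * q s ^ (R - r j)" using rR[OF that(1)] by (simp add: power_add[symmetric])
    then show ?thesis using rh(2)[OF that] by (simp add: H_def mult.assoc[symmetric])
  qed
  have H_deg: "of_degree i C (H j)" if "j < T" for j
  proof -
    have "C0 j \<le> (\<Sum>j<T. C0 j)" using that by (intro member_le_sum) auto
    then have "C0 j + (R - r j) * Cq \<le> C" unfolding C_def by (intro add_mono mult_right_mono) auto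
    moreover have "of_degree i (C0 j + (R - r j) * Cq) (H j)"
      unfolding H_def by (intro of_degree_mult rh(1) that of_degree_power Cq)
    ultimately show ?thesis by (rule of_degree_mono[rotated])
  qed
  have Q_deg: "of_degree i C (\<lambda>s. q s ^ R)"
    by (rule of_degree_mono[OF of_degree_power[OF Cq]]) (simp add: C_def)
  obtain k where k: "0 < k" "((i + 1) * (k * C) + 1) ^ i < k ^ (i + 1)" by (rule degree_count)
  define E where "E = PiE {..<Suc i} (\<lambda>_. {..<k})"
  have E: "finite E" by (simp add: E_def finite_PiE)
  define mon where "mon e W = (\<Prod>j<Suc i. t j W ^ e j)" for e W
  \<comment> \<open>Multiplying up to the same power of \<open>q s ^ R\<close> gives all products of
    powers one denominator, hence a uniform degree bound.\<close>
  define M where "M e s = (\<Prod>j<Suc i. H j s ^ e j * (q s ^ R) ^ (k - e j))" for e s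
  have M: "mon e (\<phi> s) * (q s ^ R) ^ (Suc i * k) = M e s" if "e \<in> E" "q s \<noteq> 0" for e s
  proof -
    have "(q s ^ R) ^ (Suc i * k) = (\<Prod>j<Suc i. (q s ^ R) ^ k)"
      unfolding prod_constant card_lessThan by (simp only: power_mult[symmetric] mult_ac)
    then have "mon e (\<phi> s) * (q s ^ R) ^ (Suc i * k) = (\<Prod>j<Suc i. t j (\<phi> s) ^ e j * (q s ^ R) ^ k)"
      by (simp only: prod.distrib mon_def)
    also have "\<dots> = M e s"
      unfolding M_def
    proof (rule prod.cong)
      fix j assume j: "j \<in> {..<Suc i}"
      then have "e j \<le> k" using that(1) by (auto simp: E_def PiE_iff intro: less_imp_le)
      then have "(q s ^ R) ^ k = (q s ^ R) ^ e j * (q s ^ R) ^ (k - e j)" by (simp only: power_add[symmetric] le_add_diff_inverse)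
      then show "t j (\<phi> s) ^ e j * (q s ^ R) ^ k = H j s ^ e j * (q s ^ R) ^ (k - e j)"
        using H[of j s] j i that(2) by (simp add: power_mult_distrib mult.assoc[symmetric] flip: H[of j s])
    qed simp
    finally show ?thesis .
  qed
  have M_deg: "of_degree i (Suc i * (k * C)) (M e)" if "e \<in> E" for e
    unfolding M_def
  proof (rule of_degree_prod)
    fix j assume j: "j < Suc i"
    then have "e j \<le> k" using that by (auto simp: E_def PiE_iff intro: less_imp_le)
    then have "e j * C + (k - e j) * C = k * C" by (simp add: add_mult_distrib[symmetric])
    then show "of_degree i (k * C) (\<lambda>s. H j s ^ e j * (q s ^ R) ^ (k - e j))"
      using of_degree_mult[OF of_degree_power[OF H_deg, of j "e j"] of_degree_power[OF Q_deg, of "k - e j"]] j i by simp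
  qed
  define G where "G = bounded_monomials i (Suc i * (k * C))"
  have "\<forall>e. \<exists>a. e \<in> E \<longrightarrow> (\<forall>s\<in>subparams i. M e s = (\<Sum>g\<in>G. a g * g s))"
    using M_deg unfolding of_degree_def combination_on_def G_def by blast
  then obtain a where a: "\<And>e s. e \<in> E \<Longrightarrow> s \<in> subparams i \<Longrightarrow> M e s = (\<Sum>g\<in>G. a e g * g s)" by metis
  have "card G < card E"
    using card_bounded_monomials[of i "Suc i * (k * C)"] k(2) by (simp add: G_def E_def card_PiE)
  then obtain c where c: "\<exists>e\<in>E. c e \<noteq> 0" "\<forall>g\<in>G. (\<Sum>e\<in>E. c e * a e g) = 0"
    using nontrivial_solution[of G E a] E by (auto simp: G_def)
  define f where "f W = (\<Sum>e\<in>E. c e * mon e W)" for W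
  have f_poly: "f \<in> poly_fun n"
    using t i unfolding f_def mon_def poly_fun_eq
    by (intro polyfun_sum polyfun.mult polyfun.const polyfun_prod polyfun_power) auto
  have f0: "f (\<phi> s) = 0" if s: "s \<in> param_set i q" for s
  proof -
    have qs: "q s \<noteq> 0" "s \<in> subparams i" using s by (auto simp: param_set_def)
    have "f (\<phi> s) * (q s ^ R) ^ (Suc i * k) = (\<Sum>e\<in>E. c e * M e s)"
      unfolding f_def sum_distrib_right using M qs by (intro sum.cong) (auto simp: mult.assoc)
    also have "\<dots> = (\<Sum>e\<in>E. \<Sum>g\<in>G. c e * a e g * g s)"
      using a qs by (simp add: sum_distrib_left mult.assoc)
    also have "\<dots> = (\<Sum>g\<in>G. (\<Sum>e\<in>E. c e * a e g) * g s)"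
      unfolding sum_distrib_right by (rule sum.swap)
    finally show ?thesis using c(2) qs(1) by simp
  qed
  define deg where "deg e = (\<Sum>j<Suc i. e j)" for e :: "nat \<Rightarrow> nat"
  \<comment> \<open>The lowest total degree occurring in \<open>f\<close> governs its behaviour at
    the origin, because each \<open>t j\<close> is asymptotic to its linear part.\<close>
  define d where "d = (LEAST d. \<exists>e\<in>E. c e \<noteq> 0 \<and> deg e = d)"
  have "\<exists>e\<in>E. c e \<noteq> 0 \<and> deg e = d" unfolding d_def by (rule LeastI_ex) (use c(1) in blast)
  then obtain e0 where e0: "e0 \<in> E" "c e0 \<noteq> 0" "deg e0 = d" by blast
  have d_le: "d \<le> deg e" if "e \<in> E" "c e \<noteq> 0" for e unfolding d_def using that by (intro Least_le) blast
  define c' where "c' e = (if deg e = d then c e else 0)" for e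
  \<comment> \<open>A direction involving only the first \<open>i + 1\<close> parameters in which
    the lowest homogeneous part of \<open>f\<close> does not vanish.\<close>
  obtain s where s: "(\<Sum>e\<in>E. c' e * (\<Prod>j<Suc i. s j ^ e j)) \<noteq> 0" "\<And>j. Suc i \<le> j \<Longrightarrow> s j = 0"
    using nonvanishing_point[of e0 "Suc i" k c'] e0 by (auto simp: E_def c'_def)
  have lim: "((\<lambda>y. f (\<phi> (\<lambda>l. y * s l)) / y ^ d) \<longlongrightarrow> (\<Sum>e\<in>E. c' e * (\<Prod>j<Suc i. s j ^ e j))) (at 0)"
  proof -
    have "((\<lambda>y. \<Sum>e\<in>E. c e * (y ^ (deg e - d) * (\<Prod>j<Suc i. (t j (\<phi> (\<lambda>l. y * s l)) / y) ^ e j)))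
        \<longlongrightarrow> (\<Sum>e\<in>E. c' e * (\<Prod>j<Suc i. s j ^ e j))) (at 0)"
    proof (rule tendsto_sum)
      fix e assume e: "e \<in> E"
      have P: "((\<lambda>y. \<Prod>j<Suc i. (t j (\<phi> (\<lambda>l. y * s l)) / y) ^ e j) \<longlongrightarrow> (\<Prod>j<Suc i. s j ^ e j)) (at 0)"
        using i by (intro tendsto_prod tendsto_power deriv) auto
      show "((\<lambda>y. c e * (y ^ (deg e - d) * (\<Prod>j<Suc i. (t j (\<phi> (\<lambda>l. y * s l)) / y) ^ e j)))
        \<longlongrightarrow> c' e * (\<Prod>j<Suc i. s j ^ e j)) (at 0)"
      proof (cases "c e = 0 \<or> deg e = d")
        case True
        then show ?thesis using P by (auto simp: c'_def intro!: tendsto_intros)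
      next
        case False
        then have "deg e - d > 0" using d_le[OF e] by auto
        then have "((\<lambda>y::complex. y ^ (deg e - d)) \<longlongrightarrow> 0) (at 0)"
          using tendsto_power[OF tendsto_ident_at[of "0::complex" UNIV], of "deg e - d"] by (simp add: power_0_left)
        from tendsto_mult[OF tendsto_const[of "c e"] tendsto_mult[OF this P]]
        show ?thesis using False by (simp add: c'_def)
      qed
    qed
    moreover have "\<forall>\<^sub>F y in at 0. (\<Sum>e\<in>E. c e * (y ^ (deg e - d) * (\<Prod>j<Suc i. (t j (\<phi> (\<lambda>l. y * s l)) / y) ^ e j)))
        = f (\<phi> (\<lambda>l. y * s l)) / y ^ d"
      unfolding eventually_at_filter
    proof (intro always_eventually allI impI)
      fix y :: complex assume y: "y \<noteq> 0"
      have "c e * (y ^ (deg e - d) * (\<Prod>j<Suc i. (t j (\<phi> (\<lambda>l. y * s l)) / y) ^ e j)) = c e * mon e (\<phi> (\<lambda>l. y * s l)) / y ^ d"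
        if e: "e \<in> E" for e
      proof (cases "c e = 0")
        case False
        have "(\<Prod>j<Suc i. (t j (\<phi> (\<lambda>l. y * s l)) / y) ^ e j) = mon e (\<phi> (\<lambda>l. y * s l)) / y ^ deg e"
          unfolding mon_def power_divide prod_dividef deg_def power_sum ..
        moreover have "y ^ deg e = y ^ (deg e - d) * y ^ d"
          using d_le[OF e False] by (simp add: power_add[symmetric])
        ultimately show ?thesis using y by simp
      qed simp
      then show "(\<Sum>e\<in>E. c e * (y ^ (deg e - d) * (\<Prod>j<Suc i. (t j (\<phi> (\<lambda>l. y * s l)) / y) ^ e j)))
        = f (\<phi> (\<lambda>l. y * s l)) / y ^ d"
        unfolding f_def sum_divide_distrib by (intro sum.cong) auto
    qed
    ultimately show ?thesis by (rule Lim_transform_eventually)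
  qed
  have "\<forall>\<^sub>F y in at 0. f (\<phi> (\<lambda>l. y * s l)) / y ^ d \<noteq> 0"
    by (rule tendsto_imp_eventually_ne[OF lim s(1)])
  moreover have "\<forall>\<^sub>F y in at 0. q (\<lambda>l. y * s l) \<noteq> 0"
    by (rule tendsto_imp_eventually_ne[OF polyfun_tendsto[OF q] q0])
  ultimately have "\<forall>\<^sub>F y in at (0::complex). f (\<phi> (\<lambda>l. y * s l)) / y ^ d \<noteq> 0 \<and> q (\<lambda>l. y * s l) \<noteq> 0"
    by (rule eventually_conj)
  then obtain y where y: "f (\<phi> (\<lambda>l. y * s l)) \<noteq> 0" "q (\<lambda>l. y * s l) \<noteq> 0"
    using eventually_happens[of _ "at (0::complex)"] by fastforce
  define s1 where "s1 = (\<lambda>l. y * s l)"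
  have "s1 \<in> param_set (Suc i) q" using y s(2) by (auto simp: s1_def param_set_def subparams_def)
  then have "\<phi> s1 \<in> param_closure n \<phi> q (Suc i)" by (rule param_closure_in[OF \<phi>])
  moreover have "\<phi> s1 \<notin> param_closure n \<phi> q i"
    using f_poly f0 y(1) by (auto simp: param_closure_def s1_def)
  ultimately show ?thesis by blast
qed

text \<open>Functionals dual to the tangent basis, applied to the displacement, are polynomials
  \<open>t j\<close> with derivative \<open>s j\<close> along \<open>s\<close>. The closures then
  form a strict chain whose length is the dimension of the tangent space.\<close>

lemma smooth_at_param:
  assumes V: "V \<in> rep_B3 n" and u: "tangent_basis n V u"
    and \<phi>: "rational_param n (tangent_dim n V) \<phi> q" and \<phi>0: "\<phi> (\<lambda>_. 0) = V"
    and deriv: "\<And>s x. x \<in> coords n \<Longrightarrow> ((\<lambda>y. (crd x (\<phi> (\<lambda>l. y * s l)) - crd x V) / y)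
      \<longlongrightarrow> (\<Sum>l<tangent_dim n V. s l * u l x)) (at 0)"
  shows "smooth_at n V"
proof -
  define T where "T = tangent_dim n V"
  have supp: "u l x = 0" if "l < T" "x \<notin> coords n" for l x
    using tangent_basisD(1)[OF u] that unfolding tangents_def T_def by blast
  obtain \<eta> where \<eta>: "\<And>j l. j < T \<Longrightarrow> l < T \<Longrightarrow> (\<Sum>x\<in>coords n. \<eta> j x * u l x) = (if j = l then 1 else 0)"
    using dual_functionals[OF finite_coords supp tangent_basisD(2)[OF u, folded T_def]] by blast
  define t where "t j W = (\<Sum>x\<in>coords n. \<eta> j x * (crd x W - crd x V))" for j W
  have t_poly: "t j \<in> poly_fun n" for j
    unfolding t_def poly_fun_eq by (intro polyfun_sum polyfun.mult polyfun_diff polyfun.const polyfun.gen imageI)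
  have t_deriv: "((\<lambda>y. t j (\<phi> (\<lambda>l. y * s l)) / y) \<longlongrightarrow> s j) (at 0)" if "j < T" for s j
  proof -
    have "((\<lambda>y. \<Sum>x\<in>coords n. \<eta> j x * ((crd x (\<phi> (\<lambda>l. y * s l)) - crd x V) / y)) \<longlongrightarrow>
        (\<Sum>x\<in>coords n. \<eta> j x * (\<Sum>l<T. s l * u l x))) (at 0)"
      unfolding T_def by (intro tendsto_sum tendsto_mult tendsto_const deriv)
    moreover have "(\<Sum>x\<in>coords n. \<eta> j x * (\<Sum>l<T. s l * u l x)) = (\<Sum>l<T. s l * (\<Sum>x\<in>coords n. \<eta> j x * u l x))"
      unfolding sum_distrib_left by (subst sum.swap) (simp add: mult_ac)
    moreover have "\<dots> = (\<Sum>l<T. if l = j then s j else 0)"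
      using \<eta>[OF that] by (intro sum.cong) auto
    moreover have "\<dots> = s j" using that by simp
    ultimately show ?thesis by (simp add: t_def sum_divide_distrib)
  qed
  have "closed_chain n V T (param_closure n \<phi> q)"
    unfolding closed_chain_def
  proof (intro conjI allI impI)
    fix i assume "i \<le> T"
    show "irreducible_closed n (param_closure n \<phi> q i)" by (rule param_closure_irreducible[OF \<phi>])
    have "(\<lambda>_. 0) \<in> param_set i q" using \<phi> by (simp add: param_set_def subparams_def rational_param_def)
    from param_closure_in[OF \<phi> this] show "V \<in> param_closure n \<phi> q i" by (simp add: \<phi>0)
  next
    fix i assume i: "i < T"
    have "param_set i q \<subseteq> param_set (Suc i) q" by (auto simp: param_set_def subparams_def)
    then have "param_closure n \<phi> q i \<subseteq> param_closure n \<phi> q (Suc i)" unfolding param_closure_def by blast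
    moreover have "param_closure n \<phi> q i \<noteq> param_closure n \<phi> q (Suc i)"
      using \<phi> i t_poly t_deriv unfolding T_def by (rule param_closure_strict)
    ultimately show "param_closure n \<phi> q i \<subset> param_closure n \<phi> q (Suc i)" by blast
  qed
  then show ?thesis unfolding T_def by (rule smooth_atI[OF V])
qed

section \<open>Deformations\<close>

lemma idm_square [simp]:
  "X \<in> shp n n \<Longrightarrow> idm n * X = X" "X \<in> shp n n \<Longrightarrow> X * idm n = X"
  by simp_all

section \<open>Adjugates of polynomial matrix families\<close>

definition fdet :: "nat \<Rightarrow> fmat \<Rightarrow> complex" where "fdet n X = det (tomat n n X)"

definition fadj :: "nat \<Rightarrow> fmat \<Rightarrow> fmat" where "fadj n X = emb (adj_mat (tomat n n X))"

lemma fadj_shp [simp]: "fadj n X \<in> shp n n"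
  unfolding fadj_def by (rule emb_shp, rule adj_mat(1), simp)

lemma fadj_mult:
  assumes "X \<in> shp n n"
  shows "X * fadj n X = sc (fdet n X) (idm n)" "fadj n X * X = sc (fdet n X) (idm n)"
proof -
  have c: "tomat n n X \<in> carrier_mat n n" "adj_mat (tomat n n X) \<in> carrier_mat n n"
    by (simp_all add: adj_mat(1)[of _ n])
  show "X * fadj n X = sc (fdet n X) (idm n)" "fadj n X * X = sc (fdet n X) (idm n)"
    using arg_cong[OF adj_mat(2)[OF c(1)], of emb] arg_cong[OF adj_mat(3)[OF c(1)], of emb]
    by (simp_all add: emb_mult[OF c] emb_mult[OF c(2,1)] emb_tomat[OF assms] emb_smult emb_one fadj_def fdet_def)
qed

lemma fdet_idm: "fdet n (idm n) = 1"
  unfolding fdet_def using tomat_emb[of "1\<^sub>m n" n n] by (simp add: emb_one)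

lemma fadj_idm: "fadj n (idm n) = idm n"
  using fadj_mult(1)[of "idm n" n] by (simp add: fdet_idm sc_simps)

definition fpoly :: "nat \<Rightarrow> nat \<Rightarrow> ((nat \<Rightarrow> complex) \<Rightarrow> fmat) \<Rightarrow> bool" where
  "fpoly n T F \<longleftrightarrow> (\<forall>s. F s \<in> shp n n) \<and> (\<forall>i j. (\<lambda>s. ent (F s) i j) \<in> polyfun (slots T))"

lemma fpolyD:
  assumes "fpoly n T F"
  shows "F s \<in> shp n n" "(\<lambda>s. ent (F s) i j) \<in> polyfun (slots T)"
  using assms unfolding fpoly_def by blast+

lemma fpolyI:
  assumes "\<And>s. F s \<in> shp n n" "\<And>i j. (\<lambda>s. ent (F s) i j) \<in> polyfun (slots T)"
  shows "fpoly n T F"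
  unfolding fpoly_def using assms by simp

lemma fpoly_mult:
  assumes F: "fpoly n T F" and G: "fpoly n T G"
  shows "fpoly n T (\<lambda>s. F s * G s)"
proof (rule fpolyI)
  show "F s * G s \<in> shp n n" for s by (rule shp_mult[OF fpolyD(1)[OF F] fpolyD(1)[OF G]])
  show "(\<lambda>s. ent (F s * G s) i j) \<in> polyfun (slots T)" for i j
    unfolding ent_mult[OF fpolyD(1)[OF F]]
    by (intro polyfun_sum polyfun.mult fpolyD(2)[OF F] fpolyD(2)[OF G])
qed

lemma fpoly_add: "fpoly n T F \<Longrightarrow> fpoly n T G \<Longrightarrow> fpoly n T (\<lambda>s. F s + G s)"
  by (rule fpolyI) (auto intro: fpolyD polyfun.add)

lemma fpoly_const: "M \<in> shp n n \<Longrightarrow> fpoly n T (\<lambda>_. M)"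
  by (rule fpolyI) (auto intro: polyfun.const)

lemma fpoly_linear:
  assumes "\<And>j. j < T \<Longrightarrow> G j \<in> shp n n"
  shows "fpoly n T (\<lambda>s. \<Sum>j<T. sc (s j) (G j))"
proof (rule fpolyI)
  show "(\<Sum>j<T. sc (s j) (G j)) \<in> shp n n" for s by (rule shp_sum) (simp add: assms)
  have "(\<lambda>s. s j) \<in> polyfun (slots T)" if "j < T" for j
    using that by (intro polyfun.gen) (auto simp: slots_def)
  then show "(\<lambda>s. ent (\<Sum>j<T. sc (s j) (G j)) i j) \<in> polyfun (slots T)" for i j
    unfolding ent_sum ent_simps by (intro polyfun_sum polyfun.mult polyfun.const) auto
qed

lemma polyfun_det:
  assumes "\<And>s. F s \<in> carrier_mat m m"
    and "\<And>i j. i < m \<Longrightarrow> j < m \<Longrightarrow> (\<lambda>s. F s $$ (i, j)) \<in> polyfun X"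
  shows "(\<lambda>s. det (F s)) \<in> polyfun X"
  unfolding det_def'[OF assms(1)]
proof (intro polyfun_sum polyfun.mult polyfun.const polyfun_prod)
  fix p i assume "p \<in> {p. p permutes {0..<m}}" "i \<in> {0..<m}"
  then have "i < m" "p i < m" using permutes_in_image[of p "{0..<m}" i] by auto
  then show "(\<lambda>s. F s $$ (i, p i)) \<in> polyfun X" by (rule assms(2))
qed

lemma polyfun_fdet:
  assumes "fpoly n T F"
  shows "(\<lambda>s. fdet n (F s)) \<in> polyfun (slots T)"
  unfolding fdet_def by (rule polyfun_det[of _ n]) (auto simp: tomat_def intro: fpolyD[OF assms])

lemma fpoly_fadj:
  assumes F: "fpoly n T F"
  shows "fpoly n T (\<lambda>s. fadj n (F s))"
proof (rule fpolyI)
  fix i j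
  show "(\<lambda>s. ent (fadj n (F s)) i j) \<in> polyfun (slots T)"
  proof (cases "i < n \<and> j < n")
    case False
    then have "ent (fadj n (F s)) i j = 0" for s by (rule ent_shp[OF fadj_shp])
    then show ?thesis using polyfun.const[of 0] by simp
  next
    case True
    have *: "ent (fadj n (F s)) i j = (- 1) ^ (j + i) * det (mat_delete (tomat n n (F s)) j i)" for s
      using True adj_mat(1)[of "tomat n n (F s)" n]
      by (simp add: fadj_def ent_emb[of _ n n]) (simp add: adj_mat_def cofactor_def tomat_def)
    have "(\<lambda>s. det (mat_delete (tomat n n (F s)) j i)) \<in> polyfun (slots T)"
    proof (rule polyfun_det[of _ "n - 1"])
      show "mat_delete (tomat n n (F s)) j i \<in> carrier_mat (n - 1) (n - 1)" for s
        by (simp add: mat_delete_def tomat_def)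
      fix a b assume "a < n - 1" "b < n - 1"
      then have "mat_delete (tomat n n (F s)) j i $$ (a, b) =
          ent (F s) (if a < j then a else Suc a) (if b < i then b else Suc b)" for s
        by (auto simp: mat_delete_def tomat_def)
      then show "(\<lambda>s. mat_delete (tomat n n (F s)) j i $$ (a, b)) \<in> polyfun (slots T)"
        using fpolyD(2)[OF F] by simp
    qed
    then show ?thesis unfolding * by (intro polyfun.mult polyfun.const)
  qed
qed simp

section \<open>Entrywise limits and difference quotients\<close>

definition flim :: "(complex \<Rightarrow> fmat) \<Rightarrow> fmat \<Rightarrow> bool" where
  "flim F L \<longleftrightarrow> (\<forall>i j. ((\<lambda>y. ent (F y) i j) \<longlongrightarrow> ent L i j) (at 0))"

lemma flim_const: "flim (\<lambda>_. L) L"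
  by (simp add: flim_def)

lemma flim_add: "flim F L \<Longrightarrow> flim G M \<Longrightarrow> flim (\<lambda>y. F y + G y) (L + M)"
  by (auto simp: flim_def intro!: tendsto_add)

lemma flim_diff: "flim F L \<Longrightarrow> flim G M \<Longrightarrow> flim (\<lambda>y. F y - G y) (L - M)"
  by (auto simp: flim_def intro!: tendsto_diff)

lemma flim_sc: "(c \<longlongrightarrow> d) (at 0) \<Longrightarrow> flim F L \<Longrightarrow> flim (\<lambda>y. sc (c y) (F y)) (sc d L)"
  by (auto simp: flim_def intro!: tendsto_mult)

lemma flim_mult:
  assumes "flim F L" "flim G M" "\<And>y. F y \<in> shp n n" "L \<in> shp n n"
  shows "flim (\<lambda>y. F y * G y) (L * M)"
  using assms(1,2) unfolding flim_def ent_mult[OF assms(3)] ent_mult[OF assms(4)]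
  by (intro allI tendsto_sum tendsto_mult) auto

lemma flim_fpoly:
  assumes "fpoly n T F"
  shows "flim (\<lambda>y. F (\<lambda>j. y * s j)) (F (\<lambda>_. 0))"
  unfolding flim_def using polyfun_tendsto[OF fpolyD(2)[OF assms]] by blast

text \<open>A polynomial numerator over the determinant, so inverses of polynomial families are
  rational. When the determinant is zero, the value is the zero matrix.\<close>

definition finv :: "nat \<Rightarrow> fmat \<Rightarrow> fmat" where
  "finv n X = sc (1 / fdet n X) (fadj n X)"

lemma finv_shp [simp]: "finv n X \<in> shp n n"
  by (simp add: finv_def)

lemma finv_mult:
  assumes "X \<in> shp n n" "fdet n X \<noteq> 0"
  shows "X * finv n X = idm n" "finv n X * X = idm n"
  using assms by (simp_all add: finv_def sc_simps fadj_mult)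

lemma finv_idm: "finv n (idm n) = idm n"
  by (simp add: finv_def fadj_idm fdet_idm sc_simps)

lemma finv_commute:
  assumes "X \<in> shp n n" "fdet n X \<noteq> 0" "P \<in> shp n n" "P * X = X * P"
  shows "P * finv n X = finv n X * P"
proof -
  have "finv n X * (P * X) * finv n X = finv n X * (X * P) * finv n X" by (simp add: assms(4))
  then have "(finv n X * P) * (X * finv n X) = (finv n X * X) * (P * finv n X)" by (simp only: mult.assoc)
  moreover have "finv n X * P \<in> shp n n" "P * finv n X \<in> shp n n" 
    by (intro shp_mult[of _ n n _ n] finv_shp assms(3))+
  ultimately show ?thesis using finv_mult[OF assms(1,2)] by simp
qed

lemma flim_finv:
  assumes F: "fpoly n T F" "F (\<lambda>_. 0) = idm n"
  shows "flim (\<lambda>y. finv n (F (\<lambda>j. y * s j))) (idm n)"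
proof -
  have "((\<lambda>y. fdet n (F (\<lambda>j. y * s j))) \<longlongrightarrow> fdet n (F (\<lambda>_. 0))) (at 0)"
    by (rule polyfun_tendsto[OF polyfun_fdet[OF F(1)]])
  then have "((\<lambda>y. 1 / fdet n (F (\<lambda>j. y * s j))) \<longlongrightarrow> 1 / 1) (at 0)"
    by (intro tendsto_divide tendsto_const) (simp_all add: F(2) fdet_idm)
  from flim_sc[OF this flim_fpoly[OF fpoly_fadj[OF F(1)], of s]]
  show ?thesis by (simp add: finv_def F(2) fadj_idm sc_simps)
qed

text \<open>The limit is the sum of two commutators and the derivative of the scaling factor.
  \<open>g'\<close> and \<open>h'\<close> stand for the inverses of \<open>1 + y G\<close> and
  \<open>1 + y H\<close>, which exist only near the origin, hence the eventual hypothesis.\<close>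

lemma conjugation_derivative:
  assumes a: "a \<in> shp n n" and G: "G \<in> shp n n" and H: "H \<in> shp n n"
    and D: "flim D D0" "\<And>y. D y \<in> shp n n" "D0 \<in> shp n n"
    and g': "flim g' (idm n)" "\<And>y. g' y \<in> shp n n" and h': "flim h' (idm n)" "\<And>y. h' y \<in> shp n n"
    and inv: "\<forall>\<^sub>F y in at 0. (idm n + sc y G) * g' y = idm n \<and> (idm n + sc y H) * h' y = idm n"
  shows "flim (\<lambda>y. sc (1 / y) ((idm n + sc y G) * ((idm n + sc y (D y)) * ((idm n + sc y H) * a * h' y)) * g' y - a))
    (G * a - a * G + D0 * a + (H * a - a * H))"
proof -
  note S = shp_mult[of _ n n _ n]
  define b where "b y = (idm n + sc y H) * a * h' y" for y
  define Z where "Z y = (idm n + sc y (D y)) * b y" for y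
  have y0: "((\<lambda>y::complex. y) \<longlongrightarrow> 0) (at 0)" by (rule tendsto_ident_at)
  have I: "flim (\<lambda>y. idm n + sc y M) (idm n)" if "M \<in> shp n n" for M
    using flim_add[OF flim_const[of "idm n"] flim_sc[OF y0 flim_const[of M]]] by (simp add: sc_simps)
  have shb: "b y \<in> shp n n" for y unfolding b_def by (intro S shp_simps a H h')
  have shZ: "Z y \<in> shp n n" for y unfolding Z_def by (intro S shp_simps shb D)
  have lb: "flim b a"
  proof -
    have "flim (\<lambda>y. (idm n + sc y H) * a) (idm n * a)"
      by (rule flim_mult[OF I[OF H] flim_const, of n]) (intro shp_simps a H)+
    from flim_mult[OF this h'(1), of n] show ?thesis unfolding b_def using a H by (simp add: S)
  qed
  have lID: "flim (\<lambda>y. idm n + sc y (D y)) (idm n)"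
    using flim_add[OF flim_const[of "idm n"] flim_sc[OF y0 D(1)]] by (simp add: sc_simps)
  have lZ: "flim Z a"
    using flim_mult[OF lID lb, of n] unfolding Z_def using a D by simp
  have lim: "flim (\<lambda>y. (D y * b y + (H * a - a * H) * h' y + (G * Z y - a * G)) * g' y)
      ((D0 * a + (H * a - a * H) * idm n + (G * a - a * G)) * idm n)"
    by (intro flim_mult[of _ _ _ _ n] flim_add flim_diff flim_const D lb h' lZ g' shp_simps S a H G shb shZ)
  \<comment> \<open>The difference quotient is rewritten without the factor \<open>1 / y\<close>;
    only continuity of the inverses at the origin is then needed, not their derivatives.\<close>
  have eq: "(D y * b y + (H * a - a * H) * h' y + (G * Z y - a * G)) * g' y =
      sc (1 / y) ((idm n + sc y G) * Z y * g' y - a)"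
    if y: "y \<noteq> 0" and i: "(idm n + sc y G) * g' y = idm n" "(idm n + sc y H) * h' y = idm n" for y
  proof -
    have "sc y (D y * b y) = Z y - b y" unfolding Z_def using shb by (simp add: distrib_right sc_simps)
    moreover have "sc y ((H * a - a * H) * h' y) = b y - a"
    proof -
      have "b y - a = (idm n + sc y H) * a * h' y - a * ((idm n + sc y H) * h' y)" using a by (simp add: b_def i)
      also have "\<dots> = sc y ((H * a - a * H) * h' y)"
        using a h'(2)[of y] S[OF a h'(2)[of y]]
        by (simp add: distrib_left distrib_right left_diff_distrib right_diff_distrib sc_simps mult.assoc)
      finally show ?thesis by simp
    qed
    moreover have "sc y (G * Z y - a * G) = (idm n + sc y G) * Z y - a * (idm n + sc y G) - (Z y - a)"
      using a shZ[of y] by (simp add: distrib_left distrib_right sc_simps)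
    ultimately have "sc y (D y * b y + (H * a - a * H) * h' y + (G * Z y - a * G)) =
        (idm n + sc y G) * Z y - a * (idm n + sc y G)"
      unfolding sc_simps(4) by simp
    then have "sc y ((D y * b y + (H * a - a * H) * h' y + (G * Z y - a * G)) * g' y) =
        ((idm n + sc y G) * Z y - a * (idm n + sc y G)) * g' y"
      by (simp only: sc_simps(1)[symmetric])
    also have "\<dots> = (idm n + sc y G) * Z y * g' y - a * ((idm n + sc y G) * g' y)"
      by (simp only: left_diff_distrib mult.assoc)
    also have "\<dots> = (idm n + sc y G) * Z y * g' y - a" using a by (simp add: i)
    finally show ?thesis by (rule sc_inverse[OF y])
  qed
  have "\<forall>\<^sub>F y in at 0. (D y * b y + (H * a - a * H) * h' y + (G * Z y - a * G)) * g' y =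
      sc (1 / y) ((idm n + sc y G) * Z y * g' y - a)"
    using inv eventually_neq_at_within[of 0 0 UNIV] by eventually_elim (auto intro: eq)
  then have ev: "\<forall>\<^sub>F y in at 0. ent ((D y * b y + (H * a - a * H) * h' y + (G * Z y - a * G)) * g' y) i j =
      ent (sc (1 / y) ((idm n + sc y G) * Z y * g' y - a)) i j" for i j
    by eventually_elim simp
  have "flim (\<lambda>y. sc (1 / y) ((idm n + sc y G) * Z y * g' y - a))
      ((D0 * a + (H * a - a * H) * idm n + (G * a - a * G)) * idm n)"
    using lim ev unfolding flim_def by (blast intro: Lim_transform_eventually)
  moreover have "(D0 * a + (H * a - a * H) * idm n + (G * a - a * G)) * idm n =
      G * a - a * G + D0 * a + (H * a - a * H)"
    using a G H D(3) by (simp add: S algebra_simps)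
  ultimately show ?thesis by (simp add: Z_def b_def)
qed

lemma invertible_matI:
  assumes "A \<in> carrier_mat n n" "Y \<in> shp n n" "emb A * Y = idm n" "Y * emb A = idm n"
  shows "invertible_mat A"
proof -
  have c: "A * tomat n n Y \<in> carrier_mat n n" "tomat n n Y * A \<in> carrier_mat n n"
    by (intro mult_carrier_mat[of _ n n _ n] tomat_carrier assms(1))+
  have "A * tomat n n Y = 1\<^sub>m n" "tomat n n Y * A = 1\<^sub>m n"
    using assms by (intro emb_inj[of _ n n] c; simp add: emb_mult[of _ n n _ n] emb_tomat emb_one)+
  then show ?thesis using assms(1)
    unfolding invertible_mat_def inverts_mat_def by (intro conjI exI[of _ "tomat n n Y"]) (auto simp: carrier_matD[OF tomat_carrier])
qed

lemma invertible_matD: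
  assumes "A \<in> carrier_mat n n" "invertible_mat A"
  obtains Y where "Y \<in> shp n n" "emb A * Y = idm n" "Y * emb A = idm n"
proof -
  obtain B where B: "A * B = 1\<^sub>m n" "B * A = 1\<^sub>m (dim_row B)"
    using assms unfolding invertible_mat_def inverts_mat_def by auto
  have "dim_col B = n" using arg_cong[OF B(1), of dim_col] by simp
  moreover have "dim_row B = n" using arg_cong[OF B(2), of dim_col] assms(1) by simp
  ultimately have c: "B \<in> carrier_mat n n" by auto
  then have "emb A * emb B = idm n" "emb B * emb A = idm n"
    using arg_cong[OF B(1), of emb] arg_cong[OF B(2), of emb] assms(1)
    by (auto simp: emb_mult[of _ n n _ n] emb_one)
  then show thesis using that emb_shp[OF c] by blast
qed

definition invf :: "nat \<Rightarrow> fmat \<Rightarrow> bool" where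
  "invf n X \<longleftrightarrow> X \<in> shp n n \<and> (\<exists>Y\<in>shp n n. X * Y = idm n \<and> Y * X = idm n)"

lemma invf_mult:
  assumes "invf n X" "invf n Y"
  shows "invf n (X * Y)"
proof -
  obtain X' Y' where *: "X \<in> shp n n" "Y \<in> shp n n" "X' \<in> shp n n" "X * X' = idm n" "X' * X = idm n"
      "Y' \<in> shp n n" "Y * Y' = idm n" "Y' * Y = idm n" using assms unfolding invf_def by blast
  have "(X * Y) * (Y' * X') = X * (Y * Y') * X'" "(Y' * X') * (X * Y) = Y' * (X' * X) * Y"
    by (simp_all only: mult.assoc)
  then have "(X * Y) * (Y' * X') = idm n" "(Y' * X') * (X * Y) = idm n" using * by simp_all
  then show ?thesis unfolding invf_def using * by (intro conjI bexI[of _ "Y' * X'"]) (auto intro: shp_mult)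
qed

lemma invf_finv:
  assumes "X \<in> shp n n" "fdet n X \<noteq> 0"
  shows "invf n X" "invf n (finv n X)"
  using assms finv_mult[OF assms] unfolding invf_def by (auto intro: finv_shp)

lemma invf_tomat:
  assumes "invf n X"
  shows "invertible_mat (tomat n n X)"
proof -
  obtain Y where "X \<in> shp n n" "Y \<in> shp n n" "X * Y = idm n" "Y * X = idm n"
    using assms unfolding invf_def by blast
  then show ?thesis by (intro invertible_matI[of _ n Y]) (simp_all add: emb_tomat)
qed

text \<open>
  The deformation \<open>(g (1 + M)\<^sup>3 h A h\<^sup>-\<^sup>1 g\<^sup>-\<^sup>1, g (1 + M)\<^sup>2 k B k\<^sup>-\<^sup>1 g\<^sup>-\<^sup>1)\<close> of \<open>(A, B)\<close> with \<open>g = 1 + G\<close>,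
  \<open>h = 1 + H\<close>, \<open>k = 1 + K\<close> stays inside the representation variety because \<open>h\<close> and \<open>k\<close>
  commute with \<open>A\<^sup>2 = B\<^sup>3\<close> and \<open>M\<close> commutes with everything else.
\<close>

lemma smooth_at_deformations:
  assumes V: "V \<in> rep_B3 n"
  defines "A \<equiv> emb (fst V)" and "B \<equiv> emb (snd V)"
  assumes \<M>: "\<And>M. M \<in> \<M> \<Longrightarrow> M \<in> shp n n \<and> M * A = A * M \<and> M * B = B * M"
    and \<H>: "\<And>H. H \<in> \<H> \<Longrightarrow> H \<in> shp n n \<and> H * (A * A) = (A * A) * H"
    and comm: "\<And>M H. M \<in> \<M> \<Longrightarrow> H \<in> \<H> \<Longrightarrow> M * H = H * M"
    and tangent: "\<And>u. u \<in> tangents n V \<Longrightarrow> \<exists>G M H K. G \<in> shp n n \<and> M \<in> \<M> \<and> H \<in> \<H> \<and> K \<in> \<H> \<and>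
      fX n u = G * A - A * G + sc 3 (M * A) + (H * A - A * H) \<and>
      fY n u = G * B - B * G + sc 2 (M * B) + (K * B - B * K)"
  shows "smooth_at n V"
proof -
  define T where "T = tangent_dim n V"
  have AB: "A \<in> shp n n" "B \<in> shp n n" "A * A = B * B * B" "fst V \<in> carrier_mat n n" "snd V \<in> carrier_mat n n"
    using rep_B3D[OF V] by (simp_all add: A_def B_def)
  have w: "\<exists>w. tangents n V \<noteq> {\<lambda>_. 0} \<longrightarrow> w \<in> tangents n V \<and> w \<noteq> (\<lambda>_. 0)"
    using tangents_0[of n V] by blast
  then obtain w where w: "tangents n V \<noteq> {\<lambda>_. 0} \<Longrightarrow> w \<in> tangents n V \<and> w \<noteq> (\<lambda>_. 0)" by blast
  obtain u where u: "tangent_basis n V u" using tangent_basis_exists[OF V w] by blast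
  have "\<forall>l. \<exists>G M H K. l < T \<longrightarrow> G \<in> shp n n \<and> M \<in> \<M> \<and> H \<in> \<H> \<and> K \<in> \<H> \<and>
      fX n (u l) = G * A - A * G + sc 3 (M * A) + (H * A - A * H) \<and>
      fY n (u l) = G * B - B * G + sc 2 (M * B) + (K * B - B * K)"
    using tangent tangent_basisD(1)[OF u] unfolding T_def by blast
  then obtain G M H K where GMHK: "\<forall>l. l < T \<longrightarrow> G l \<in> shp n n \<and> M l \<in> \<M> \<and> H l \<in> \<H> \<and> K l \<in> \<H> \<and>
      fX n (u l) = G l * A - A * G l + sc 3 (M l * A) + (H l * A - A * H l) \<and>
      fY n (u l) = G l * B - B * G l + sc 2 (M l * B) + (K l * B - B * K l)"
    by metis
  define lc where "lc X s = (\<Sum>l<T. sc (s l) (X l))" for X :: "nat \<Rightarrow> fmat" and s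
  define P where "P X s = idm n + lc X s" for X s
  have shps: "G l \<in> shp n n" "M l \<in> shp n n" "H l \<in> shp n n" "K l \<in> shp n n" if "l < T" for l
    using GMHK \<M> \<H> that by blast+
  have lc_poly: "fpoly n T (lc G)" "fpoly n T (lc M)" "fpoly n T (lc H)" "fpoly n T (lc K)"
    unfolding lc_def[abs_def] by (intro fpoly_linear shps; assumption)+
  have P_poly: "fpoly n T (P G)" "fpoly n T (P M)" "fpoly n T (P H)" "fpoly n T (P K)"
    unfolding P_def[abs_def] by (intro fpoly_add fpoly_const lc_poly; simp)+
  have lc0: "lc X (\<lambda>_. 0) = 0" for X by (simp add: lc_def sc_simps)
  have P0: "P X (\<lambda>_. 0) = idm n" for X by (simp add: P_def lc0)
  have lc_y: "lc X (\<lambda>j. y * s j) = sc y (lc X s)" for X y s by (simp add: lc_def sc_sum sc_simps)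
  note lc_shp = lc_poly[THEN fpolyD(1)] and P_shp = P_poly[THEN fpolyD(1)]
  have lc_comm: "lc X s * Y = Y * lc X s" if "\<And>l. l < T \<Longrightarrow> X l * Y = Y * X l" for X s Y
    using that by (simp add: lc_def sum_distrib_left sum_distrib_right sc_simps)
  have P_comm: "P X s * Y = Y * P X s" if "\<And>l. l < T \<Longrightarrow> X l * Y = Y * X l" "Y \<in> shp n n" for X s Y
    using lc_comm[of X Y s, OF that(1)] that(2) by (simp add: P_def distrib_left distrib_right)
  have MA: "P M s * A = A * P M s" "P M s * B = B * P M s" for s
    using GMHK \<M> AB by (auto intro!: P_comm)
  have MH: "P M s * P H s' = P H s' * P M s" "P M s * P K s' = P K s' * P M s" for s s'
  proof -
    have "M l * P H s' = P H s' * M l" "M l * P K s' = P K s' * M l" if "l < T" for l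
      using P_comm[of H "M l" s'] P_comm[of K "M l" s'] GMHK comm shps that by metis+
    then show "P M s * P H s' = P H s' * P M s" "P M s * P K s' = P K s' * P M s"
      using P_shp by (auto intro!: P_comm)
  qed
  have HC: "P H s * (A * A) = A * A * P H s" "P K s * (A * A) = A * A * P K s" for s
    using GMHK \<H> AB by (auto intro!: P_comm shp_mult)
  \<comment> \<open>The determinants of \<open>g\<close>, \<open>h\<close> and \<open>k\<close> are
    needed for the inverses, that of \<open>1 + M\<close> for the invertibility of the deformed
    matrices.\<close>
  define q where "q s = fdet n (P G s) * fdet n (P H s) * fdet n (P K s) * fdet n (P M s)" for s
  have q: "q \<in> polyfun (slots T)"
    unfolding q_def by (intro polyfun.mult polyfun_fdet P_poly)
  have q0: "q (\<lambda>_. 0) \<noteq> 0" by (simp add: q_def P0 fdet_idm)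
  define FA where "FA s = P G s * (P M s * P M s * P M s * (P H s * A * finv n (P H s))) * finv n (P G s)" for s
  define FB where "FB s = P G s * (P M s * P M s * (P K s * B * finv n (P K s))) * finv n (P G s)" for s
  note S = shp_mult[of _ n n _ n]
  have F_shp: "FA s \<in> shp n n" "FB s \<in> shp n n" for s
    unfolding FA_def FB_def by (intro S P_shp AB finv_shp)+
  define \<phi> where "\<phi> s = (tomat n n (FA s), tomat n n (FB s))" for s
  have "invf n A" "invf n B"
  proof -
    have "invertible_mat (fst V)" "invertible_mat (snd V)" using V by (auto simp: rep_B3_def GL_def)
    then show "invf n A" "invf n B" using invertible_matD[OF AB(4)] invertible_matD[OF AB(5)] AB(1,2)
      unfolding invf_def A_def B_def by metis+
  qed
  have rep: "\<phi> s \<in> rep_B3 n" if "q s \<noteq> 0" for s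
  proof -
    have d: "fdet n (P G s) \<noteq> 0" "fdet n (P H s) \<noteq> 0" "fdet n (P K s) \<noteq> 0" "fdet n (P M s) \<noteq> 0"
      using that by (auto simp: q_def)
    define g where "g = P G s"
    define h where "h = P H s"
    define k where "k = P K s"
    define m where "m = P M s"
    define g' where "g' = finv n g"
    define h' where "h' = finv n h"
    define k' where "k' = finv n k"
    have sh: "g \<in> shp n n" "h \<in> shp n n" "k \<in> shp n n" "m \<in> shp n n" "g' \<in> shp n n" "h' \<in> shp n n" "k' \<in> shp n n"
      using P_shp by (simp_all add: g_def h_def k_def m_def g'_def h'_def k'_def)
    have inv: "g' * g = idm n" "h' * h = idm n" "h * h' = idm n" "k' * k = idm n" "k * k' = idm n"
      using d sh finv_mult by (simp_all add: g'_def h'_def k'_def g_def h_def k_def)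
    have mh: "m * h = h * m" "m * k = k * m" using MH by (simp_all add: m_def h_def k_def)
    have mh': "m * h' = h' * m" "m * k' = k' * m"
      unfolding h'_def k'_def using d sh mh by (auto intro!: finv_commute simp: h_def k_def)
    have ma: "m * A = A * m" "m * B = B * m" using MA by (simp_all add: m_def)
    define a where "a = h * A * h'"
    define b where "b = k * B * k'"
    have sab: "a \<in> shp n n" "b \<in> shp n n" unfolding a_def b_def by (intro S sh AB)+
    have ma': "m * a = a * m" "m * b = b * m"
      unfolding a_def b_def by (metis mult.assoc mh mh' ma)+
    \<comment> \<open>Because \<open>h\<close> commutes with \<open>A * A\<close>, conjugating
      \<open>A\<close> alone by \<open>h\<close> keeps its square; in the same way \<open>b\<close>
      keeps the cube of \<open>B\<close>. Hence the defining equation survives separate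
      conjugation.\<close>
    have "a * a = h * A * (h' * h) * A * h'" by (simp only: a_def mult.assoc)
    also have "\<dots> = h * (A * A) * h'" using inv sh AB by (simp add: S mult.assoc)
    also have "h * (A * A) = A * A * h" using HC by (simp add: h_def)
    also have "A * A * h * h' = A * A" using inv AB sh by (simp add: S mult.assoc)
    finally have aa: "a * a = A * A" .
    have "b * b * b = k * B * (k' * k) * B * (k' * k) * B * k'" by (simp only: b_def mult.assoc)
    also have "\<dots> = k * (B * B * B) * k'" using inv sh AB by (simp add: S mult.assoc)
    also have "k * (B * B * B) = A * A * k" using HC by (simp add: k_def AB(3)[symmetric])
    also have "A * A * k * k' = A * A" using inv AB sh by (simp add: S mult.assoc)
    finally have bb: "b * b * b = A * A" .
    have FAs: "FA s = g * (m * m * m * a) * g'" "FB s = g * (m * m * b) * g'"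
      by (simp_all add: FA_def FB_def g_def h_def k_def m_def g'_def h'_def k'_def a_def b_def)
    have "FA s * FA s = g * (m * m * m * a) * (g' * g) * (m * m * m * a) * g'"
      by (simp only: FAs mult.assoc)
    also have "\<dots> = g * (m * m * m * a * (m * m * m * a)) * g'"
      using inv sh sab by (simp add: S mult.assoc)
    \<comment> \<open>\<open>m\<close> commutes with \<open>a\<close> and \<open>b\<close>, so the
      square of \<open>m * m * m * a\<close> and the cube of \<open>m * m * b\<close> both carry the
      sixth power of \<open>m\<close>.\<close>
    also have "m * m * m * a * (m * m * m * a) = m * m * m * m * m * m * (A * A)"
      unfolding aa[symmetric] by (metis mult.assoc ma'(1))
    finally have 1: "FA s * FA s = g * (m * m * m * m * m * m * (A * A)) * g'" .
    have "FB s * FB s * FB s = g * (m * m * b) * (g' * g) * (m * m * b) * (g' * g) * (m * m * b) * g'"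
      by (simp only: FAs mult.assoc)
    also have "\<dots> = g * (m * m * b * (m * m * b) * (m * m * b)) * g'"
      using inv sh sab by (simp add: S mult.assoc)
    also have "m * m * b * (m * m * b) * (m * m * b) = m * m * m * m * m * m * (b * b * b)"
      by (metis mult.assoc ma'(2))
    finally have 2: "FA s * FA s = FB s * FB s * FB s" using 1 by (simp add: bb)
    have "invf n (FA s)" "invf n (FB s)"
      unfolding FA_def FB_def by (intro invf_mult invf_finv P_shp d \<open>invf n A\<close> \<open>invf n B\<close>)+
    then have "invertible_mat (tomat n n (FA s))" "invertible_mat (tomat n n (FB s))"
      by (auto intro: invf_tomat)
    moreover have "tomat n n (FA s) ^\<^sub>m 2 = tomat n n (FB s) ^\<^sub>m 3"
      using 2 F_shp by (intro emb_inj[of _ n n])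
        (simp_all add: eval_nat_numeral mult_carrier_mat[of _ n n _ n] emb_mult[of _ n n _ n] emb_tomat mult.assoc)
    ultimately show ?thesis by (simp add: \<phi>_def rep_B3_def GL_def)
  qed
  have \<phi>: "rational_param n T \<phi> q"
    unfolding rational_param_def
  proof (intro conjI ballI allI impI q q0)
    fix s assume "q s \<noteq> 0" then show "\<phi> s \<in> rep_B3 n" by (rule rep)
  next
    fix x assume x: "x \<in> coords n"
    then obtain b i j where xx: "x = (b, i, j)" "i < n" "j < n" by (auto simp: coords_def)
    \<comment> \<open>Adjugates replace the inverses. This uses up two of the four determinants in
      \<open>q\<close>; the other two stay as polynomial factors.\<close>
    define RA where "RA s = P G s * (P M s * P M s * P M s * (P H s * A * fadj n (P H s))) * fadj n (P G s)" for s
    define RB where "RB s = P G s * (P M s * P M s * (P K s * B * fadj n (P K s))) * fadj n (P G s)" for s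
    have R: "fpoly n T RA" "fpoly n T RB"
      unfolding RA_def RB_def by (intro fpoly_mult P_poly fpoly_const AB fpoly_fadj)+
    have eq: "ent (FA s) i j * q s = fdet n (P K s) * fdet n (P M s) * ent (RA s) i j"
      "ent (FB s) i j * q s = fdet n (P H s) * fdet n (P M s) * ent (RB s) i j" if "q s \<noteq> 0" for s
      using that by (auto simp: FA_def FB_def RA_def RB_def finv_def sc_simps q_def)
    show "\<exists>h\<in>polyfun (slots T). \<forall>s. q s \<noteq> 0 \<longrightarrow> crd x (\<phi> s) * q s = h s"
    proof (cases b)
      case True
      have "(\<lambda>s. fdet n (P K s) * fdet n (P M s) * ent (RA s) i j) \<in> polyfun (slots T)"
        by (intro polyfun.mult polyfun_fdet P_poly fpolyD(2)[OF R(1)])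
      moreover have "crd x (\<phi> s) = ent (FA s) i j" for s
        using xx True by (simp add: crd_def \<phi>_def tomat_def)
      ultimately show ?thesis using eq(1) by auto
    next
      case False
      have "(\<lambda>s. fdet n (P H s) * fdet n (P M s) * ent (RB s) i j) \<in> polyfun (slots T)"
        by (intro polyfun.mult polyfun_fdet P_poly fpolyD(2)[OF R(2)])
      moreover have "crd x (\<phi> s) = ent (FB s) i j" for s
        using xx False by (simp add: crd_def \<phi>_def tomat_def)
      ultimately show ?thesis using eq(2) by auto
    qed
  qed
  have "FA (\<lambda>_. 0) = A" "FB (\<lambda>_. 0) = B"
    using AB by (simp_all add: FA_def FB_def P0 finv_idm)
  then have \<phi>0: "\<phi> (\<lambda>_. 0) = V"
    using AB(4,5) by (simp add: \<phi>_def A_def B_def tomat_emb)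
  have ev: "\<forall>\<^sub>F y in at 0. q (\<lambda>j. y * s j) \<noteq> 0" for s
    by (rule tendsto_imp_eventually_ne[OF polyfun_tendsto[OF q] q0])
  have Psc: "P X (\<lambda>j. y * s j) = idm n + sc y (lc X s)" for X y s by (simp add: P_def lc_y)
  have evG: "\<forall>\<^sub>F y in at 0. (idm n + sc y (lc G s)) * finv n (P G (\<lambda>j. y * s j)) = idm n \<and>
      (idm n + sc y (lc H s)) * finv n (P H (\<lambda>j. y * s j)) = idm n \<and>
      (idm n + sc y (lc K s)) * finv n (P K (\<lambda>j. y * s j)) = idm n" for s
    using ev[of s] by eventually_elim (auto simp: q_def Psc[symmetric] intro!: finv_mult(1) P_shp)
  define L where "L s = (\<lambda>x. \<Sum>l<T. s l * u l x)" for s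
  have LX: "fX n (L s) = lc G s * A - A * lc G s + sc 3 (lc M s) * A + (lc H s * A - A * lc H s)" for s
  proof -
    have "fX n (L s) = (\<Sum>l<T. sc (s l) (fX n (u l)))"
      by (rule fmat_eqI) (auto simp: L_def fX_def fm.rep_eq ent_sum intro!: sum.neutral)
    also have "\<dots> = (\<Sum>l<T. sc (s l) (G l * A - A * G l + sc 3 (M l * A) + (H l * A - A * H l)))"
      using GMHK by (intro sum.cong) auto
    also have "\<dots> = lc G s * A - A * lc G s + sc 3 (lc M s) * A + (lc H s * A - A * lc H s)"
      by (simp add: lc_def sum_distrib_left sum_distrib_right sc_sum sc_simps sum.distrib sum_subtractf mult.commute)
    finally show ?thesis .
  qed
  have LY: "fY n (L s) = lc G s * B - B * lc G s + sc 2 (lc M s) * B + (lc K s * B - B * lc K s)" for s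
  proof -
    have "fY n (L s) = (\<Sum>l<T. sc (s l) (fY n (u l)))"
      by (rule fmat_eqI) (auto simp: L_def fY_def fm.rep_eq ent_sum intro!: sum.neutral)
    also have "\<dots> = (\<Sum>l<T. sc (s l) (G l * B - B * G l + sc 2 (M l * B) + (K l * B - B * K l)))"
      using GMHK by (intro sum.cong) auto
    also have "\<dots> = lc G s * B - B * lc G s + sc 2 (lc M s) * B + (lc K s * B - B * lc K s)"
      by (simp add: lc_def sum_distrib_left sum_distrib_right sc_sum sc_simps sum.distrib sum_subtractf mult.commute)
    finally show ?thesis .
  qed
  have y0: "((\<lambda>y::complex. c * y ^ Suc m) \<longlongrightarrow> 0) (at 0)" for c m
    by (rule tendsto_eq_intros | simp)+
  have dA: "flim (\<lambda>y. sc (1 / y) (FA (\<lambda>j. y * s j) - A)) (fX n (L s))" for s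
  proof -
    define m where "m = lc M s"
    have m: "m \<in> shp n n" using lc_shp by (simp add: m_def)
    \<comment> \<open>From (1 + y m)^3 = 1 + y (3 m + 3 y m^2 + y^2 m^3).\<close>
    define D where "D y = sc 3 m + sc (3 * y) (m * m) + sc (y * y) (m * m * m)" for y
    have "flim D (sc 3 m + sc 0 (m * m) + sc 0 (m * m * m))"
      unfolding D_def using y0[of 3 0] y0[of 1 1]
      by (intro flim_add flim_sc flim_const) (simp_all add: power2_eq_square)
    then have D: "flim D (sc 3 m)" by (simp add: sc_simps)
    have DP: "P M (\<lambda>j. y * s j) * P M (\<lambda>j. y * s j) * P M (\<lambda>j. y * s j) = idm n + sc y (D y)" for y
      unfolding Psc m_def[symmetric] using m
      by (simp add: D_def S distrib_left distrib_right sc_simps mult.assoc)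
         (rule fmat_eqI, simp add: algebra_simps)
    have "flim (\<lambda>y. sc (1 / y) ((idm n + sc y (lc G s)) * ((idm n + sc y (D y)) * ((idm n + sc y (lc H s)) * A *
        finv n (P H (\<lambda>j. y * s j)))) * finv n (P G (\<lambda>j. y * s j)) - A))
      (lc G s * A - A * lc G s + sc 3 m * A + (lc H s * A - A * lc H s))"
    proof (rule conjugation_derivative)
      show "D y \<in> shp n n" for y unfolding D_def by (intro shp_simps S m)
      show "\<forall>\<^sub>F y in at 0. (idm n + sc y (lc G s)) * finv n (P G (\<lambda>j. y * s j)) = idm n \<and>
        (idm n + sc y (lc H s)) * finv n (P H (\<lambda>j. y * s j)) = idm n"
        using evG[of s] by eventually_elim blast
    qed (use AB lc_shp D m flim_finv P_poly P0 in auto)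
    then show ?thesis unfolding FA_def DP LX m_def[symmetric] unfolding Psc .
  qed
  have dB: "flim (\<lambda>y. sc (1 / y) (FB (\<lambda>j. y * s j) - B)) (fY n (L s))" for s
  proof -
    define m where "m = lc M s"
    have m: "m \<in> shp n n" using lc_shp by (simp add: m_def)
    define D where "D y = sc 2 m + sc y (m * m)" for y
    have "flim D (sc 2 m + sc 0 (m * m))"
      unfolding D_def using y0[of 1 0] by (intro flim_add flim_sc flim_const) simp_all
    then have D: "flim D (sc 2 m)" by (simp add: sc_simps)
    have DP: "P M (\<lambda>j. y * s j) * P M (\<lambda>j. y * s j) = idm n + sc y (D y)" for y
      unfolding Psc m_def[symmetric] using m
      by (simp add: D_def S distrib_left distrib_right sc_simps mult.assoc)
         (rule fmat_eqI, simp add: algebra_simps)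
    have "flim (\<lambda>y. sc (1 / y) ((idm n + sc y (lc G s)) * ((idm n + sc y (D y)) * ((idm n + sc y (lc K s)) * B *
        finv n (P K (\<lambda>j. y * s j)))) * finv n (P G (\<lambda>j. y * s j)) - B))
      (lc G s * B - B * lc G s + sc 2 m * B + (lc K s * B - B * lc K s))"
    proof (rule conjugation_derivative)
      show "D y \<in> shp n n" for y unfolding D_def by (intro shp_simps S m)
      show "\<forall>\<^sub>F y in at 0. (idm n + sc y (lc G s)) * finv n (P G (\<lambda>j. y * s j)) = idm n \<and>
        (idm n + sc y (lc K s)) * finv n (P K (\<lambda>j. y * s j)) = idm n"
        using evG[of s] by eventually_elim blast
    qed (use AB lc_shp D m flim_finv P_poly P0 in auto)
    then show ?thesis unfolding FB_def DP LY m_def[symmetric] unfolding Psc .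
  qed
  show ?thesis
  proof (rule smooth_at_param[OF V u \<phi>[unfolded T_def] \<phi>0])
    fix s x assume "x \<in> coords n"
    then obtain b i j where xx: "x = (b, i, j)" "i < n" "j < n" by (auto simp: coords_def)
    have "ent A i j = fst V $$ (i, j)" "ent B i j = snd V $$ (i, j)"
      using xx AB(4,5) by (simp_all add: A_def B_def ent_emb[of _ n n])
    moreover have "ent (fX n (L s)) i j = L s (True, i, j)" "ent (fY n (L s)) i j = L s (False, i, j)"
      using xx by (simp_all add: fX_def fY_def fm.rep_eq)
    moreover have "((\<lambda>y. ent (sc (1 / y) (FA (\<lambda>j. y * s j) - A)) i j) \<longlongrightarrow> ent (fX n (L s)) i j) (at 0)"
      "((\<lambda>y. ent (sc (1 / y) (FB (\<lambda>j. y * s j) - B)) i j) \<longlongrightarrow> ent (fY n (L s)) i j) (at 0)"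
      using dA dB unfolding flim_def by blast+
    ultimately show "((\<lambda>y. (crd x (\<phi> (\<lambda>l. y * s l)) - crd x V) / y)
      \<longlongrightarrow> (\<Sum>l<tangent_dim n V. s l * u l x)) (at 0)"
      using xx by (cases b) (simp_all add: crd_def \<phi>_def tomat_def L_def T_def)
  qed
qed

section \<open>Eigenspace splittings\<close>

text \<open>With fewer rows than columns, the preimages of the unit vectors would be dependent,
  contradicting the independence of the unit vectors.\<close>

lemma surjective_card_le:
  fixes v :: "'i \<Rightarrow> 'j \<Rightarrow> complex"
  assumes I: "finite I" and J: "finite J" and surj: "\<And>y. \<exists>f. \<forall>j\<in>J. y j = (\<Sum>i\<in>I. f i * v i j)"
  shows "card J \<le> card I"
proof (rule ccontr)
  assume "\<not> card J \<le> card I"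
  obtain r where r: "\<And>k j. j \<in> J \<Longrightarrow> (if j = k then 1 else 0) = (\<Sum>i\<in>I. r k i * v i j)"
    using surj[of "\<lambda>j. if j = _ then 1 else 0"] by metis
  obtain g where g: "\<exists>k\<in>J. g k \<noteq> 0" "\<forall>i\<in>I. (\<Sum>k\<in>J. g k * r k i) = 0"
    using nontrivial_solution[OF I J, of r] \<open>\<not> card J \<le> card I\<close> by auto
  have "g j = 0" if j: "j \<in> J" for j
  proof -
    have "g j = (\<Sum>k\<in>J. g k * (if j = k then 1 else 0))"
      using j J by (simp add: if_distrib[of "\<lambda>a. _ * a"] cong: if_cong)
    also have "\<dots> = (\<Sum>k\<in>J. \<Sum>i\<in>I. g k * r k i * v i j)"
      by (simp add: r[OF j] sum_distrib_left mult.assoc)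
    also have "\<dots> = (\<Sum>i\<in>I. (\<Sum>k\<in>J. g k * r k i) * v i j)"
      unfolding sum_distrib_right by (rule sum.swap)
    finally show ?thesis using g(2) by simp
  qed
  then show False using g(1) by blast
qed

text \<open>Adjoining \<open>y\<close> as a further row leaves more rows than columns. Injectivity
  forces the resulting relation to involve \<open>y\<close>, which can then be solved for.\<close>

lemma injective_imp_surjective:
  fixes v :: "'i \<Rightarrow> 'j \<Rightarrow> complex"
  assumes I: "finite I" and J: "finite J" and card: "card J \<le> card I"
    and inj: "\<And>f. \<forall>j\<in>J. (\<Sum>i\<in>I. f i * v i j) = 0 \<Longrightarrow> \<forall>i\<in>I. f i = 0"
  shows "\<exists>f. \<forall>j\<in>J. y j = (\<Sum>i\<in>I. f i * v i j)"
proof -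
  define I' where "I' = insert None (Some ` I)"
  define v' where "v' i = (case i of None \<Rightarrow> y | Some i \<Rightarrow> v i)" for i
  have "card I' = Suc (card I)" using I by (simp add: I'_def card_image)
  then obtain f where f: "\<exists>i\<in>I'. f i \<noteq> 0" "\<forall>j\<in>J. (\<Sum>i\<in>I'. f i * v' i j) = 0"
    using nontrivial_solution[OF J, of I' v'] I card by (auto simp: I'_def)
  have split: "(\<Sum>i\<in>I'. f i * v' i j) = f None * y j + (\<Sum>i\<in>I. f (Some i) * v i j)" for j
    using I by (simp add: I'_def v'_def sum.reindex)
  have "f None \<noteq> 0"
  proof
    assume "f None = 0"
    then have "\<forall>i\<in>I. f (Some i) = 0" using f(2) split by (intro inj) auto
    then show False using f(1) \<open>f None = 0\<close> by (auto simp: I'_def)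
  qed
  then have "y j = (\<Sum>i\<in>I. (- f (Some i) / f None) * v i j)" if "j \<in> J" for j
  proof -
    have "f None * y j = - (\<Sum>i\<in>I. f (Some i) * v i j)"
      using f(2) that by (auto simp: split eq_neg_iff_add_eq_0)
    then have "y j = - (\<Sum>i\<in>I. f (Some i) * v i j) / f None" using \<open>f None \<noteq> 0\<close> by (simp add: field_simps)
    then show ?thesis by (simp add: sum_negf sum_divide_distrib)
  qed
  then show ?thesis by (intro exI[of _ "\<lambda>i. - f (Some i) / f None"]) simp
qed

text \<open>A relation with \<open>f i0\<close> nonzero makes row \<open>i0\<close> redundant, and
  the remaining rows are too few to span.\<close>

lemma surjective_imp_injective:
  fixes v :: "'i \<Rightarrow> 'j \<Rightarrow> complex"
  assumes I: "finite I" and J: "finite J" and card: "card I \<le> card J"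
    and surj: "\<And>y. \<exists>f. \<forall>j\<in>J. y j = (\<Sum>i\<in>I. f i * v i j)"
    and f: "\<forall>j\<in>J. (\<Sum>i\<in>I. f i * v i j) = 0" and i0: "i0 \<in> I"
  shows "f i0 = 0"
proof (rule ccontr)
  assume nz: "f i0 \<noteq> 0"
  define I' where "I' = I - {i0}"
  have I': "finite I'" "I = insert i0 I'" "i0 \<notin> I'" using I i0 by (auto simp: I'_def)
  have "card J \<le> card I'"
  proof (rule surjective_card_le[OF I'(1) J])
    fix y
    obtain g where g: "\<forall>j\<in>J. y j = (\<Sum>i\<in>I. g i * v i j)" using surj by blast
    have "y j = (\<Sum>i\<in>I'. (g i - g i0 / f i0 * f i) * v i j)" if j: "j \<in> J" for j
    proof -
      have "y j = (\<Sum>i\<in>I. g i * v i j) - g i0 / f i0 * (\<Sum>i\<in>I. f i * v i j)" using f g j by simp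
      also have "\<dots> = (\<Sum>i\<in>I. (g i - g i0 / f i0 * f i) * v i j)"
        by (simp add: sum_distrib_left sum_subtractf left_diff_distrib mult.assoc)
      also have "\<dots> = (\<Sum>i\<in>I'. (g i - g i0 / f i0 * f i) * v i j)"
        using I' nz by simp
      finally show ?thesis .
    qed
    then show "\<exists>f. \<forall>j\<in>J. y j = (\<Sum>i\<in>I'. f i * v i j)"
      by (intro exI[of _ "\<lambda>i. g i - g i0 / f i0 * f i"] ballI)
  qed
  then show False using card I' by simp
qed

text \<open>If every functional that kills the rows also killed \<open>y\<close>, then pairing with
  \<open>y\<close> would be a combination of the pairings with the rows, which writes
  \<open>y\<close> as a combination of the rows.\<close>

lemma annihilating_functional:
  fixes v :: "'i \<Rightarrow> 'j \<Rightarrow> complex"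
  assumes I: "finite I" and J: "finite J" and y: "\<nexists>f. \<forall>j\<in>J. y j = (\<Sum>i\<in>I. f i * v i j)"
  shows "\<exists>\<eta>. (\<forall>i\<in>I. (\<Sum>j\<in>J. \<eta> j * v i j) = 0) \<and> (\<Sum>j\<in>J. \<eta> j * y j) \<noteq> 0"
proof (rule ccontr)
  assume no: "\<not> ?thesis"
  have "\<exists>c. \<forall>\<eta>. (\<Sum>j\<in>J. \<eta> j * y j) = (\<Sum>i\<in>I. c i * (\<Sum>j\<in>J. \<eta> j * v i j))"
    by (rule lin_functional_combination[OF I])
       (use no in \<open>auto simp: lin_functional_def distrib_right sum.distrib sum_distrib_left mult.assoc\<close>)
  then obtain c where c: "\<And>\<eta>. (\<Sum>j\<in>J. \<eta> j * y j) = (\<Sum>i\<in>I. c i * (\<Sum>j\<in>J. \<eta> j * v i j))" by blast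
  have "y k = (\<Sum>i\<in>I. c i * v i k)" if "k \<in> J" for k
  proof -
    have "(\<Sum>j\<in>J. (if j = k then 1 else 0) * w j) = w k" for w :: "'j \<Rightarrow> complex"
      using that J by (simp add: if_distrib[of "\<lambda>a. a * _"] cong: if_cong)
    then show ?thesis using c[of "\<lambda>j. if j = k then 1 else 0"] by simp
  qed
  then have "\<exists>f. \<forall>j\<in>J. y j = (\<Sum>i\<in>I. f i * v i j)" by (intro exI[of _ c] ballI)
  then show False using y by (rule notE[rotated])
qed

section \<open>Eigenspaces from idempotents\<close>

definition skip :: "nat \<Rightarrow> nat \<Rightarrow> nat" where
  "skip p k = (if k < p then k else Suc k)"

lemma sum_skip:
  fixes f :: "nat \<Rightarrow> 'a::comm_monoid_add"
  assumes "p < Suc r"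
  shows "(\<Sum>k<Suc r. f k) = f p + (\<Sum>k<r. f (skip p k))"
proof -
  have "bij_betw (skip p) {..<r} ({..<Suc r} - {p})"
    by (rule bij_betwI[of _ _ _ "\<lambda>k. if k < p then k else k - 1"]) (use assms in \<open>auto simp: skip_def split: if_splits\<close>)
  then have "(\<Sum>k<r. f (skip p k)) = (\<Sum>k\<in>{..<Suc r} - {p}. f k)" by (rule sum.reindex_bij_betw)
  then show ?thesis using assms by (simp add: sum.remove[of "{..<Suc r}" p] del: sum.lessThan_Suc)
qed

text \<open>A factorization \<open>e = F * G\<close> with \<open>e * F = F\<close> and least inner
  size \<open>r\<close>. Minimality makes \<open>F\<close> left cancellable, and
  \<open>F * (G * F - idm r) = e * F - F = 0\<close> then yields
  \<open>G * F = idm r\<close>.\<close>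

lemma idempotent_factorization:
  assumes e: "e \<in> shp n n" "e * e = e"
  obtains r F G where "F \<in> shp n r" "G \<in> shp r n" "e = F * G" "G * F = idm r" "e * F = F" "G * e = G"
proof -
  define P where "P r \<longleftrightarrow> (\<exists>F G. F \<in> shp n r \<and> G \<in> shp r n \<and> e = F * G \<and> e * F = F)" for r
  have "P n" unfolding P_def using e by (intro exI[of _ e] exI[of _ "idm n"]) auto
  define r where "r = (LEAST r. P r)"
  have "P r" unfolding r_def by (rule LeastI[of P, OF \<open>P n\<close>])
  then obtain F G where FG: "F \<in> shp n r" "G \<in> shp r n" "e = F * G" "e * F = F" unfolding P_def by blast
  \<comment> \<open>A nonzero column of \<open>D\<close> is a linear dependency among the columns of
    \<open>F\<close>. One column, here the \<open>p\<close>-th, can then be eliminated, which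
    contradicts the minimality of \<open>r\<close>.\<close>
  have cancel: "D = 0" if D: "D \<in> shp r c" "F * D = 0" for D c
  proof (rule ccontr)
    assume "D \<noteq> 0"
    then obtain p j where pj: "ent D p j \<noteq> 0" using fmat_eqI[of D 0] by auto
    then have "p < r" using D(1) by (auto simp: shp_def)
    then obtain r' where r': "r = Suc r'" by (cases r) auto
    have Fp: "ent F x p = - (\<Sum>k<r'. ent D (skip p k) j / ent D p j * ent F x (skip p k))" for x
    proof -
      have "0 = (\<Sum>k<r. ent F x k * ent D k j)" using D(2) ent_mult[OF FG(1), of D x j] by simp
      also have "\<dots> = ent F x p * ent D p j + (\<Sum>k<r'. ent F x (skip p k) * ent D (skip p k) j)"
        unfolding r' using \<open>p < r\<close> r' by (intro sum_skip) simp
      finally have "ent F x p * ent D p j = - (\<Sum>k<r'. ent F x (skip p k) * ent D (skip p k) j)"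
        by (simp add: eq_neg_iff_add_eq_0)
      then have "ent F x p = - (\<Sum>k<r'. ent F x (skip p k) * ent D (skip p k) j) / ent D p j"
        using pj by (simp add: field_simps)
      then show ?thesis by (simp add: sum_divide_distrib mult.commute)
    qed
    define F' where "F' = fm n r' (\<lambda>x k. ent F x (skip p k))"
    define G' where "G' = fm r' n (\<lambda>k y. ent G (skip p k) y - ent D (skip p k) j / ent D p j * ent G p y)"
    have sh: "F' \<in> shp n r'" "G' \<in> shp r' n" by (simp_all add: F'_def G'_def)
    have "e = F' * G'"
    proof (rule fmat_eqI)
      fix x y
      show "ent e x y = ent (F' * G') x y"
      proof (cases "x < n \<and> y < n")
        case False
        then show ?thesis using ent_shp[OF e(1) False] ent_shp[OF shp_mult[OF sh] False] by simp
      next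
        case True
        have "ent e x y = (\<Sum>k<r. ent F x k * ent G k y)" using FG(3) ent_mult[OF FG(1)] by simp
        also have "\<dots> = ent F x p * ent G p y + (\<Sum>k<r'. ent F x (skip p k) * ent G (skip p k) y)"
          unfolding r' using \<open>p < r\<close> r' by (intro sum_skip) simp
        also have "ent F x p * ent G p y = (\<Sum>k<r'. - (ent D (skip p k) j / ent D p j * ent F x (skip p k) * ent G p y))"
          by (subst Fp) (simp add: sum_distrib_right sum_negf)
        also have "(\<Sum>k<r'. - (ent D (skip p k) j / ent D p j * ent F x (skip p k) * ent G p y)) +
            (\<Sum>k<r'. ent F x (skip p k) * ent G (skip p k) y) = (\<Sum>k<r'. ent F' x k * ent G' k y)"
          unfolding sum.distrib[symmetric] using True
          by (intro sum.cong) (simp_all add: F'_def G'_def fm.rep_eq algebra_simps)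
        also have "\<dots> = ent (F' * G') x y" by (simp add: ent_mult[OF sh(1)])
        finally show ?thesis .
      qed
    qed
    moreover have "e * F' = F'"
    proof (rule fmat_eqI)
      fix x k
      have "ent (e * F') x k = (if k < r' then ent (e * F) x (skip p k) else 0)"
        unfolding ent_mult[OF e(1)] F'_def by (auto simp: fm.rep_eq intro!: sum.cong)
      also have "\<dots> = ent F' x k" using ent_shp[OF FG(1), of x] by (auto simp: FG(4) F'_def fm.rep_eq)
      finally show "ent (e * F') x k = ent F' x k" .
    qed
    ultimately have "P r'" unfolding P_def using sh by blast
    then have "r \<le> r'" unfolding r_def by (rule Least_le)
    then show False using r' by simp
  qed
  have GF: "G * F \<in> shp r r" using FG by (auto intro: shp_mult)
  have "F * (G * F - idm r) = e * F - F" using FG by (simp add: right_diff_distrib mult.assoc[symmetric])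
  then have "F * (G * F - idm r) = 0" using FG(4) by simp
  then have "G * F - idm r = 0" using GF by (intro cancel[OF shp_simps(3)[OF GF shp_simps(7)]])
  then have GFI: "G * F = idm r" by simp
  have "G * e = (G * F) * G" by (simp add: FG(3) mult.assoc)
  then have "G * e = G" using GFI FG(2) by simp
  then show thesis using that FG GFI by blast
qed

text \<open>\<open>F l\<close> and \<open>G l\<close> are the inclusion of and the projection to the
  eigenspace for \<open>\<rho> l\<close>, of dimension \<open>m l\<close>. Indices 0 and 1 belong to
  \<open>A\<close>, indices 2, 3, 4 to \<open>B\<close>, so \<open>m\<close> is the dimension vector
  (a, b; x, y, z) up to the order of eigenvalues.\<close>

definition br_splitting :: "nat \<Rightarrow> fmat \<Rightarrow> fmat \<Rightarrow> (nat \<Rightarrow> complex) \<Rightarrow> (nat \<Rightarrow> nat) \<Rightarrow> (nat \<Rightarrow> fmat) \<Rightarrow> (nat \<Rightarrow> fmat) \<Rightarrow> bool" where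
  "br_splitting n A B \<rho> m F G \<longleftrightarrow> A \<in> shp n n \<and> B \<in> shp n n \<and>
     (\<forall>l<5. F l \<in> shp n (m l) \<and> G l \<in> shp (m l) n \<and> G l * F l = idm (m l)) \<and>
     (\<Sum>l<2. F l * G l) = idm n \<and> (\<Sum>l\<in>{2..<5}. F l * G l) = idm n \<and>
     (\<forall>l<2. A * F l = sc (\<rho> l) (F l) \<and> G l * A = sc (\<rho> l) (G l)) \<and>
     (\<forall>l\<in>{2..<5}. B * F l = sc (\<rho> l) (F l) \<and> G l * B = sc (\<rho> l) (G l))"

text \<open>\<open>\<rho> 0, \<rho> 1\<close> are the square roots and \<open>\<rho> 2, \<rho> 3, \<rho> 4\<close> the cube roots of \<open>c\<close>.\<close>

definition br_roots :: "complex \<Rightarrow> (nat \<Rightarrow> complex) \<Rightarrow> bool" where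
  "br_roots c \<rho> \<longleftrightarrow> c \<noteq> 0 \<and> (\<forall>l<2. \<rho> l ^ 2 = c) \<and> (\<forall>l\<in>{2..<5}. \<rho> l ^ 3 = c) \<and>
     inj_on \<rho> {..<2} \<and> inj_on \<rho> {2..<5} \<and> (\<Sum>l<2. 1 / \<rho> l) = 0 \<and>
     (\<Sum>l\<in>{2..<5}. 1 / \<rho> l) = 0 \<and> (\<Sum>l\<in>{2..<5}. 1 / \<rho> l ^ 2) = 0"

text \<open>The roots are one root times all square or cube roots of unity. The sums of reciprocals
  vanish because 1 + \<open>\<omega>\<close> + \<open>\<omega>\<close>^2 = 0, and similarly for the
  two signs.\<close>

lemma br_roots_exist:
  assumes c: "c \<noteq> 0" and \<omega>: "\<omega> ^ 3 = 1" "\<omega> \<noteq> (1::complex)"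
  obtains \<rho> where "br_roots c \<rho>"
proof -
  obtain r where r: "r ^ 2 = c" using power2_csqrt by blast
  obtain s where s: "s ^ 3 = c"
  proof -
    have "\<not> constant (poly [:- c, 0, 0, 1:])"
    proof
      assume "constant (poly [:- c, 0, 0, 1:])"
      then have "poly [:- c, 0, 0, 1:] 1 = poly [:- c, 0, 0, 1:] 0" unfolding constant_def by blast
      then show False by simp
    qed
    then obtain z where "poly [:- c, 0, 0, 1:] z = 0" using fundamental_theorem_of_algebra by blast
    then have "z ^ 3 = c" by (simp add: power3_eq_cube algebra_simps)
    then show thesis by (rule that)
  qed
  have rs: "r \<noteq> 0" "s \<noteq> 0" using r s c by auto
  have "(\<omega> - 1) * (1 + \<omega> + \<omega> ^ 2) = 0" using \<omega>(1) by (simp add: algebra_simps power2_eq_square power3_eq_cube)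
  then have w: "1 + \<omega> + \<omega> ^ 2 = 0" using \<omega>(2) by simp
  have w0: "\<omega> \<noteq> 0" using \<omega>(1) by auto
  have inv: "1 / \<omega> = \<omega> ^ 2" "1 / \<omega> ^ 2 = \<omega>"
    using \<omega>(1) w0 by (simp_all add: field_simps power2_eq_square power3_eq_cube)
  have ww: "\<omega> ^ 2 \<noteq> 1" "\<omega> ^ 2 \<noteq> \<omega>"
  proof -
    show "\<omega> ^ 2 \<noteq> 1"
    proof
      assume "\<omega> ^ 2 = 1"
      then have "\<omega> ^ 3 = \<omega>" by (simp add: power3_eq_cube power2_eq_square)
      then show False using \<omega> by simp
    qed
    show "\<omega> ^ 2 \<noteq> \<omega>" using w0 \<omega>(2) by (simp add: power2_eq_square)
  qed
  define \<rho> where "\<rho> l = (if l = 0 then r else if l = 1 then - r else s * \<omega> ^ (l - 2))" for l :: nat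
  have set5: "{2..<5} = {2, 3, 4::nat}" "{..<2} = {0, 1::nat}" by auto
  have \<rho>: "\<rho> 0 = r" "\<rho> 1 = - r" "\<rho> 2 = s" "\<rho> 3 = s * \<omega>" "\<rho> 4 = s * \<omega> ^ 2"
    by (simp_all add: \<rho>_def)
  have \<omega>6: "(\<omega> ^ 2) ^ 3 = 1"
  proof -
    have "(\<omega> ^ 2) ^ 3 = (\<omega> ^ 3) ^ 2" by (simp add: power_mult[symmetric])
    then show ?thesis using \<omega>(1) by simp
  qed
  have \<omega>4: "(\<omega> ^ 2) ^ 2 = \<omega>"
  proof -
    have "(\<omega> ^ 2) ^ 2 = \<omega> ^ 3 * \<omega>" by (simp add: power_mult[symmetric] eval_nat_numeral)
    then show ?thesis using \<omega>(1) by simp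
  qed
  have "br_roots c \<rho>"
    unfolding br_roots_def set5
  proof (intro conjI)
    show "\<forall>l<2. \<rho> l ^ 2 = c" using r by (auto simp: \<rho>_def less_2_cases_iff)
    show "\<forall>l\<in>{2, 3, 4}. \<rho> l ^ 3 = c" using s \<omega>(1) \<omega>6 by (simp add: \<rho> power_mult_distrib)
    show "inj_on \<rho> {0, 1}" using rs unfolding inj_on_def by (auto simp: \<rho> \<rho>(2)[unfolded One_nat_def])
    show "inj_on \<rho> {2, 3, 4}" using rs w0 ww \<omega>(2) unfolding inj_on_def by (auto simp: \<rho>)
    show "(\<Sum>l\<in>{0, 1}. 1 / \<rho> l) = 0" by (simp add: \<rho> \<rho>(2)[unfolded One_nat_def])
    have "(\<Sum>l\<in>{2, 3, 4}. 1 / \<rho> l) = 1 / s * (1 + 1 / \<omega> + 1 / \<omega> ^ 2)" by (simp add: \<rho> distrib_left)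
    also have "\<dots> = 1 / s * (1 + \<omega> + \<omega> ^ 2)" by (simp only: inv ac_simps)
    finally show "(\<Sum>l\<in>{2, 3, 4}. 1 / \<rho> l) = 0" by (simp only: w mult_zero_right)
    have "(\<Sum>l\<in>{2, 3, 4}. 1 / \<rho> l ^ 2) = 1 / s ^ 2 * (1 + 1 / \<omega> ^ 2 + 1 / (\<omega> ^ 2) ^ 2)"
      by (simp add: \<rho> power_mult_distrib distrib_left)
    also have "\<dots> = 1 / s ^ 2 * (1 + \<omega> + \<omega> ^ 2)" by (simp only: inv \<omega>4 ac_simps)
    finally show "(\<Sum>l\<in>{2, 3, 4}. 1 / \<rho> l ^ 2) = 0" by (simp only: w mult_zero_right)
  qed (rule c)
  then show thesis by (rule that)
qed

text \<open>The spectral idempotents are (1 + A/\<open>\<rho>\<close>)/2 and (1 +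
  B/\<open>\<rho>\<close> + B^2/\<open>\<rho>\<close>^2)/3. The vanishing sums of reciprocal roots
  make each group add up to the identity, and factoring each idempotent gives an inclusion and a
  projection.\<close>

lemma br_splitting_exists:
  assumes A: "A \<in> shp n n" "A * A = sc c (idm n)" and B: "B \<in> shp n n" "B * B * B = sc c (idm n)"
    and \<rho>: "br_roots c \<rho>"
  obtains m F G where "br_splitting n A B \<rho> m F G"
proof -
  note S = shp_mult[of _ n n _ n]
  have c: "c \<noteq> 0" and \<rho>2: "\<And>l. l < 2 \<Longrightarrow> \<rho> l * \<rho> l = c" and \<rho>3: "\<And>l. l \<in> {2..<5} \<Longrightarrow> \<rho> l * \<rho> l * \<rho> l = c"
    using \<rho> by (auto simp: br_roots_def power2_eq_square power3_eq_cube)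
  define e where "e l = (if l < 2 then sc (1 / 2) (idm n + sc (1 / \<rho> l) A)
      else sc (1 / 3) (idm n + sc (1 / \<rho> l) B + sc (1 / \<rho> l ^ 2) (B * B)))" for l
  define C where "C l = (if l < 2 then A else B)" for l :: nat
  have e_shp: "e l \<in> shp n n" for l unfolding e_def using A B by (auto intro!: shp_simps S)
  have eig: "C l * e l = sc (\<rho> l) (e l) \<and> e l * C l = sc (\<rho> l) (e l) \<and> e l * e l = e l" if l: "l < 5" for l
  proof (cases "l < 2")
    case True
    have r0: "\<rho> l \<noteq> 0" using \<rho>2[OF True] c by auto
    have "1 / \<rho> l * c = \<rho> l" using \<rho>2[OF True] r0 by (simp add: field_simps)
    then have AA: "sc (1 / \<rho> l) (A * A) = sc (\<rho> l) (idm n)" by (simp only: A(2) sc_simps)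
    have "sc (1 / 2) (A + sc (\<rho> l) (idm n)) = sc (\<rho> l) (e l)"
      using True r0 by (intro fmat_eqI) (simp add: e_def field_simps)
    moreover have "A * e l = sc (1 / 2) (A + sc (1 / \<rho> l) (A * A))" "e l * A = sc (1 / 2) (A + sc (1 / \<rho> l) (A * A))"
      using True A(1) unfolding e_def by (simp_all only: distrib_left distrib_right sc_simps(1,2) idm_square if_True)
    ultimately have 1: "A * e l = sc (\<rho> l) (e l)" "e l * A = sc (\<rho> l) (e l)" by (simp_all only: AA)
    have "e l * e l = sc (1 / 2) (e l + sc (1 / \<rho> l) (A * e l))"
      using True e_shp[of l] by (subst (1) e_def) (simp add: distrib_right sc_simps)
    also have "\<dots> = e l" unfolding 1 using r0 by (intro fmat_eqI) (simp add: field_simps)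
    finally show ?thesis using 1 True by (simp add: C_def)
  next
    case False
    then have l: "l \<in> {2..<5}" using l by auto
    have r0: "\<rho> l \<noteq> 0" using \<rho>3[OF l] c by auto
    have s: "1 / \<rho> l ^ 2 * c = \<rho> l" using \<rho>3[OF l] r0 by (simp add: field_simps power2_eq_square)
    have BBB: "B * (B * B) = sc c (idm n)" using B(2) by (simp add: mult.assoc)
    have s': "\<rho> l * (1 / \<rho> l ^ 2) = 1 / \<rho> l" using r0 by (simp add: power2_eq_square)
    have 1: "B * e l = sc (\<rho> l) (e l)" "e l * B = sc (\<rho> l) (e l)"
      using False B r0 BBB s s' by (auto intro!: fmat_eqI simp: e_def distrib_left distrib_right sc_simps mult.assoc field_simps)
    have "e l * e l = sc (1 / 3) (e l + sc (1 / \<rho> l) (B * e l) + sc (1 / \<rho> l ^ 2) (B * (B * e l)))"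
      using False e_shp[of l] by (subst (1) e_def) (simp add: distrib_right sc_simps mult.assoc)
    also have "\<dots> = e l" unfolding 1 sc_simps using r0
      by (intro fmat_eqI) (simp add: 1 field_simps power2_eq_square)
    finally show ?thesis using 1 False by (simp add: C_def)
  qed
  have "\<exists>mFG. \<forall>l<5. fst (snd (mFG l)) \<in> shp n (fst (mFG l)) \<and> snd (snd (mFG l)) \<in> shp (fst (mFG l)) n \<and>
      e l = fst (snd (mFG l)) * snd (snd (mFG l)) \<and> snd (snd (mFG l)) * fst (snd (mFG l)) = idm (fst (mFG l)) \<and>
      e l * fst (snd (mFG l)) = fst (snd (mFG l)) \<and> snd (snd (mFG l)) * e l = snd (snd (mFG l))"
  proof (rule choice, rule allI)
    fix l
    show "\<exists>y. l < 5 \<longrightarrow> fst (snd y) \<in> shp n (fst y) \<and> snd (snd y) \<in> shp (fst y) n \<and>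
      e l = fst (snd y) * snd (snd y) \<and> snd (snd y) * fst (snd y) = idm (fst y) \<and>
      e l * fst (snd y) = fst (snd y) \<and> snd (snd y) * e l = snd (snd y)"
    proof (cases "l < 5")
      case True
      obtain r F G where "F \<in> shp n r" "G \<in> shp r n" "e l = F * G" "G * F = idm r" "e l * F = F" "G * e l = G"
        using idempotent_factorization[OF e_shp] eig[OF True] by metis
      then show ?thesis by (intro exI[of _ "(r, F, G)"]) simp
    qed simp
  qed
  then obtain mFG where mFG: "\<forall>l<5. fst (snd (mFG l)) \<in> shp n (fst (mFG l)) \<and> snd (snd (mFG l)) \<in> shp (fst (mFG l)) n \<and>
      e l = fst (snd (mFG l)) * snd (snd (mFG l)) \<and> snd (snd (mFG l)) * fst (snd (mFG l)) = idm (fst (mFG l)) \<and>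
      e l * fst (snd (mFG l)) = fst (snd (mFG l)) \<and> snd (snd (mFG l)) * e l = snd (snd (mFG l))" by blast
  define m F G where "m l = fst (mFG l)" and "F l = fst (snd (mFG l))" and "G l = snd (snd (mFG l))" for l
  have FG: "F l \<in> shp n (m l)" "G l \<in> shp (m l) n" "F l * G l = e l" "G l * F l = idm (m l)" "e l * F l = F l" "G l * e l = G l"
    if "l < 5" for l using mFG that by (auto simp: m_def F_def G_def)
  have CF: "C l * F l = sc (\<rho> l) (F l)" "G l * C l = sc (\<rho> l) (G l)" if "l < 5" for l
  proof -
    have "C l * F l = C l * e l * F l" using FG[OF that] by (simp add: mult.assoc)
    then show "C l * F l = sc (\<rho> l) (F l)" using eig[OF that] FG[OF that] by (simp add: sc_simps)
    have "G l * C l = G l * (e l * C l)" using FG[OF that] by (simp add: mult.assoc[symmetric])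
    then show "G l * C l = sc (\<rho> l) (G l)" using eig[OF that] FG[OF that] by (simp add: sc_simps)
  qed
  have set5: "{2..<5} = {2, 3, 4::nat}" "{..<2} = {0, 1::nat}" by auto
  have \<rho>s: "1 / \<rho> 0 + 1 / \<rho> 1 = 0" "1 / \<rho> 2 + (1 / \<rho> 3 + 1 / \<rho> 4) = 0" "1 / \<rho> 2 ^ 2 + (1 / \<rho> 3 ^ 2 + 1 / \<rho> 4 ^ 2) = 0"
    using \<rho> unfolding br_roots_def set5 by simp_all
  have "e 0 + e 1 = sc (1 / 2) (sc 2 (idm n) + sc (1 / \<rho> 0 + 1 / \<rho> 1) A)"
    by (rule fmat_eqI) (simp add: e_def algebra_simps)
  then have e01: "e 0 + e 1 = idm n" unfolding \<rho>s by (simp add: sc_simps)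
  have "e 2 + (e 3 + e 4) = sc (1 / 3) (sc 3 (idm n) + sc (1 / \<rho> 2 + (1 / \<rho> 3 + 1 / \<rho> 4)) B
      + sc (1 / \<rho> 2 ^ 2 + (1 / \<rho> 3 ^ 2 + 1 / \<rho> 4 ^ 2)) (B * B))"
    by (rule fmat_eqI) (simp add: e_def algebra_simps)
  then have e234: "e 2 + (e 3 + e 4) = idm n" unfolding \<rho>s by (simp add: sc_simps)
  have "br_splitting n A B \<rho> m F G"
    unfolding br_splitting_def
  proof (intro conjI allI impI ballI A B)
    show "(\<Sum>l<2. F l * G l) = idm n" "(\<Sum>l\<in>{2..<5}. F l * G l) = idm n"
      using e01 e234 by (simp_all add: set5 FG)
    show "A * F l = sc (\<rho> l) (F l)" "G l * A = sc (\<rho> l) (G l)" if "l < 2" for l using CF[of l] that by (simp_all add: C_def)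
    show "B * F l = sc (\<rho> l) (F l)" "G l * B = sc (\<rho> l) (G l)" if "l \<in> {2..<5}" for l using CF[of l] that by (simp_all add: C_def)
  qed (use FG in auto)
  then show thesis by (rule that)
qed

section \<open>Cocycles between simple pairs\<close>

lemma br_splittingD:
  assumes "br_splitting n A B \<rho> m F G"
  shows "A \<in> shp n n" "B \<in> shp n n"
    "l < 5 \<Longrightarrow> F l \<in> shp n (m l)" "l < 5 \<Longrightarrow> G l \<in> shp (m l) n" "l < 5 \<Longrightarrow> G l * F l = idm (m l)"
    "(\<Sum>l<2. F l * G l) = idm n" "(\<Sum>l\<in>{2..<5}. F l * G l) = idm n"
    "l < 2 \<Longrightarrow> A * F l = sc (\<rho> l) (F l)" "l < 2 \<Longrightarrow> G l * A = sc (\<rho> l) (G l)"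
    "l \<in> {2..<5} \<Longrightarrow> B * F l = sc (\<rho> l) (F l)" "l \<in> {2..<5} \<Longrightarrow> G l * B = sc (\<rho> l) (G l)"
  using assms unfolding br_splitting_def by simp_all

lemma sc_cancel: "sc a X = sc b X \<Longrightarrow> a \<noteq> b \<Longrightarrow> X = 0"
proof -
  assume "sc a X = sc b X" "a \<noteq> b"
  then have "sc (a - b) X = 0" "a - b \<noteq> 0" by (simp_all add: sc_diff_left)
  then show "X = 0" using sc_inverse[of "a - b" X 0] by (simp add: sc_simps)
qed

text \<open>The block between eigenspaces of different eigenvalues is multiplied by two different
  scalars on applying \<open>C' * X = X * C\<close>, so it is zero and only matching blocks
  remain.\<close>

lemma commuting_block_form:
  assumes F': "\<And>l. l \<in> \<Lambda> \<Longrightarrow> G' l * C' = sc (\<rho> l) (G' l)" and F: "\<And>l. l \<in> \<Lambda> \<Longrightarrow> C * F l = sc (\<rho> l) (F l)"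
    and sum': "(\<Sum>l\<in>\<Lambda>. F' l * G' l) = idm n'" and sum: "(\<Sum>l\<in>\<Lambda>. F l * G l) = idm n"
    and X: "X \<in> shp n' n" "C' * X = X * C" and inj: "inj_on \<rho> \<Lambda>" and fin: "finite \<Lambda>"
  shows "X = (\<Sum>l\<in>\<Lambda>. F' l * (G' l * X * F l) * G l)"
proof -
  have cross: "G' l * X * F k = 0" if "l \<in> \<Lambda>" "k \<in> \<Lambda>" "l \<noteq> k" for l k
  proof -
    have "sc (\<rho> l) (G' l * X * F k) = G' l * (C' * X) * F k"
      using F'[OF that(1)] by (simp add: mult.assoc[symmetric] sc_simps)
    also have "\<dots> = sc (\<rho> k) (G' l * X * F k)" unfolding X(2) using F[OF that(2)] by (simp add: mult.assoc sc_simps)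
    finally show ?thesis using that inj by (auto intro: sc_cancel dest: inj_onD)
  qed
  have "X = idm n' * X * idm n" using X(1) by simp
  also have "\<dots> = (\<Sum>l\<in>\<Lambda>. \<Sum>k\<in>\<Lambda>. F' l * (G' l * X * F k) * G k)"
    unfolding sum'[symmetric] sum[symmetric]
    by (simp add: sum_distrib_left sum_distrib_right mult.assoc) (rule sum.swap)
  also have "\<dots> = (\<Sum>l\<in>\<Lambda>. \<Sum>k\<in>\<Lambda>. if k = l then F' l * (G' l * X * F l) * G l else 0)"
    using cross by (intro sum.cong) auto
  also have "\<dots> = (\<Sum>l\<in>\<Lambda>. F' l * (G' l * X * F l) * G l)" using fin by simp
  finally show ?thesis .
qed

definition block_index :: "(nat \<Rightarrow> nat) \<Rightarrow> (nat \<Rightarrow> nat) \<Rightarrow> (nat \<times> nat \<times> nat) set" where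
  "block_index m' m = Sigma {..<5} (\<lambda>l. {..<m' l} \<times> {..<m l})"

text \<open>The rank-one matrix formed by column \<open>a\<close> of \<open>F' l\<close> and row
  \<open>b\<close> of \<open>G l\<close>: a matrix unit between matching eigenspaces, written as a
  vector indexed by matrix positions.\<close>

definition block_vec :: "(nat \<Rightarrow> fmat) \<Rightarrow> (nat \<Rightarrow> fmat) \<Rightarrow> nat \<times> nat \<times> nat \<Rightarrow> nat \<times> nat \<Rightarrow> complex" where
  "block_vec F' G = (\<lambda>(l, a, b) (x, y). ent (F' l) x a * ent (G l) b y)"

lemma finite_block_index [simp]: "finite (block_index m' m)"
  by (simp add: block_index_def)

lemma card_block_index: "card (block_index m' m) = (\<Sum>l<5. m' l * m l)"
  by (simp add: block_index_def card_cartesian_product)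

lemma block_sum:
  assumes F': "\<And>l. l < 5 \<Longrightarrow> F' l \<in> shp n' (m' l)" and G: "\<And>l. l < 5 \<Longrightarrow> G l \<in> shp (m l) n"
    and \<alpha>: "\<And>l. l < 5 \<Longrightarrow> \<alpha> l \<in> shp (m' l) (m l)"
  shows "ent (\<Sum>l<5. F' l * \<alpha> l * G l) x y =
    (\<Sum>i\<in>block_index m' m. (\<lambda>(l, a, b). ent (\<alpha> l) a b) i * block_vec F' G i (x, y))"
proof -
  have "ent (F' l * \<alpha> l * G l) x y = (\<Sum>(a, b)\<in>{..<m' l} \<times> {..<m l}. ent (\<alpha> l) a b * (ent (F' l) x a * ent (G l) b y))"
    if l: "l < 5" for l
  proof -
    have "ent (F' l * \<alpha> l * G l) x y = (\<Sum>b<m l. \<Sum>a<m' l. ent (\<alpha> l) a b * (ent (F' l) x a * ent (G l) b y))"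
      unfolding ent_mult[OF shp_mult[OF F'[OF l] \<alpha>[OF l]]] ent_mult[OF F'[OF l]]
      by (simp add: sum_distrib_left sum_distrib_right mult_ac)
    also have "\<dots> = (\<Sum>a<m' l. \<Sum>b<m l. ent (\<alpha> l) a b * (ent (F' l) x a * ent (G l) b y))" by (rule sum.swap)
    finally show ?thesis by (simp add: sum.cartesian_product)
  qed
  then have "ent (\<Sum>l<5. F' l * \<alpha> l * G l) x y =
      (\<Sum>l<5. \<Sum>(a, b)\<in>{..<m' l} \<times> {..<m l}. ent (\<alpha> l) a b * (ent (F' l) x a * ent (G l) b y))"
    unfolding ent_sum by (intro sum.cong) auto
  also have "\<dots> = (\<Sum>(l, p)\<in>block_index m' m. case p of (a, b) \<Rightarrow> ent (\<alpha> l) a b * (ent (F' l) x a * ent (G l) b y))"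
    unfolding block_index_def by (rule sum.Sigma) auto
  also have "\<dots> = (\<Sum>i\<in>block_index m' m. (\<lambda>(l, a, b). ent (\<alpha> l) a b) i * block_vec F' G i (x, y))"
    by (intro sum.cong) (auto simp: block_vec_def)
  finally show ?thesis .
qed

section \<open>Maps commuting with one generator\<close>

definition homs :: "nat \<Rightarrow> fmat \<Rightarrow> nat \<Rightarrow> fmat \<Rightarrow> fmat set" where
  "homs n C n' C' = {X \<in> shp n' n. C' * X = X * C}"

definition hom_zero :: "nat \<Rightarrow> fmat \<Rightarrow> fmat \<Rightarrow> nat \<Rightarrow> fmat \<Rightarrow> fmat \<Rightarrow> bool" where
  "hom_zero n A B n' A' B' \<longleftrightarrow> homs n A n' A' \<inter> homs n B n' B' \<subseteq> {0}"

text \<open>Surjectivity of Hom_A + Hom_B onto all linear maps. The cokernel classifies extensions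
  of the two representations on which A^2 = B^3 acts by the same scalar, as in the Mayer-Vietoris
  sequence of a free product.\<close>

definition homs_span :: "nat \<Rightarrow> fmat \<Rightarrow> fmat \<Rightarrow> nat \<Rightarrow> fmat \<Rightarrow> fmat \<Rightarrow> bool" where
  "homs_span n A B n' A' B' \<longleftrightarrow> (\<forall>Z\<in>shp n' n. \<exists>X\<in>homs n A n' A'. \<exists>Y\<in>homs n B n' B'. Z = X + Y)"

text \<open>Both splittings use the same roots \<open>\<rho>\<close>, so that eigenspaces of the two
  representations are matched index by index.\<close>

locale two_splittings =
  fixes n n' :: nat and A B A' B' :: fmat and \<rho> and m m' and F G F' G' and c
  assumes s: "br_splitting n A B \<rho> m F G" and s': "br_splitting n' A' B' \<rho> m' F' G'" and roots: "br_roots c \<rho>"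
begin

lemma block_hom:
  assumes "l < 2" "\<alpha> \<in> shp (m' l) (m l)"
  shows "F' l * \<alpha> * G l \<in> homs n A n' A'"
proof -
  have "A' * (F' l * \<alpha> * G l) = (A' * F' l) * \<alpha> * G l" "F' l * \<alpha> * G l * A = F' l * \<alpha> * (G l * A)"
    by (simp_all only: mult.assoc)
  then show ?thesis using assms br_splittingD(3,8)[OF s', of l] br_splittingD(4,9)[OF s, of l]
    unfolding homs_def by (auto simp: sc_simps intro!: shp_mult)
qed

lemma block_hom':
  assumes "l \<in> {2..<5}" "\<alpha> \<in> shp (m' l) (m l)"
  shows "F' l * \<alpha> * G l \<in> homs n B n' B'"
proof -
  have "B' * (F' l * \<alpha> * G l) = (B' * F' l) * \<alpha> * G l" "F' l * \<alpha> * G l * B = F' l * \<alpha> * (G l * B)"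
    by (simp_all only: mult.assoc)
  then show ?thesis using assms br_splittingD(3,10)[OF s', of l] br_splittingD(4,11)[OF s, of l]
    unfolding homs_def by (auto simp: sc_simps intro!: shp_mult)
qed

lemma homs_sum: "(\<And>i. i \<in> I \<Longrightarrow> f i \<in> homs n C n' C') \<Longrightarrow> (\<Sum>i\<in>I. f i) \<in> homs n C n' C'"
  unfolding homs_def by (auto simp: sum_distrib_left sum_distrib_right intro!: sum.cong)

lemma hom_form:
  assumes "X \<in> homs n A n' A'"
  shows "X = (\<Sum>l<2. F' l * (G' l * X * F l) * G l)"
  by (rule commuting_block_form[where n = n and n' = n' and C = A and C' = A' and \<rho> = \<rho>])
     (use assms roots br_splittingD[OF s] br_splittingD[OF s'] in \<open>auto simp: homs_def br_roots_def\<close>)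

lemma hom_form':
  assumes "X \<in> homs n B n' B'"
  shows "X = (\<Sum>l\<in>{2..<5}. F' l * (G' l * X * F l) * G l)"
  by (rule commuting_block_form[where n = n and n' = n' and C = B and C' = B' and \<rho> = \<rho>])
     (use assms roots br_splittingD[OF s] br_splittingD[OF s'] in \<open>auto simp: homs_def br_roots_def\<close>)

lemma sum5: "(\<Sum>l<5. f l) = (\<Sum>l<2. f l) + (\<Sum>l\<in>{2..<5}. f l)" for f :: "nat \<Rightarrow> 'a::comm_monoid_add"
  using sum.atLeastLessThan_concat[of 0 2 5 f] by (simp add: atLeast0LessThan)

lemma in_span:
  assumes X: "X \<in> homs n A n' A'" and Y: "Y \<in> homs n B n' B'"
  shows "\<exists>f. \<forall>x y. ent (X + Y) x y = (\<Sum>i\<in>block_index m' m. f i * block_vec F' G i (x, y))"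
proof -
  define \<alpha> where "\<alpha> l = (if l < 2 then G' l * X * F l else G' l * Y * F l)" for l
  have XY: "X \<in> shp n' n" "Y \<in> shp n' n" using X Y by (auto simp: homs_def)
  have "X + Y = (\<Sum>l<5. F' l * \<alpha> l * G l)"
    unfolding sum5 by (subst hom_form[OF X], subst hom_form'[OF Y]) (simp add: \<alpha>_def)
  moreover have "\<alpha> l \<in> shp (m' l) (m l)" if "l < 5" for l
    using br_splittingD(4)[OF s' that] br_splittingD(3)[OF s that] XY
    by (auto simp: \<alpha>_def intro: shp_mult)
  ultimately have "\<forall>x y. ent (X + Y) x y = (\<Sum>i\<in>block_index m' m. (\<lambda>(l, a, b). ent (\<alpha> l) a b) i * block_vec F' G i (x, y))"
    using block_sum[of F' n' m' G m n \<alpha>] br_splittingD(3)[OF s'] br_splittingD(4)[OF s] by simp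
  then show ?thesis by (rule exI[of _ "\<lambda>(l, a, b). ent (\<alpha> l) a b"])
qed

text \<open>Coefficients are turned into blocks of two commuting maps. The last clause reads the
  coefficients back from these blocks and later yields injectivity.\<close>

lemma span_homs:
  shows "\<exists>X\<in>homs n A n' A'. \<exists>Y\<in>homs n B n' B'.
    (\<forall>x y. ent (X + Y) x y = (\<Sum>i\<in>block_index m' m. f i * block_vec F' G i (x, y))) \<and>
    (\<forall>l<5. G' l * (if l < 2 then X else Y) * F l = fm (m' l) (m l) (\<lambda>a b. f (l, a, b)))"
proof -
  define \<alpha> where "\<alpha> l = fm (m' l) (m l) (\<lambda>a b. f (l, a, b))" for l
  define X where "X = (\<Sum>l<2. F' l * \<alpha> l * G l)"
  define Y where "Y = (\<Sum>l\<in>{2..<5}. F' l * \<alpha> l * G l)"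
  have \<alpha>: "\<alpha> l \<in> shp (m' l) (m l)" for l by (simp add: \<alpha>_def)
  have "X \<in> homs n A n' A'" "Y \<in> homs n B n' B'"
    unfolding X_def Y_def by (intro homs_sum block_hom block_hom' \<alpha>; simp)+
  moreover have "ent (X + Y) x y = (\<Sum>i\<in>block_index m' m. f i * block_vec F' G i (x, y))" for x y
  proof -
    have "X + Y = (\<Sum>l<5. F' l * \<alpha> l * G l)" by (simp add: sum5 X_def Y_def)
    then have "ent (X + Y) x y = (\<Sum>i\<in>block_index m' m. (\<lambda>(l, a, b). ent (\<alpha> l) a b) i * block_vec F' G i (x, y))"
      using block_sum[of F' n' m' G m n \<alpha>] br_splittingD(3)[OF s'] br_splittingD(4)[OF s] \<alpha> by simp
    also have "\<dots> = (\<Sum>i\<in>block_index m' m. f i * block_vec F' G i (x, y))"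
      by (intro sum.cong) (auto simp: block_index_def \<alpha>_def fm.rep_eq)
    finally show ?thesis .
  qed
  moreover have "G' l * (if l < 2 then X else Y) * F l = \<alpha> l" if l: "l < 5" for l
  proof -
    define \<Lambda> where "\<Lambda> = (if l < 2 then {..<2} else {2..<5::nat})"
    have \<Lambda>: "l \<in> \<Lambda>" "finite \<Lambda>" "\<Lambda> \<subseteq> {..<5}" using l by (auto simp: \<Lambda>_def)
    have orth: "G l * F k = 0 \<and> G' l * F' k = 0" if k: "k \<in> \<Lambda>" "k \<noteq> l" for k
    proof (cases "l < 2")
      case True
      then have kk: "k < 2" using k by (simp add: \<Lambda>_def)
      have ne: "\<rho> l \<noteq> \<rho> k" using roots kk True k(2) unfolding br_roots_def by (auto dest: inj_onD)
      have "sc (\<rho> l) (G l * F k) = sc (\<rho> k) (G l * F k)"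
        using br_splittingD(9)[OF s True] br_splittingD(8)[OF s kk] by (metis sc_simps(1,2) mult.assoc)
      moreover have "sc (\<rho> l) (G' l * F' k) = sc (\<rho> k) (G' l * F' k)"
        using br_splittingD(9)[OF s' True] br_splittingD(8)[OF s' kk] by (metis sc_simps(1,2) mult.assoc)
      ultimately show ?thesis using sc_cancel ne by blast
    next
      case False
      then have kk: "k \<in> {2..<5}" "l \<in> {2..<5}" using k l by (auto simp: \<Lambda>_def)
      have ne: "\<rho> l \<noteq> \<rho> k" using roots kk k(2) unfolding br_roots_def by (auto dest: inj_onD)
      have "sc (\<rho> l) (G l * F k) = sc (\<rho> k) (G l * F k)"
        using br_splittingD(11)[OF s kk(2)] br_splittingD(10)[OF s kk(1)] by (metis sc_simps(1,2) mult.assoc)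
      moreover have "sc (\<rho> l) (G' l * F' k) = sc (\<rho> k) (G' l * F' k)"
        using br_splittingD(11)[OF s' kk(2)] br_splittingD(10)[OF s' kk(1)] by (metis sc_simps(1,2) mult.assoc)
      ultimately show ?thesis using sc_cancel ne by blast
    qed
    have "G' l * (if l < 2 then X else Y) * F l = G' l * (\<Sum>k\<in>\<Lambda>. F' k * \<alpha> k * G k) * F l"
      by (simp add: \<Lambda>_def X_def Y_def)
    also have "\<dots> = (\<Sum>k\<in>\<Lambda>. (G' l * F' k) * \<alpha> k * (G k * F l))"
      by (simp add: sum_distrib_left sum_distrib_right mult.assoc)
    also have "\<dots> = (\<Sum>k\<in>\<Lambda>. if k = l then (G' l * F' l) * \<alpha> l * (G l * F l) else 0)"
      using orth by (intro sum.cong) auto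
    also have "\<dots> = \<alpha> l"
      using \<Lambda> br_splittingD(5)[OF s l] br_splittingD(5)[OF s' l] \<alpha>[of l] by simp
    finally show ?thesis .
  qed
  ultimately show ?thesis unfolding \<alpha>_def by blast
qed

lemma homs_span_iff:
  "homs_span n A B n' A' B' \<longleftrightarrow>
    (\<forall>y. \<exists>f. \<forall>j\<in>{..<n'} \<times> {..<n}. y j = (\<Sum>i\<in>block_index m' m. f i * block_vec F' G i j))"
proof
  assume span: "homs_span n A B n' A' B'"
  show "\<forall>y. \<exists>f. \<forall>j\<in>{..<n'} \<times> {..<n}. y j = (\<Sum>i\<in>block_index m' m. f i * block_vec F' G i j)"
  proof
    fix y :: "nat \<times> nat \<Rightarrow> complex"
    define Z where "Z = fm n' n (\<lambda>a b. y (a, b))"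
    obtain X Y where XY: "X \<in> homs n A n' A'" "Y \<in> homs n B n' B'" "Z = X + Y"
      using span unfolding homs_span_def Z_def by (meson shp_simps(6))
    obtain f where f: "\<forall>x y. ent (X + Y) x y = (\<Sum>i\<in>block_index m' m. f i * block_vec F' G i (x, y))"
      using in_span[OF XY(1,2)] by (elim exE)
    have "y j = (\<Sum>i\<in>block_index m' m. f i * block_vec F' G i j)" if "j \<in> {..<n'} \<times> {..<n}" for j
    proof -
      obtain a b where j: "j = (a, b)" "a < n'" "b < n" using \<open>j \<in> _\<close> by auto
      have "y j = ent Z a b" using j by (simp add: Z_def fm.rep_eq)
      then show ?thesis using f by (simp add: XY(3) j(1))
    qed
    then show "\<exists>f. \<forall>j\<in>{..<n'} \<times> {..<n}. y j = (\<Sum>i\<in>block_index m' m. f i * block_vec F' G i j)"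
      by (intro exI[of _ f] ballI)
  qed
next
  assume surj: "\<forall>y. \<exists>f. \<forall>j\<in>{..<n'} \<times> {..<n}. y j = (\<Sum>i\<in>block_index m' m. f i * block_vec F' G i j)"
  show "homs_span n A B n' A' B'"
    unfolding homs_span_def
  proof
    fix Z assume Z: "Z \<in> shp n' n"
    obtain f where f: "\<forall>j\<in>{..<n'} \<times> {..<n}. (\<lambda>(a, b). ent Z a b) j = (\<Sum>i\<in>block_index m' m. f i * block_vec F' G i j)"
      using surj[THEN spec, of "\<lambda>(a, b). ent Z a b"] by (elim exE)
    obtain X Y where XY: "X \<in> homs n A n' A'" "Y \<in> homs n B n' B'"
        "\<forall>x y. ent (X + Y) x y = (\<Sum>i\<in>block_index m' m. f i * block_vec F' G i (x, y))"
      using span_homs[of f] by (elim bexE conjE)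
    have XYs: "X + Y \<in> shp n' n" using XY(1,2) by (auto simp: homs_def)
    have "Z = X + Y"
    proof (rule fmat_eqI)
      fix a b
      show "ent Z a b = ent (X + Y) a b"
      proof (cases "a < n' \<and> b < n")
        case True
        then show ?thesis using bspec[OF f, of "(a, b)"] XY(3) by simp
      next
        case False
        then show ?thesis using ent_shp[OF Z False] ent_shp[OF XYs False] by simp
      qed
    qed
    then show "\<exists>X\<in>homs n A n' A'. \<exists>Y\<in>homs n B n' B'. Z = X + Y" using XY(1,2) by blast
  qed
qed

text \<open>A relation among the matrix units says \<open>X + Y = 0\<close> with \<open>X\<close>
  commuting with the first generators and \<open>Y\<close> with the second. Then
  \<open>X = - Y\<close> commutes with both and is zero, and so are its blocks.\<close>

lemma hom_zero_injective:
  assumes hz: "hom_zero n A B n' A' B'"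
    and f: "\<forall>j\<in>{..<n'} \<times> {..<n}. (\<Sum>i\<in>block_index m' m. f i * block_vec F' G i j) = 0"
  shows "\<forall>i\<in>block_index m' m. f i = 0"
proof
  obtain X Y where XY: "X \<in> homs n A n' A'" "Y \<in> homs n B n' B'"
    and e: "\<forall>x y. ent (X + Y) x y = (\<Sum>i\<in>block_index m' m. f i * block_vec F' G i (x, y))"
    and \<alpha>: "\<forall>l<5. G' l * (if l < 2 then X else Y) * F l = fm (m' l) (m l) (\<lambda>a b. f (l, a, b))"
    using span_homs[of f] by (elim bexE conjE)
  have XYs: "X + Y \<in> shp n' n" using XY by (auto simp: homs_def)
  have "X + Y = 0"
  proof (rule fmat_eqI)
    fix a b
    show "ent (X + Y) a b = ent 0 a b"
      using e f ent_shp[OF XYs, of a b] by (cases "a < n' \<and> b < n") auto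
  qed
  then have YX: "Y = - X" by (simp add: eq_neg_iff_add_eq_0 add.commute)
  then have "X \<in> homs n B n' B'" using XY(2) by (simp add: homs_def) (metis minus_minus shp_simps(4))
  then have "X = 0" using hz XY(1) unfolding hom_zero_def by blast
  then have z: "X = 0" "Y = 0" using YX by simp_all
  fix i assume i: "i \<in> block_index m' m"
  then obtain l a b where i': "i = (l, a, b)" "l < 5" "a < m' l" "b < m l" by (auto simp: block_index_def)
  have "fm (m' l) (m l) (\<lambda>a b. f (l, a, b)) = 0" using \<alpha>[THEN spec, of l] i'(2) unfolding z by simp
  then have "ent (fm (m' l) (m l) (\<lambda>a b. f (l, a, b))) a b = 0" by simp
  then show "f i = 0" using i' by (simp add: fm.rep_eq)
qed

text \<open>A functional that vanishes on the span but not everywhere, written as the trace pairing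
  with a matrix; hence the transposed indices in its definition.\<close>

lemma obstruction:
  assumes "\<not> homs_span n A B n' A' B'"
  obtains N where "N \<in> shp n n'" "N \<noteq> 0" "\<And>X. X \<in> homs n A n' A' \<Longrightarrow> trc (N * X) = 0"
    "\<And>Y. Y \<in> homs n B n' B' \<Longrightarrow> trc (N * Y) = 0"
proof -
  define J where "J = {..<n'} \<times> {..<n}"
  obtain y where y: "\<nexists>f. \<forall>j\<in>J. y j = (\<Sum>i\<in>block_index m' m. f i * block_vec F' G i j)"
    using assms unfolding homs_span_iff J_def by blast
  obtain \<eta> where \<eta>: "\<forall>i\<in>block_index m' m. (\<Sum>j\<in>J. \<eta> j * block_vec F' G i j) = 0" "(\<Sum>j\<in>J. \<eta> j * y j) \<noteq> 0"
    using annihilating_functional[OF _ _ y] by (auto simp: J_def)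
  define N where "N = fm n n' (\<lambda>b a. \<eta> (a, b))"
  have N: "N \<in> shp n n'" by (simp add: N_def)
  have tr: "trc (N * X) = (\<Sum>j\<in>J. \<eta> j * (case j of (a, b) \<Rightarrow> ent X a b))" if X: "X \<in> shp n' n" for X
  proof -
    have "trc (N * X) = (\<Sum>b<n. \<Sum>a<n'. \<eta> (a, b) * ent X a b)"
      by (simp add: trc_eq[OF shp_mult[OF N X]] ent_mult[OF N]) (simp add: N_def fm.rep_eq)
    also have "\<dots> = (\<Sum>a<n'. \<Sum>b<n. \<eta> (a, b) * ent X a b)" by (rule sum.swap)
    also have "\<dots> = (\<Sum>j\<in>J. \<eta> j * (case j of (a, b) \<Rightarrow> ent X a b))"
      unfolding J_def sum.cartesian_product by (intro sum.cong) auto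
    finally show ?thesis .
  qed
  have zero: "trc (N * (X + Y)) = 0" if XY: "X \<in> homs n A n' A'" "Y \<in> homs n B n' B'" for X Y
  proof -
    obtain f where f: "\<forall>x y. ent (X + Y) x y = (\<Sum>i\<in>block_index m' m. f i * block_vec F' G i (x, y))"
      using in_span[OF XY] by (elim exE)
    have "X + Y \<in> shp n' n" using XY by (auto simp: homs_def)
    from tr[OF this] have "trc (N * (X + Y)) = (\<Sum>j\<in>J. \<Sum>i\<in>block_index m' m. f i * (\<eta> j * block_vec F' G i j))"
      using f by (auto simp: sum_distrib_left mult_ac intro!: sum.cong)
    also have "\<dots> = (\<Sum>i\<in>block_index m' m. \<Sum>j\<in>J. f i * (\<eta> j * block_vec F' G i j))" by (rule sum.swap)
    also have "\<dots> = 0" using \<eta>(1) by (simp add: sum_distrib_left[symmetric])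
    finally show ?thesis .
  qed
  have h0: "0 \<in> homs n C n' C'" for C C' by (simp add: homs_def)
  have "N \<noteq> 0"
  proof
    assume N0: "N = 0"
    have "\<eta> j = 0" if "j \<in> J" for j
    proof -
      obtain a b where j: "j = (a, b)" "a < n'" "b < n" using \<open>j \<in> J\<close> by (auto simp: J_def)
      have "ent N b a = \<eta> (a, b)" using j by (simp add: N_def fm.rep_eq)
      then show ?thesis using N0 j by simp
    qed
    then show False using \<eta>(2) by simp
  qed
  then show thesis using that[OF N] zero[OF _ h0] zero[OF h0] by simp
qed

end

text \<open>Spanning in one direction bounds \<open>n * n'\<close> by the number of matching blocks,
  which is symmetric in the two representations. In the other direction the block map is injective
  by \<open>hom_zero\<close>, so the same bound makes it surjective.\<close>

lemma homs_span_sym: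
  assumes t: "two_splittings n n' A B A' B' \<rho> m m' F G F' G' c"
    and hz: "hom_zero n' A' B' n A B" and span: "homs_span n A B n' A' B'"
  shows "homs_span n' A' B' n A B"
proof -
  interpret t: two_splittings n n' A B A' B' \<rho> m m' F G F' G' c by (rule t)
  interpret t': two_splittings n' n A' B' A B \<rho> m' m F' G' F G c
    using t.s t.s' t.roots by unfold_locales
  have "card ({..<n'} \<times> {..<n}) \<le> card (block_index m' m)"
    using span unfolding t.homs_span_iff by (intro surjective_card_le[where v = "block_vec F' G"]) (simp, simp, erule spec)
  then have card: "card ({..<n} \<times> {..<n'}) \<le> card (block_index m m')"
    by (simp add: card_block_index card_cartesian_product mult.commute)
  show ?thesis unfolding t'.homs_span_iff
    by (rule allI, rule injective_imp_surjective[OF _ _ card], simp, simp, rule t'.hom_zero_injective[OF hz])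
qed

text \<open>Two consequences of irreducibility suffice for the cocycle computations: Schur's lemma,
  and the absence of common eigenvectors in dimension at least two.\<close>

definition simple_pair :: "nat \<Rightarrow> fmat \<Rightarrow> fmat \<Rightarrow> bool" where
  "simple_pair n A B \<longleftrightarrow> 0 < n \<and> A \<in> shp n n \<and> B \<in> shp n n \<and>
     (\<forall>X\<in>homs n A n A \<inter> homs n B n B. \<exists>c. X = sc c (idm n)) \<and>
     (2 \<le> n \<longrightarrow> (\<forall>v\<in>shp n 1. \<forall>a b. A * v = sc a v \<longrightarrow> B * v = sc b v \<longrightarrow> v = 0))"

text \<open>
  The eigenspaces of \<open>A\<close> and of \<open>B\<close> on a simple pair of size at least two intersect trivially. This bounds
  the sum of the dimensions of the two commutants by \<open>n\<^sup>2\<close>, and they meet in the scalars.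
\<close>

lemma squares_bound:
  fixes a b x y z n :: nat
  assumes "a + b = n" "x + y + z = n" "x \<le> a" "x \<le> b" "y \<le> a" "y \<le> b" "z \<le> a" "z \<le> b"
  shows "a * a + b * b + x * x + y * y + z * z \<le> n * n"
proof -
  \<comment> \<open>All of \<open>x\<close>, \<open>y\<close>, \<open>z\<close> are at most the
    minimum of \<open>a\<close> and \<open>b\<close>, so the sum of their squares is at most
    \<open>k * n = k * a + k * b\<close>, which is bounded by \<open>2 * a * b\<close>.\<close>
  define k where "k = min a b"
  have "x * x + y * y + z * z \<le> k * x + k * y + k * z"
    using assms by (intro add_mono mult_right_mono) (auto simp: k_def)
  also have "\<dots> = k * a + k * b" using assms(1,2) by (simp add: distrib_left[symmetric])
  also have "\<dots> \<le> b * a + a * b" by (intro add_mono mult_right_mono) (auto simp: k_def)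
  finally show ?thesis using assms(1) by (auto simp: algebra_simps)
qed

text \<open>There are at most \<open>n * n\<close> matrix units, so spanning would make them
  independent. But the identity is a combination of those for \<open>A\<close> and also of those for
  \<open>B\<close>, which is a nontrivial relation.\<close>

lemma not_homs_span_self:
  assumes sp: "simple_pair n A B" and n: "2 \<le> n"
    and s: "br_splitting n A B \<rho> m F G" and roots: "br_roots c \<rho>"
  shows "\<not> homs_span n A B n A B"
proof
  assume span: "homs_span n A B n A B"
  interpret t: two_splittings n n A B A B \<rho> m m F G F G c using s roots by unfold_locales
  have AB: "A \<in> shp n n" "B \<in> shp n n" using sp by (auto simp: simple_pair_def)
  \<comment> \<open>Traces turn the resolutions of the identity into dimension counts.\<close>
  have tr: "of_nat (\<Sum>l\<in>\<Lambda>. m l) = (of_nat n :: complex)" if "(\<Sum>l\<in>\<Lambda>. F l * G l) = idm n" "\<Lambda> \<subseteq> {..<5}" for \<Lambda>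
  proof -
    have tid: "trc (idm k) = of_nat k" for k by (simp add: trc_eq[of _ k] idm.rep_eq)
    have "of_nat n = trc (\<Sum>l\<in>\<Lambda>. F l * G l)" using that(1) tid by simp
    also have "\<dots> = (\<Sum>l\<in>\<Lambda>. of_nat (m l))"
      unfolding trc_sum using that(2) br_splittingD(5)[OF s] by (intro sum.cong) (auto simp: trc_mult[of "F _"] tid)
    finally show ?thesis by simp
  qed
  have ab: "m 0 + m 1 = n"
    using tr[OF br_splittingD(6)[OF s]] by (simp only: of_nat_eq_iff) (simp add: numeral_2_eq_2)
  have xyz: "m 2 + m 3 + m 4 = n"
  proof -
    have "{2..<5} = {2, 3, 4::nat}" by auto
    then show ?thesis using tr[OF br_splittingD(7)[OF s]] by (simp only: of_nat_eq_iff) (simp add: add.assoc)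
  qed
  \<comment> \<open>If two eigenspaces had total dimension above \<open>n\<close>, a dependency
    between them would give a common eigenvector of \<open>A\<close> and \<open>B\<close>.\<close>
  have le: "m l + m k \<le> n" if l: "l < 2" and k: "k \<in> {2..<5}" for l k
  proof (rule ccontr)
    assume "\<not> m l + m k \<le> n"
    have l5: "l < 5" "k < 5" using l k by auto
    define w where "w i x = (if i < m l then ent (F l) x i else ent (F k) x (i - m l))" for i x
    obtain f where f: "\<exists>i\<in>{..<m l + m k}. f i \<noteq> 0" "\<forall>x\<in>{..<n}. (\<Sum>i<m l + m k. f i * w i x) = 0"
      using nontrivial_solution[of "{..<n}" "{..<m l + m k}" w] \<open>\<not> m l + m k \<le> n\<close> by auto
    define \<alpha> where "\<alpha> = fm (m l) 1 (\<lambda>i _. f i)"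
    define \<beta> where "\<beta> = fm (m k) 1 (\<lambda>i _. f (m l + i))"
    have sh: "\<alpha> \<in> shp (m l) 1" "\<beta> \<in> shp (m k) 1" by (simp_all add: \<alpha>_def \<beta>_def)
    have vs: "F l * \<alpha> \<in> shp n 1" "F k * \<beta> \<in> shp n 1"
      using br_splittingD(3)[OF s] l5 sh by (auto intro: shp_mult)
    have eq: "F l * \<alpha> + F k * \<beta> = 0"
    proof (rule fmat_eqI)
      fix x j
      show "ent (F l * \<alpha> + F k * \<beta>) x j = ent 0 x j"
      proof (cases "x < n \<and> j < 1")
        case True
        have "(\<Sum>i<m l + m k. f i * w i x) = (\<Sum>i<m l. f i * ent (F l) x i) + (\<Sum>i<m k. f (m l + i) * ent (F k) x i)"
          unfolding sum_lessThan_add by (simp add: w_def)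
        then show ?thesis using f(2) True
          by (simp add: ent_mult[OF br_splittingD(3)[OF s l5(1)]] ent_mult[OF br_splittingD(3)[OF s l5(2)]]
              \<alpha>_def \<beta>_def fm.rep_eq mult.commute)
      next
        case False
        then show ?thesis using ent_shp[OF vs(1) False] ent_shp[OF vs(2) False] by simp
      qed
    qed
    then have lk: "F l * \<alpha> = - (F k * \<beta>)" by (simp add: eq_neg_iff_add_eq_0)
    have "A * (F l * \<alpha>) = sc (\<rho> l) (F l * \<alpha>)"
      using br_splittingD(8)[OF s l] by (simp add: mult.assoc[symmetric] sc_simps)
    moreover have "B * (F l * \<alpha>) = sc (\<rho> k) (F l * \<alpha>)"
      using br_splittingD(10)[OF s k] by (simp add: lk mult.assoc[symmetric] sc_simps)
    ultimately have v0: "F l * \<alpha> = 0" using sp n vs(1) unfolding simple_pair_def by blast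
    have "\<alpha> = G l * (F l * \<alpha>)" using br_splittingD(5)[OF s l5(1)] sh by (simp add: mult.assoc[symmetric])
    then have "\<alpha> = 0" by (simp add: v0)
    have "\<beta> = G k * (F k * \<beta>)" using br_splittingD(5)[OF s l5(2)] sh by (simp add: mult.assoc[symmetric])
    then have "\<beta> = 0" using v0 lk by simp
    have "f i = 0" if "i < m l + m k" for i
    proof (cases "i < m l")
      case True
      then have "f i = ent \<alpha> i 0" by (simp add: \<alpha>_def fm.rep_eq)
      then show ?thesis by (simp add: \<open>\<alpha> = 0\<close>)
    next
      case False
      then have "f i = ent \<beta> (i - m l) 0" using that by (simp add: \<beta>_def fm.rep_eq)
      then show ?thesis by (simp add: \<open>\<beta> = 0\<close>)
    qed
    then show False using f(1) by auto
  qed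
  have "m 0 * m 0 + m 1 * m 1 + m 2 * m 2 + m 3 * m 3 + m 4 * m 4 \<le> n * n"
    using ab xyz le[of 0 2] le[of 0 3] le[of 0 4] le[of 1 2] le[of 1 3] le[of 1 4]
    by (intro squares_bound) auto
  then have card: "card (block_index m m) \<le> card ({..<n} \<times> {..<n})"
    by (simp add: card_block_index card_cartesian_product eval_nat_numeral)
  \<comment> \<open>The coefficients of the relation \<open>idm n - idm n = 0\<close>: plus one on
    the eigenspaces of \<open>A\<close>, minus one on those of \<open>B\<close>.\<close>
  define f where "f = (\<lambda>(l, a :: nat, b). if a = b then (if l < (2::nat) then 1 else - 1) else (0::complex))"
  have f0: "\<forall>j\<in>{..<n} \<times> {..<n}. (\<Sum>i\<in>block_index m m. f i * block_vec F G i j) = 0"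
  proof
    fix j assume "j \<in> {..<n} \<times> {..<n}"
    then obtain x y where j: "j = (x, y)" by auto
    define \<alpha> where "\<alpha> l = sc (if l < (2::nat) then 1 else - 1) (idm (m l))" for l
    have F\<alpha>G: "F l * \<alpha> l * G l = (if l < 2 then F l * G l else - (F l * G l))" if "l < 5" for l
    proof -
      have "F l * \<alpha> l * G l = sc (if l < 2 then 1 else - 1) (F l * G l)"
        using idm_left[OF br_splittingD(4)[OF s that]] by (simp add: \<alpha>_def sc_simps mult.assoc)
      then show ?thesis by (auto intro: fmat_eqI)
    qed
    have "(\<Sum>l<5. F l * \<alpha> l * G l) = (\<Sum>l<2. F l * G l) + (\<Sum>l\<in>{2..<5}. - (F l * G l))"
      unfolding t.sum5 by (intro arg_cong2[of _ _ _ _ "(+)"] sum.cong) (simp_all add: F\<alpha>G)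
    also have "\<dots> = 0" by (simp add: sum_negf br_splittingD(6,7)[OF s])
    finally have "0 = (\<Sum>i\<in>block_index m m. (\<lambda>(l, a, b). ent (\<alpha> l) a b) i * block_vec F G i (x, y))"
      using block_sum[of F n m G m n \<alpha>] br_splittingD(3,4)[OF s] by (simp add: \<alpha>_def)
    also have "\<dots> = (\<Sum>i\<in>block_index m m. f i * block_vec F G i (x, y))"
      by (intro sum.cong) (auto simp: \<alpha>_def f_def idm.rep_eq block_index_def split: if_splits)
    finally show "(\<Sum>i\<in>block_index m m. f i * block_vec F G i j) = 0" by (simp add: j)
  qed
  have "0 < m 0 \<or> 0 < m 1" using ab n by auto
  then obtain l where l: "l < 2" "0 < m l" by (metis one_less_numeral_iff pos2 semiring_norm(76))
  then have "(l, 0, 0) \<in> block_index m m" by (auto simp: block_index_def)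
  then have "f (l, 0, 0) = 0"
    by (rule surjective_imp_injective[OF _ _ card span[unfolded t.homs_span_iff, THEN spec] f0, rotated 2]) simp_all
  then show False using l by (simp add: f_def)
qed

text \<open>\<open>(X, Y)\<close> is the off-diagonal part of an extension of the first
  representation by the second. The equation is the linearised \<open>A\<^sup>2 = B\<^sup>3\<close>,
  and an inner pair is one removed by a change of splitting.\<close>

definition cocycles_inner :: "nat \<Rightarrow> fmat \<Rightarrow> fmat \<Rightarrow> nat \<Rightarrow> fmat \<Rightarrow> fmat \<Rightarrow> bool" where
  "cocycles_inner n A B n' A' B' \<longleftrightarrow> (\<forall>X\<in>shp n' n. \<forall>Y\<in>shp n' n.
     A' * X + X * A = B' * B' * Y + B' * Y * B + Y * B * B \<longrightarrow>
     (\<exists>G\<in>shp n' n. X = A' * G - G * A \<and> Y = B' * G - G * B))"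

text \<open>The commutator with the common value \<open>L\<close> of both sides gives
  \<open>c' - c\<close> times \<open>X\<close> and times \<open>Y\<close>, so \<open>L\<close>
  divided by that difference is the required \<open>G\<close>.\<close>

lemma cocycles_inner_distinct:
  assumes sh: "A \<in> shp n n" "B \<in> shp n n" "A' \<in> shp n' n'" "B' \<in> shp n' n'"
    and c: "A * A = sc c (idm n)" "B * B * B = sc c (idm n)" "A' * A' = sc c' (idm n')" "B' * B' * B' = sc c' (idm n')"
    and ne: "c \<noteq> c'"
  shows "cocycles_inner n A B n' A' B'"
  unfolding cocycles_inner_def
proof (intro ballI impI)
  fix X Y assume X: "X \<in> shp n' n" and Y: "Y \<in> shp n' n"
    and eq: "A' * X + X * A = B' * B' * Y + B' * Y * B + Y * B * B"
  define L where "L = A' * X + X * A"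
  have L: "L \<in> shp n' n" unfolding L_def using sh X by (auto intro!: shp_simps shp_mult)
  have "A' * L - L * A = (A' * A') * X - X * (A * A)" by (simp add: L_def algebra_simps)
  also have "\<dots> = sc (c' - c) X" using X by (simp add: c sc_simps sc_diff_left)
  finally have 1: "A' * L - L * A = sc (c' - c) X" .
  have "B' * L - L * B = (B' * B' * B') * Y - Y * (B * B * B)" by (simp add: L_def eq algebra_simps)
  also have "\<dots> = sc (c' - c) Y" using Y by (simp add: c sc_simps sc_diff_left)
  finally have 2: "B' * L - L * B = sc (c' - c) Y" .
  define G where "G = sc (1 / (c' - c)) L"
  have "G \<in> shp n' n" using L by (simp add: G_def)
  moreover have "A' * G - G * A = sc (1 / (c' - c)) (A' * L - L * A)" "B' * G - G * B = sc (1 / (c' - c)) (B' * L - L * B)"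
    by (simp_all add: G_def sc_simps)
  then have "X = A' * G - G * A" "Y = B' * G - G * B" using ne by (simp_all add: 1 2 sc_simps)
  ultimately show "\<exists>G\<in>shp n' n. X = A' * G - G * A \<and> Y = B' * G - G * B" by blast
qed

text \<open>Averaging over a square root: \<open>A' * X\<close> divided by \<open>2 * c\<close> is a
  solution, because anticommutation turns its commutator into \<open>2 * c\<close> times
  \<open>X\<close>.\<close>

lemma anticommuting_inner:
  assumes c: "c \<noteq> 0" and X: "X \<in> shp n' n" and sh: "A \<in> shp n n" "A' \<in> shp n' n'"
    and sq: "A * A = sc c (idm n)" "A' * A' = sc c (idm n')" and eq: "A' * X + X * A = 0"
  obtains G where "G \<in> shp n' n" "X = A' * G - G * A"
proof -
  define G where "G = sc (1 / (2 * c)) (A' * X)"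
  have G: "G \<in> shp n' n" unfolding G_def using X sh by (auto intro!: shp_simps shp_mult)
  have AX: "A' * X = - (X * A)" using eq by (simp add: eq_neg_iff_add_eq_0)
  have XA: "A' * X * A = - (X * (A * A))" by (simp add: AX mult.assoc)
  have "A' * (A' * X) - A' * X * A = (A' * A') * X + X * (A * A)"
    unfolding XA by (simp add: mult.assoc)
  also have "\<dots> = sc (2 * c) X" using X by (simp add: sq sc_simps) (rule fmat_eqI, simp)
  finally have "A' * (A' * X) - A' * X * A = sc (2 * c) X" .
  then have "A' * G - G * A = sc (1 / (2 * c)) (sc (2 * c) X)" by (simp add: G_def sc_simps flip: sc_simps(5))
  then have "X = A' * G - G * A" using c by (simp add: sc_simps)
  then show thesis using that G by blast
qed

text \<open>The cubic analogue of averaging. The commutator of \<open>P\<close> with the pair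
  \<open>B', B\<close> is the left side of the hypothesis times \<open>B\<close>, minus three times
  \<open>Y * B * B * B\<close>.\<close>

lemma cube_root_inner:
  assumes c: "c \<noteq> 0" and Y: "Y \<in> shp n' n" and sh: "B \<in> shp n n" "B' \<in> shp n' n'"
    and cu: "B * B * B = sc c (idm n)" and eq: "B' * B' * Y + B' * Y * B + Y * B * B = 0"
  obtains H where "H \<in> shp n' n" "Y = B' * H - H * B"
proof -
  define P where "P = B' * Y * B + Y * B * B + Y * B * B"
  define H where "H = sc (- 1 / (3 * c)) P"
  have P: "P \<in> shp n' n" unfolding P_def using Y sh by (auto intro!: shp_simps shp_mult)
  have "B' * P - P * B = (B' * B' * Y + B' * Y * B + Y * B * B) * B - (Y * (B * B * B) + Y * (B * B * B) + Y * (B * B * B))"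
    by (simp add: P_def algebra_simps)
  also have "\<dots> = sc (- (3 * c)) Y" using Y by (simp add: eq cu sc_simps) (rule fmat_eqI, simp)
  finally have BP: "B' * P - P * B = sc (- (3 * c)) Y" .
  have "B' * H - H * B = sc (- 1 / (3 * c)) (B' * P - P * B)" by (simp add: H_def sc_simps)
  also have "\<dots> = Y" using c by (simp add: BP sc_simps)
  finally show thesis using that[of H] P by (simp add: H_def)
qed

text \<open>The common value \<open>L\<close> intertwines both generators, so it vanishes and
  \<open>X\<close>, \<open>Y\<close> are inner separately, via \<open>G\<close> and
  \<open>H\<close>; splitting \<open>G - H\<close> as a sum of commuting maps makes the two choices
  agree. Conversely, every \<open>Z\<close> gives the cocycle formed by its commutator with the
  first generators and zero.\<close>

lemma cocycles_inner_iff: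
  assumes c: "c \<noteq> 0" and sh: "A \<in> shp n n" "B \<in> shp n n" "A' \<in> shp n' n'" "B' \<in> shp n' n'"
    and sq: "A * A = sc c (idm n)" "B * B * B = sc c (idm n)" "A' * A' = sc c (idm n')" "B' * B' * B' = sc c (idm n')"
    and hz: "hom_zero n A B n' A' B'"
  shows "cocycles_inner n A B n' A' B' \<longleftrightarrow> homs_span n A B n' A' B'"
proof
  assume inner: "cocycles_inner n A B n' A' B'"
  show "homs_span n A B n' A' B'"
    unfolding homs_span_def
  proof
    fix Z assume Z: "Z \<in> shp n' n"
    define X where "X = A' * Z - Z * A"
    have X: "X \<in> shp n' n" unfolding X_def using sh Z by (auto intro!: shp_simps shp_mult)
    have "A' * X + X * A = (A' * A') * Z - Z * (A * A)" by (simp add: X_def algebra_simps)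
    then have "A' * X + X * A = B' * B' * 0 + B' * 0 * B + 0 * B * B" using Z by (simp add: sq sc_simps)
    then obtain G where G: "G \<in> shp n' n" "X = A' * G - G * A" "0 = B' * G - G * B"
      using inner X shp_simps(1) unfolding cocycles_inner_def by blast
    have "Z - G \<in> homs n A n' A'" using G(1,2) Z by (simp add: homs_def X_def algebra_simps)
    moreover have "G \<in> homs n B n' B'" using G by (simp add: homs_def)
    ultimately show "\<exists>X\<in>homs n A n' A'. \<exists>Y\<in>homs n B n' B'. Z = X + Y" by (intro bexI[of _ "Z - G"] bexI[of _ G]) simp_all
  qed
next
  assume span: "homs_span n A B n' A' B'"
  show "cocycles_inner n A B n' A' B'"
    unfolding cocycles_inner_def
  proof (intro ballI impI)
    fix X Y assume X: "X \<in> shp n' n" and Y: "Y \<in> shp n' n"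
      and eq: "A' * X + X * A = B' * B' * Y + B' * Y * B + Y * B * B"
    define L where "L = A' * X + X * A"
    have L: "L \<in> shp n' n" unfolding L_def using sh X by (auto intro!: shp_simps shp_mult)
    have "A' * L - L * A = (A' * A') * X - X * (A * A)" by (simp add: L_def algebra_simps)
    then have 1: "A' * L = L * A" using X by (simp add: sq sc_simps)
    have "B' * L - L * B = (B' * B' * B') * Y - Y * (B * B * B)" by (simp add: L_def eq algebra_simps)
    then have 2: "B' * L = L * B" using Y by (simp add: sq sc_simps)
    have L0: "L = 0" using hz L 1 2 unfolding hom_zero_def homs_def by blast
    obtain G where G: "G \<in> shp n' n" "X = A' * G - G * A"
      by (rule anticommuting_inner[OF c X sh(1,3) sq(1,3)]) (use L0 in \<open>simp add: L_def\<close>)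
    obtain H where H: "H \<in> shp n' n" "Y = B' * H - H * B"
      by (rule cube_root_inner[OF c Y sh(2,4) sq(2)]) (use L0 in \<open>simp add: L_def eq\<close>)
    obtain P Q where PQ: "P \<in> homs n A n' A'" "Q \<in> homs n B n' B'" "G - H = P + Q"
      using span G(1) H(1) unfolding homs_span_def by blast
    have GP: "G - P = H + Q" using PQ(3) by (simp add: algebra_simps)
    have "G - P \<in> shp n' n" using G(1) PQ(1) by (simp add: homs_def)
    moreover have "X = A' * (G - P) - (G - P) * A" using PQ(1) G(2) by (simp add: homs_def algebra_simps)
    moreover have "Y = B' * (G - P) - (G - P) * B" unfolding GP using PQ(2) H(2) by (simp add: homs_def algebra_simps)
    ultimately show "\<exists>G\<in>shp n' n. X = A' * G - G * A \<and> Y = B' * G - G * B" by blast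
  qed
qed

text \<open>Here \<open>L\<close> is a scalar \<open>k\<close> by Schur's lemma. Subtracting the
  derivative of (t^3 A, t^2 B), with t = k/(6c), removes it, and the remaining components are inner
  one at a time.\<close>

lemma self_cocycle:
  assumes sp: "simple_pair n A B" and c: "c \<noteq> 0" and sq: "A * A = sc c (idm n)" "B * B * B = sc c (idm n)"
    and X: "X \<in> shp n n" and Y: "Y \<in> shp n n"
    and eq: "A * X + X * A = B * B * Y + B * Y * B + Y * B * B"
  obtains t H K where "H \<in> shp n n" "K \<in> shp n n" "X = sc (3 * t) A + (H * A - A * H)" "Y = sc (2 * t) B + (K * B - B * K)"
proof -
  have sh: "A \<in> shp n n" "B \<in> shp n n" using sp by (auto simp: simple_pair_def)
  define L where "L = A * X + X * A"
  have L: "L \<in> shp n n" unfolding L_def using sh X by (auto intro!: shp_simps shp_mult)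
  have "A * L - L * A = (A * A) * X - X * (A * A)" by (simp add: L_def algebra_simps)
  then have 1: "A * L = L * A" using X by (simp add: sq sc_simps)
  have "B * L - L * B = (B * B * B) * Y - Y * (B * B * B)" by (simp add: L_def eq algebra_simps)
  then have 2: "B * L = L * B" using Y by (simp add: sq sc_simps)
  have "L \<in> homs n A n A \<inter> homs n B n B" using L 1 2 by (simp add: homs_def)
  then obtain k where k: "L = sc k (idm n)" using sp unfolding simple_pair_def by blast
  define X' where "X' = X - sc (k / (2 * c)) A"
  define Y' where "Y' = Y - sc (k / (3 * c)) B"
  have sh': "X' \<in> shp n n" "Y' \<in> shp n n" using X Y sh by (simp_all add: X'_def Y'_def)
  have "A * X' + X' * A = L - sc (k / (2 * c)) (A * A + A * A)" by (simp add: X'_def L_def algebra_simps sc_simps)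
  also have "\<dots> = 0" unfolding k sq using c by (intro fmat_eqI) (simp add: field_simps)
  finally have X'0: "A * X' + X' * A = 0" .
  have "B * B * Y' + B * Y' * B + Y' * B * B = L - sc (k / (3 * c)) (B * B * B + B * B * B + B * B * B)"
    by (simp add: Y'_def L_def eq algebra_simps sc_simps)
  also have "\<dots> = 0" unfolding k sq using c by (intro fmat_eqI) (simp add: field_simps)
  finally have Y'0: "B * B * Y' + B * Y' * B + Y' * B * B = 0" .
  obtain H where H: "H \<in> shp n n" "X' = A * H - H * A"
    by (rule anticommuting_inner[OF c sh'(1) sh(1,1) sq(1,1) X'0])
  obtain K where K: "K \<in> shp n n" "Y' = B * K - K * B"
    by (rule cube_root_inner[OF c sh'(2) sh(2,2) sq(2) Y'0])
  have "X = sc (3 * (k / (6 * c))) A + ((- H) * A - A * (- H))"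
    using H(2) c by (simp add: X'_def algebra_simps)
  moreover have "Y = sc (2 * (k / (6 * c))) B + ((- K) * B - B * (- K))"
    using K(2) c by (simp add: Y'_def algebra_simps)
  ultimately show thesis using that[of "- H" "- K" "k / (6 * c)"] H(1) K(1) by simp
qed

text \<open>For any \<open>Z\<close> the sums \<open>A' * Z + Z * A\<close> and
  \<open>B' * B' * Z + B' * Z * B + Z * B * B\<close> commute with the generators, hence pair to
  zero with \<open>N\<close>. Cyclicity and nondegeneracy of the trace turn this into identities for
  \<open>N\<close>.\<close>

lemma orthogonal_anticommute:
  assumes sh: "A \<in> shp n n" "B \<in> shp n n" "A' \<in> shp n' n'" "B' \<in> shp n' n'"
    and sq: "A * A = sc c (idm n)" "B * B * B = sc c (idm n)" "A' * A' = sc c (idm n')" "B' * B' * B' = sc c (idm n')"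
    and N: "N \<in> shp n n'"
    and trA: "\<And>X. X \<in> homs n A n' A' \<Longrightarrow> trc (N * X) = 0" and trB: "\<And>Y. Y \<in> homs n B n' B' \<Longrightarrow> trc (N * Y) = 0"
  shows "N * A' + A * N = 0" "N * B' * B' + B * N * B' + B * B * N = 0"
proof -
  show "N * A' + A * N = 0"
  proof (rule trc_nondegenerate)
    show "N * A' + A * N \<in> shp n n'" using sh N by (auto intro!: shp_simps shp_mult)
    fix Z assume Z: "Z \<in> shp n' n"
    have "A' * (A' * Z + Z * A) = (A' * A') * Z + A' * Z * A" "(A' * Z + Z * A) * A = A' * Z * A + Z * (A * A)"
      by (simp_all add: algebra_simps)
    then have "A' * Z + Z * A \<in> homs n A n' A'" using Z sh by (auto simp: homs_def sq sc_simps intro!: shp_simps shp_mult)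
    then have "trc (N * (A' * Z + Z * A)) = 0" by (rule trA)
    moreover have "trc (A * N * Z) = trc (N * Z * A)" by (metis trc_mult mult.assoc)
    ultimately show "trc ((N * A' + A * N) * Z) = 0" by (simp add: algebra_simps trc_simps)
  qed
  show "N * B' * B' + B * N * B' + B * B * N = 0"
  proof (rule trc_nondegenerate)
    show "N * B' * B' + B * N * B' + B * B * N \<in> shp n n'" using sh N by (auto intro!: shp_simps shp_mult)
    fix Z assume Z: "Z \<in> shp n' n"
    have "B' * (B' * B' * Z + B' * Z * B + Z * B * B) = (B' * B' * B') * Z + (B' * B' * Z * B + B' * Z * B * B)"
      "(B' * B' * Z + B' * Z * B + Z * B * B) * B = (B' * B' * Z * B + B' * Z * B * B) + Z * (B * B * B)"
      by (simp_all add: algebra_simps)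
    then have "B' * B' * Z + B' * Z * B + Z * B * B \<in> homs n B n' B'"
      using Z sh by (auto simp: homs_def sq sc_simps add.commute intro!: shp_simps shp_mult)
    then have "trc (N * (B' * B' * Z + B' * Z * B + Z * B * B)) = 0" by (rule trB)
    moreover have "trc (B * N * B' * Z) = trc (N * B' * Z * B)" "trc (B * B * N * Z) = trc (N * Z * B * B)"
      by (metis trc_mult mult.assoc)+
    ultimately show "trc ((N * B' * B' + B * N * B' + B * B * N) * Z) = 0" by (simp add: algebra_simps trc_simps)
  qed
qed

section \<open>Schur's lemma\<close>

definition unit_col :: "nat \<Rightarrow> nat \<Rightarrow> fmat" where
  "unit_col c j = fm c 1 (\<lambda>i _. if i = j then 1 else 0)"

lemma unit_col_shp [simp]: "unit_col c j \<in> shp c 1"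
  by (simp add: unit_col_def)

lemma ent_mult_unit_col: "X \<in> shp r c \<Longrightarrow> j < c \<Longrightarrow> ent (X * unit_col c j) i 0 = ent X i j"
  by (simp add: ent_mult unit_col_def fm.rep_eq if_distrib[of "times _"] cong: if_cong)

lemma eq_columns:
  assumes "X \<in> shp r c" "Y \<in> shp r c" "\<And>j. j < c \<Longrightarrow> X * unit_col c j = Y * unit_col c j"
  shows "X = Y"
proof (rule fmat_eqI)
  fix i j
  show "ent X i j = ent Y i j"
    using assms(3)[of j] ent_mult_unit_col[OF assms(1), of j i] ent_mult_unit_col[OF assms(2), of j i]
      ent_shp[OF assms(1), of i j] ent_shp[OF assms(2), of i j]
    by (cases "j < c") auto
qed

lemma factor_columns:
  assumes P: "P \<in> shp a b" and Z: "Z \<in> shp a c" and cols: "\<And>j. j < c \<Longrightarrow> \<exists>v\<in>shp b 1. Z * unit_col c j = P * v"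
  obtains S where "S \<in> shp b c" "Z = P * S"
proof -
  obtain v where v: "\<forall>j<c. v j \<in> shp b 1 \<and> Z * unit_col c j = P * v j"
    using cols by metis
  define S where "S = fm b c (\<lambda>i j. ent (v j) i 0)"
  have S: "S \<in> shp b c" by (simp add: S_def)
  have "S * unit_col c j = v j" if "j < c" for j
  proof (rule fmat_eqI)
    fix i k
    have vj: "v j \<in> shp b 1" using v that by blast
    show "ent (S * unit_col c j) i k = ent (v j) i k"
    proof (cases "k = 0")
      case True
      then show ?thesis using ent_mult_unit_col[OF S that, of i] that ent_shp[OF vj, of i 0]
        by (auto simp: S_def fm.rep_eq)
    next
      case False
      then show ?thesis
        using ent_shp[OF shp_mult[OF S unit_col_shp], of i k] ent_shp[OF vj, of i k] by simp
    qed
  qed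
  then have "Z = P * S"
    using v P S by (intro eq_columns[OF Z shp_mult[OF P S]]) (simp add: mult.assoc)
  then show thesis using that S by blast
qed

section \<open>Column vectors and invariant subspaces\<close>

definition fvec :: "complex vec \<Rightarrow> fmat" where
  "fvec v = fm (dim_vec v) 1 (\<lambda>i _. v $ i)"

lemma ent_fvec: "v \<in> carrier_vec n \<Longrightarrow> ent (fvec v) i j = (if i < n \<and> j = 0 then v $ i else 0)"
  by (auto simp: fvec_def fm.rep_eq)

lemma fvec_shp: "v \<in> carrier_vec n \<Longrightarrow> fvec v \<in> shp n 1"
  by (auto simp: fvec_def)

lemma fvec_simps:
  "fvec (0\<^sub>v n) = 0"
  "v \<in> carrier_vec n \<Longrightarrow> w \<in> carrier_vec n \<Longrightarrow> fvec (v + w) = fvec v + fvec w"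
  "v \<in> carrier_vec n \<Longrightarrow> fvec (a \<cdot>\<^sub>v v) = sc a (fvec v)"
  by (rule fmat_eqI; auto simp: ent_fvec[of _ n])+

lemma fvec_mult:
  assumes "A \<in> carrier_mat r c" "v \<in> carrier_vec c"
  shows "fvec (A *\<^sub>v v) = emb A * fvec v"
  by (rule fmat_eqI)
     (use assms in \<open>auto simp: ent_fvec[of _ r] ent_fvec[of _ c] ent_mult[OF emb_shp[OF assms(1)]] ent_emb[OF assms(1)]
        scalar_prod_def atLeast0LessThan intro!: sum.cong\<close>)

lemma fvec_inj:
  assumes "v \<in> carrier_vec n" "w \<in> carrier_vec n" "fvec v = fvec w"
  shows "v = w"
proof (rule eq_vecI)
  fix i assume "i < dim_vec w"
  then show "v $ i = w $ i"
    using arg_cong[OF assms(3), of "\<lambda>X. ent X i 0"] assms(1,2) by (simp add: ent_fvec[of _ n])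
qed (use assms in auto)

lemma fvec_surj:
  assumes "X \<in> shp n 1"
  obtains v where "v \<in> carrier_vec n" "fvec v = X"
proof
  show "vec n (\<lambda>i. ent X i 0) \<in> carrier_vec n" by simp
  show "fvec (vec n (\<lambda>i. ent X i 0)) = X"
    by (rule fmat_eqI) (use ent_shp[OF assms] in \<open>auto simp: ent_fvec[of _ n]\<close>)
qed

definition irreducible_pair :: "nat \<Rightarrow> fmat \<Rightarrow> fmat \<Rightarrow> bool" where
  "irreducible_pair n A B \<longleftrightarrow> 0 < n \<and> A \<in> shp n n \<and> B \<in> shp n n \<and>
    (\<forall>U. U \<subseteq> shp n 1 \<longrightarrow> 0 \<in> U \<longrightarrow> (\<forall>u\<in>U. \<forall>v\<in>U. u + v \<in> U) \<longrightarrow> (\<forall>a. \<forall>u\<in>U. sc a u \<in> U) \<longrightarrow>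
      (\<forall>u\<in>U. A * u \<in> U \<and> B * u \<in> U) \<longrightarrow> U = {0} \<or> U = shp n 1)"

lemma irreducible_pairD:
  assumes "irreducible_pair n A B"
  shows "0 < n" "A \<in> shp n n" "B \<in> shp n n"
    "U \<subseteq> shp n 1 \<Longrightarrow> 0 \<in> U \<Longrightarrow> (\<And>u v. u \<in> U \<Longrightarrow> v \<in> U \<Longrightarrow> u + v \<in> U) \<Longrightarrow> (\<And>a u. u \<in> U \<Longrightarrow> sc a u \<in> U) \<Longrightarrow>
      (\<And>u. u \<in> U \<Longrightarrow> A * u \<in> U \<and> B * u \<in> U) \<Longrightarrow> U = {0} \<or> U = shp n 1"
  using assms unfolding irreducible_pair_def by simp_all

lemma simple_rep_irreducible:
  assumes "simple_rep V"
  shows "irreducible_pair (rep_dim V) (emb (fst V)) (emb (snd V))"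
proof -
  define n where "n = rep_dim V"
  have V: "V \<in> rep_B3 n" and n: "0 < n"
    and inv: "\<And>W. invariant_subspace V W \<Longrightarrow> W = {0\<^sub>v n} \<or> W = carrier_vec n"
    using assms by (auto simp: simple_rep_def is_rep_B3_def n_def)
  note V = rep_B3D[OF V]
  have "U = {0} \<or> U = shp n 1"
    if U: "U \<subseteq> shp n 1" "0 \<in> U" "\<forall>u\<in>U. \<forall>v\<in>U. u + v \<in> U" "\<forall>a. \<forall>u\<in>U. sc a u \<in> U"
      "\<forall>u\<in>U. emb (fst V) * u \<in> U \<and> emb (snd V) * u \<in> U" for U
  proof -
    define W where "W = {v \<in> carrier_vec n. fvec v \<in> U}"
    have "VectorSpace.subspace class_ring W (module_vec TYPE(complex) n)"
      unfolding VectorSpace.subspace_def LinearCombinations.submodule_def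
      using U(2-4) by (auto simp: W_def vec_vs vec_module module_vec_simps class_ring_simps fvec_simps(1) fvec_simps(2,3)[of _ n])
    then have "invariant_subspace V W"
      using U(5) V(1,2) unfolding invariant_subspace_def n_def[symmetric] by (auto simp: W_def fvec_mult[of _ n n])
    then have "W = {0\<^sub>v n} \<or> W = carrier_vec n" by (rule inv)
    moreover have "U = fvec ` W"
    proof
      show "U \<subseteq> fvec ` W"
      proof
        fix u assume u: "u \<in> U"
        then obtain v where "v \<in> carrier_vec n" "fvec v = u" using U(1) fvec_surj by blast
        then show "u \<in> fvec ` W" using u by (auto simp: W_def)
      qed
    qed (auto simp: W_def)
    moreover have "fvec ` carrier_vec n = shp n 1"
      using fvec_shp fvec_surj by (blast elim: fvec_surj)
    ultimately show ?thesis by (auto simp: fvec_simps)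
  qed
  then show ?thesis using V(4,5) n unfolding irreducible_pair_def n_def[symmetric] by blast
qed

text \<open>The kernel and the image of \<open>X\<close> are invariant, so \<open>X\<close> is
  injective and surjective.\<close>

lemma intertwiner_dichotomy:
  assumes irr: "irreducible_pair n A B" "irreducible_pair n' A' B'"
    and X: "X \<in> homs n A n' A'" "X \<in> homs n B n' B'" and X0: "X \<noteq> 0"
  shows "n' = n \<and> invf n X"
proof -
  note I = irreducible_pairD[OF irr(1)] and I' = irreducible_pairD[OF irr(2)]
  have Xs: "X \<in> shp n' n" and AX: "A' * X = X * A" and BX: "B' * X = X * B" using X by (auto simp: homs_def)
  define U where "U = {u \<in> shp n 1. X * u = 0}"
  define W where "W = (\<lambda>u. X * u) ` shp n 1"
  have "U = {0} \<or> U = shp n 1"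
  proof (rule I(4))
    fix u assume "u \<in> U"
    moreover have "X * (A * u) = A' * (X * u)" "X * (B * u) = B' * (X * u)"
      by (simp_all only: AX BX mult.assoc[symmetric])
    ultimately show "A * u \<in> U \<and> B * u \<in> U" using I(2,3) by (auto simp: U_def)
  qed (auto simp: U_def distrib_left sc_simps)
  moreover have "U \<noteq> shp n 1"
  proof
    assume "U = shp n 1"
    then have "X * unit_col n j = 0 * unit_col n j" for j using unit_col_shp[of n j] by (auto simp: U_def)
    then show False using eq_columns[OF Xs, of 0] X0 by simp
  qed
  ultimately have U: "U = {0}" by blast
  have "W = {0} \<or> W = shp n' 1"
  proof (rule I'(4))
    fix u assume "u \<in> W"
    then obtain v where v: "v \<in> shp n 1" "u = X * v" by (auto simp: W_def)
    have "A' * u = X * (A * v)" "B' * u = X * (B * v)" unfolding v(2)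
      by (simp_all only: AX BX mult.assoc[symmetric])
    then show "A' * u \<in> W \<and> B' * u \<in> W" using I(2,3) v(1) unfolding W_def by blast
  next
    fix u v assume "u \<in> W" "v \<in> W"
    then obtain s t where "s \<in> shp n 1" "u = X * s" "t \<in> shp n 1" "v = X * t" by (auto simp: W_def)
    then have "u + v = X * (s + t)" "s + t \<in> shp n 1" by (auto simp: distrib_left)
    then show "u + v \<in> W" unfolding W_def by (rule image_eqI)
  next
    fix a u assume "u \<in> W"
    then obtain s where "s \<in> shp n 1" "u = X * s" by (auto simp: W_def)
    then have "sc a u = X * sc a s" "sc a s \<in> shp n 1" by (auto simp: sc_simps)
    then show "sc a u \<in> W" unfolding W_def by (rule image_eqI)
  next
    show "W \<subseteq> shp n' 1" using Xs by (auto simp: W_def)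
    have "0 = X * 0" by simp
    then show "0 \<in> W" unfolding W_def by (rule image_eqI) simp
  qed
  moreover have "W \<noteq> {0}"
  proof
    assume "W = {0}"
    then have "X * u = 0" if "u \<in> shp n 1" for u using that by (auto simp: W_def)
    then show False using U \<open>U \<noteq> shp n 1\<close> by (auto simp: U_def)
  qed
  ultimately have W: "W = shp n' 1" by blast
  obtain Y where Y: "Y \<in> shp n n'" "idm n' = X * Y"
  proof (rule factor_columns[OF Xs, of "idm n'" n'])
    show "\<exists>v\<in>shp n 1. idm n' * unit_col n' j = X * v" for j
      using W unit_col_shp[of n' j] by (auto simp: W_def)
  qed auto
  have "Y * X - idm n = 0"
  proof (rule eq_columns)
    show YX: "Y * X - idm n \<in> shp n n" using Y(1) Xs by auto
    fix j
    have "X * (Y * X - idm n) = (X * Y) * X - X" using Xs by (simp add: right_diff_distrib mult.assoc)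
    also have "\<dots> = 0" using Xs by (simp add: Y(2)[symmetric])
    finally have "X * ((Y * X - idm n) * unit_col n j) = 0" by (simp add: mult.assoc[symmetric])
    then have "(Y * X - idm n) * unit_col n j \<in> U" using shp_mult[OF YX unit_col_shp[of n j]] by (simp add: U_def)
    then show "(Y * X - idm n) * unit_col n j = 0 * unit_col n j" using U by simp
  qed simp
  then have YX: "Y * X = idm n" by simp
  \<comment> \<open>The traces of \<open>X * Y\<close> and \<open>Y * X\<close> agree, which forces
    equal dimensions.\<close>
  have tid: "trc (idm k) = of_nat k" for k by (simp add: trc_eq[of _ k] idm.rep_eq)
  have "(of_nat n' :: complex) = of_nat n" using trc_mult[of X Y] Y(2)[symmetric] YX by (simp add: tid)
  then have "n' = n" by simp
  then show ?thesis unfolding invf_def using Y YX Xs by auto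
qed

lemma eigenvector_exists:
  assumes X: "X \<in> shp n n" and n: "0 < n"
  obtains a v where "v \<in> shp n 1" "v \<noteq> 0" "X * v = sc a v"
proof -
  define M where "M = tomat n n X"
  have M: "M \<in> carrier_mat n n" "emb M = X" using emb_tomat[OF X] by (auto simp: M_def)
  have "\<not> constant (poly (char_poly M))"
    using degree_monic_char_poly[OF M(1)] n by (simp add: constant_degree)
  then obtain a where "poly (char_poly M) a = 0" using fundamental_theorem_of_algebra by blast
  then obtain v where v: "v \<in> carrier_vec n" "v \<noteq> 0\<^sub>v n" "M *\<^sub>v v = a \<cdot>\<^sub>v v"
    using eigenvalue_root_char_poly[OF M(1), of a] M(1) by (auto simp: eigenvalue_def eigenvector_def)
  have "fvec v \<noteq> 0" using fvec_inj[OF v(1), of "0\<^sub>v n"] v(2) by (auto simp: fvec_simps)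
  moreover have "X * fvec v = sc a (fvec v)"
    using arg_cong[OF v(3), of fvec] v(1) M by (simp add: fvec_mult[of _ n n] fvec_simps(1) fvec_simps(2,3)[of _ n])
  ultimately show thesis using that fvec_shp[OF v(1)] by blast
qed

text \<open>Subtracting an eigenvalue from an endomorphism leaves one with nonzero kernel, which is
  zero by the dichotomy. A common eigenvector spans an invariant line, which cannot be everything in
  dimension at least two.\<close>

lemma irreducible_simple_pair:
  assumes irr: "irreducible_pair n A B"
  shows "simple_pair n A B"
proof -
  note I = irreducible_pairD[OF irr]
  have "\<exists>c. X = sc c (idm n)" if X: "X \<in> homs n A n A" "X \<in> homs n B n B" for X
  proof -
    have Xs: "X \<in> shp n n" using X by (simp add: homs_def)
    obtain a v where v: "v \<in> shp n 1" "v \<noteq> 0" "X * v = sc a v" using eigenvector_exists[OF Xs I(1)] .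
    define Z where "Z = X - sc a (idm n)"
    have Z: "Z \<in> homs n A n A" "Z \<in> homs n B n B"
      using X I(2,3) by (auto simp: homs_def Z_def left_diff_distrib right_diff_distrib sc_simps)
    have Zv: "Z * v = 0" using v by (simp add: Z_def left_diff_distrib sc_simps)
    have "Z = 0"
    proof (rule ccontr)
      assume "Z \<noteq> 0"
      then obtain Y where "Y * Z = idm n" using intertwiner_dichotomy[OF irr irr Z] by (auto simp: invf_def)
      then have "idm n * v = Y * (Z * v)" by (simp add: mult.assoc[symmetric])
      then show False using v Zv by simp
    qed
    then show ?thesis by (auto simp: Z_def)
  qed
  moreover have "v = 0" if n: "2 \<le> n" and v: "v \<in> shp n 1" "A * v = sc a v" "B * v = sc b v" for v a b
  proof (rule ccontr)
    assume v0: "v \<noteq> 0"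
    define U where "U = range (\<lambda>t. sc t v)"
    have "U = {0} \<or> U = shp n 1"
    proof (rule I(4))
      show "U \<subseteq> shp n 1" using v by (auto simp: U_def)
      show "0 \<in> U" unfolding U_def by (rule range_eqI[of _ _ 0]) (simp add: sc_simps)
    next
      fix u w assume "u \<in> U" "w \<in> U"
      then obtain s t where "u = sc s v" "w = sc t v" by (auto simp: U_def)
      then have "u + w = sc (s + t) v" by (simp add: sc_add_left)
      then show "u + w \<in> U" unfolding U_def by (rule range_eqI)
    next
      fix c u assume "u \<in> U"
      then obtain s where "u = sc s v" by (auto simp: U_def)
      then show "sc c u \<in> U" by (simp add: sc_simps U_def)
    next
      fix u assume "u \<in> U"
      then obtain s where "u = sc s v" by (auto simp: U_def)
      then show "A * u \<in> U \<and> B * u \<in> U" using v by (simp add: sc_simps U_def)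
    qed
    moreover have "v \<in> U" unfolding U_def by (rule range_eqI[of _ _ 1]) (simp add: sc_simps)
    ultimately have "U = shp n 1" using v0 by auto
    then have "unit_col n 0 \<in> U" "unit_col n 1 \<in> U" using unit_col_shp by simp_all
    then obtain s t where st: "unit_col n 0 = sc s v" "unit_col n 1 = sc t v" unfolding U_def by (elim rangeE)
    have "ent (unit_col n 0) 0 0 = 1" "ent (unit_col n 0) 1 0 = 0" "ent (unit_col n 1) 1 0 = 1"
      using n by (simp_all add: unit_col_def fm.rep_eq)
    then show False unfolding st by auto
  qed
  ultimately show ?thesis unfolding simple_pair_def using I(1-3) by blast
qed

lemma simple_rep_is_rep:
  assumes "simple_rep V"
  shows "V \<in> rep_B3 (rep_dim V)"
  using assms by (simp add: simple_rep_def is_rep_B3_def)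

text \<open>\<open>A * A\<close> equals the cube of \<open>B\<close> and so commutes with both
  generators; Schur's lemma makes it a scalar, nonzero because \<open>A\<close> is
  invertible.\<close>

lemma simple_rep_central_character:
  assumes V: "simple_rep V"
  defines "n \<equiv> rep_dim V" and "A \<equiv> emb (fst V)" and "B \<equiv> emb (snd V)"
  obtains c where "c \<noteq> 0" "A * A = sc c (idm n)" "B * B * B = sc c (idm n)"
proof -
  have rep: "V \<in> rep_B3 n" unfolding n_def by (rule simple_rep_is_rep[OF V])
  note D = rep_B3D[OF rep, folded A_def B_def]
  have sp: "simple_pair n A B"
    unfolding n_def A_def B_def by (rule irreducible_simple_pair[OF simple_rep_irreducible[OF V]])
  have "A * A \<in> homs n A n A \<inter> homs n B n B"
  proof -
    have "B * (A * A) = A * A * B" unfolding D(3) by (simp only: mult.assoc)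
    then show ?thesis using D(4,5) by (auto simp: homs_def mult.assoc)
  qed
  then obtain c where c: "A * A = sc c (idm n)" using sp unfolding simple_pair_def by blast
  have "c \<noteq> 0"
  proof
    assume c0: "c = 0"
    have "invertible_mat (fst V)" using rep by (auto simp: rep_B3_def GL_def)
    then obtain Y where Y: "A * Y = idm n" using invertible_matD[OF D(1)] unfolding A_def by blast
    have "A * A * Y = A" using D(4) by (simp add: mult.assoc Y)
    then have "A = 0" using c c0 by (simp add: sc_simps)
    then have "ent (idm n) 0 0 = 0" using Y by (simp flip: Y)
    then show False using sp by (simp add: simple_pair_def idm.rep_eq)
  qed
  then show thesis using that[of c] c D(3) by simp
qed

lemma hom_zero_not_iso:
  assumes V: "simple_rep V" and W: "simple_rep W" and ni: "\<not> rep_iso V W"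
  shows "hom_zero (rep_dim V) (emb (fst V)) (emb (snd V)) (rep_dim W) (emb (fst W)) (emb (snd W))"
  unfolding hom_zero_def
proof
  fix X assume X: "X \<in> homs (rep_dim V) (emb (fst V)) (rep_dim W) (emb (fst W)) \<inter> homs (rep_dim V) (emb (snd V)) (rep_dim W) (emb (snd W))"
  show "X \<in> {0}"
  proof (rule ccontr)
    assume "X \<notin> {0}"
    then have n: "rep_dim W = rep_dim V" "invf (rep_dim V) X"
      using intertwiner_dichotomy[OF simple_rep_irreducible[OF V] simple_rep_irreducible[OF W]] X by auto
    define n where "n = rep_dim V"
    note VD = rep_B3D[OF simple_rep_is_rep[OF V], folded n_def] and WD = rep_B3D[OF simple_rep_is_rep[OF W], unfolded n, folded n_def]
    have Xs: "X \<in> shp n n" using X by (simp add: homs_def n n_def)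
    have "tomat n n X * fst V = fst W * tomat n n X" "tomat n n X * snd V = snd W * tomat n n X"
      using X VD WD by (intro emb_inj[of _ n n]; simp add: mult_carrier_mat[of _ n n _ n] emb_mult[of _ n n _ n] emb_tomat[OF Xs] homs_def)+
    then have "tomat n n X \<in> intertwiners V W" by (simp add: intertwiners_def n n_def)
    then show False using ni invf_tomat[OF n(2)] unfolding rep_iso_def n_def by blast
  qed
qed

section \<open>Block matrices\<close>

lemma homs_mult: "X \<in> homs n C n' C' \<Longrightarrow> Z \<in> homs n' C' n'' C'' \<Longrightarrow> Z * X \<in> homs n C n'' C''"
proof -
  assume *: "X \<in> homs n C n' C'" "Z \<in> homs n' C' n'' C''"
  then have "C'' * (Z * X) = Z * X * C" by (simp add: homs_def mult.assoc[symmetric]) (simp add: mult.assoc)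
  then show ?thesis using * by (auto simp: homs_def)
qed

lemma homs_add: "X \<in> homs n C n' C' \<Longrightarrow> Z \<in> homs n C n' C' \<Longrightarrow> X + Z \<in> homs n C n' C'"
  by (auto simp: homs_def distrib_left distrib_right)

definition inl :: "nat \<Rightarrow> nat \<Rightarrow> fmat" where "inl a b = fm (a + b) a (\<lambda>i j. if i = j then 1 else 0)"
definition prl :: "nat \<Rightarrow> nat \<Rightarrow> fmat" where "prl a b = fm a (a + b) (\<lambda>i j. if i = j then 1 else 0)"
definition inr :: "nat \<Rightarrow> nat \<Rightarrow> fmat" where "inr a b = fm (a + b) b (\<lambda>i j. if i = a + j then 1 else 0)"
definition prr :: "nat \<Rightarrow> nat \<Rightarrow> fmat" where "prr a b = fm b (a + b) (\<lambda>i j. if j = a + i then 1 else 0)"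

lemma biproduct_shp [simp]: "inl a b \<in> shp (a + b) a" "prl a b \<in> shp a (a + b)" "inr a b \<in> shp (a + b) b" "prr a b \<in> shp b (a + b)"
  by (simp_all add: inl_def prl_def inr_def prr_def)

lemma ent_biproduct_left:
  "X \<in> shp a c \<Longrightarrow> ent (inl a b * X) i j = ent X i j"
  "X \<in> shp b c \<Longrightarrow> ent (inr a b * X) i j = (if a \<le> i then ent X (i - a) j else 0)"
  "X \<in> shp (a + b) c \<Longrightarrow> ent (prl a b * X) i j = (if i < a then ent X i j else 0)"
  "X \<in> shp (a + b) c \<Longrightarrow> ent (prr a b * X) i j = (if i < b then ent X (a + i) j else 0)"
proof -
  assume X: "X \<in> shp a c"
  have "ent (inl a b * X) i j = (\<Sum>k<a. if k = i then ent X k j else 0)"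
    unfolding ent_mult'[OF X] by (intro sum.cong) (auto simp: inl_def fm.rep_eq)
  then show "ent (inl a b * X) i j = ent X i j" using ent_shp[OF X, of i j] by auto
next
  assume X: "X \<in> shp b c"
  have "ent (inr a b * X) i j = (\<Sum>k<b. if k = i - a then (if a \<le> i then ent X k j else 0) else 0)"
    unfolding ent_mult'[OF X] by (intro sum.cong) (auto simp: inr_def fm.rep_eq)
  then show "ent (inr a b * X) i j = (if a \<le> i then ent X (i - a) j else 0)" using ent_shp[OF X, of "i - a" j] by auto
next
  assume X: "X \<in> shp (a + b) c"
  have "ent (prl a b * X) i j = (\<Sum>k<a + b. if k = i then (if i < a then ent X k j else 0) else 0)"
    unfolding ent_mult'[OF X] by (intro sum.cong) (auto simp: prl_def fm.rep_eq)
  then show "ent (prl a b * X) i j = (if i < a then ent X i j else 0)" by auto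
  have "ent (prr a b * X) i j = (\<Sum>k<a + b. if k = a + i then (if i < b then ent X k j else 0) else 0)"
    unfolding ent_mult'[OF X] by (intro sum.cong) (auto simp: prr_def fm.rep_eq)
  then show "ent (prr a b * X) i j = (if i < b then ent X (a + i) j else 0)" by auto
qed

lemma ent_biproduct_right:
  "X \<in> shp c a \<Longrightarrow> ent (X * prl a b) i j = ent X i j"
  "X \<in> shp c b \<Longrightarrow> ent (X * prr a b) i j = (if a \<le> j then ent X i (j - a) else 0)"
proof -
  assume X: "X \<in> shp c a"
  have "ent (X * prl a b) i j = (\<Sum>k<a. if k = j then ent X i k else 0)"
    unfolding ent_mult[OF X] by (intro sum.cong) (auto simp: prl_def fm.rep_eq)
  then show "ent (X * prl a b) i j = ent X i j" using ent_shp[OF X, of i j] by auto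
next
  assume X: "X \<in> shp c b"
  have "ent (X * prr a b) i j = (\<Sum>k<b. if k = j - a then (if a \<le> j then ent X i k else 0) else 0)"
    unfolding ent_mult[OF X] by (intro sum.cong) (auto simp: prr_def fm.rep_eq)
  then show "ent (X * prr a b) i j = (if a \<le> j then ent X i (j - a) else 0)" using ent_shp[OF X, of i "j - a"] by auto
qed

lemma biproduct:
  "prl a b * inl a b = idm a" "prl a b * inr a b = 0" "prr a b * inl a b = 0" "prr a b * inr a b = idm b"
  "inl a b * prl a b + inr a b * prr a b = idm (a + b)"
proof -
  note S = biproduct_shp[of a b]
  show "prl a b * inl a b = idm a" "prl a b * inr a b = 0" "prr a b * inl a b = 0" "prr a b * inr a b = idm b"
    by (rule fmat_eqI; simp add: ent_biproduct_left(3,4)[OF S(1)] ent_biproduct_left(3,4)[OF S(3)];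
        auto simp: inl_def inr_def fm.rep_eq idm.rep_eq)+
  show "inl a b * prl a b + inr a b * prr a b = idm (a + b)"
    by (rule fmat_eqI; simp add: ent_biproduct_left(1)[OF S(2)] ent_biproduct_left(2)[OF S(4)];
        auto simp: prl_def prr_def fm.rep_eq idm.rep_eq)
qed

lemma biproduct_assoc:
  "prl a b * (inl a b * X) = idm a * X" "prl a b * (inr a b * X) = 0"
  "prr a b * (inl a b * X) = 0" "prr a b * (inr a b * X) = idm b * X"
  by (simp_all add: biproduct mult.assoc[symmetric])

lemma emb_block_diag:
  assumes A: "A \<in> carrier_mat a a" and D: "D \<in> carrier_mat b b"
  shows "emb (four_block_mat A (0\<^sub>m a b) (0\<^sub>m b a) D) = inl a b * emb A * prl a b + inr a b * emb D * prr a b"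
proof (rule fmat_eqI)
  fix i j
  note S = emb_shp[OF A] emb_shp[OF D]
  have c: "four_block_mat A (0\<^sub>m a b) (0\<^sub>m b a) D \<in> carrier_mat (a + b) (a + b)" using A D by simp
  show "ent (emb (four_block_mat A (0\<^sub>m a b) (0\<^sub>m b a) D)) i j = ent (inl a b * emb A * prl a b + inr a b * emb D * prr a b) i j"
    using A D unfolding ent_emb[OF c] ent_simps ent_biproduct_right(1)[OF shp_mult[OF biproduct_shp(1) S(1)]]
      ent_biproduct_right(2)[OF shp_mult[OF biproduct_shp(3) S(2)]] ent_biproduct_left(1)[OF S(1)] ent_biproduct_left(2)[OF S(2)]
      ent_emb[OF A] ent_emb[OF D] by auto
qed

section \<open>Block triangular matrices\<close>

definition upper :: "nat \<Rightarrow> nat \<Rightarrow> fmat \<Rightarrow> fmat \<Rightarrow> fmat \<Rightarrow> fmat" where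
  "upper a b P Q R = inl a b * P * prl a b + inl a b * Q * prr a b + inr a b * R * prr a b"

lemma upper_shp:
  assumes "P \<in> shp a a" "Q \<in> shp a b" "R \<in> shp b b"
  shows "upper a b P Q R \<in> shp (a + b) (a + b)"
  unfolding upper_def by (intro shp_simps shp_mult[OF shp_mult[OF biproduct_shp(1)]] shp_mult[OF shp_mult[OF biproduct_shp(3)]])
    (use assms biproduct_shp in auto)

lemma upper_mult:
  assumes P: "P' \<in> shp a a" and Q: "Q' \<in> shp a b" and R: "R' \<in> shp b b"
  shows "upper a b P Q R * upper a b P' Q' R' = upper a b (P * P') (P * Q' + Q * R') (R * R')"
proof -
  have id: "idm a * (P' * X) = P' * X" "idm a * (Q' * X) = Q' * X" "idm b * (R' * X) = R' * X" for X
    using assms by (simp_all add: mult.assoc[symmetric])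
  show ?thesis
    by (simp add: upper_def distrib_left distrib_right mult.assoc biproduct_assoc id add_ac)
qed

lemma upper_one: "upper a b (idm a) 0 (idm b) = idm (a + b)"
  using biproduct(5)[of a b] idm_right[OF biproduct_shp(1)] idm_right[OF biproduct_shp(3)] by (simp add: upper_def)

lemma upper_inl_prr:
  assumes "P \<in> shp a a" "R \<in> shp b b"
  shows "upper a b P Q R * inl a b = inl a b * P" "prr a b * upper a b P Q R = R * prr a b"
    "prl a b * upper a b P Q R = P * prl a b + idm a * Q * prr a b"
proof -
  have id: "idm a * (P * X) = P * X" "idm b * (R * X) = R * X" for X
    using assms by (simp_all add: mult.assoc[symmetric])
  show "upper a b P Q R * inl a b = inl a b * P" "prr a b * upper a b P Q R = R * prr a b"
    "prl a b * upper a b P Q R = P * prl a b + idm a * Q * prr a b"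
    using assms by (simp_all add: upper_def distrib_left distrib_right mult.assoc biproduct_assoc biproduct id)
qed

lemma invf_upper:
  assumes P: "invf a P" and Q: "Q \<in> shp a b" and R: "invf b R"
  shows "invf (a + b) (upper a b P Q R)"
proof -
  obtain P' where P': "P \<in> shp a a" "P' \<in> shp a a" "P * P' = idm a" "P' * P = idm a" using P by (auto simp: invf_def)
  obtain R' where R': "R \<in> shp b b" "R' \<in> shp b b" "R * R' = idm b" "R' * R = idm b" using R by (auto simp: invf_def)
  have S: "- (P' * Q * R') \<in> shp a b" using P' Q R' by auto
  have "P * (- (P' * Q * R')) + Q * R' = - ((P * P') * Q * R') + Q * R'" by (simp add: mult.assoc)
  then have "P * (- (P' * Q * R')) + Q * R' = 0" using Q by (simp add: P')
  then have 1: "upper a b P Q R * upper a b P' (- (P' * Q * R')) R' = idm (a + b)"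
    unfolding upper_mult[OF P'(2) S R'(2)] P' R' by (simp add: upper_one)
  have "P' * Q + (- (P' * Q * R')) * R = P' * Q - P' * Q * (R' * R)" by (simp add: mult.assoc)
  also have "\<dots> = 0" using shp_mult[OF P'(2) Q] by (simp add: R')
  finally have 2: "upper a b P' (- (P' * Q * R')) R' * upper a b P Q R = idm (a + b)"
    unfolding upper_mult[OF P'(1) Q R'(1)] P' R' by (simp add: upper_one)
  show ?thesis unfolding invf_def
    using 1 2 upper_shp[OF P'(1) Q R'(1)] upper_shp[OF P'(2) S R'(2)] by blast
qed

lemma rep_B3_invf:
  assumes "V \<in> rep_B3 n"
  shows "invf n (emb (fst V))" "invf n (emb (snd V))"
proof -
  have "invertible_mat (fst V)" "invertible_mat (snd V)" using assms by (auto simp: rep_B3_def GL_def)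
  then show "invf n (emb (fst V))" "invf n (emb (snd V))"
    using invertible_matD[OF rep_B3D(1)[OF assms]] invertible_matD[OF rep_B3D(2)[OF assms]] rep_B3D(4,5)[OF assms]
    unfolding invf_def by metis+
qed

lemma rep_B3I:
  assumes A: "invf n A" and B: "invf n B" and eq: "A * A = B * B * B"
  shows "(tomat n n A, tomat n n B) \<in> rep_B3 n"
proof -
  have s: "A \<in> shp n n" "B \<in> shp n n" using A B by (auto simp: invf_def)
  have "tomat n n A ^\<^sub>m 2 = tomat n n B ^\<^sub>m 3"
    using eq s by (intro emb_inj[of _ n n])
      (simp_all add: eval_nat_numeral mult_carrier_mat[of _ n n _ n] emb_mult[of _ n n _ n] emb_tomat mult.assoc)
  then show ?thesis using invf_tomat[OF A] invf_tomat[OF B] by (simp add: rep_B3_def GL_def)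
qed

lemma intertwiners_iff:
  assumes V: "V \<in> rep_B3 n" "rep_dim V = n" and W: "W \<in> rep_B3 n'" "rep_dim W = n'" and \<phi>: "\<phi> \<in> carrier_mat n' n"
  shows "\<phi> \<in> intertwiners V W \<longleftrightarrow>
    emb \<phi> \<in> homs n (emb (fst V)) n' (emb (fst W)) \<and> emb \<phi> \<in> homs n (emb (snd V)) n' (emb (snd W))"
proof -
  have *: "\<phi> * C = C' * \<phi> \<longleftrightarrow> emb C' * emb \<phi> = emb \<phi> * emb C" if C: "C \<in> carrier_mat n n" "C' \<in> carrier_mat n' n'" for C C'
  proof -
    have "\<phi> * C = C' * \<phi> \<longleftrightarrow> emb (\<phi> * C) = emb (C' * \<phi>)"
      by (rule iffI, simp, rule emb_inj[OF mult_carrier_mat[OF \<phi> C(1)] mult_carrier_mat[OF C(2) \<phi>]])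
    then show ?thesis unfolding emb_mult[OF \<phi> C(1)] emb_mult[OF C(2) \<phi>] by (simp add: eq_commute)
  qed
  show ?thesis
    unfolding intertwiners_def homs_def V(2) W(2) using rep_B3D(1,2)[OF V(1)] rep_B3D(1,2)[OF W(1)] \<phi> emb_shp[OF \<phi>] *
    by simp
qed

section \<open>Extensions\<close>

lemma fvec_eq_0: "v \<in> carrier_vec n \<Longrightarrow> fvec v = 0 \<longleftrightarrow> v = 0\<^sub>v n"
  using fvec_inj[of v n "0\<^sub>v n"] by (auto simp: fvec_simps(1))

text \<open>A linear splitting \<open>r\<close>, \<open>s\<close> of the sequence proves kernel,
  image and surjectivity statements by matrix identities.\<close>

lemma extensionsI:
  assumes M: "is_rep_B3 M" "rep_dim M = a" and N: "is_rep_B3 N" "rep_dim N = b" and E: "is_rep_B3 E" "rep_dim E = d"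
    and \<iota>: "\<iota> \<in> intertwiners N E" and \<pi>: "\<pi> \<in> intertwiners E M"
    and r: "r \<in> shp b d" "r * emb \<iota> = idm b" and s: "s \<in> shp d a" "emb \<pi> * s = idm a"
    and 0: "emb \<pi> * emb \<iota> = 0" and 1: "emb \<iota> * r + s * emb \<pi> = idm d"
  shows "(E, \<iota>, \<pi>) \<in> extensions M N"
proof -
  have c: "\<iota> \<in> carrier_mat d b" "\<pi> \<in> carrier_mat a d"
    using \<iota> \<pi> M N E by (auto simp: intertwiners_def)
  note m = fvec_mult[OF c(1)] fvec_mult[OF c(2)]
  have k: "mat_kernel \<iota> = {0\<^sub>v b}"
  proof
    show "mat_kernel \<iota> \<subseteq> {0\<^sub>v b}"
    proof
      fix v assume "v \<in> mat_kernel \<iota>"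
      then have v: "v \<in> carrier_vec b" "\<iota> *\<^sub>v v = 0\<^sub>v d" using mat_kernelD[OF c(1)] by auto
      have "idm b * fvec v = r * (emb \<iota> * fvec v)" by (simp add: mult.assoc[symmetric] r)
      also have "\<dots> = 0" using m(1)[OF v(1)] v(2) by (simp add: fvec_simps(1))
      finally show "v \<in> {0\<^sub>v b}" using fvec_eq_0[OF v(1)] fvec_shp[OF v(1)] by simp
    qed
    show "{0\<^sub>v b} \<subseteq> mat_kernel \<iota>" using c(1) by (auto intro!: mat_kernelI)
  qed
  have i: "(\<lambda>v. \<iota> *\<^sub>v v) ` carrier_vec b = mat_kernel \<pi>"
  proof (intro subset_antisym subsetI)
    fix w assume "w \<in> (\<lambda>v. \<iota> *\<^sub>v v) ` carrier_vec b"
    then obtain v where v: "v \<in> carrier_vec b" "w = \<iota> *\<^sub>v v" by blast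
    have w: "w \<in> carrier_vec d" using v c by simp
    have "fvec (\<pi> *\<^sub>v w) = emb \<pi> * emb \<iota> * fvec v" using m(2)[OF w] m(1)[OF v(1)] v(2) by (simp add: mult.assoc)
    then have "\<pi> *\<^sub>v w = 0\<^sub>v a" using fvec_eq_0[of "\<pi> *\<^sub>v w" a] c w by (simp add: 0)
    then show "w \<in> mat_kernel \<pi>" using c(2) w by (intro mat_kernelI)
  next
    fix w assume "w \<in> mat_kernel \<pi>"
    then have w: "w \<in> carrier_vec d" "\<pi> *\<^sub>v w = 0\<^sub>v a" using mat_kernelD[OF c(2)] by auto
    obtain v where v: "v \<in> carrier_vec b" "fvec v = r * fvec w" using fvec_surj[OF shp_mult[OF r(1) fvec_shp[OF w(1)]]] .
    have p: "emb \<pi> * fvec w = 0" using m(2)[OF w(1)] w(2) by (simp add: fvec_simps(1))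
    have "fvec w = (emb \<iota> * r + s * emb \<pi>) * fvec w" using fvec_shp[OF w(1)] by (simp add: 1)
    also have "\<dots> = fvec (\<iota> *\<^sub>v v)" using m(1)[OF v(1)] v(2) p by (simp add: distrib_right mult.assoc)
    finally have "w = \<iota> *\<^sub>v v" using w c v(1) by (intro fvec_inj[of _ d]) auto
    then show "w \<in> (\<lambda>v. \<iota> *\<^sub>v v) ` carrier_vec b" using v(1) by blast
  qed
  have p: "(\<lambda>v. \<pi> *\<^sub>v v) ` carrier_vec d = carrier_vec a"
  proof (intro subset_antisym subsetI)
    fix w :: "complex vec" assume w: "w \<in> carrier_vec a"
    obtain v where v: "v \<in> carrier_vec d" "fvec v = s * fvec w" using fvec_surj[OF shp_mult[OF s(1) fvec_shp[OF w]]] .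
    have "fvec (\<pi> *\<^sub>v v) = emb \<pi> * s * fvec w" using m(2)[OF v(1)] v(2) by (simp add: mult.assoc)
    then have "fvec (\<pi> *\<^sub>v v) = fvec w" using fvec_shp[OF w] by (simp add: s)
    then have "w = \<pi> *\<^sub>v v" using w c v(1) by (intro fvec_inj[of _ a]) auto
    then show "w \<in> (\<lambda>v. \<pi> *\<^sub>v v) ` carrier_vec d" using v(1) by blast
  qed (use c in auto)
  show ?thesis unfolding extensions_def using E(1) \<iota> \<pi> k i p by (simp add: M(2) N(2) E(2))
qed

text \<open>Surjectivity gives a linear section \<open>s\<close>. The map
  \<open>idm d - s * p\<close> takes values in the kernel of \<open>p\<close>, that is in the image
  of \<open>i\<close>, and factoring it through \<open>i\<close> gives \<open>r\<close>.\<close>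

lemma extensions_splitting:
  assumes x: "(E, \<iota>, \<pi>) \<in> extensions M N" and dims: "rep_dim M = a" "rep_dim N = b" "rep_dim E = d"
  obtains r s where "r \<in> shp b d" "s \<in> shp d a" "r * emb \<iota> = idm b" "emb \<pi> * s = idm a"
    "emb \<pi> * emb \<iota> = 0" "emb \<iota> * r + s * emb \<pi> = idm d" "r * s = 0"
proof -
  have x: "\<iota> \<in> carrier_mat d b" "\<pi> \<in> carrier_mat a d" "mat_kernel \<iota> = {0\<^sub>v b}"
      "(\<lambda>v. \<iota> *\<^sub>v v) ` carrier_vec b = mat_kernel \<pi>" "(\<lambda>v. \<pi> *\<^sub>v v) ` carrier_vec d = carrier_vec a"
    using x by (simp_all add: extensions_def intertwiners_def dims)
  define i where "i = emb \<iota>"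
  define p where "p = emb \<pi>"
  have ip: "i \<in> shp d b" "p \<in> shp a d" unfolding i_def p_def using x(1,2) by (auto intro: emb_shp)
  note m = fvec_mult[OF x(1), folded i_def] fvec_mult[OF x(2), folded p_def]
  have surj: "\<exists>v\<in>shp d 1. w = p * v" if w: "w \<in> shp a 1" for w
  proof -
    obtain w' where w': "w' \<in> carrier_vec a" "fvec w' = w" using fvec_surj[OF w] .
    then obtain v where "v \<in> carrier_vec d" "w' = \<pi> *\<^sub>v v" using x(5) by blast
    then show ?thesis using m(2)[of v] w'(2) fvec_shp[of v d] by (intro bexI[of _ "fvec v"]) simp_all
  qed
  have ker: "\<exists>v\<in>shp b 1. w = i * v" if w: "w \<in> shp d 1" "p * w = 0" for w
  proof -
    obtain w' where w': "w' \<in> carrier_vec d" "fvec w' = w" using fvec_surj[OF w(1)] .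
    have "fvec (\<pi> *\<^sub>v w') = 0" using m(2)[OF w'(1)] w' w(2) by simp
    then have "\<pi> *\<^sub>v w' = 0\<^sub>v a" using fvec_eq_0[of "\<pi> *\<^sub>v w'" a] x(2) w'(1) by simp
    then have "w' \<in> mat_kernel \<pi>" using x(2) w'(1) by (intro mat_kernelI)
    then obtain v where "v \<in> carrier_vec b" "w' = \<iota> *\<^sub>v v" using x(4) by blast
    then show ?thesis using m(1)[of v] w'(2) fvec_shp[of v b] by (intro bexI[of _ "fvec v"]) simp_all
  qed
  have inj: "v = 0" if v: "v \<in> shp b 1" "i * v = 0" for v
  proof -
    obtain v' where v': "v' \<in> carrier_vec b" "fvec v' = v" using fvec_surj[OF v(1)] .
    have "fvec (\<iota> *\<^sub>v v') = 0" using m(1)[OF v'(1)] v' v(2) by simp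
    then have "\<iota> *\<^sub>v v' = 0\<^sub>v d" using fvec_eq_0[of "\<iota> *\<^sub>v v'" d] x(1) v'(1) by simp
    then have "v' \<in> mat_kernel \<iota>" using x(1) v'(1) by (intro mat_kernelI)
    then show ?thesis using x(3) v'(2) by (simp add: fvec_simps(1))
  qed
  have cancel: "X = 0" if X: "X \<in> shp b c" "i * X = 0" for X c
  proof (rule eq_columns[OF X(1)])
    fix j
    show "X * unit_col c j = 0 * unit_col c j"
      using X inj[of "X * unit_col c j"] shp_mult[OF X(1) unit_col_shp] by (simp add: mult.assoc[symmetric])
  qed simp
  have pi: "p * i = 0"
  proof (rule eq_columns[OF shp_mult[OF ip(2,1)]])
    fix j
    obtain v where v: "v \<in> carrier_vec b" "fvec v = unit_col b j" using fvec_surj[OF unit_col_shp] .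
    have "\<iota> *\<^sub>v v \<in> mat_kernel \<pi>" using x(4) v(1) by blast
    then have "\<pi> *\<^sub>v (\<iota> *\<^sub>v v) = 0\<^sub>v a" "\<iota> *\<^sub>v v \<in> carrier_vec d" using mat_kernelD[OF x(2)] by auto
    then have "p * (i * unit_col b j) = 0" using m(2)[of "\<iota> *\<^sub>v v"] m(1)[OF v(1)] v(2) by (simp add: fvec_simps(1))
    then show "p * i * unit_col b j = 0 * unit_col b j" by (simp add: mult.assoc)
  qed simp
  obtain s where s: "s \<in> shp d a" "idm a = p * s"
  proof (rule factor_columns[OF ip(2), of "idm a" a])
    show "\<exists>v\<in>shp d 1. idm a * unit_col a j = p * v" for j
      by (rule surj, rule shp_mult[of _ a a], simp, rule unit_col_shp)
  qed simp
  define e where "e = idm d - s * p"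
  have e: "e \<in> shp d d" unfolding e_def using s ip by auto
  have "p * e = p - (p * s) * p" unfolding e_def using ip by (simp add: right_diff_distrib mult.assoc)
  then have pe: "p * e = 0" using ip by (simp flip: s(2))
  obtain r where r: "r \<in> shp b d" "e = i * r"
  proof (rule factor_columns[OF ip(1) e])
    fix j
    have "p * (e * unit_col d j) = 0" using pe by (simp add: mult.assoc[symmetric])
    then show "\<exists>v\<in>shp b 1. e * unit_col d j = i * v" by (rule ker[OF shp_mult[OF e unit_col_shp]])
  qed
  have "i * (r * i - idm b) = e * i - i" using ip by (simp add: right_diff_distrib mult.assoc[symmetric] r(2))
  also have "\<dots> = 0" using ip pi by (simp add: e_def left_diff_distrib mult.assoc)
  finally have "r * i - idm b = 0"
    by (rule cancel[of _ b, rotated]) (rule shp_simps(3)[OF shp_mult[OF r(1) ip(1)] shp_simps(7)])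
  then have ri: "r * i = idm b" by simp
  have "i * (r * s) = e * s" by (simp add: mult.assoc[symmetric] r(2))
  also have "\<dots> = 0" using s(1) by (simp add: e_def left_diff_distrib mult.assoc flip: s(2))
  finally have "r * s = 0" by (rule cancel[of _ a, rotated]) (rule shp_mult[OF r(1) s(1)])
  moreover have "i * r + s * p = idm d" using r(2) by (simp add: e_def algebra_simps)
  ultimately show thesis using that[OF r(1) s(1)] ri pi s(2) unfolding i_def p_def by simp
qed

text \<open>If the off-diagonal part \<open>r * C * s\<close> is inner, via \<open>G\<close>, then
  changing the splitting by \<open>G\<close> turns the retraction and the section into maps that
  commute with the operators.\<close>

lemma conjugate_splitting:
  assumes C: "C * i = i * CN" "p * C = CM * p" and Z: "r * C * s = CN * G - G * CM"
    and sp: "i * r + s * p = idm d" "r * i = idm b" "p * s = idm a" "p * i = 0" "r * s = 0"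
    and sh: "C \<in> shp d d" "i \<in> shp d b" "r \<in> shp b d" "p \<in> shp a d" "s \<in> shp d a" "CN \<in> shp b b" "CM \<in> shp a a" "G \<in> shp b a"
  shows "(r + G * p) * C = CN * (r + G * p)" "C * (s - i * G) = (s - i * G) * CM"
proof -
  have rC: "r * C = CN * r + (CN * G - G * CM) * p"
  proof -
    have "r * C = r * C * (i * r + s * p)" using idm_right[OF shp_mult[OF sh(3,1)]] by (simp add: sp(1))
    also have "\<dots> = (r * i) * CN * r + (r * C * s) * p" using C(1) by (simp add: distrib_left mult.assoc) (simp add: mult.assoc[symmetric] C(1))
    also have "\<dots> = CN * r + (CN * G - G * CM) * p" unfolding Z sp(2) using sh by simp
    finally show ?thesis .
  qed
  have Cs: "C * s = i * (CN * G - G * CM) + s * CM"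
  proof -
    have "C * s = (i * r + s * p) * C * s" using sh by (simp add: sp(1))
    also have "\<dots> = i * (r * C * s) + s * (p * C) * s" by (simp add: distrib_right mult.assoc)
    also have "s * (p * C) * s = s * CM * (p * s)" by (simp add: C(2) mult.assoc)
    also have "\<dots> = s * CM" using sh by (simp add: sp(3) mult.assoc)
    finally show ?thesis unfolding Z .
  qed
  show "(r + G * p) * C = CN * (r + G * p)"
    by (simp add: distrib_right distrib_left rC left_diff_distrib mult.assoc C(2))
  have "C * (i * G) = i * CN * G" by (simp add: mult.assoc[symmetric] C(1))
  then show "C * (s - i * G) = (s - i * G) * CM"
    by (simp add: right_diff_distrib left_diff_distrib Cs mult.assoc)
qed

text \<open>Any linear splitting yields a cocycle; when it is inner, the same \<open>G\<close>
  corrects the splitting for both generators at once.\<close>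

lemma extensions_split:
  assumes M: "M \<in> rep_B3 a" "rep_dim M = a" and N: "N \<in> rep_B3 b" "rep_dim N = b"
    and x: "(E, \<iota>, \<pi>) \<in> extensions M N" and d: "rep_dim E = d"
    and inner: "cocycles_inner a (emb (fst M)) (emb (snd M)) b (emb (fst N)) (emb (snd N))"
  obtains r s where "r \<in> shp b d" "s \<in> shp d a" "r * emb \<iota> = idm b" "emb \<pi> * s = idm a" "r * s = 0"
    "emb \<pi> * emb \<iota> = 0" "r \<in> homs d (emb (fst E)) b (emb (fst N)) \<inter> homs d (emb (snd E)) b (emb (snd N))"
    "s \<in> homs a (emb (fst M)) d (emb (fst E)) \<inter> homs a (emb (snd M)) d (emb (snd E))"
proof -
  have E: "E \<in> rep_B3 d" and i\<iota>: "\<iota> \<in> intertwiners N E" and p\<pi>: "\<pi> \<in> intertwiners E M"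
    using x d by (auto simp: extensions_def is_rep_B3_def)
  have c: "\<iota> \<in> carrier_mat d b" "\<pi> \<in> carrier_mat a d" using i\<iota> p\<pi> by (auto simp: intertwiners_def d M(2) N(2))
  obtain r s where rs: "r \<in> shp b d" "s \<in> shp d a" "r * emb \<iota> = idm b" "emb \<pi> * s = idm a"
    "emb \<pi> * emb \<iota> = 0" "emb \<iota> * r + s * emb \<pi> = idm d" "r * s = 0"
    using extensions_splitting[OF x M(2) N(2) d] .
  define i where "i = emb \<iota>"
  define p where "p = emb \<pi>"
  note rs = rs[folded i_def p_def]
  define AM where "AM = emb (fst M)" define BM where "BM = emb (snd M)"
  define AN where "AN = emb (fst N)" define BN where "BN = emb (snd N)"
  define A where "A = emb (fst E)" define B where "B = emb (snd E)"
  note fold = AM_def[symmetric] BM_def[symmetric] AN_def[symmetric] BN_def[symmetric] A_def[symmetric] B_def[symmetric] i_def[symmetric] p_def[symmetric]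
  have MD: "AM \<in> shp a a" "BM \<in> shp a a" and ND: "AN \<in> shp b b" "BN \<in> shp b b"
    and ED: "A \<in> shp d d" "B \<in> shp d d" "A * A = B * B * B"
    using rep_B3D[OF M(1)] rep_B3D[OF N(1)] rep_B3D[OF E] by (simp_all add: fold)
  have ip: "i \<in> shp d b" "p \<in> shp a d" unfolding i_def p_def using c by (auto intro: emb_shp)
  have iN: "A * i = i * AN" "B * i = i * BN" and pM: "p * A = AM * p" "p * B = BM * p"
    using i\<iota> p\<pi> unfolding intertwiners_iff[OF N E d c(1)] intertwiners_iff[OF E d M c(2)] by (auto simp: homs_def fold)
  \<comment> \<open>The off-diagonal blocks of the middle term with respect to the linear splitting.
    Comparing the blocks of \<open>A * A = B * B * B\<close> shows that they form a cocycle.\<close>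
  define X where "X = r * A * s"
  define Y where "Y = r * B * s"
  have XY: "X \<in> shp b a" "Y \<in> shp b a" unfolding X_def Y_def using rs(1,2) ED by auto
  have rC: "r * C = CN * r + (r * C * s) * p" if C: "C * i = i * CN" "C \<in> shp d d" "CN \<in> shp b b" for C CN
  proof -
    have "r * C = r * C * (i * r + s * p)" using idm_right[OF shp_mult[OF rs(1) C(2)]] by (simp add: rs(6))
    also have "\<dots> = r * (C * i) * r + (r * C * s) * p" by (simp add: distrib_left mult.assoc)
    also have "r * (C * i) * r = (r * i) * CN * r" by (simp add: C(1) mult.assoc)
    finally show ?thesis using C rs(3) by simp
  qed
  have pCs: "p * C * s = CM" if "p * C = CM * p" "CM \<in> shp a a" for C CM
    using that rs(4) by (simp add: mult.assoc)
  have rA: "r * A = AN * r + X * p" unfolding X_def by (rule rC[OF iN(1) ED(1) ND(1)])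
  have rB: "r * B = BN * r + Y * p" unfolding Y_def by (rule rC[OF iN(2) ED(2) ND(2)])
  have "r * (A * A) * s = AN * X + X * AM"
  proof -
    have "r * (A * A) * s = (r * A) * (A * s)" by (simp only: mult.assoc)
    also have "\<dots> = (AN * r + X * p) * (A * s)" by (simp only: rA)
    also have "\<dots> = AN * (r * A * s) + X * (p * A * s)" by (simp only: distrib_right mult.assoc)
    finally show ?thesis by (simp add: X_def pCs[OF pM(1) MD(1)])
  qed
  moreover have "r * (B * B * B) * s = BN * BN * Y + BN * Y * BM + Y * BM * BM"
  proof -
    have pB: "p * (B * s) = BM" using pCs[OF pM(2) MD(2)] by (simp add: mult.assoc)
    have rBs: "r * (B * s) = Y" by (simp add: Y_def mult.assoc)
    have rX: "r * (B * V) = BN * (r * V) + Y * (p * V)" for V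
      using arg_cong[OF rB, of "\<lambda>U. U * V"] by (simp add: distrib_right mult.assoc)
    have pX: "p * (B * V) = BM * (p * V)" for V
      using arg_cong[OF pM(2), of "\<lambda>U. U * V"] by (simp add: mult.assoc)
    have "r * (B * B * B) * s = r * (B * (B * (B * s)))" by (simp add: mult.assoc)
    also have "\<dots> = BN * (BN * Y + Y * BM) + Y * (BM * BM)" unfolding rX[of "B * (B * s)"] rX[of "B * s"] pX[of "B * s"] rBs pB ..
    finally show ?thesis by (simp add: distrib_left mult.assoc add_ac)
  qed
  ultimately have "AN * X + X * AM = BN * BN * Y + BN * Y * BM + Y * BM * BM" by (simp add: ED(3))
  then obtain G where G: "G \<in> shp b a" "X = AN * G - G * AM" "Y = BN * G - G * BM"
    using inner XY unfolding cocycles_inner_def fold by blast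
  note cA = conjugate_splitting[OF iN(1) pM(1) G(2)[unfolded X_def] rs(6,3,4,5,7) ED(1) ip(1) rs(1) ip(2) rs(2) ND(1) MD(1) G(1)]
  note cB = conjugate_splitting[OF iN(2) pM(2) G(3)[unfolded Y_def] rs(6,3,4,5,7) ED(2) ip(1) rs(1) ip(2) rs(2) ND(2) MD(2) G(1)]
  show thesis
  proof (rule that[of "r + G * p" "s - i * G", unfolded fold])
    show sh: "r + G * p \<in> shp b d" "s - i * G \<in> shp d a" using rs(1,2) ip G(1) by auto
    show "(r + G * p) * i = idm b" "p * (s - i * G) = idm a"
      using rs(3,4,5) by (simp_all add: distrib_right right_diff_distrib mult.assoc) (simp add: mult.assoc[symmetric] rs(5))
    have "(r + G * p) * (s - i * G) = r * s - (r * i) * G + G * (p * s) - G * (p * i) * G" by (simp add: algebra_simps)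
    then show "(r + G * p) * (s - i * G) = 0" using G(1) by (simp add: rs)
    show "p * i = 0" by (rule rs(5))
    show "r + G * p \<in> homs d A b AN \<inter> homs d B b BN" using sh cA(1) cB(1) by (simp add: homs_def)
    show "s - i * G \<in> homs a AM d A \<inter> homs a BM d B" using sh cA(2) cB(2) by (simp add: homs_def)
  qed
qed

text \<open>Two extensions that split as representations are related by sending submodule to
  submodule and section to section.\<close>

lemma extensions_equivalent:
  assumes M: "M \<in> rep_B3 a" "rep_dim M = a" and N: "N \<in> rep_B3 b" "rep_dim N = b"
    and inner: "cocycles_inner a (emb (fst M)) (emb (snd M)) b (emb (fst N)) (emb (snd N))"
    and x: "x \<in> extensions M N" and y: "y \<in> extensions M N"
  shows "(x, y) \<in> ext_equiv M N"
proof -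
  obtain E \<iota> \<pi> where x': "x = (E, \<iota>, \<pi>)" by (cases x)
  obtain E' \<iota>' \<pi>' where y': "y = (E', \<iota>', \<pi>')" by (cases y)
  define d where "d = rep_dim E"
  define d' where "d' = rep_dim E'"
  have E: "E \<in> rep_B3 d" "\<iota> \<in> intertwiners N E" "\<pi> \<in> intertwiners E M"
    and E': "E' \<in> rep_B3 d'" "\<iota>' \<in> intertwiners N E'" "\<pi>' \<in> intertwiners E' M"
    using x y by (auto simp: x' y' extensions_def is_rep_B3_def d_def d'_def)
  have dd: "rep_dim E = d" "rep_dim E' = d'" by (simp_all add: d_def d'_def)
  have c: "\<iota> \<in> carrier_mat d b" "\<pi> \<in> carrier_mat a d" "\<iota>' \<in> carrier_mat d' b" "\<pi>' \<in> carrier_mat a d'"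
    using E E' by (auto simp: intertwiners_def dd M(2) N(2))
  obtain r s where rs: "r \<in> shp b d" "s \<in> shp d a" "r * emb \<iota> = idm b" "emb \<pi> * s = idm a" "r * s = 0"
    "emb \<pi> * emb \<iota> = 0" "r \<in> homs d (emb (fst E)) b (emb (fst N)) \<inter> homs d (emb (snd E)) b (emb (snd N))"
    "s \<in> homs a (emb (fst M)) d (emb (fst E)) \<inter> homs a (emb (snd M)) d (emb (snd E))"
    using extensions_split[OF M N x[unfolded x'] dd(1) inner] .
  obtain r' s' where rs': "r' \<in> shp b d'" "s' \<in> shp d' a" "r' * emb \<iota>' = idm b" "emb \<pi>' * s' = idm a" "r' * s' = 0"
    "emb \<pi>' * emb \<iota>' = 0" "r' \<in> homs d' (emb (fst E')) b (emb (fst N)) \<inter> homs d' (emb (snd E')) b (emb (snd N))"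
    "s' \<in> homs a (emb (fst M)) d' (emb (fst E')) \<inter> homs a (emb (snd M)) d' (emb (snd E'))"
    using extensions_split[OF M N y[unfolded y'] dd(2) inner] .
  have i': "emb \<iota>' \<in> homs b (emb (fst N)) d' (emb (fst E')) \<inter> homs b (emb (snd N)) d' (emb (snd E'))"
    and p: "emb \<pi> \<in> homs d (emb (fst E)) a (emb (fst M)) \<inter> homs d (emb (snd E)) a (emb (snd M))"
    using E'(2) E(3) unfolding intertwiners_iff[OF N E'(1) dd(2) c(3)] intertwiners_iff[OF E(1) dd(1) M c(2)] by auto
  \<comment> \<open>On the image of \<open>\<iota>\<close> this is \<open>\<iota>'\<close>; on the
    section it passes through the quotient to the section of the other extension.\<close>
  define \<Phi> where "\<Phi> = emb \<iota>' * r + s' * emb \<pi>"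
  have \<Phi>: "\<Phi> \<in> homs d (emb (fst E)) d' (emb (fst E'))" "\<Phi> \<in> homs d (emb (snd E)) d' (emb (snd E'))"
    unfolding \<Phi>_def using rs(7) rs'(8) i' p by (blast intro: homs_add homs_mult)+
  then have \<Phi>s: "\<Phi> \<in> shp d' d" by (simp add: homs_def)
  define \<phi> where "\<phi> = tomat d' d \<Phi>"
  have \<phi>: "\<phi> \<in> carrier_mat d' d" "emb \<phi> = \<Phi>" using emb_tomat[OF \<Phi>s] by (simp_all add: \<phi>_def)
  have "\<phi> \<in> intertwiners E E'" unfolding intertwiners_iff[OF E(1) dd(1) E'(1) dd(2) \<phi>(1)] \<phi>(2) using \<Phi> by simp
  moreover have "\<phi> * \<iota> = \<iota>'"
  proof (rule emb_inj[OF mult_carrier_mat[OF \<phi>(1) c(1)] c(3)])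
    show "emb (\<phi> * \<iota>) = emb \<iota>'"
      using emb_shp[OF c(3)] by (simp add: emb_mult[OF \<phi>(1) c(1)] \<phi>(2) \<Phi>_def distrib_right mult.assoc rs)
  qed
  moreover have "\<pi>' * \<phi> = \<pi>"
  proof (rule emb_inj[OF mult_carrier_mat[OF c(4) \<phi>(1)] c(2)])
    show "emb (\<pi>' * \<phi>) = emb \<pi>"
      using emb_shp[OF c(2)] by (simp add: emb_mult[OF c(4) \<phi>(1)] \<phi>(2) \<Phi>_def distrib_left mult.assoc[symmetric] rs')
  qed
  ultimately show ?thesis using x y unfolding ext_equiv_def x' y' by blast
qed

lemma upper_inr: "R \<in> shp b b \<Longrightarrow> upper a b P 0 R * inr a b = inr a b * R"
  by (simp add: upper_def distrib_right mult.assoc biproduct)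

section \<open>Extensions built from cocycles\<close>

context
  fixes M N :: rep and a b d :: nat and AM BM AN BN :: fmat
  assumes M: "M \<in> rep_B3 a" "rep_dim M = a" and N: "N \<in> rep_B3 b" "rep_dim N = b"
  defines "d \<equiv> b + a" and "AM \<equiv> emb (fst M)" and "BM \<equiv> emb (snd M)" and "AN \<equiv> emb (fst N)" and "BN \<equiv> emb (snd N)"
begin

definition cocycle_rep :: "fmat \<Rightarrow> fmat \<Rightarrow> rep" where
  "cocycle_rep X Y = (tomat d d (upper b a AN X AM), tomat d d (upper b a BN Y BM))"

definition cocycle_extension :: "fmat \<Rightarrow> fmat \<Rightarrow> extension" where
  "cocycle_extension X Y = (cocycle_rep X Y, tomat d b (inl b a), tomat a d (prr b a))"

lemma rep_shp: "AM \<in> shp a a" "BM \<in> shp a a" "AN \<in> shp b b" "BN \<in> shp b b"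
  using rep_B3D(4,5)[OF M(1)] rep_B3D(4,5)[OF N(1)] by (simp_all add: AM_def BM_def AN_def BN_def)

lemma emb_cocycle_rep:
  assumes "X \<in> shp b a" "Y \<in> shp b a"
  shows "emb (fst (cocycle_rep X Y)) = upper b a AN X AM" "emb (snd (cocycle_rep X Y)) = upper b a BN Y BM"
  unfolding cocycle_rep_def fst_conv snd_conv d_def using assms rep_shp by (intro emb_tomat upper_shp; simp)+

lemma cocycle_rep_B3:
  assumes X: "X \<in> shp b a" and Y: "Y \<in> shp b a"
    and eq: "AN * X + X * AM = BN * BN * Y + BN * Y * BM + Y * BM * BM"
  shows "cocycle_rep X Y \<in> rep_B3 d"
  unfolding cocycle_rep_def
proof (rule rep_B3I)
  note i = rep_B3_invf[OF M(1), folded AM_def BM_def] rep_B3_invf[OF N(1), folded AN_def BN_def]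
  show "invf d (upper b a AN X AM)" "invf d (upper b a BN Y BM)"
    unfolding d_def by (rule invf_upper; fact i X Y)+
  show "upper b a AN X AM * upper b a AN X AM = upper b a BN Y BM * upper b a BN Y BM * upper b a BN Y BM"
    unfolding upper_mult[OF rep_shp(3) X rep_shp(1)] upper_mult[OF rep_shp(4) Y rep_shp(2)]
    by (simp add: eq rep_B3D(3)[OF M(1), folded AM_def BM_def] rep_B3D(3)[OF N(1), folded AN_def BN_def]
        distrib_right add.assoc)
qed

lemma rep_dim_cocycle: "rep_dim (cocycle_rep X Y) = d"
  by (simp add: rep_dim_def cocycle_rep_def tomat_def)

lemma cocycle_extension_in:
  assumes X: "X \<in> shp b a" and Y: "Y \<in> shp b a"
    and eq: "AN * X + X * AM = BN * BN * Y + BN * Y * BM + Y * BM * BM"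
  shows "cocycle_extension X Y \<in> extensions M N"
  unfolding cocycle_extension_def
proof (rule extensionsI)
  note E = cocycle_rep_B3[OF assms]
  have e: "emb (tomat d b (inl b a)) = inl b a" "emb (tomat a d (prr b a)) = prr b a"
    unfolding d_def by (rule emb_tomat; simp)+
  show "is_rep_B3 M" "is_rep_B3 N" "is_rep_B3 (cocycle_rep X Y)"
    using M N E by (simp_all add: is_rep_B3_def rep_dim_cocycle)
  show "rep_dim M = a" "rep_dim N = b" "rep_dim (cocycle_rep X Y) = d" using M N by (simp_all add: rep_dim_cocycle)
  show "tomat d b (inl b a) \<in> intertwiners N (cocycle_rep X Y)"
    unfolding intertwiners_iff[OF N E rep_dim_cocycle tomat_carrier] e emb_cocycle_rep[OF X Y] homs_def
    using rep_shp by (simp add: upper_inl_prr d_def flip: AN_def BN_def)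
  show "tomat a d (prr b a) \<in> intertwiners (cocycle_rep X Y) M"
    unfolding intertwiners_iff[OF E rep_dim_cocycle M tomat_carrier] e emb_cocycle_rep[OF X Y] homs_def
    using rep_shp by (simp add: upper_inl_prr d_def flip: AM_def BM_def)
  show "prl b a * emb (tomat d b (inl b a)) = idm b" "emb (tomat a d (prr b a)) * inr b a = idm a"
    "emb (tomat a d (prr b a)) * emb (tomat d b (inl b a)) = 0"
    "emb (tomat d b (inl b a)) * prl b a + inr b a * emb (tomat a d (prr b a)) = idm d"
    unfolding e unfolding d_def by (rule biproduct)+
qed (simp_all add: d_def)

lemma split_extension_eq: "split_extension M N = cocycle_extension 0 0"
proof -
  note C = rep_B3D(1,2)[OF M(1)] rep_B3D(1,2)[OF N(1)]
  have blk: "four_block_mat P (0\<^sub>m b a) (0\<^sub>m a b) Q = tomat d d (upper b a (emb P) 0 (emb Q))"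
    if P: "P \<in> carrier_mat b b" and Q: "Q \<in> carrier_mat a a" for P Q
  proof (rule emb_inj[of _ d d])
    show "four_block_mat P (0\<^sub>m b a) (0\<^sub>m a b) Q \<in> carrier_mat d d" using P Q by (simp add: d_def)
    have "upper b a (emb P) 0 (emb Q) \<in> shp d d" unfolding d_def using P Q by (intro upper_shp emb_shp) simp_all
    from emb_tomat[OF this] show "emb (four_block_mat P (0\<^sub>m b a) (0\<^sub>m a b) Q) = emb (tomat d d (upper b a (emb P) 0 (emb Q)))"
      by (simp add: emb_block_diag[OF P Q] upper_def)
  qed simp
  have diag: "diag_block_mat [P, Q] = tomat d d (upper b a (emb P) 0 (emb Q))"
    if PQ: "P \<in> carrier_mat b b" "Q \<in> carrier_mat a a" for P Q
    unfolding blk[OF PQ, symmetric] using PQ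
    by (subst diag_block_mat.simps(2), subst diag_block_mat_singleton) (simp add: Let_def)
  have "direct_sum_reps [N, M] = cocycle_rep 0 0"
    unfolding direct_sum_reps_def cocycle_rep_def list.map diag[OF C(3,1)] diag[OF C(4,2)] AM_def BM_def AN_def BN_def ..
  moreover have "1\<^sub>m b @\<^sub>r 0\<^sub>m a b = tomat d b (inl b a)"
    by (rule eq_matI) (auto simp: append_rows_def tomat_def inl_def fm.rep_eq d_def)
  moreover have "mat a (b + a) (\<lambda>(i, j). if j = b + i then 1 else 0) = tomat a d (prr b a)"
    by (rule eq_matI) (auto simp: tomat_def prr_def fm.rep_eq d_def)
  ultimately show ?thesis by (simp add: split_extension_def cocycle_extension_def M(2) N(2))
qed

text \<open>If cocycles are inner, all extensions are equivalent. Conversely, an equivalence from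
  the split extension to the one built from \<open>(X, Y)\<close> is block triangular with identity
  quotient part, and its upper right block exhibits the cocycle as inner.\<close>

lemma Ext1_zero_iff: "Ext1 M N = {Ext1_zero M N} \<longleftrightarrow> cocycles_inner a AM BM b AN BN"
proof
  have split: "split_extension M N \<in> extensions M N"
    unfolding split_extension_eq by (rule cocycle_extension_in) simp_all
  {
    assume inner: "cocycles_inner a AM BM b AN BN"
    have "ext_equiv M N `` {x} = extensions M N" if x: "x \<in> extensions M N" for x
    proof
      show "extensions M N \<subseteq> ext_equiv M N `` {x}"
        using extensions_equivalent[OF M N inner[unfolded AM_def BM_def AN_def BN_def] x] by auto
      show "ext_equiv M N `` {x} \<subseteq> extensions M N" by (auto simp: ext_equiv_def)
    qed
    then show "Ext1 M N = {Ext1_zero M N}"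
      using split by (auto simp: Ext1_def Ext1_zero_def quotient_def)
  }
  assume Ext: "Ext1 M N = {Ext1_zero M N}"
  show "cocycles_inner a AM BM b AN BN"
    unfolding cocycles_inner_def
  proof (intro ballI impI)
    fix X Y assume X: "X \<in> shp b a" and Y: "Y \<in> shp b a"
      and eq: "AN * X + X * AM = BN * BN * Y + BN * Y * BM + Y * BM * BM"
    define E where "E = cocycle_rep X Y"
    define E0 where "E0 = cocycle_rep 0 0"
    have E: "E \<in> rep_B3 d" "E0 \<in> rep_B3 d" unfolding E_def E0_def
      by (rule cocycle_rep_B3[OF X Y eq], rule cocycle_rep_B3) simp_all
    have dE: "rep_dim E = d" "rep_dim E0 = d" by (simp_all add: E_def E0_def rep_dim_cocycle)
    define x where "x = cocycle_extension X Y"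
    have x: "x \<in> extensions M N" unfolding x_def by (rule cocycle_extension_in[OF X Y eq])
    \<comment> \<open>Reflexivity puts \<open>x\<close> in its own class; as there is a single
      class, the split extension is related to \<open>x\<close>.\<close>
    have "(x, x) \<in> ext_equiv M N"
    proof -
      have "1\<^sub>m d \<in> intertwiners E E" using rep_B3D(1,2)[OF E(1)] by (simp add: intertwiners_def dE)
      moreover have "1\<^sub>m d * tomat d b (inl b a) = tomat d b (inl b a)" "tomat a d (prr b a) * 1\<^sub>m d = tomat a d (prr b a)"
        by (simp_all add: left_mult_one_mat[OF tomat_carrier] right_mult_one_mat[OF tomat_carrier])
      ultimately show ?thesis using x unfolding ext_equiv_def x_def cocycle_extension_def E_def[symmetric] by blast
    qed
    moreover have "ext_equiv M N `` {x} = ext_equiv M N `` {split_extension M N}"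
      using Ext quotientI[OF x, of "ext_equiv M N"] unfolding Ext1_def Ext1_zero_def by simp
    ultimately have "(cocycle_extension 0 0, x) \<in> ext_equiv M N" unfolding split_extension_eq by blast
    then have "\<exists>\<phi>\<in>intertwiners E0 E. \<phi> * tomat d b (inl b a) = tomat d b (inl b a) \<and>
        tomat a d (prr b a) * \<phi> = tomat a d (prr b a)"
      unfolding ext_equiv_def x_def cocycle_extension_def E_def E0_def by simp
    then obtain \<phi> where \<phi>: "\<phi> \<in> intertwiners E0 E" "tomat a d (prr b a) * \<phi> = tomat a d (prr b a)"
      by (elim bexE conjE)
    have c: "\<phi> \<in> carrier_mat d d" using \<phi>(1) by (simp add: intertwiners_def dE)
    define \<Phi> where "\<Phi> = emb \<phi>"
    have \<Phi>: "\<Phi> \<in> shp d d" "upper b a AN X AM * \<Phi> = \<Phi> * upper b a AN 0 AM" "upper b a BN Y BM * \<Phi> = \<Phi> * upper b a BN 0 BM"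
      using \<phi>(1) unfolding intertwiners_iff[OF E(2) dE(2) E(1) dE(1) c] homs_def \<Phi>_def
      by (simp_all add: E_def E0_def emb_cocycle_rep X Y)
    have p\<Phi>: "prr b a * \<Phi> = prr b a"
      using arg_cong[OF \<phi>(2), of emb] emb_tomat[of "prr b a" a d]
      unfolding emb_mult[OF tomat_carrier c] by (simp add: \<Phi>_def d_def)
    \<comment> \<open>The upper right block of the equivalence. Since \<open>p\<Phi>\<close> makes
      the lower row that of the identity, comparing these blocks shows that \<open>- G\<close>
      conjugates.\<close>
    define G where "G = prl b a * (\<Phi> * inr b a)"
    have G: "G \<in> shp b a" unfolding G_def
      by (rule shp_mult[OF biproduct_shp(2) shp_mult[OF \<Phi>(1)[unfolded d_def] biproduct_shp(3)]])
    have key: "Z = CN * (- G) - (- G) * CM"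
      if U: "upper b a CN Z CM * \<Phi> = \<Phi> * upper b a CN 0 CM" and sh: "Z \<in> shp b a" "CN \<in> shp b b" "CM \<in> shp a a" for CN CM Z
    proof -
      have "G * CM = prl b a * (\<Phi> * upper b a CN 0 CM) * inr b a"
        by (simp add: G_def mult.assoc upper_inr[OF sh(3)])
      also have "\<dots> = (prl b a * upper b a CN Z CM) * \<Phi> * inr b a" by (simp only: U[symmetric] mult.assoc)
      also have "\<dots> = CN * G + idm b * Z * ((prr b a * \<Phi>) * inr b a)"
        by (simp add: upper_inl_prr(3)[OF sh(2,3)] G_def distrib_right mult.assoc)
      also have "\<dots> = CN * G + Z" using sh(1) by (simp add: p\<Phi> biproduct mult.assoc)
      finally show ?thesis by (simp add: algebra_simps)
    qed
    show "\<exists>G\<in>shp b a. X = AN * G - G * AM \<and> Y = BN * G - G * BM"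
      using G key[OF \<Phi>(2) X rep_shp(3,1)] key[OF \<Phi>(3) Y rep_shp(4,2)] by (intro bexI[of _ "- G"] conjI shp_simps)
  qed
qed

end

text \<open>\<open>J p\<close> and \<open>P p\<close> are inclusions and projections of the
  summands, counted with multiplicity, and they intertwine both generators.\<close>

definition decomposes :: "nat \<Rightarrow> fmat \<Rightarrow> fmat \<Rightarrow> nat \<Rightarrow> (nat \<Rightarrow> nat) \<Rightarrow> (nat \<Rightarrow> fmat) \<Rightarrow> (nat \<Rightarrow> fmat) \<Rightarrow>
    (nat \<Rightarrow> fmat) \<Rightarrow> (nat \<Rightarrow> fmat) \<Rightarrow> bool" where
  "decomposes n A B m d a b J P \<longleftrightarrow>
    (\<forall>p<m. J p \<in> shp n (d p) \<and> P p \<in> shp (d p) n \<and> A * J p = J p * a p \<and> P p * A = a p * P p \<and>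
       B * J p = J p * b p \<and> P p * B = b p * P p \<and> (\<forall>q<m. P p * J q = (if p = q then idm (d p) else 0))) \<and>
    (\<Sum>p<m. J p * P p) = idm n"

lemma decomposesD:
  assumes "decomposes n A B m d a b J P" "p < m"
  shows "J p \<in> shp n (d p)" "P p \<in> shp (d p) n" "A * J p = J p * a p" "P p * A = a p * P p"
    "B * J p = J p * b p" "P p * B = b p * P p" "q < m \<Longrightarrow> P p * J q = (if p = q then idm (d p) else 0)"
  using assms unfolding decomposes_def by blast+

lemma direct_sum_decomposes:
  assumes "\<forall>S\<in>set Ss. S \<in> rep_B3 (rep_dim S)"
  shows "\<exists>n J P. fst (direct_sum_reps Ss) \<in> carrier_mat n n \<and> snd (direct_sum_reps Ss) \<in> carrier_mat n n \<and>
    decomposes n (emb (fst (direct_sum_reps Ss))) (emb (snd (direct_sum_reps Ss))) (length Ss)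
      (\<lambda>p. rep_dim (Ss ! p)) (\<lambda>p. emb (fst (Ss ! p))) (\<lambda>p. emb (snd (Ss ! p))) J P"
  using assms
proof (induction Ss)
  case Nil
  have "idm 0 = 0" by (rule fmat_eqI) (simp add: idm.rep_eq)
  then show ?case by (intro exI[of _ 0]) (simp add: direct_sum_reps_def decomposes_def)
next
  case (Cons S Ss)
  define a where "a = rep_dim S"
  have S: "S \<in> rep_B3 a" using Cons.prems by (simp add: a_def)
  define A where "A = emb (fst S)"
  define B where "B = emb (snd S)"
  note SD = rep_B3D[OF S, folded A_def B_def]
  define D where "D = direct_sum_reps Ss"
  have Ss: "\<forall>S\<in>set Ss. S \<in> rep_B3 (rep_dim S)" using Cons.prems by simp
  obtain n J P where D: "fst D \<in> carrier_mat n n" "snd D \<in> carrier_mat n n"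
    and dec: "decomposes n (emb (fst D)) (emb (snd D)) (length Ss)
      (\<lambda>p. rep_dim (Ss ! p)) (\<lambda>p. emb (fst (Ss ! p))) (\<lambda>p. emb (snd (Ss ! p))) J P"
    using Cons.IH[OF Ss] unfolding D_def by (elim exE conjE)
  define A' where "A' = emb (fst D)"
  define B' where "B' = emb (snd D)"
  have sD: "A' \<in> shp n n" "B' \<in> shp n n" unfolding A'_def B'_def using D by (auto intro: emb_shp)
  have ds: "direct_sum_reps (S # Ss) = (four_block_mat (fst S) (0\<^sub>m a n) (0\<^sub>m n a) (fst D), four_block_mat (snd S) (0\<^sub>m a n) (0\<^sub>m n a) (snd D))"
    using D SD(1,2) by (simp add: direct_sum_reps_def D_def Let_def)
  have up: "emb (fst (direct_sum_reps (S # Ss))) = upper a n A 0 A'" "emb (snd (direct_sum_reps (S # Ss))) = upper a n B 0 B'"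
    unfolding ds fst_conv snd_conv emb_block_diag[OF SD(1) D(1)] emb_block_diag[OF SD(2) D(2)]
    by (simp_all add: upper_def A_def B_def A'_def B'_def)
  have c: "fst (direct_sum_reps (S # Ss)) \<in> carrier_mat (a + n) (a + n)" "snd (direct_sum_reps (S # Ss)) \<in> carrier_mat (a + n) (a + n)"
    unfolding ds using D SD by simp_all
  define J' where "J' p = (case p of 0 \<Rightarrow> inl a n | Suc p \<Rightarrow> inr a n * J p)" for p
  define P' where "P' p = (case p of 0 \<Rightarrow> prl a n | Suc p \<Rightarrow> P p * prr a n)" for p
  note d = decomposesD[OF dec, folded A'_def B'_def]
  have U: "upper a n A 0 A' * inl a n = inl a n * A" "upper a n A 0 A' * inr a n = inr a n * A'"
    "prl a n * upper a n A 0 A' = A * prl a n" "prr a n * upper a n A 0 A' = A' * prr a n"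
    "upper a n B 0 B' * inl a n = inl a n * B" "upper a n B 0 B' * inr a n = inr a n * B'"
    "prl a n * upper a n B 0 B' = B * prl a n" "prr a n * upper a n B 0 B' = B' * prr a n"
    using SD(4,5) sD by (simp_all add: upper_inl_prr upper_inr)
  have "decomposes (a + n) (upper a n A 0 A') (upper a n B 0 B') (length (S # Ss))
      (\<lambda>p. rep_dim ((S # Ss) ! p)) (\<lambda>p. emb (fst ((S # Ss) ! p))) (\<lambda>p. emb (snd ((S # Ss) ! p))) J' P'"
    unfolding decomposes_def
  proof (intro conjI allI impI)
    fix p assume p: "p < length (S # Ss)"
    have "J' p \<in> shp (a + n) (rep_dim ((S # Ss) ! p)) \<and> P' p \<in> shp (rep_dim ((S # Ss) ! p)) (a + n) \<and>
      upper a n A 0 A' * J' p = J' p * emb (fst ((S # Ss) ! p)) \<and> P' p * upper a n A 0 A' = emb (fst ((S # Ss) ! p)) * P' p \<and>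
      upper a n B 0 B' * J' p = J' p * emb (snd ((S # Ss) ! p)) \<and> P' p * upper a n B 0 B' = emb (snd ((S # Ss) ! p)) * P' p"
    proof (cases p)
      case 0
      then show ?thesis by (simp add: J'_def P'_def U A_def[symmetric] B_def[symmetric] a_def[symmetric])
    next
      case (Suc q)
      then have q: "q < length Ss" using p by simp
      have "upper a n A 0 A' * (inr a n * J q) = inr a n * (A' * J q)" "upper a n B 0 B' * (inr a n * J q) = inr a n * (B' * J q)"
        by (simp_all add: mult.assoc[symmetric] U)
      moreover have "P q * prr a n * upper a n A 0 A' = P q * A' * prr a n" "P q * prr a n * upper a n B 0 B' = P q * B' * prr a n"
        by (simp_all add: mult.assoc U)
      moreover have "inr a n * J q \<in> shp (a + n) (rep_dim (Ss ! q))" "P q * prr a n \<in> shp (rep_dim (Ss ! q)) (a + n)"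
        using d(1,2)[OF q] by (auto intro: shp_mult[OF biproduct_shp(3)] shp_mult[OF _ biproduct_shp(4)])
      ultimately show ?thesis using d(3-6)[OF q] by (simp add: Suc J'_def P'_def mult.assoc)
    qed
    then show "J' p \<in> shp (a + n) (rep_dim ((S # Ss) ! p))" "P' p \<in> shp (rep_dim ((S # Ss) ! p)) (a + n)"
      "upper a n A 0 A' * J' p = J' p * emb (fst ((S # Ss) ! p))" "P' p * upper a n A 0 A' = emb (fst ((S # Ss) ! p)) * P' p"
      "upper a n B 0 B' * J' p = J' p * emb (snd ((S # Ss) ! p))" "P' p * upper a n B 0 B' = emb (snd ((S # Ss) ! p)) * P' p"
      by blast+
    fix q assume q: "q < length (S # Ss)"
    show "P' p * J' q = (if p = q then idm (rep_dim ((S # Ss) ! p)) else 0)"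
    proof (cases p)
      case 0
      then show ?thesis by (cases q) (simp_all add: J'_def P'_def biproduct biproduct_assoc a_def)
    next
      case p': (Suc p')
      show ?thesis
      proof (cases q)
        case 0
        then show ?thesis by (simp add: p' J'_def P'_def mult.assoc biproduct)
      next
        case (Suc q')
        have "P p' * (idm n * J q') = P p' * J q'" using d(1)[of q'] q Suc by simp
        then show ?thesis using d(7)[of p' q'] p q by (simp add: p' Suc J'_def P'_def mult.assoc biproduct_assoc)
      qed
    qed
  next
    have "(\<Sum>p<length (S # Ss). J' p * P' p) = inl a n * prl a n + inr a n * (\<Sum>p<length Ss. J p * P p) * prr a n"
      unfolding list.size(4) add_Suc_right add_0_right sum.lessThan_Suc_shift
      by (simp add: J'_def P'_def sum_distrib_left sum_distrib_right mult.assoc)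
    also have "\<dots> = idm (a + n)" using dec by (simp add: decomposes_def biproduct idm_right[OF biproduct_shp(3)])
    finally show "(\<Sum>p<length (S # Ss). J' p * P' p) = idm (a + n)" .
  qed
  then show ?case unfolding up
    by (intro exI[of _ "a + n"] exI[of _ J'] exI[of _ P'] conjI c)
qed

lemma rep_iso_decomposes:
  assumes V: "V \<in> rep_B3 n" and iso: "rep_iso V (direct_sum_reps Ss)" and Ss: "\<forall>S\<in>set Ss. S \<in> rep_B3 (rep_dim S)"
  obtains J P where "decomposes n (emb (fst V)) (emb (snd V)) (length Ss)
      (\<lambda>p. rep_dim (Ss ! p)) (\<lambda>p. emb (fst (Ss ! p))) (\<lambda>p. emb (snd (Ss ! p))) J P"
proof -
  define D where "D = direct_sum_reps Ss"
  note VD = rep_B3D[OF V]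
  obtain m J P where D: "fst D \<in> carrier_mat m m" "snd D \<in> carrier_mat m m"
    and dec: "decomposes m (emb (fst D)) (emb (snd D)) (length Ss)
      (\<lambda>p. rep_dim (Ss ! p)) (\<lambda>p. emb (fst (Ss ! p))) (\<lambda>p. emb (snd (Ss ! p))) J P"
    using direct_sum_decomposes[OF Ss] unfolding D_def by (elim exE conjE)
  have dims: "rep_dim V = n" "rep_dim D = m" using VD D by (auto simp: rep_dim_def)
  obtain \<phi> where "\<phi> \<in> intertwiners V D" "invertible_mat \<phi>" using iso unfolding rep_iso_def D_def by blast
  then have \<phi>: "\<phi> \<in> carrier_mat m n" "invertible_mat \<phi>" "\<phi> * fst V = fst D * \<phi>" "\<phi> * snd V = snd D * \<phi>"
    by (simp_all add: intertwiners_def dims)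
  then have mn: "m = n" by (auto simp: invertible_mat_def)
  note D = D[unfolded mn] and \<phi> = \<phi>[unfolded mn] and dec = dec[unfolded mn]
  define \<Phi> where "\<Phi> = emb \<phi>"
  obtain \<Psi> where \<Psi>: "\<Psi> \<in> shp n n" "\<Phi> * \<Psi> = idm n" "\<Psi> * \<Phi> = idm n"
    using invertible_matD[OF \<phi>(1,2)] unfolding \<Phi>_def by metis
  define A where "A = emb (fst V)" define B where "B = emb (snd V)"
  define A' where "A' = emb (fst D)" define B' where "B' = emb (snd D)"
  have sh: "A \<in> shp n n" "B \<in> shp n n" "\<Phi> \<in> shp n n" "A' \<in> shp n n" "B' \<in> shp n n"
    using VD D \<phi>(1) by (auto simp: A_def B_def A'_def B'_def \<Phi>_def intro: emb_shp)
  have \<Phi>AB: "\<Phi> * A = A' * \<Phi>" "\<Phi> * B = B' * \<Phi>"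
    using arg_cong[OF \<phi>(3), of emb] arg_cong[OF \<phi>(4), of emb] \<phi>(1) VD D
    by (simp_all add: emb_mult[of _ n n _ n] A_def B_def A'_def B'_def \<Phi>_def)
  have conj: "C * \<Psi> = \<Psi> * C'" if "\<Phi> * C = C' * \<Phi>" "C \<in> shp n n" "C' \<in> shp n n" for C C'
  proof -
    have "C * \<Psi> = \<Psi> * (\<Phi> * C) * \<Psi>" using that(2) \<Psi>(3) by (simp add: mult.assoc[symmetric])
    also have "\<dots> = (\<Psi> * C') * (\<Phi> * \<Psi>)" unfolding that(1) by (simp only: mult.assoc)
    finally show ?thesis using shp_mult[OF \<Psi>(1) that(3)] \<Psi>(2) by simp
  qed
  have \<Psi>AB: "A * \<Psi> = \<Psi> * A'" "B * \<Psi> = \<Psi> * B'" by (rule conj; fact \<Phi>AB sh)+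
  note d = decomposesD[OF dec, folded A'_def B'_def]
  have "decomposes n A B (length Ss) (\<lambda>p. rep_dim (Ss ! p)) (\<lambda>p. emb (fst (Ss ! p))) (\<lambda>p. emb (snd (Ss ! p)))
      (\<lambda>p. \<Psi> * J p) (\<lambda>p. P p * \<Phi>)"
    unfolding decomposes_def
  proof (intro conjI allI impI)
    fix p assume p: "p < length Ss"
    show "\<Psi> * J p \<in> shp n (rep_dim (Ss ! p))" "P p * \<Phi> \<in> shp (rep_dim (Ss ! p)) n"
      by (rule shp_mult[OF \<Psi>(1) d(1)[OF p]], rule shp_mult[OF d(2)[OF p] sh(3)])
    show "A * (\<Psi> * J p) = \<Psi> * J p * emb (fst (Ss ! p))" "B * (\<Psi> * J p) = \<Psi> * J p * emb (snd (Ss ! p))"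
      by (simp_all add: mult.assoc[symmetric] \<Psi>AB) (simp_all add: mult.assoc d(3,5)[OF p])
    show "P p * \<Phi> * A = emb (fst (Ss ! p)) * (P p * \<Phi>)" "P p * \<Phi> * B = emb (snd (Ss ! p)) * (P p * \<Phi>)"
      by (simp_all add: mult.assoc \<Phi>AB) (simp_all add: mult.assoc[symmetric] d(4,6)[OF p])
    fix q assume q: "q < length Ss"
    have "P p * \<Phi> * (\<Psi> * J q) = P p * (\<Phi> * \<Psi>) * J q" by (simp only: mult.assoc)
    then show "P p * \<Phi> * (\<Psi> * J q) = (if p = q then idm (rep_dim (Ss ! p)) else 0)"
      using d(7)[OF p q] d(2)[OF p] by (simp add: \<Psi>(2))
  next
    have "(\<Sum>p<length Ss. \<Psi> * J p * (P p * \<Phi>)) = \<Psi> * (\<Sum>p<length Ss. J p * P p) * \<Phi>"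
      by (simp add: sum_distrib_left sum_distrib_right mult.assoc)
    then show "(\<Sum>p<length Ss. \<Psi> * J p * (P p * \<Phi>)) = idm n"
      using dec \<Psi>(1,3) by (simp add: decomposes_def)
  qed
  then show thesis using that unfolding A_def B_def by blast
qed

section \<open>Isotypic decompositions\<close>

text \<open>\<open>ty\<close> labels the isomorphism types. Summands with the same label are given
  by identical matrices, so the identity matrix is an intertwiner between them.\<close>

locale isotypic =
  fixes n m :: nat and A B :: fmat and d :: "nat \<Rightarrow> nat" and a b J P :: "nat \<Rightarrow> fmat" and c :: "nat \<Rightarrow> complex"
    and ty :: "nat \<Rightarrow> nat"
  assumes dec: "decomposes n A B m d a b J P"
    and AB: "A \<in> shp n n" "B \<in> shp n n"
    and sp: "p < m \<Longrightarrow> simple_pair (d p) (a p) (b p)"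
    and c: "p < m \<Longrightarrow> c p \<noteq> 0" "p < m \<Longrightarrow> a p * a p = sc (c p) (idm (d p))" "p < m \<Longrightarrow> b p * b p * b p = sc (c p) (idm (d p))"
    and same: "p < m \<Longrightarrow> q < m \<Longrightarrow> ty p = ty q \<Longrightarrow> d p = d q \<and> a p = a q \<and> b p = b q"
begin

lemmas D = decomposesD[OF dec]

lemma ab: "p < m \<Longrightarrow> a p \<in> shp (d p) (d p)" "p < m \<Longrightarrow> b p \<in> shp (d p) (d p)"
  using sp by (simp_all add: simple_pair_def)

section \<open>Block calculus over the summands\<close>

definition blk :: "(nat \<Rightarrow> nat \<Rightarrow> fmat) \<Rightarrow> fmat" where
  "blk F = (\<Sum>q<m. \<Sum>p<m. J q * F q p * P p)"

definition diag :: "(nat \<Rightarrow> fmat) \<Rightarrow> nat \<Rightarrow> nat \<Rightarrow> fmat" where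
  "diag h q p = (if q = p then h p else 0)"

lemma blk_cong: "(\<And>q p. q < m \<Longrightarrow> p < m \<Longrightarrow> F q p = F' q p) \<Longrightarrow> blk F = blk F'"
  unfolding blk_def by (intro sum.cong refl) auto

lemma blk_shp: "(\<And>q p. q < m \<Longrightarrow> p < m \<Longrightarrow> F q p \<in> shp (d q) (d p)) \<Longrightarrow> blk F \<in> shp n n"
  unfolding blk_def by (intro shp_sum) (auto intro!: shp_mult[OF shp_mult[OF D(1)] D(2)])

lemma blk_linear:
  "blk F + blk F' = blk (\<lambda>q p. F q p + F' q p)" "blk F - blk F' = blk (\<lambda>q p. F q p - F' q p)"
  "sc t (blk F) = blk (\<lambda>q p. sc t (F q p))"
  by (simp_all add: blk_def distrib_left distrib_right sum.distrib sum_subtractf left_diff_distrib right_diff_distrib sc_sum sc_simps)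

lemma blk_expand:
  assumes X: "X \<in> shp n n"
  shows "X = blk (\<lambda>q p. P q * X * J p)"
proof -
  have "X = (\<Sum>q<m. J q * P q) * X * (\<Sum>p<m. J p * P p)" using dec X by (simp add: decomposes_def)
  also have "\<dots> = (\<Sum>p<m. \<Sum>q<m. J q * (P q * X * J p) * P p)"
    by (simp add: sum_distrib_left sum_distrib_right mult.assoc)
  finally show ?thesis unfolding blk_def by (subst sum.swap)
qed

lemma blk_diag: "blk (diag h) = (\<Sum>p<m. J p * h p * P p)"
proof -
  have "(\<Sum>p<m. J q * diag h q p * P p) = (\<Sum>p<m. if q = p then J p * h p * P p else 0)" for q
    by (intro sum.cong) (auto simp: diag_def)
  then show ?thesis by (simp add: blk_def)
qed

lemma diag_mult:
  assumes h: "\<And>p. p < m \<Longrightarrow> h p \<in> shp (d p) (d p)"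
  shows "blk (diag h) * blk F = blk (\<lambda>q p. h q * F q p)" "blk F * blk (diag h) = blk (\<lambda>q p. F q p * h p)"
proof -
  have l: "J r * h r * P r * (J q * X) = (if q = r then J q * (h q * X) else 0)" if "q < m" "r < m" for q r X
  proof -
    have 1: "J r * h r * P r * (J q * X) = J r * (h r * (P r * J q)) * X" by (simp only: mult.assoc)
    have 2: "h r * (P r * J q) = (if r = q then h r else 0)" using D(7)[OF that(2,1)] h[OF that(2)] by auto
    show ?thesis unfolding 1 2 by (auto simp: mult.assoc)
  qed
  have r: "X * P p * (J r * h r * P r) = (if p = r then X * h p * P p else 0)" if "p < m" "r < m" for p r X
  proof -
    have "X * P p * (J r * h r * P r) = X * ((P p * J r) * h r) * P r" by (simp only: mult.assoc)
    then show ?thesis using D(7)[OF that] h[OF that(1)] by auto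
  qed
  have "blk (diag h) * blk F = (\<Sum>q<m. \<Sum>p<m. \<Sum>r<m. J r * h r * P r * (J q * (F q p * P p)))"
    unfolding blk_diag by (simp add: blk_def sum_distrib_left sum_distrib_right mult.assoc)
  also have "\<dots> = (\<Sum>q<m. \<Sum>p<m. \<Sum>r<m. if q = r then J q * (h q * (F q p * P p)) else 0)"
    using l by (intro sum.cong refl) auto
  also have "\<dots> = blk (\<lambda>q p. h q * F q p)" unfolding blk_def by (intro sum.cong refl) (auto simp: mult.assoc)
  finally show "blk (diag h) * blk F = blk (\<lambda>q p. h q * F q p)" .
  have "blk F * blk (diag h) = (\<Sum>r<m. \<Sum>q<m. \<Sum>p<m. J q * F q p * P p * (J r * h r * P r))"
    unfolding blk_diag by (simp add: blk_def sum_distrib_left sum_distrib_right)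
  also have "\<dots> = (\<Sum>q<m. \<Sum>r<m. \<Sum>p<m. J q * F q p * P p * (J r * h r * P r))" by (rule sum.swap)
  also have "\<dots> = (\<Sum>q<m. \<Sum>p<m. \<Sum>r<m. J q * F q p * P p * (J r * h r * P r))"
    by (intro sum.cong refl sum.swap)
  also have "\<dots> = (\<Sum>q<m. \<Sum>p<m. \<Sum>r<m. if p = r then J q * F q p * h p * P p else 0)"
    using r by (intro sum.cong refl) auto
  also have "\<dots> = blk (\<lambda>q p. F q p * h p)" unfolding blk_def by (intro sum.cong refl) (auto simp: mult.assoc)
  finally show "blk F * blk (diag h) = blk (\<lambda>q p. F q p * h p)" .
qed

lemma diag_mult_ab:
  "blk (diag a) * blk F = blk (\<lambda>q p. a q * F q p)" "blk F * blk (diag a) = blk (\<lambda>q p. F q p * a p)"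
  "blk (diag b) * blk F = blk (\<lambda>q p. b q * F q p)" "blk F * blk (diag b) = blk (\<lambda>q p. F q p * b p)"
  using ab by (simp_all add: diag_mult)

lemma AB_diag: "A = blk (diag a)" "B = blk (diag b)"
proof -
  have "A = blk (\<lambda>q p. P q * A * J p)" by (rule blk_expand[OF AB(1)])
  also have "\<dots> = blk (diag a)"
  proof (rule blk_cong)
    fix q p assume qp: "q < m" "p < m"
    show "P q * A * J p = diag a q p"
      using D(4)[OF qp(1)] D(7)[OF qp] ab(1)[OF qp(2)] by (auto simp: diag_def mult.assoc)
  qed
  finally show "A = blk (diag a)" .
  have "B = blk (\<lambda>q p. P q * B * J p)" by (rule blk_expand[OF AB(2)])
  also have "\<dots> = blk (diag b)"
  proof (rule blk_cong)
    fix q p assume qp: "q < m" "p < m"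
    show "P q * B * J p = diag b q p"
      using D(6)[OF qp(1)] D(7)[OF qp] ab(2)[OF qp(2)] by (auto simp: diag_def mult.assoc)
  qed
  finally show "B = blk (diag b)" .
qed

lemma block_cocycle:
  assumes eq: "A * X + X * A = B * B * Y + B * Y * B + Y * B * B" and q: "q < m" and p: "p < m"
  defines "X' \<equiv> P q * X * J p" and "Y' \<equiv> P q * Y * J p"
  shows "a q * X' + X' * a p = b q * b q * Y' + b q * Y' * b p + Y' * b p * b p"
proof -
  have PB: "P q * (B * Z) = b q * (P q * Z)" "P q * (A * Z) = a q * (P q * Z)" for Z
    using D(4,6)[OF q] by (simp_all add: mult.assoc[symmetric])
  have BJ: "B * (J p * Z) = J p * (b p * Z)" for Z
    using D(5)[OF p] by (simp add: mult.assoc[symmetric])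
  have "P q * (A * X + X * A) * J p = P q * (B * B * Y + B * Y * B + Y * B * B) * J p" by (simp only: eq)
  then show ?thesis
    by (simp add: distrib_left distrib_right mult.assoc PB BJ D(3,5)[OF p] X'_def Y'_def)
qed

lemma commute_1: "X \<in> shp 1 1 \<Longrightarrow> Y \<in> shp 1 1 \<Longrightarrow> X * Y = Y * X"
proof (rule fmat_eqI)
  fix i j assume *: "X \<in> shp 1 1" "Y \<in> shp 1 1"
  show "ent (X * Y) i j = ent (Y * X) i j"
    unfolding ent_mult[OF *(1)] ent_mult[OF *(2)]
    using ent_shp[OF *(1), of i 0] ent_shp[OF *(2), of i 0] ent_shp[OF *(1), of 0 j] ent_shp[OF *(2), of 0 j]
    by (cases "i = 0"; cases "j = 0") auto
qed

text \<open>Between different types the block is inner. Between equal types it is a self-cocycle: in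
  dimension one all commutators vanish and only a scaling remains, otherwise \<open>one\<close>
  makes the block diagonal and separate conjugation is allowed.\<close>

lemma block_solution:
  assumes eq: "A * X + X * A = B * B * Y + B * Y * B + Y * B * B" and XY: "X \<in> shp n n" "Y \<in> shp n n"
    and inner: "\<And>p q. p < m \<Longrightarrow> q < m \<Longrightarrow> ty p \<noteq> ty q \<Longrightarrow> cocycles_inner (d p) (a p) (b p) (d q) (a q) (b q)"
    and one: "\<And>p q. p < m \<Longrightarrow> q < m \<Longrightarrow> p \<noteq> q \<Longrightarrow> ty p = ty q \<Longrightarrow> d p = 1"
    and q: "q < m" and p: "p < m"
  shows "\<exists>g t h k. g \<in> shp (d q) (d p) \<and> h \<in> shp (d p) (d p) \<and> k \<in> shp (d p) (d p) \<and> (d p = 1 \<longrightarrow> h = 0 \<and> k = 0) \<and>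
    P q * X * J p = g * a p - a q * g + (if ty q = ty p then sc (3 * t) (a p) else 0) + (if q = p then h * a p - a p * h else 0) \<and>
    P q * Y * J p = g * b p - b q * g + (if ty q = ty p then sc (2 * t) (b p) else 0) + (if q = p then k * b p - b p * k else 0)"
proof -
  define X' where "X' = P q * X * J p"
  define Y' where "Y' = P q * Y * J p"
  have s: "X' \<in> shp (d q) (d p)" "Y' \<in> shp (d q) (d p)"
    unfolding X'_def Y'_def by (rule shp_mult[OF shp_mult[OF D(2)[OF q]] D(1)[OF p]]; rule XY)+
  note eq' = block_cocycle[OF eq q p, folded X'_def Y'_def]
  show ?thesis
  proof (cases "ty q = ty p")
    case False
    then obtain G where "G \<in> shp (d q) (d p)" "X' = a q * G - G * a p" "Y' = b q * G - G * b p"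
      using inner[OF p q] s eq' unfolding cocycles_inner_def by metis
    then show ?thesis using False unfolding X'_def Y'_def
      \<comment> \<open>The sign changes because inner cocycles are
        \<open>a q * G - G * a p\<close>, while deformations are written with the opposite
        commutator.\<close>
      by (intro exI[of _ "- G"] exI[of _ 0]) auto
  next
    case True
    then have e: "d q = d p" "a q = a p" "b q = b p" using same[OF q p] by auto
    obtain t H K where HK: "H \<in> shp (d p) (d p)" "K \<in> shp (d p) (d p)"
        "X' = sc (3 * t) (a p) + (H * a p - a p * H)" "Y' = sc (2 * t) (b p) + (K * b p - b p * K)"
      using self_cocycle[OF sp[OF p] c(1)[OF p] c(2)[OF p] c(3)[OF p] s[unfolded e] eq'[unfolded e]] .
    show ?thesis
    proof (cases "d p = 1")
      case one: True
      have "H * a p = a p * H" "K * b p = b p * K"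
        using HK(1,2) ab[OF p] unfolding one by (auto intro: commute_1)
      then show ?thesis using HK True unfolding X'_def Y'_def
        by (intro exI[of _ 0] exI[of _ t]) auto
    next
      case False
      then have "q = p" using one[OF q p] True e by auto
      then show ?thesis using HK False unfolding X'_def Y'_def
        by (intro exI[of _ 0] exI[of _ t] exI[of _ H] exI[of _ K]) auto
    qed
  qed
qed

text \<open>Every tangent vector is a sum of conjugation, scaling and separate conjugation, block by
  block; the assumptions make the last two kinds commute, as the deformation requires.\<close>

lemma smooth:
  assumes V: "V \<in> rep_B3 n" and AV: "A = emb (fst V)" "B = emb (snd V)"
    and inner: "\<And>p q. p < m \<Longrightarrow> q < m \<Longrightarrow> ty p \<noteq> ty q \<Longrightarrow> cocycles_inner (d p) (a p) (b p) (d q) (a q) (b q)"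
    and one: "\<And>p q. p < m \<Longrightarrow> q < m \<Longrightarrow> p \<noteq> q \<Longrightarrow> ty p = ty q \<Longrightarrow> d p = 1"
  shows "smooth_at n V"
proof -
  \<comment> \<open>Scalar blocks between summands of equal type; these commute with both
    generators.\<close>
  define \<M> where "\<M> = {blk F | F. \<forall>q<m. \<forall>p<m. \<exists>t. F q p = (if ty q = ty p then sc t (idm (d p)) else 0)}"
  \<comment> \<open>Block diagonal, and zero on one-dimensional summands: this is what makes it
    commute with \<open>\<M>\<close>.\<close>
  define \<H> where "\<H> = {blk (diag h) | h. \<forall>p<m. h p \<in> shp (d p) (d p) \<and> (d p = 1 \<longrightarrow> h p = 0)}"
  have M: "M \<in> shp n n \<and> M * A = A * M \<and> M * B = B * M" if M: "M \<in> \<M>" for M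
  proof -
    obtain F where F: "M = blk F" "\<forall>q<m. \<forall>p<m. \<exists>t. F q p = (if ty q = ty p then sc t (idm (d p)) else 0)"
      using M unfolding \<M>_def by blast
    have F': "F q p \<in> shp (d q) (d p) \<and> F q p * a p = a q * F q p \<and> F q p * b p = b q * F q p" if qp: "q < m" "p < m" for q p
    proof -
      obtain t where "F q p = (if ty q = ty p then sc t (idm (d p)) else 0)" using F(2) qp by blast
      then show ?thesis using same[OF qp] ab[OF qp(2)] by (auto simp: sc_simps)
    qed
    have "M * A = A * M" "M * B = B * M"
      unfolding F(1) AB_diag diag_mult_ab using F' by (auto intro!: blk_cong)
    then show ?thesis using F' unfolding F(1) by (auto intro!: blk_shp)
  qed
  have A2: "A * A = blk (diag (\<lambda>p. sc (c p) (idm (d p))))"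
    unfolding AB_diag diag_mult_ab using c(2) by (intro blk_cong) (auto simp: diag_def)
  have H: "H \<in> shp n n \<and> H * (A * A) = (A * A) * H" if H: "H \<in> \<H>" for H
  proof -
    obtain h where h: "H = blk (diag h)" "\<forall>p<m. h p \<in> shp (d p) (d p) \<and> (d p = 1 \<longrightarrow> h p = 0)"
      using H unfolding \<H>_def by blast
    have "H * (A * A) = (A * A) * H"
      unfolding A2 h(1) by (subst (1 2) diag_mult) (use h(2) in \<open>auto simp: diag_def sc_simps intro!: blk_cong\<close>)
    moreover have "H \<in> shp n n" unfolding h(1) using h(2) by (intro blk_shp) (auto simp: diag_def)
    ultimately show ?thesis by blast
  qed
  have MH: "M * H = H * M" if M: "M \<in> \<M>" and H: "H \<in> \<H>" for M H
  proof -
    obtain F where F: "M = blk F" "\<forall>q<m. \<forall>p<m. \<exists>t. F q p = (if ty q = ty p then sc t (idm (d p)) else 0)"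
      using M unfolding \<M>_def by blast
    obtain h where h: "H = blk (diag h)" "\<forall>p<m. h p \<in> shp (d p) (d p) \<and> (d p = 1 \<longrightarrow> h p = 0)"
      using H unfolding \<H>_def by blast
    have "F q p * h p = h q * F q p" if qp: "q < m" "p < m" for q p
    proof -
      obtain t where t: "F q p = (if ty q = ty p then sc t (idm (d p)) else 0)" using F(2) qp by blast
      show ?thesis
      proof (cases "ty q = ty p \<and> q \<noteq> p")
        case True
        \<comment> \<open>Distinct summands of equal type have dimension one by assumption, and
          there \<open>\<H>\<close> prescribes zero.\<close>
        then have "h p = 0 \<and> h q = 0" using one[OF qp] one[OF qp(2,1)] h(2) qp by auto
        then show ?thesis by simp
      next
        case False
        then show ?thesis using t h(2) qp by (auto simp: sc_simps)
      qed
    qed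
    moreover have hs: "h p \<in> shp (d p) (d p)" if "p < m" for p using h(2) that by blast
    ultimately show ?thesis unfolding F(1) h(1) by (simp add: diag_mult cong: blk_cong)
  qed
  show ?thesis
  proof (rule smooth_at_deformations[OF V, where \<M> = \<M> and \<H> = \<H>, folded AV])
    fix u assume "u \<in> tangents n V"
    then have eq: "A * fX n u + fX n u * A = B * B * fY n u + B * fY n u * B + fY n u * B * B"
      by (simp add: tangents_def dF_def AV)
    define \<Phi> where "\<Phi> q p w \<longleftrightarrow> (case w of (g, t, h, k) \<Rightarrow>
      g \<in> shp (d q) (d p) \<and> h \<in> shp (d p) (d p) \<and> k \<in> shp (d p) (d p) \<and> (d p = 1 \<longrightarrow> h = 0 \<and> k = 0) \<and>
      P q * fX n u * J p = g * a p - a q * g + (if ty q = ty p then sc (3 * t) (a p) else 0) + (if q = p then h * a p - a p * h else 0) \<and>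
      P q * fY n u * J p = g * b p - b q * g + (if ty q = ty p then sc (2 * t) (b p) else 0) + (if q = p then k * b p - b p * k else 0))"
      for q p w
    have "\<exists>w. \<Phi> q p w" if "q < m" "p < m" for q p
      using block_solution[OF eq fXY_shp inner one that] unfolding \<Phi>_def by simp
    define w where "w q p = (SOME w. \<Phi> q p w)" for q p
    define g where "g q p = fst (w q p)" for q p
    define t where "t q p = fst (snd (w q p))" for q p
    define h where "h p = fst (snd (snd (w p p)))" for p
    define k where "k p = snd (snd (snd (w p p)))" for p
    have W: "\<Phi> q p (w q p)" if "q < m" "p < m" for q p
      unfolding w_def by (rule someI_ex) (fact \<open>\<And>p q. q < m \<Longrightarrow> p < m \<Longrightarrow> \<exists>w. \<Phi> q p w\<close>[OF that])
    have g: "g q p \<in> shp (d q) (d p)" if "q < m" "p < m" for q p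
      using W[OF that] by (auto simp: \<Phi>_def g_def split: prod.splits)
    have hk: "h p \<in> shp (d p) (d p)" "k p \<in> shp (d p) (d p)" "d p = 1 \<longrightarrow> h p = 0 \<and> k p = 0" if "p < m" for p
      using W[OF that that] by (auto simp: \<Phi>_def h_def k_def split: prod.splits)
    have X: "P q * fX n u * J p = g q p * a p - a q * g q p + (if ty q = ty p then sc (3 * t q p) (a p) else 0) + (if q = p then h p * a p - a p * h p else 0)"
      "P q * fY n u * J p = g q p * b p - b q * g q p + (if ty q = ty p then sc (2 * t q p) (b p) else 0) + (if q = p then k p * b p - b p * k p else 0)"
      if "q < m" "p < m" for q p
      using W[OF that] by (auto simp: \<Phi>_def g_def t_def h_def k_def split: prod.splits)
    define F where "F q p = (if ty q = ty p then sc (t q p) (idm (d p)) else 0)" for q p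
    have "blk F \<in> \<M>" unfolding \<M>_def F_def by blast
    moreover have "blk (diag h) \<in> \<H>" "blk (diag k) \<in> \<H>" unfolding \<H>_def using hk by blast+
    moreover have "blk g \<in> shp n n" by (rule blk_shp) (rule g)
    moreover have "fX n u = blk g * A - A * blk g + sc 3 (blk F * A) + (blk (diag h) * A - A * blk (diag h))"
      by (subst blk_expand[OF fXY_shp(1)], unfold AB_diag diag_mult_ab blk_linear, rule blk_cong)
         (use ab(1) in \<open>simp add: X F_def diag_def sc_simps\<close>)
    moreover have "fY n u = blk g * B - B * blk g + sc 2 (blk F * B) + (blk (diag k) * B - B * blk (diag k))"
      by (subst blk_expand[OF fXY_shp(2)], unfold AB_diag diag_mult_ab blk_linear, rule blk_cong)
         (use ab(2) in \<open>simp add: X F_def diag_def sc_simps\<close>)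
    ultimately show "\<exists>G M H K. G \<in> shp n n \<and> M \<in> \<M> \<and> H \<in> \<H> \<and> K \<in> \<H> \<and>
        fX n u = G * A - A * G + sc 3 (M * A) + (H * A - A * H) \<and>
        fY n u = G * B - B * G + sc 2 (M * B) + (K * B - B * K)"
      by (intro exI[of _ "blk g"] exI[of _ "blk F"] exI[of _ "blk (diag h)"] exI[of _ "blk (diag k)"] conjI)
  qed (fact M H MH)+
qed

text \<open>The obstruction between the summands \<open>p\<close> and \<open>q\<close> gives a
  matrix supported in one off-diagonal block that annihilates the image of the differential. The
  quadratic form becomes nonzero at a tangent vector mixing a scaling of one summand with a map
  between the two.\<close>

lemma not_smooth:
  assumes V: "V \<in> rep_B3 n" and AV: "A = emb (fst V)" "B = emb (snd V)" and \<omega>: "\<omega> ^ 3 = 1" "\<omega> \<noteq> (1::complex)"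
    and p: "p < m" and q: "q < m" and pq: "p \<noteq> q" and cc: "c q = c p"
    and ns: "\<not> homs_span (d p) (a p) (b p) (d q) (a q) (b q)"
  shows "\<not> smooth_at n V"
proof -
  obtain \<rho> where \<rho>: "br_roots (c p) \<rho>" using br_roots_exist[OF c(1)[OF p] \<omega>] .
  note sq = c(2,3)[OF p] c(2,3)[OF q, unfolded cc]
  note s = ab[OF p] ab[OF q]
  obtain mp Fp Gp where "br_splitting (d p) (a p) (b p) \<rho> mp Fp Gp" using br_splitting_exists[OF s(1) sq(1) s(2) sq(2) \<rho>] .
  moreover obtain mq Fq Gq where "br_splitting (d q) (a q) (b q) \<rho> mq Fq Gq" using br_splitting_exists[OF s(3) sq(3) s(4) sq(4) \<rho>] .
  ultimately interpret t: two_splittings "d p" "d q" "a p" "b p" "a q" "b q" \<rho> mp mq Fp Gp Fq Gq "c p"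
    using \<rho> by unfold_locales
  obtain N0 where N0: "N0 \<in> shp (d p) (d q)" "N0 \<noteq> 0" "\<And>X. X \<in> homs (d p) (a p) (d q) (a q) \<Longrightarrow> trc (N0 * X) = 0"
    "\<And>Y. Y \<in> homs (d p) (b p) (d q) (b q) \<Longrightarrow> trc (N0 * Y) = 0" using t.obstruction[OF ns] by blast
  note anti = orthogonal_anticommute[OF s sq N0(1,3,4)]
  obtain Z where Z: "Z \<in> shp (d q) (d p)" "trc (N0 * Z) \<noteq> 0" using trc_nondegenerate[OF N0(1)] N0(2) by blast
  \<comment> \<open>A commutator with \<open>Z\<close> satisfies the linearised equation for
    \<open>A\<close> alone, because \<open>a p\<close> and \<open>a q\<close> have the same square;
    \<open>B\<close> need not move.\<close>
  define W where "W = Z * a p - a q * Z"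
  have W: "W \<in> shp (d q) (d p)" unfolding W_def using Z(1) s by auto
  have Jp: "P p * J p = idm (d p)" "P q * J q = idm (d q)" "P p * J q = 0" "P q * J p = 0"
    using D(7)[OF p p] D(7)[OF q q] D(7)[OF p q] D(7)[OF q p] pq by auto
  have R: "P p * (J p * U) = idm (d p) * U" "P q * (J q * U) = idm (d q) * U" "P p * (J q * U) = 0" "P q * (J p * U) = 0" for U
    using Jp by (simp_all add: mult.assoc[symmetric])
  have PA: "P p * (A * U) = a p * (P p * U)" "P q * (A * U) = a q * (P q * U)"
    "P p * (B * U) = b p * (P p * U)" "P q * (B * U) = b q * (P q * U)" for U
    using D(4,6)[OF p] D(4,6)[OF q] by (simp_all add: mult.assoc[symmetric])
  have AJ: "A * (J p * U) = J p * (a p * U)" "A * (J q * U) = J q * (a q * U)"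
    "B * (J p * U) = J p * (b p * U)" "B * (J q * U) = J q * (b q * U)" for U
    using D(3,5)[OF p] D(3,5)[OF q] by (simp_all add: mult.assoc[symmetric])
  define N where "N = J p * (N0 * P q)"
  have N: "N \<in> shp n n" unfolding N_def by (rule shp_mult[OF D(1)[OF p] shp_mult[OF N0(1) D(2)[OF q]]])
  have "N * A + A * N = J p * (N0 * a q + a p * N0) * P q"
    by (simp add: N_def distrib_left distrib_right mult.assoc AJ D(4)[OF q])
  then have NA: "N * A + A * N = 0" by (simp add: anti)
  have "N * B * B + B * N * B + B * B * N = J p * (N0 * b q * b q + b p * N0 * b q + b p * b p * N0) * P q"
  proof -
    have "P q * (B * B) = b q * (b q * P q)" using PA(4)[of B] D(6)[OF q] by simp
    then show ?thesis by (simp add: N_def distrib_left distrib_right mult.assoc AJ D(6)[OF q])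
  qed
  then have NB: "N * B * B + B * N * B + B * B * N = 0" by (simp add: anti)
  \<comment> \<open>Scaling the \<open>p\<close>-th summand and conjugating only \<open>A\<close> by \<open>J q * Z * P p\<close> are tangent directions;
    the mixed term of the quadratic form at their sum is \<open>trc (N0 * Z)\<close>.\<close>
  define X0 where "X0 = J p * (a p * P p)"
  define X1 where "X1 = J q * (W * P p)"
  \<comment> \<open>The factors \<open>1 / (2 * c p)\<close> here and \<open>1 / (3 * c p)\<close>
    in \<open>Y\<close> make both sides of the tangent equation equal to the projection
    \<open>J p * P p\<close>.\<close>
  define X where "X = sc (1 / (2 * c p)) X0 + X1"
  define Y0 where "Y0 = J p * (b p * P p)"
  define Y where "Y = sc (1 / (3 * c p)) Y0"
  have sX: "X \<in> shp n n" "Y \<in> shp n n" unfolding X_def Y_def X0_def X1_def Y0_def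
    by (intro shp_simps shp_mult[OF D(1)[OF p] shp_mult[OF s(1) D(2)[OF p]]]
        shp_mult[OF D(1)[OF q] shp_mult[OF W D(2)[OF p]]] shp_mult[OF D(1)[OF p] shp_mult[OF s(2) D(2)[OF p]]])+
  have app: "a p * (a p * P p) = sc (c p) (P p)" "b p * (b p * (b p * P p)) = sc (c p) (P p)"
    using sq(1,2) D(2)[OF p] by (simp_all add: mult.assoc[symmetric] sc_simps)
  have aW: "a q * W + W * a p = 0"
  proof -
    have "a q * W + W * a p = Z * (a p * a p) - (a q * a q) * Z" by (simp add: W_def algebra_simps)
    then show ?thesis using Z(1) by (simp add: sq sc_simps)
  qed
  define u where "u = vec_of n (tomat n n X, tomat n n Y)"
  have u: "fX n u = X" "fY n u = Y" unfolding u_def by (simp_all add: fXY_vec_of emb_tomat sX)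
  have AX0: "A * X0 + X0 * A = sc (2 * c p) (J p * P p)"
    by (simp add: X0_def mult.assoc AJ D(4)[OF p] app sc_simps) (rule fmat_eqI, simp)
  have AX1: "A * X1 + X1 * A = 0"
  proof -
    have "A * X1 + X1 * A = J q * (a q * W + W * a p) * P p"
      by (simp add: X1_def mult.assoc AJ D(4)[OF p] distrib_left distrib_right)
    then show ?thesis by (simp add: aW)
  qed
  have "A * X + X * A = sc (1 / (2 * c p)) (A * X0 + X0 * A) + (A * X1 + X1 * A)"
    by (simp add: X_def distrib_left distrib_right sc_simps add_ac)
  also have "\<dots> = J p * P p" using c(1)[OF p] by (simp add: AX0 AX1 sc_simps)
  finally have AX: "A * X + X * A = J p * P p" .
  have BY0: "B * B * Y0 + B * Y0 * B + Y0 * B * B = sc (3 * c p) (J p * P p)"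
  proof -
    have "P p * (B * B) = b p * (b p * P p)" using PA(3)[of B] D(6)[OF p] by simp
    then show ?thesis
      by (simp add: Y0_def mult.assoc AJ D(6)[OF p] app sc_simps) (rule fmat_eqI, simp)
  qed
  have "B * B * Y + B * Y * B + Y * B * B = sc (1 / (3 * c p)) (B * B * Y0 + B * Y0 * B + Y0 * B * B)"
    by (simp add: Y_def sc_simps)
  also have "\<dots> = J p * P p" using c(1)[OF p] by (simp add: BY0 sc_simps)
  finally have "dF A B X Y = 0" using AX by (simp add: dF_def)
  then have tan: "u \<in> tangents n V" unfolding tangents_def by (simp add: u AV[symmetric]) (simp add: u_def vec_of_def)
  have NY: "N * Y0 = 0" "N * (B * Y0) = 0" by (simp_all add: N_def Y0_def mult.assoc AJ R)
  have NYY: "N * (B * Y * Y + Y * B * Y + Y * Y * B) = 0"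
  proof -
    have "N * (B * Y0 * Y0 + Y0 * B * Y0 + Y0 * Y0 * B) = (N * (B * Y0)) * Y0 + (N * Y0) * (B * Y0) + (N * Y0) * (Y0 * B)"
      by (simp add: distrib_left mult.assoc)
    then show ?thesis by (simp add: Y_def sc_simps NY flip: sc_simps(4))
  qed
  have NX: "N * (X * X) = sc (1 / (2 * c p)) (J p * (N0 * (W * (a p * P p))))"
  proof -
    have "N * X = J p * (N0 * (W * P p))"
      using W by (simp add: X_def N_def X0_def X1_def distrib_left sc_simps mult.assoc R mult.assoc[symmetric, of "idm _"])
    then have "N * (X * X) = J p * (N0 * (W * (P p * X)))" by (simp add: mult.assoc[symmetric])
    moreover have "P p * X = sc (1 / (2 * c p)) (a p * P p)"
      using s(1) by (simp add: X_def X0_def X1_def distrib_left sc_simps R mult.assoc[symmetric, of "idm _"])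
    ultimately show ?thesis by (simp add: sc_simps)
  qed
  have "quad_form n B N u u = trc (N * (X * X)) - trc (N * (B * Y * Y + Y * B * Y + Y * Y * B))"
    by (simp add: quad_form_def u right_diff_distrib trc_simps)
  also have "\<dots> = 1 / (2 * c p) * trc (J p * (N0 * (W * (a p * P p))))" unfolding NYY NX by (simp add: trc_simps)
  also have "trc (J p * (N0 * (W * (a p * P p)))) = trc (N0 * (W * a p) * (P p * J p))"
    using trc_mult[of "J p" "N0 * (W * (a p * P p))"] by (simp add: mult.assoc)
  also have "\<dots> = trc (N0 * (W * a p))"
    using idm_right[OF shp_mult[OF N0(1) shp_mult[OF W s(1)]]] by (simp add: Jp)
  \<comment> \<open>Anticommutation moves \<open>a q\<close> past \<open>N0\<close>. Both resulting
    terms have trace \<open>c p * trc (N0 * Z)\<close>, which cancels the factor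
    \<open>1 / (2 * c p)\<close>.\<close>
  also have "N0 * (W * a p) = N0 * Z * (a p * a p) - (N0 * a q) * Z * a p"
    by (simp add: W_def left_diff_distrib right_diff_distrib mult.assoc)
  also have "N0 * a q = - (a p * N0)" using anti(1) by (simp add: eq_neg_iff_add_eq_0)
  also have "N0 * Z * (a p * a p) - - (a p * N0) * Z * a p = sc (c p) (N0 * Z) + a p * (N0 * Z * a p)"
    using Z(1) by (simp add: sq sc_simps mult.assoc)
  also have "trc \<dots> = c p * trc (N0 * Z) + trc (N0 * Z * (a p * a p))"
    using trc_mult[of "a p" "N0 * Z * a p"] by (simp add: trc_simps mult.assoc)
  also have "N0 * Z * (a p * a p) = sc (c p) (N0 * Z)" using shp_mult[OF N0(1) Z(1)] by (simp add: sq sc_simps)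
  finally have "quad_form n B N u u = trc (N0 * Z)" using c(1)[OF p] by (simp add: trc_simps)
  then have "quad_form n (emb (snd V)) N u u \<noteq> 0" using Z(2) AV by simp
  then show ?thesis by (rule not_smooth_atI[OF V N NA[unfolded AV] NB[unfolded AV] tan])
qed

end

lemma length_filter_concat_replicate:
  "distinct L \<Longrightarrow> length (filter (\<lambda>j. j = i) (concat (map (\<lambda>i. replicate (e i) i) L))) = (if i \<in> set L then e i else 0)"
  by (induction L) (auto simp: filter_replicate)

text \<open>For different central characters inner cocycles are automatic. For equal ones the
  question is whether commuting maps span, which is symmetric by
  \<open>homs_span_sym\<close>.\<close>

lemma cocycles_inner_reverse:
  assumes V: "simple_rep V" and W: "simple_rep W" and ni: "\<not> rep_iso V W" "\<not> rep_iso W V" and \<omega>: "\<omega> ^ 3 = 1" "\<omega> \<noteq> (1::complex)"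
    and inner: "cocycles_inner (rep_dim V) (emb (fst V)) (emb (snd V)) (rep_dim W) (emb (fst W)) (emb (snd W))"
  shows "cocycles_inner (rep_dim W) (emb (fst W)) (emb (snd W)) (rep_dim V) (emb (fst V)) (emb (snd V))"
proof -
  note VD = rep_B3D(4,5)[OF simple_rep_is_rep[OF V]] and WD = rep_B3D(4,5)[OF simple_rep_is_rep[OF W]]
  obtain c where c: "c \<noteq> 0" "emb (fst V) * emb (fst V) = sc c (idm (rep_dim V))"
      "emb (snd V) * emb (snd V) * emb (snd V) = sc c (idm (rep_dim V))"
    using simple_rep_central_character[OF V] .
  obtain c' where c': "c' \<noteq> 0" "emb (fst W) * emb (fst W) = sc c' (idm (rep_dim W))"
      "emb (snd W) * emb (snd W) * emb (snd W) = sc c' (idm (rep_dim W))"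
    using simple_rep_central_character[OF W] .
  show ?thesis
  proof (cases "c' = c")
    case False
    then show ?thesis by (rule cocycles_inner_distinct[OF WD VD c'(2,3) c(2,3)])
  next
    case True
    note c' = c'[unfolded True]
    note hz = hom_zero_not_iso[OF V W ni(1)] hom_zero_not_iso[OF W V ni(2)]
    have span: "homs_span (rep_dim V) (emb (fst V)) (emb (snd V)) (rep_dim W) (emb (fst W)) (emb (snd W))"
      using inner unfolding cocycles_inner_iff[OF c(1) VD WD c(2,3) c'(2,3) hz(1)] .
    obtain \<rho> where \<rho>: "br_roots c \<rho>" using br_roots_exist[OF c(1) \<omega>] .
    obtain m F G where s: "br_splitting (rep_dim V) (emb (fst V)) (emb (snd V)) \<rho> m F G"
      using br_splitting_exists[OF VD(1) c(2) VD(2) c(3) \<rho>] .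
    obtain m' F' G' where s': "br_splitting (rep_dim W) (emb (fst W)) (emb (snd W)) \<rho> m' F' G'"
      using br_splitting_exists[OF WD(1) c'(2) WD(2) c'(3) \<rho>] .
    have "homs_span (rep_dim W) (emb (fst W)) (emb (snd W)) (rep_dim V) (emb (fst V)) (emb (snd V))"
      by (rule homs_span_sym[OF two_splittings.intro[OF s s' \<rho>] hz(2) span])
    then show ?thesis unfolding cocycles_inner_iff[OF c(1) WD VD c'(2,3) c(2,3) hz(2)] .
  qed
qed

theorem theorem8:
  fixes n k :: nat
    and V :: rep
    and S S' :: "nat \<Rightarrow> rep"
    and e :: "nat \<Rightarrow> nat"
    and lam :: "nat \<Rightarrow> complex"
    and \<alpha> :: "nat \<Rightarrow> nat \<times> nat \<times> nat \<times> nat \<times> nat"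
    and \<omega> :: complex
  assumes omega: "\<omega> ^ 3 = 1" "\<omega> \<noteq> 1"
    and V: "V \<in> rep_B3 n"
    and decomposition:
      "rep_iso V (direct_sum_reps (concat (map (\<lambda>i. replicate (e i) (S i)) [1..<Suc k])))"
    and simple: "\<And>i. i \<in> {1..k} \<Longrightarrow> simple_rep (S i)"
    and non_iso: "\<And>i j. i \<in> {1..k} \<Longrightarrow> j \<in> {1..k} \<Longrightarrow> i \<noteq> j \<Longrightarrow> \<not> rep_iso (S i) (S j)"
    and mult: "\<And>i. i \<in> {1..k} \<Longrightarrow> e i \<ge> 1"
    and lam: "\<And>i. i \<in> {1..k} \<Longrightarrow> lam i \<noteq> 0"
    and S_eq: "\<And>i. i \<in> {1..k} \<Longrightarrow> S i = twist (lam i) (S' i)"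
    and simple': "\<And>i. i \<in> {1..k} \<Longrightarrow> simple_rep (S' i)"
    and alpha: "\<And>i. i \<in> {1..k} \<Longrightarrow> S' i \<in> rep_alpha \<omega> (\<alpha> i)"
  shows "smooth_at n V \<longleftrightarrow>
      (\<forall>i j. 1 \<le> i \<and> i < j \<and> j \<le> k \<longrightarrow> Ext1 (S i) (S j) = {Ext1_zero (S i) (S j)}) \<and>
      (\<forall>i. 1 \<le> i \<and> i \<le> k \<longrightarrow> rep_dim (S i) = 1 \<or> e i = 1)"
proof -
  \<comment> \<open>The list of types with multiplicities; a position \<open>p\<close> in it stands
    for one simple summand of type \<open>ty p\<close>.\<close>
  define il where "il = concat (map (\<lambda>i. replicate (e i) i) [1..<Suc k])"
  define m where "m = length il"
  define ty where "ty p = il ! p" for p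
  have Ss: "concat (map (\<lambda>i. replicate (e i) (S i)) [1..<Suc k]) = map S il"
    by (simp add: il_def map_concat o_def del: upt_Suc)
  have "set il \<subseteq> {1..k}" by (auto simp: il_def simp del: upt_Suc)
  then have ty: "ty p \<in> {1..k}" if "p < m" for p using that nth_mem[of p il] unfolding ty_def m_def by blast
  have card: "card {p. p < m \<and> ty p = i} = e i" if "i \<in> {1..k}" for i
  proof -
    have "card {p. p < m \<and> ty p = i} = length (filter (\<lambda>j. j = i) il)"
      unfolding m_def ty_def by (simp add: length_filter_conv_card)
    also have "\<dots> = e i" unfolding il_def using that by (subst length_filter_concat_replicate) (simp_all del: upt_Suc)
    finally show ?thesis .
  qed
  have occurs: "\<exists>p<m. ty p = i" if "i \<in> {1..k}" for i
  proof (rule ccontr)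
    assume "\<not> (\<exists>p<m. ty p = i)"
    then have empty: "{p. p < m \<and> ty p = i} = {}" by blast
    show False using card[OF that, unfolded empty] mult[OF that] by simp
  qed
  define r where "r i = rep_dim (S i)" for i
  define a where "a i = emb (fst (S i))" for i
  define b where "b i = emb (snd (S i))" for i
  define c where "c i = (SOME c. c \<noteq> 0 \<and> a i * a i = sc c (idm (r i)) \<and> b i * b i * b i = sc c (idm (r i)))" for i
  have c: "c i \<noteq> 0 \<and> a i * a i = sc (c i) (idm (r i)) \<and> b i * b i * b i = sc (c i) (idm (r i))" if "i \<in> {1..k}" for i
    unfolding c_def
    by (rule someI_ex, rule simple_rep_central_character[OF simple[OF that], folded a_def b_def r_def], intro exI conjI)
  have irr: "simple_pair (r i) (a i) (b i)" if "i \<in> {1..k}" for i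
    unfolding r_def a_def b_def by (rule irreducible_simple_pair[OF simple_rep_irreducible[OF simple[OF that]]])
  have rep: "S i \<in> rep_B3 (r i)" if "i \<in> {1..k}" for i
    unfolding r_def by (rule simple_rep_is_rep[OF simple[OF that]])
  note sh = rep_B3D(4,5)[OF rep, folded a_def b_def]
  have Ext: "Ext1 (S i) (S j) = {Ext1_zero (S i) (S j)} \<longleftrightarrow> cocycles_inner (r i) (a i) (b i) (r j) (a j) (b j)"
    if "i \<in> {1..k}" "j \<in> {1..k}" for i j
    unfolding a_def b_def
    by (rule Ext1_zero_iff[OF rep[OF that(1)] r_def[symmetric] rep[OF that(2)] r_def[symmetric]])
  have "\<forall>S\<in>set (map S il). S \<in> rep_B3 (rep_dim S)"
    using \<open>set il \<subseteq> {1..k}\<close> rep by (auto simp: r_def)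
  then obtain J P where "decomposes n (emb (fst V)) (emb (snd V)) (length (map S il))
      (\<lambda>p. rep_dim (map S il ! p)) (\<lambda>p. emb (fst (map S il ! p))) (\<lambda>p. emb (snd (map S il ! p))) J P"
    using rep_iso_decomposes[OF V decomposition[unfolded Ss]] by blast
  then have dec: "decomposes n (emb (fst V)) (emb (snd V)) m (\<lambda>p. r (ty p)) (\<lambda>p. a (ty p)) (\<lambda>p. b (ty p)) J P"
    by (simp add: decomposes_def m_def r_def a_def b_def ty_def)
  interpret iso: isotypic n m "emb (fst V)" "emb (snd V)" "\<lambda>p. r (ty p)" "\<lambda>p. a (ty p)" "\<lambda>p. b (ty p)" J P "\<lambda>p. c (ty p)" ty
    by unfold_locales (use dec rep_B3D(4,5)[OF V] irr c ty in auto)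
  show ?thesis
  proof (intro iffI conjI allI impI)
    fix i j assume smooth: "smooth_at n V" and "1 \<le> i \<and> i < j \<and> j \<le> k"
    then have ij: "i \<in> {1..k}" "j \<in> {1..k}" "i \<noteq> j" by auto
    show "Ext1 (S i) (S j) = {Ext1_zero (S i) (S j)}"
      unfolding Ext[OF ij(1,2)]
    proof (rule ccontr)
      assume nin: "\<not> cocycles_inner (r i) (a i) (b i) (r j) (a j) (b j)"
      note ci = c[OF ij(1)] and cj = c[OF ij(2)]
      \<comment> \<open>Different scalars would make all cocycles inner, so a failure of vanishing
        forces equal central characters, as \<open>iso.not_smooth\<close> requires.\<close>
      have cc: "c j = c i"
      proof (rule ccontr)
        assume "c j \<noteq> c i"
        then have "cocycles_inner (r i) (a i) (b i) (r j) (a j) (b j)"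
          using ci cj by (intro cocycles_inner_distinct[where c = "c i" and c' = "c j"] sh ij) auto
        then show False using nin by blast
      qed
      have "cocycles_inner (r i) (a i) (b i) (r j) (a j) (b j) \<longleftrightarrow> homs_span (r i) (a i) (b i) (r j) (a j) (b j)"
        using ci cj[unfolded cc] hom_zero_not_iso[OF simple[OF ij(1)] simple[OF ij(2)] non_iso[OF ij]]
        by (intro cocycles_inner_iff[where c = "c i"] sh ij) (simp_all add: a_def b_def r_def)
      then have ns: "\<not> homs_span (r i) (a i) (b i) (r j) (a j) (b j)" using nin by blast
      obtain p q where pq: "p < m" "ty p = i" "q < m" "ty q = j" using occurs ij(1,2) by blast
      then have "p \<noteq> q" using ij(3) by auto
      then have "\<not> smooth_at n V"
        using iso.not_smooth[OF V refl refl omega pq(1,3)] pq(2,4) cc ns by simp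
      then show False using smooth by blast
    qed
  next
    fix i assume smooth: "smooth_at n V" and i: "1 \<le> i \<and> i \<le> k"
    show "rep_dim (S i) = 1 \<or> e i = 1"
    proof (rule ccontr)
      assume no: "\<not> (rep_dim (S i) = 1 \<or> e i = 1)"
      have ik: "i \<in> {1..k}" using i by simp
      have r2: "2 \<le> r i" using no irr[OF ik] by (auto simp: r_def simple_pair_def)
      have "2 \<le> card {p. p < m \<and> ty p = i}" using card[OF ik] mult[OF ik] no by simp
      then have "\<not> card {p. p < m \<and> ty p = i} \<le> Suc 0" by simp
      \<comment> \<open>A type of multiplicity at least two occupies two distinct positions with
        identical matrices, so the self-obstruction acts between different summands.\<close>
      then obtain p q where pq: "p < m" "ty p = i" "q < m" "ty q = i" "p \<noteq> q"
        using card_le_Suc0_iff_eq[of "{p. p < m \<and> ty p = i}"] by auto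
      note ci = c[OF ik]
      obtain \<rho> where \<rho>: "br_roots (c i) \<rho>" using br_roots_exist ci omega by blast
      obtain mm F G where s: "br_splitting (r i) (a i) (b i) \<rho> mm F G"
        using br_splitting_exists[OF sh(1)[OF ik] _ sh(2)[OF ik] _ \<rho>] ci by blast
      have "\<not> homs_span (r i) (a i) (b i) (r i) (a i) (b i)"
        by (rule not_homs_span_self[OF irr[OF ik] r2 s \<rho>])
      then have "\<not> smooth_at n V"
        using iso.not_smooth[OF V refl refl omega pq(1,3,5)] pq(2,4) by simp
      then show False using smooth by blast
    qed
  next
    assume *: "(\<forall>i j. 1 \<le> i \<and> i < j \<and> j \<le> k \<longrightarrow> Ext1 (S i) (S j) = {Ext1_zero (S i) (S j)}) \<and>
      (\<forall>i. 1 \<le> i \<and> i \<le> k \<longrightarrow> rep_dim (S i) = 1 \<or> e i = 1)"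
    have inner: "cocycles_inner (r i) (a i) (b i) (r j) (a j) (b j)" if ij: "i \<in> {1..k}" "j \<in> {1..k}" "i \<noteq> j" for i j
    proof (cases "i < j")
      case True
      then have "Ext1 (S i) (S j) = {Ext1_zero (S i) (S j)}" using * ij by simp
      then show ?thesis using Ext[OF ij(1,2)] by blast
    next
      case False
      \<comment> \<open>The assumption covers only this order; \<open>cocycles_inner_reverse\<close>
        supplies the opposite one.\<close>
      then have "Ext1 (S j) (S i) = {Ext1_zero (S j) (S i)}" using * ij by simp
      then have "cocycles_inner (r j) (a j) (b j) (r i) (a i) (b i)" using Ext[OF ij(2,1)] by blast
      then show ?thesis
        using cocycles_inner_reverse[OF simple[OF ij(2)] simple[OF ij(1)] non_iso[OF ij(2,1) ij(3)[symmetric]] non_iso[OF ij] omega]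
        by (simp add: r_def a_def b_def)
    qed
    show "smooth_at n V"
    proof (rule iso.smooth[OF V refl refl])
      show "cocycles_inner (r (ty p)) (a (ty p)) (b (ty p)) (r (ty q)) (a (ty q)) (b (ty q))"
        if "p < m" "q < m" "ty p \<noteq> ty q" for p q
        using inner[OF ty ty that(3)] that by blast
      show "r (ty p) = 1" if pq: "p < m" "q < m" "p \<noteq> q" "ty p = ty q" for p q
      proof (rule ccontr)
        assume "r (ty p) \<noteq> 1"
        then have "e (ty p) = 1" using * ty[OF pq(1)] by (auto simp: r_def)
        then have "card {p'. p' < m \<and> ty p' = ty p} \<le> Suc 0" using card[OF ty[OF pq(1)]] by simp
        then have all: "\<forall>x\<in>{p'. p' < m \<and> ty p' = ty p}. \<forall>y\<in>{p'. p' < m \<and> ty p' = ty p}. x = y"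
          by (rule iffD1[OF card_le_Suc0_iff_eq, rotated]) simp
        have "p = q" by (rule bspec[OF bspec[OF all]]) (use pq in simp_all)
        then show False using pq(3) by blast
      qed
    qed
  qed
qed

end
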